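(* Let $p$ be an odd prime and $k$ a field of characteristic not $p$ containing a primitive $p$-th root of unity $\zeta$. Write $(a,b)$ for $(a,b;\zeta)$. Let $G$ be one of the following groups of order $p^5$, each generated by $\alpha,\alpha_1,\alpha_2,\beta_1,\beta_2$ with the relations $[\alpha_i,\alpha]=\beta_i$, $\beta_i^p=1$ $(i=1,2)$, triviality of all other commutators of pairs of generators, and the additional power relations listed. Then $G$ is realizable as a Galois group over $k$ if and only if there exist $a_1,a_2,a_3\in k^\times$, independent modulo $k^{\times p}$, such that both listed elements are trivial in $\mathrm{Br}(k)$. 1. $\Phi_4(221)a$: $\alpha^p=\beta_2$, $\alpha_1^p=\beta_1$, $\alpha_2^p=1$. Elements: $(\zeta^{-1}a_2,a_3)$, $(a_1,\zeta a_3)$. 2. $\Phi_4(221)b$: $\alpha^p=\beta_2$, $\alpha_2^p=\beta_1$, $\alpha_1^p=1$. Elements: $(\zeta^{-1}a_2,a_3)$, $(a_1,a_3)(a_2,\zeta)$. 3. $\Phi_4(221)c$: $\alpha_1^p=\beta_1$, $\alpha_2^p=\beta_2$, $\alpha^p=1$. Elements: $(a_2,\zeta a_3)$, $(a_1,\zeta a_3)$. 4. $\Phi_4(221)d_r$: $\alpha_1^p=\beta_1^\kappa$, $\alpha_2^p=\beta_2$, $\alpha^p=1$, where $\kappa=g^r$, for $r=1,2,\dots,\frac12(p-1)$. Elements: $(a_2,\zeta a_3)$, $(a_1,\zeta^\kappa a_3)$. 5. $\Phi_4(221)e$: $\alpha_1^p=\beta_2^{-1/4}$, $\alpha_2^p=\beta_1\beta_2$,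 $\alpha^p=1$. Elements: $(a_2,\zeta a_3)(a_1,\zeta^{-1/4})$, $(a_1,a_3)(a_2,\zeta)$. 6. $\Phi_4(221)f_0$: $\alpha_1^p=\beta_2$, $\alpha_2^p=\beta_1^\nu$, $\alpha^p=1$. Elements: $(a_2,a_3)(a_1,\zeta)$, $(a_1,a_3)(a_2,\zeta^\nu)$. 7. $\Phi_4(221)f_r$: $\alpha_1^p=\beta_2^\kappa$, $\alpha_2^p=\beta_1\beta_2$, $\alpha^p=1$, where $4\kappa=g^{2r+1}$, for $r=1,2,\dots,\frac12(p-1)$. Elements: $(a_2,\zeta a_3)(a_1,\zeta^\kappa)$, $(a_1,a_3)(a_2,\zeta)$. 8. $\Phi_4(2111)a$: $\alpha^p=\beta_2$, $\alpha_1^p=\alpha_2^p=1$. Elements: $(\zeta^{-1}a_2,a_3)$, $(a_1,a_3)$. 9. $\Phi_4(2111)b$: $\alpha_1^p=\beta_1$, $\alpha^p=\alpha_2^p=1$. Elements: $(a_2,a_3)$, $(a_1,\zeta a_3)$. 10. $\Phi_4(2111)c$: $\alpha_2^p=\beta_1$, $\alpha^p=\alpha_1^p=1$. Elements: $(a_2,a_3)$, $(a_1,a_3)(a_2,\zeta)$. 11. $\Phi_4(1^5)$: $\alpha^p=\alpha_1^p=\alpha_2^p=1$. Elements: $(a_2,a_3)$, $(a_1,a_3)$.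
   Context: $[x,y]=x^{-1}y^{-1}xy$. $\nu$ is the smallest positive integer that is a quadratic non-residue mod $p$, and $g$ is the smallest positive integer that is a primitive root mod $p$. Exponents of $\beta_1,\beta_2,\zeta$ are read modulo $p$ (so $-1/4$ and the $\kappa$ defined by an equation for $4\kappa$ are residues mod $p$). A finite group $G$ is realizable as a Galois group over $k$ if there is a Galois field extension $M/k$ with $\mathrm{Gal}(M/k)\cong G$. Elements of $k^\times$ are independent modulo $k^{\times p}$ if their classes are linearly independent in the $\mathbb F_p$-vector space $k^\times/k^{\times p}$. For $a,b\in k^\times$, $(a,b;\zeta)\in\mathrm{Br}(k)$ is the class of the $p$-cyclic $k$-algebra generated by $i_1,i_2$ with $i_1^p=b$, $i_2^p=a$, $i_1i_2=\zeta i_2i_1$; $\mathrm{Br}(k)$ is written multiplicatively. *)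

theory Defs
  imports
    "HOL-Algebra.Algebra"
    "HOL-Algebra.Algebraic_Closure_Type"
    "HOL-Number_Theory.Number_Theory"
begin

section \<open>Galois extensions and realizability\<close>

definition galois_group :: "'b::field set \<Rightarrow> 'b set \<Rightarrow> ('b \<Rightarrow> 'b) monoid" where
  "galois_group M K = (let R = ring_of_type_algebra\<lparr>carrier := M\<rparr> in
     (BijGroup M)\<lparr>carrier := {\<sigma> \<in> extensional M. \<sigma> \<in> ring_iso R R \<and> (\<forall>x\<in>K. \<sigma> x = x)}\<rparr>)"

definition galois_extension :: "'b::field set \<Rightarrow> 'b set \<Rightarrow> bool" where
  "galois_extension M K \<longleftrightarrow>
     subfield K ring_of_type_algebra \<and> subfield M ring_of_type_algebra \<and> K \<subseteq> M \<and>
     (\<forall>x\<in>M. \<exists>f :: 'b poly. f \<noteq> 0 \<and> (\<forall>i. poly.coeff f i \<in> K) \<and> poly f x = 0) \<and>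
     {x \<in> M. \<forall>\<sigma> \<in> carrier (galois_group M K). \<sigma> x = x} = K"

text \<open>
  The field k is the type \<open>'a\<close>. The Galois extensions of k are taken inside the algebraic
  closure \<open>'a alg_closure\<close>, into which every algebraic extension of k embeds over k.
\<close>
definition realizable :: "'a::field itself \<Rightarrow> ('g, 'm) monoid_scheme \<Rightarrow> bool" where
  "realizable k G \<longleftrightarrow> (\<exists>M :: 'a alg_closure set.
     galois_extension M (range to_ac) \<and> galois_group M (range to_ac) \<cong> G)"

text \<open>
  Linear independence in \<open>k\<^sup>\<times>/k\<^sup>\<times>\<^sup>p\<close>, written multiplicatively; integers represent
  the scalars from the field with p elements.
\<close>
definition independent_mod_powers :: "nat \<Rightarrow> 'a::field \<Rightarrow> 'a \<Rightarrow> 'a \<Rightarrow> bool" where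
  "independent_mod_powers p a1 a2 a3 \<longleftrightarrow> a1 \<noteq> 0 \<and> a2 \<noteq> 0 \<and> a3 \<noteq> 0 \<and>
     (\<forall>e1 e2 e3 :: int.
        (\<exists>c. c \<noteq> 0 \<and> a1 powi e1 * a2 powi e2 * a3 powi e3 = c ^ p) \<longrightarrow>
        int p dvd e1 \<and> int p dvd e2 \<and> int p dvd e3)"

section \<open>The Brauer group\<close>

text \<open>
  A finite-dimensional algebra is presented by a finite basis \<open>(e\<^sub>i)\<close>, the structure constants
  in \<open>e\<^sub>i e\<^sub>j = (\<Sum>l. strc i j l e\<^sub>l)\<close>, and the coordinates of its unit element.
  The elements are the coordinate functions supported on the basis.
\<close>
record ('i, 'a) based_algebra =
  basis :: "'i set"
  strc :: "'i \<Rightarrow> 'i \<Rightarrow> 'i \<Rightarrow> 'a"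
  unit_coord :: "'i \<Rightarrow> 'a"

definition alg_of :: "('i, 'a::field) based_algebra \<Rightarrow> ('a, 'i \<Rightarrow> 'a) module" where
  "alg_of A =
     \<lparr>carrier = {x. \<forall>i. i \<notin> basis A \<longrightarrow> x i = 0},
      monoid.mult = (\<lambda>x y l. if l \<in> basis A
                then \<Sum>i\<in>basis A. \<Sum>j\<in>basis A. x i * y j * strc A i j l else 0),
      monoid.one = (\<lambda>l. if l \<in> basis A then unit_coord A l else 0),
      ring.zero = (\<lambda>_. 0),
      ring.add = (\<lambda>x y l. x l + y l),
      module.smult = (\<lambda>c x l. c * x l)\<rparr>"

definition alg_isomorphic ::
    "('i, 'a::field) based_algebra \<Rightarrow> ('j, 'a) based_algebra \<Rightarrow> bool" where
  "alg_isomorphic A B \<longleftrightarrow> (\<exists>h \<in> ring_iso (alg_of A) (alg_of B).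
     \<forall>c. \<forall>x \<in> carrier (alg_of A). h (c \<odot>\<^bsub>alg_of A\<^esub> x) = c \<odot>\<^bsub>alg_of B\<^esub> h x)"

definition central_simple :: "('i, 'a::field) based_algebra \<Rightarrow> bool" where
  "central_simple A \<longleftrightarrow> (let R = alg_of A in
     finite (basis A) \<and> ring R \<and> \<one>\<^bsub>R\<^esub> \<noteq> \<zero>\<^bsub>R\<^esub> \<and>
     {z \<in> carrier R. \<forall>x \<in> carrier R. z \<otimes>\<^bsub>R\<^esub> x = x \<otimes>\<^bsub>R\<^esub> z} = {c \<odot>\<^bsub>R\<^esub> \<one>\<^bsub>R\<^esub> | c. True} \<and>
     (\<forall>J. ideal J R \<longrightarrow> J = {\<zero>\<^bsub>R\<^esub>} \<or> J = carrier R))"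

definition tensor ::
    "('i, 'a::field) based_algebra \<Rightarrow> ('j, 'a) based_algebra \<Rightarrow> ('i \<times> 'j, 'a) based_algebra" where
  "tensor A B =
     \<lparr>basis = basis A \<times> basis B,
      strc = (\<lambda>(i, i') (j, j') (l, l'). strc A i j l * strc B i' j' l'),
      unit_coord = (\<lambda>(i, i'). unit_coord A i * unit_coord B i')\<rparr>"

definition matrix_algebra :: "nat \<Rightarrow> (nat \<times> nat, 'a::field) based_algebra" where
  "matrix_algebra n =
     \<lparr>basis = {..<n} \<times> {..<n},
      strc = (\<lambda>(i, j) (i', j') u. if j = i' \<and> u = (i, j') then 1 else 0),
      unit_coord = (\<lambda>(i, j). if i = j then 1 else 0)\<rparr>"

definition brauer_equivalent ::
    "('i, 'a::field) based_algebra \<Rightarrow> ('j, 'a) based_algebra \<Rightarrow> bool" where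
  "brauer_equivalent A B \<longleftrightarrow> (\<exists>m > 0. \<exists>n > 0.
     alg_isomorphic (tensor A (matrix_algebra m)) (tensor B (matrix_algebra n)))"

text \<open>
  Every finite-dimensional algebra has a basis indexed by natural numbers, so the Brauer classes
  are formed inside a single type.
\<close>
definition brauer_class ::
    "('i, 'a::field) based_algebra \<Rightarrow> (nat, 'a) based_algebra set" where
  "brauer_class A = {B. central_simple B \<and> brauer_equivalent A B}"

definition Br :: "(nat, 'a::field) based_algebra set monoid" where
  "Br = \<lparr>carrier = {brauer_class A | A :: (nat, 'a) based_algebra. central_simple A},
         monoid.mult = (\<lambda>S T. \<Union>A\<in>S. \<Union>B\<in>T. brauer_class (tensor A B)),
         monoid.one = brauer_class (matrix_algebra 1)\<rparr>"

text \<open>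
  The index \<open>(s, r)\<close> stands for the monomial \<open>i\<^sub>2\<^sup>s i\<^sub>1\<^sup>r\<close>. The
  relations \<open>i\<^sub>1\<^sup>p = b\<close>, \<open>i\<^sub>2\<^sup>p = a\<close>, \<open>i\<^sub>1 i\<^sub>2 = \<zeta> i\<^sub>2 i\<^sub>1\<close> give
  \<open>(i\<^sub>2\<^sup>s i\<^sub>1\<^sup>r) (i\<^sub>2\<^sup>u i\<^sub>1\<^sup>t) = \<zeta>\<^sup>r\<^sup>u i\<^sub>2\<^sup>s\<^sup>+\<^sup>u i\<^sub>1\<^sup>r\<^sup>+\<^sup>t\<close>.
\<close>
definition cyclic_algebra :: "nat \<Rightarrow> 'a::field \<Rightarrow> 'a \<Rightarrow> 'a \<Rightarrow> (nat \<times> nat, 'a) based_algebra" where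
  "cyclic_algebra p \<zeta> a b =
     \<lparr>basis = {..<p} \<times> {..<p},
      strc = (\<lambda>(s, r) (u, t) v. if v = ((s + u) mod p, (r + t) mod p)
                then \<zeta> ^ (r * u) * a ^ ((s + u) div p) * b ^ ((r + t) div p) else 0),
      unit_coord = (\<lambda>v. if v = (0, 0) then 1 else 0)\<rparr>"

definition symbol_class :: "nat \<Rightarrow> 'a::field \<Rightarrow> 'a \<Rightarrow> 'a \<Rightarrow> (nat, 'a) based_algebra set" where
  "symbol_class p \<zeta> a b = brauer_class (cyclic_algebra p \<zeta> a b)"

text \<open>The monomial model satisfies the defining relations, and its basis consists of the monomials in the generators.\<close>

definition unit_vec :: "'i \<Rightarrow> 'i \<Rightarrow> 'a::field" where
  "unit_vec v = (\<lambda>w. if w = v then 1 else 0)"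

lemma cyclic_algebra_mult_monomials:
  fixes \<zeta> a b :: "'a::field"
  assumes "s < p" "r < p" "u < p" "t < p"
  shows "unit_vec (s, r) \<otimes>\<^bsub>alg_of (cyclic_algebra p \<zeta> a b)\<^esub> unit_vec (u, t) =
    (\<zeta> ^ (r * u) * a ^ ((s + u) div p) * b ^ ((r + t) div p))
      \<odot>\<^bsub>alg_of (cyclic_algebra p \<zeta> a b)\<^esub> unit_vec ((s + u) mod p, (r + t) mod p)"
proof
  fix l :: "nat \<times> nat"
  let ?I = "{..<p} \<times> {..<p}"
  define c where "c = strc (cyclic_algebra p \<zeta> a b)"
  have "(\<Sum>j\<in>?I. unit_vec (s, r) i * unit_vec (u, t) j * c i j l)
      = (if i = (s, r) then c i (u, t) l else 0)" for i
  proof (cases "i = (s, r)")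
    case True
    have "(\<Sum>j\<in>?I. unit_vec (s, r) i * unit_vec (u, t) j * c i j l)
        = (\<Sum>j\<in>?I. if j = (u, t) then c i j l else 0)"
      using True by (intro sum.cong) (simp_all add: unit_vec_def)
    then show ?thesis using True assms by simp
  qed (simp add: unit_vec_def)
  then have "(\<Sum>i\<in>?I. \<Sum>j\<in>?I. unit_vec (s, r) i * unit_vec (u, t) j * c i j l)
      = (\<Sum>i\<in>?I. if i = (s, r) then c i (u, t) l else 0)"
    by simp
  also have "\<dots> = c (s, r) (u, t) l"
    using assms by simp
  finally show "(unit_vec (s, r) \<otimes>\<^bsub>alg_of (cyclic_algebra p \<zeta> a b)\<^esub> unit_vec (u, t)) l =
    ((\<zeta> ^ (r * u) * a ^ ((s + u) div p) * b ^ ((r + t) div p))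
      \<odot>\<^bsub>alg_of (cyclic_algebra p \<zeta> a b)\<^esub> unit_vec ((s + u) mod p, (r + t) mod p)) l"
    using assms unfolding c_def alg_of_def by (auto simp: cyclic_algebra_def unit_vec_def)
qed

lemma cyclic_algebra_one:
  "p > 0 \<Longrightarrow> \<one>\<^bsub>alg_of (cyclic_algebra p \<zeta> a b)\<^esub> = unit_vec (0, 0)"
  by (auto simp: alg_of_def cyclic_algebra_def unit_vec_def)

lemma cyclic_algebra_i1_power:
  assumes "p > 1" "n < p"
  shows "unit_vec (0, 1) [^]\<^bsub>alg_of (cyclic_algebra p \<zeta> a b)\<^esub> n = unit_vec (0, n)"
  using assms(2)
proof (induction n)
  case 0
  then show ?case using assms by (simp add: cyclic_algebra_one)
next
  case (Suc n)
  then show ?case using assms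
    by (simp add: cyclic_algebra_mult_monomials) (simp add: alg_of_def)
qed

lemma cyclic_algebra_i2_power:
  assumes "p > 1" "n < p"
  shows "unit_vec (1, 0) [^]\<^bsub>alg_of (cyclic_algebra p \<zeta> a b)\<^esub> n = unit_vec (n, 0)"
  using assms(2)
proof (induction n)
  case 0
  then show ?case using assms by (simp add: cyclic_algebra_one)
next
  case (Suc n)
  then show ?case using assms
    by (simp add: cyclic_algebra_mult_monomials) (simp add: alg_of_def)
qed

lemma cyclic_algebra_relations:
  fixes \<zeta> a b :: "'a::field" and p :: nat
  defines "R \<equiv> alg_of (cyclic_algebra p \<zeta> a b)"
    and "i1 \<equiv> unit_vec (0, 1)" and "i2 \<equiv> unit_vec (1, 0)"
  assumes p: "p > 1"
  shows "i1 [^]\<^bsub>R\<^esub> p = b \<odot>\<^bsub>R\<^esub> \<one>\<^bsub>R\<^esub>" "i2 [^]\<^bsub>R\<^esub> p = a \<odot>\<^bsub>R\<^esub> \<one>\<^bsub>R\<^esub>"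
    and "i1 \<otimes>\<^bsub>R\<^esub> i2 = \<zeta> \<odot>\<^bsub>R\<^esub> (i2 \<otimes>\<^bsub>R\<^esub> i1)"
    and "\<And>s r. s < p \<Longrightarrow> r < p \<Longrightarrow> (i2 [^]\<^bsub>R\<^esub> s) \<otimes>\<^bsub>R\<^esub> (i1 [^]\<^bsub>R\<^esub> r) = unit_vec (s, r)"
proof -
  obtain q where q: "p = Suc q" "q > 0" using p by (cases p) auto
  have pw: "i1 [^]\<^bsub>R\<^esub> p = (i1 [^]\<^bsub>R\<^esub> q) \<otimes>\<^bsub>R\<^esub> i1" "i2 [^]\<^bsub>R\<^esub> p = (i2 [^]\<^bsub>R\<^esub> q) \<otimes>\<^bsub>R\<^esub> i2"
    by (simp_all add: q)
  have q': "i1 [^]\<^bsub>R\<^esub> q = unit_vec (0, q)" "i2 [^]\<^bsub>R\<^esub> q = unit_vec (q, 0)"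
    unfolding R_def i1_def i2_def using p q
    by (simp_all only: cyclic_algebra_i1_power cyclic_algebra_i2_power lessI)
  show "i1 [^]\<^bsub>R\<^esub> p = b \<odot>\<^bsub>R\<^esub> \<one>\<^bsub>R\<^esub>" "i2 [^]\<^bsub>R\<^esub> p = a \<odot>\<^bsub>R\<^esub> \<one>\<^bsub>R\<^esub>"
    unfolding pw q' unfolding R_def i1_def i2_def using p q
    by (simp_all add: cyclic_algebra_mult_monomials cyclic_algebra_one)
  show "i1 \<otimes>\<^bsub>R\<^esub> i2 = \<zeta> \<odot>\<^bsub>R\<^esub> (i2 \<otimes>\<^bsub>R\<^esub> i1)"
    unfolding R_def i1_def i2_def using p
    by (simp add: cyclic_algebra_mult_monomials) (simp add: alg_of_def)
  show "(i2 [^]\<^bsub>R\<^esub> s) \<otimes>\<^bsub>R\<^esub> (i1 [^]\<^bsub>R\<^esub> r) = unit_vec (s, r)" if "s < p" "r < p" for s r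
    unfolding R_def i1_def i2_def
      cyclic_algebra_i1_power[OF p that(2)] cyclic_algebra_i2_power[OF p that(1)]
    using p that by (simp add: cyclic_algebra_mult_monomials) (simp add: alg_of_def)
qed

section \<open>The groups\<close>

definition commutator :: "('g, 'm) monoid_scheme \<Rightarrow> 'g \<Rightarrow> 'g \<Rightarrow> 'g" where
  "commutator G x y = inv\<^bsub>G\<^esub> x \<otimes>\<^bsub>G\<^esub> inv\<^bsub>G\<^esub> y \<otimes>\<^bsub>G\<^esub> x \<otimes>\<^bsub>G\<^esub> y"

definition Phi4_generators ::
    "nat \<Rightarrow> ('g, 'm) monoid_scheme \<Rightarrow> 'g \<Rightarrow> 'g \<Rightarrow> 'g \<Rightarrow> 'g \<Rightarrow> 'g \<Rightarrow> bool" where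
  "Phi4_generators p G \<alpha> \<alpha>1 \<alpha>2 \<beta>1 \<beta>2 \<longleftrightarrow>
     group G \<and> Coset.order G = p ^ 5 \<and>
     {\<alpha>, \<alpha>1, \<alpha>2, \<beta>1, \<beta>2} \<subseteq> carrier G \<and> generate G {\<alpha>, \<alpha>1, \<alpha>2, \<beta>1, \<beta>2} = carrier G \<and>
     commutator G \<alpha>1 \<alpha> = \<beta>1 \<and> commutator G \<alpha>2 \<alpha> = \<beta>2 \<and>
     \<beta>1 [^]\<^bsub>G\<^esub> p = \<one>\<^bsub>G\<^esub> \<and> \<beta>2 [^]\<^bsub>G\<^esub> p = \<one>\<^bsub>G\<^esub> \<and>
     commutator G \<alpha>1 \<alpha>2 = \<one>\<^bsub>G\<^esub> \<and> commutator G \<beta>1 \<beta>2 = \<one>\<^bsub>G\<^esub> \<and>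
     (\<forall>x \<in> {\<alpha>, \<alpha>1, \<alpha>2}. \<forall>y \<in> {\<beta>1, \<beta>2}. commutator G x y = \<one>\<^bsub>G\<^esub>)"

definition least_nonresidue :: "nat \<Rightarrow> nat" where
  "least_nonresidue p = (LEAST n. n > 0 \<and> \<not> QuadRes (int p) (int n))"

definition least_primroot :: "nat \<Rightarrow> nat" where
  "least_primroot p = (LEAST n. n > 0 \<and> residue_primroot p n)"

end

theory Submission
  imports Defs "HOL-Library.Function_Algebras"
begin

text \<open>
  The group \<open>G\<close> is a central extension of an elementary abelian group of rank 3 by the group
  generated by \<open>\<beta>1\<close> and \<open>\<beta>2\<close>. A realization of \<open>G\<close> contains the fixed field \<open>K\<close> of \<open>\<beta>1\<close>, \<open>\<beta>2\<close>, a Kummer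
  extension \<open>k(x\<^sub>0, x\<^sub>1, x\<^sub>2)\<close> with \<open>x\<^sub>i\<^sup>p = a\<^sub>i\<^sub>+\<^sub>1\<close> and Galois group generated by \<open>s\<^sub>0, s\<^sub>1, s\<^sub>2\<close>, and an eigenvector \<open>y\<close> of
  \<open>\<beta>1\<close> that is fixed by \<open>\<beta>2\<close> (or conversely) yields elements \<open>f\<^sub>i = s\<^sub>i y / y\<close> of \<open>K\<close> whose norms and commutation rules
  mirror the relations of \<open>G\<close> modulo \<open>\<beta>2\<close> (or \<open>\<beta>1\<close>). Conversely, given such families, Hilbert 90 for the \<open>f\<^sub>i\<^sup>p\<close> provides
  the \<open>p\<close>-th powers of \<open>y\<close>, and adjoining the two roots to \<open>K\<close> realizes \<open>G\<close>. Multiplying \<open>f\<^sub>0\<close> by \<open>x\<^sub>2\<close> makes the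
  cocycle symmetric, and symmetric cocycles with norms \<open>w\<^sub>i\<close> exist if and only if the tensor product of the symbol
  algebras \<open>(a\<^sub>i\<^sub>+\<^sub>1, w\<^sub>i)\<close> is split: this algebra acts on \<open>K\<close> by the operators \<open>z \<mapsto> h\<^sub>i s\<^sub>i z\<close> and multiplication by the \<open>x\<^sub>i\<close>.
\<close>

section \<open>Algebras given by structure constants\<close>

text \<open>Two characters of the group generated by \<beta>1 and \<beta>2, one trivial on \<beta>2
  and one trivial on \<beta>1, separate its elements. An embedding problem with kernel of rank 2
  therefore falls into two problems with kernel of order p over the same Kummer extension, and each
  contributes one of the two listed elements. The generators \<alpha>1, \<alpha>2, \<alpha> carry
  the indices 0, 1, 2; exchanging 0 and 1 turns the problem for \<beta>2 into that for \<beta>1. The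
  factor \<zeta> in the cocycle can be absorbed at either of the two noncommuting generators.
  Multiplying \<open>f 0\<close> by \<open>x 2\<close> changes its norm by \<open>a 2\<close>,
  whence second entries such as \<zeta> a3. If the p-th power of \<alpha> is nontrivial,
  \<open>f 2\<close> is divided by \<open>x 0\<close> instead; this is the origin of the entry
  \<zeta>^-1 a2. That the two roots adjoined to \<open>K\<close> have degree p^2 is no extra
  condition: \<beta>1 and \<beta>2 are nontrivial commutators, and a root lying in the smaller field
  would make a cocycle symmetric. Symbol algebras and their tensor products are handled as twisted
  group algebras with explicit bases.\<close>

lemma sum_mult_Times:
  fixes f :: "'i \<Rightarrow> 'a::comm_semiring_0"
  shows "(\<Sum>(a, b)\<in>A \<times> B. f a * g b) = (\<Sum>a\<in>A. f a) * (\<Sum>b\<in>B. g b)"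
  by (simp add: sum_product sum.cartesian_product)

lemma sum_mult_Times':
  fixes f :: "'i \<Rightarrow> 'a::comm_semiring_0"
  shows "(\<Sum>l\<in>A \<times> B. f (fst l) * g (snd l)) = (\<Sum>a\<in>A. f a) * (\<Sum>b\<in>B. g b)"
  using sum_mult_Times[of f g A B] by (simp add: case_prod_unfold)

lemma sum_Times: "(\<Sum>a\<in>A. \<Sum>b\<in>B. F a b) = (\<Sum>l\<in>A \<times> B. F (fst l) (snd l))"
  by (simp add: sum.cartesian_product case_prod_unfold)

lemma sum_product_scale:
  fixes f :: "'i \<Rightarrow> 'a::comm_semiring_0"
  shows "(\<Sum>i\<in>A. \<Sum>j\<in>B. f i * g j * c) = (\<Sum>i\<in>A. f i) * (\<Sum>j\<in>B. g j) * c"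
  by (subst sum_product) (simp only: sum_distrib_right)

text \<open>\<open>alg_isomorphic\<close> with all operations written out on coordinate
  functions.\<close>

definition alg_iso :: "('i, 'a::field) based_algebra \<Rightarrow> ('j, 'a) based_algebra \<Rightarrow> (('i \<Rightarrow> 'a) \<Rightarrow> 'j \<Rightarrow> 'a) \<Rightarrow> bool" where
  "alg_iso A B h \<longleftrightarrow> bij_betw h (carrier (alg_of A)) (carrier (alg_of B)) \<and>
    (\<forall>x\<in>carrier (alg_of A). \<forall>y\<in>carrier (alg_of A).
       h (x \<otimes>\<^bsub>alg_of A\<^esub> y) = h x \<otimes>\<^bsub>alg_of B\<^esub> h y \<and> h (\<lambda>l. x l + y l) = (\<lambda>l. h x l + h y l)) \<and>
    h \<one>\<^bsub>alg_of A\<^esub> = \<one>\<^bsub>alg_of B\<^esub> \<and>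
    (\<forall>c. \<forall>x\<in>carrier (alg_of A). h (\<lambda>l. c * x l) = (\<lambda>l. c * h x l))"

lemma carrier_alg_of: "carrier (alg_of A) = {x. \<forall>i. i \<notin> basis A \<longrightarrow> x i = 0}"
  by (simp add: alg_of_def)

lemma mult_alg_of:
  "x \<otimes>\<^bsub>alg_of A\<^esub> y = (\<lambda>l. if l \<in> basis A then \<Sum>i\<in>basis A. \<Sum>j\<in>basis A. x i * y j * strc A i j l else 0)"
  by (simp add: alg_of_def)

lemma one_alg_of: "\<one>\<^bsub>alg_of A\<^esub> = (\<lambda>l. if l \<in> basis A then unit_coord A l else 0)"
  by (simp add: alg_of_def)

lemma zero_alg_of: "\<zero>\<^bsub>alg_of A\<^esub> = (\<lambda>_. 0)"
  by (simp add: alg_of_def)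

lemma add_alg_of: "x \<oplus>\<^bsub>alg_of A\<^esub> y = (\<lambda>l. x l + y l)"
  by (simp add: alg_of_def)

lemma smult_alg_of: "c \<odot>\<^bsub>alg_of A\<^esub> x = (\<lambda>l. c * x l)"
  by (simp add: alg_of_def)

lemma mult_closed_alg_of: "x \<otimes>\<^bsub>alg_of A\<^esub> y \<in> carrier (alg_of A)"
  by (simp add: carrier_alg_of mult_alg_of)

lemma one_closed_alg_of: "\<one>\<^bsub>alg_of A\<^esub> \<in> carrier (alg_of A)"
  by (simp add: carrier_alg_of one_alg_of)

lemma alg_isomorphic_iff_alg_iso: "alg_isomorphic A B \<longleftrightarrow> (\<exists>h. alg_iso A B h)"
  unfolding alg_isomorphic_def alg_iso_def ring_iso_def ring_hom_def Bex_def
  by (rule ex_cong1) (auto simp: add_alg_of smult_alg_of dest: bij_betw_apply)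

lemma alg_isomorphic_refl: "alg_isomorphic A A"
  unfolding alg_isomorphic_iff_alg_iso
  by (rule exI[of _ id]) (simp add: alg_iso_def)

lemma alg_isomorphic_trans:
  assumes "alg_isomorphic A B" "alg_isomorphic B C"
  shows "alg_isomorphic A C"
proof -
  obtain g h where g: "alg_iso A B g" and h: "alg_iso B C h"
    using assms unfolding alg_isomorphic_iff_alg_iso by blast
  have "g x \<in> carrier (alg_of B)" if "x \<in> carrier (alg_of A)" for x
    using g that by (auto simp: alg_iso_def dest: bij_betw_apply)
  then have "alg_iso A C (h \<circ> g)"
    using g h unfolding alg_iso_def by (auto intro: bij_betw_trans)
  then show ?thesis
    unfolding alg_isomorphic_iff_alg_iso by blast
qed

lemma alg_isomorphic_sym:
  assumes "alg_isomorphic A B"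
  shows "alg_isomorphic B A"
proof -
  obtain h where h: "alg_iso A B h"
    using assms unfolding alg_isomorphic_iff_alg_iso by blast
  let ?g = "inv_into (carrier (alg_of A)) h"
  have bij: "bij_betw h (carrier (alg_of A)) (carrier (alg_of B))"
    using h by (simp add: alg_iso_def)
  have gc: "?g y \<in> carrier (alg_of A)" and hg: "h (?g y) = y" if "y \<in> carrier (alg_of B)" for y
    using bij that by (auto simp: bij_betw_def inv_into_into f_inv_into_f)
  have gh: "?g y = x" if "h x = y" "x \<in> carrier (alg_of A)" for x y
    using bij that by (auto simp: bij_betw_def inv_into_f_f)
  have "alg_iso B A ?g"
    unfolding alg_iso_def
  proof (intro conjI ballI allI)
    show "bij_betw ?g (carrier (alg_of B)) (carrier (alg_of A))"
      using bij by (rule bij_betw_inv_into)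
    show "?g \<one>\<^bsub>alg_of B\<^esub> = \<one>\<^bsub>alg_of A\<^esub>"
      using h by (intro gh) (auto simp: alg_iso_def one_closed_alg_of)
  next
    fix x y assume xy: "x \<in> carrier (alg_of B)" "y \<in> carrier (alg_of B)"
    show "?g (x \<otimes>\<^bsub>alg_of B\<^esub> y) = ?g x \<otimes>\<^bsub>alg_of A\<^esub> ?g y"
      using h xy gc hg by (intro gh mult_closed_alg_of) (auto simp: alg_iso_def)
    show "?g (\<lambda>l. x l + y l) = (\<lambda>l. ?g x l + ?g y l)"
      using h xy gc hg gc[OF xy(1)] gc[OF xy(2)] by (intro gh) (auto simp: alg_iso_def carrier_alg_of)
  next
    fix c x assume x: "x \<in> carrier (alg_of B)"
    show "?g (\<lambda>l. c * x l) = (\<lambda>l. c * ?g x l)"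
      using h x gc hg gc[OF x] by (intro gh) (auto simp: alg_iso_def carrier_alg_of)
  qed
  then show ?thesis
    unfolding alg_isomorphic_iff_alg_iso by blast
qed

text \<open>\<open>H\<close> is the matrix of an isomorphism, with row \<open>i\<close> the image of
  the basis vector \<open>i\<close>, and \<open>G\<close> is the inverse matrix. In this form the
  tensor product of two isomorphisms is a Kronecker product.\<close>

definition matrix_iso :: "('i, 'a::field) based_algebra \<Rightarrow> ('j, 'a) based_algebra
    \<Rightarrow> ('i \<Rightarrow> 'j \<Rightarrow> 'a) \<Rightarrow> ('j \<Rightarrow> 'i \<Rightarrow> 'a) \<Rightarrow> bool" where
  "matrix_iso A B H G \<longleftrightarrow>
    (\<forall>i\<in>basis A. \<forall>i'\<in>basis A. \<forall>j\<in>basis B. (\<Sum>l\<in>basis A. strc A i i' l * H l j) =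
       (\<Sum>j1\<in>basis B. \<Sum>j2\<in>basis B. H i j1 * H i' j2 * strc B j1 j2 j)) \<and>
    (\<forall>j\<in>basis B. (\<Sum>i\<in>basis A. unit_coord A i * H i j) = unit_coord B j) \<and>
    (\<forall>i\<in>basis A. \<forall>i'\<in>basis A. (\<Sum>j\<in>basis B. H i j * G j i') = (if i = i' then 1 else 0)) \<and>
    (\<forall>j\<in>basis B. \<forall>j'\<in>basis B. (\<Sum>i\<in>basis A. G j i * H i j') = (if j = j' then 1 else 0))"

lemma unit_vec_in_carrier: "i \<in> basis A \<Longrightarrow> unit_vec i \<in> carrier (alg_of A)"
  by (auto simp: carrier_alg_of unit_vec_def)

lemma mult_unit_vec:
  assumes "finite (basis A)" "i \<in> basis A" "j \<in> basis A"
  shows "unit_vec i \<otimes>\<^bsub>alg_of A\<^esub> unit_vec j = (\<lambda>l. if l \<in> basis A then strc A i j l else 0)"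
proof
  fix l
  have "(\<Sum>i'\<in>basis A. \<Sum>j'\<in>basis A. unit_vec i i' * unit_vec j j' * strc A i' j' l)
      = (\<Sum>i'\<in>basis A. if i' = i then (\<Sum>j'\<in>basis A. if j' = j then strc A i' j' l else 0) else 0)"
    by (intro sum.cong refl) (auto simp: unit_vec_def intro!: sum.cong)
  also have "\<dots> = strc A i j l"
    using assms by simp
  finally show "(unit_vec i \<otimes>\<^bsub>alg_of A\<^esub> unit_vec j) l = (if l \<in> basis A then strc A i j l else 0)"
    by (simp add: mult_alg_of)
qed

lemma linear_expand:
  fixes h :: "('i \<Rightarrow> 'a::field) \<Rightarrow> 'j \<Rightarrow> 'a"
  assumes fin: "finite B"
    and add: "\<And>x y. (\<forall>i. i \<notin> B \<longrightarrow> x i = 0) \<Longrightarrow> (\<forall>i. i \<notin> B \<longrightarrow> y i = 0) \<Longrightarrow>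
      h (\<lambda>l. x l + y l) = (\<lambda>l. h x l + h y l)"
    and smult: "\<And>c x. (\<forall>i. i \<notin> B \<longrightarrow> x i = 0) \<Longrightarrow> h (\<lambda>l. c * x l) = (\<lambda>l. c * h x l)"
    and x: "\<forall>i. i \<notin> B \<longrightarrow> x i = 0"
  shows "h x j = (\<Sum>i\<in>B. x i * h (unit_vec i) j)"
proof -
  have "h x j = (\<Sum>i\<in>S. x i * h (unit_vec i) j)"
    if "finite S" "S \<subseteq> B" "\<forall>i. i \<notin> S \<longrightarrow> x i = 0" for S x
    using that
  proof (induction S arbitrary: x)
    case empty
    then have "x = (\<lambda>l. 0 * x l)" by auto
    with smult[of x 0] empty show ?case by (metis mult_zero_left sum.empty)
  next
    case (insert a S)
    let ?y = "\<lambda>l. if l = a then 0 else x l"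
    have y: "\<forall>i. i \<notin> S \<longrightarrow> ?y i = 0" using insert.prems by auto
    have u: "\<forall>i. i \<notin> B \<longrightarrow> unit_vec a i = (0::'a)" using insert.prems by (auto simp: unit_vec_def)
    have "x = (\<lambda>l. ?y l + x a * unit_vec a l)" by (auto simp: unit_vec_def)
    then have "h x = h (\<lambda>l. ?y l + x a * unit_vec a l)" by simp
    also have "\<dots> = (\<lambda>l. h ?y l + h (\<lambda>l. x a * unit_vec a l) l)"
      using y u insert.prems by (intro add) auto
    also have "h (\<lambda>l. x a * unit_vec a l) = (\<lambda>l. x a * h (unit_vec a) l)"
      using u by (rule smult)
    finally have "h x j = h ?y j + x a * h (unit_vec a) j" by simp
    also have "h ?y j = (\<Sum>i\<in>S. ?y i * h (unit_vec i) j)"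
      by (rule insert.IH) (use insert.prems y in auto)
    also have "\<dots> = (\<Sum>i\<in>S. x i * h (unit_vec i) j)"
      using insert by (intro sum.cong) auto
    finally show ?case using insert by (simp add: add.commute)
  qed
  from this[OF fin subset_refl x] show ?thesis .
qed

lemma alg_iso_expand:
  assumes "alg_iso A B h" "finite (basis A)" "x \<in> carrier (alg_of A)"
  shows "h x j = (\<Sum>i\<in>basis A. x i * h (unit_vec i) j)"
  using assms by (intro linear_expand) (auto simp: alg_iso_def carrier_alg_of)

lemma alg_isomorphic_imp_matrix_iso:
  fixes A :: "('i, 'a::field) based_algebra" and B :: "('j, 'a) based_algebra"
  assumes fin: "finite (basis A)" "finite (basis B)" and "alg_isomorphic A B"
  shows "\<exists>H G. matrix_iso A B H G"
proof -
  obtain h where h: "alg_iso A B h"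
    using assms unfolding alg_isomorphic_iff_alg_iso by blast
  let ?CA = "carrier (alg_of A)" and ?CB = "carrier (alg_of B)"
  define g where "g = inv_into ?CA h"
  have bij: "bij_betw h ?CA ?CB"
    using h by (simp add: alg_iso_def)
  have gc: "g y \<in> ?CA" and hg: "h (g y) = y" if "y \<in> ?CB" for y
    using bij that by (auto simp: g_def bij_betw_def inv_into_into f_inv_into_f)
  have gh: "g y = x" if "h x = y" "x \<in> ?CA" for x y
    using bij that by (auto simp: g_def bij_betw_def inv_into_f_f)
  have hc: "h x \<in> ?CB" if "x \<in> ?CA" for x using bij that by (auto dest: bij_betw_apply)
  have gexp: "g y i = (\<Sum>j\<in>basis B. y j * g (unit_vec j) i)" if "y \<in> ?CB" for y i
  proof (rule linear_expand[OF fin(2)])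
    fix x y :: "'j \<Rightarrow> 'a" assume xy: "\<forall>i. i \<notin> basis B \<longrightarrow> x i = 0" "\<forall>i. i \<notin> basis B \<longrightarrow> y i = 0"
    then have xy: "x \<in> ?CB" "y \<in> ?CB" by (auto simp: carrier_alg_of)
    show "g (\<lambda>l. x l + y l) = (\<lambda>l. g x l + g y l)"
      using h xy gc hg gc[OF xy(1)] gc[OF xy(2)] by (intro gh) (auto simp: alg_iso_def carrier_alg_of)
  next
    fix c and x :: "'j \<Rightarrow> 'a" assume x: "\<forall>i. i \<notin> basis B \<longrightarrow> x i = 0"
    then have x: "x \<in> ?CB" by (auto simp: carrier_alg_of)
    show "g (\<lambda>l. c * x l) = (\<lambda>l. c * g x l)"
      using h x gc hg gc[OF x] by (intro gh) (auto simp: alg_iso_def carrier_alg_of)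
  qed (use that in \<open>simp add: carrier_alg_of\<close>)
  let ?H = "\<lambda>i j. h (unit_vec i) j" and ?G = "\<lambda>j i. g (unit_vec j) i"
  have "matrix_iso A B ?H ?G"
    unfolding matrix_iso_def
  proof (intro conjI ballI)
    fix i i' j assume i: "i \<in> basis A" "i' \<in> basis A" and j: "j \<in> basis B"
    have "h (unit_vec i \<otimes>\<^bsub>alg_of A\<^esub> unit_vec i') j = (\<Sum>l\<in>basis A. strc A i i' l * h (unit_vec l) j)"
      using alg_iso_expand[OF h fin(1) mult_closed_alg_of, of "unit_vec i" "unit_vec i'" j]
      by (simp add: mult_unit_vec[OF fin(1) i])
    moreover have "h (unit_vec i \<otimes>\<^bsub>alg_of A\<^esub> unit_vec i') = h (unit_vec i) \<otimes>\<^bsub>alg_of B\<^esub> h (unit_vec i')"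
      using h i by (auto simp: alg_iso_def unit_vec_in_carrier)
    ultimately show "(\<Sum>l\<in>basis A. strc A i i' l * ?H l j) =
       (\<Sum>j1\<in>basis B. \<Sum>j2\<in>basis B. ?H i j1 * ?H i' j2 * strc B j1 j2 j)"
      using j by (simp add: mult_alg_of)
  next
    fix j assume j: "j \<in> basis B"
    have "h \<one>\<^bsub>alg_of A\<^esub> j = (\<Sum>i\<in>basis A. unit_coord A i * h (unit_vec i) j)"
      using alg_iso_expand[OF h fin(1) one_closed_alg_of, of j] by (simp add: one_alg_of)
    moreover have "h \<one>\<^bsub>alg_of A\<^esub> = \<one>\<^bsub>alg_of B\<^esub>" using h by (simp add: alg_iso_def)
    ultimately show "(\<Sum>i\<in>basis A. unit_coord A i * ?H i j) = unit_coord B j"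
      using j by (simp add: one_alg_of)
  next
    fix i i' assume i: "i \<in> basis A" "i' \<in> basis A"
    have "g (h (unit_vec i)) = unit_vec i" using i by (intro gh refl unit_vec_in_carrier)
    then show "(\<Sum>j\<in>basis B. ?H i j * ?G j i') = (if i = i' then 1 else 0)"
      using gexp[OF hc[OF unit_vec_in_carrier[OF i(1)]], of i'] by (auto simp: unit_vec_def)
  next
    fix j j' assume j: "j \<in> basis B" "j' \<in> basis B"
    show "(\<Sum>i\<in>basis A. ?G j i * ?H i j') = (if j = j' then 1 else 0)"
      using alg_iso_expand[OF h fin(1) gc[OF unit_vec_in_carrier[OF j(1)]], of j']
        hg[OF unit_vec_in_carrier[OF j(1)]] by (auto simp: unit_vec_def)
  qed
  then show ?thesis by blast
qed

lemma sum_pull4: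
  fixes F :: "'i \<Rightarrow> 'j \<Rightarrow> 'k \<Rightarrow> 'l \<Rightarrow> 'a::comm_monoid_add"
  shows "(\<Sum>a\<in>A. \<Sum>b\<in>B. \<Sum>c\<in>C. \<Sum>d\<in>D. F a b c d) = (\<Sum>c\<in>C. \<Sum>d\<in>D. \<Sum>a\<in>A. \<Sum>b\<in>B. F a b c d)"
proof -
  have "(\<Sum>a\<in>A. \<Sum>b\<in>B. \<Sum>c\<in>C. \<Sum>d\<in>D. F a b c d) = (\<Sum>p\<in>A\<times>B. \<Sum>q\<in>C\<times>D. F (fst p) (snd p) (fst q) (snd q))"
    unfolding sum_Times[of _ B A] by (intro sum.cong refl sum_Times)
  also have "\<dots> = (\<Sum>q\<in>C\<times>D. \<Sum>p\<in>A\<times>B. F (fst p) (snd p) (fst q) (snd q))"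
    by (rule sum.swap)
  also have "\<dots> = (\<Sum>c\<in>C. \<Sum>d\<in>D. \<Sum>a\<in>A. \<Sum>b\<in>B. F a b c d)"
    unfolding sum_Times[of _ D C] by (intro sum.cong refl sum_Times[symmetric])
  finally show ?thesis .
qed

lemma matrix_iso_imp_alg_isomorphic:
  fixes A :: "('i, 'a::field) based_algebra" and B :: "('j, 'a) based_algebra"
  assumes fin: "finite (basis A)" "finite (basis B)" and HG: "matrix_iso A B H G"
  shows "alg_isomorphic A B"
proof -
  let ?CA = "carrier (alg_of A)" and ?CB = "carrier (alg_of B)"
  let ?h = "\<lambda>x j. if j \<in> basis B then \<Sum>i\<in>basis A. x i * H i j else 0"
  let ?g = "\<lambda>y i. if i \<in> basis A then \<Sum>j\<in>basis B. y j * G j i else 0"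
  have "?h (x \<otimes>\<^bsub>alg_of A\<^esub> y) = ?h x \<otimes>\<^bsub>alg_of B\<^esub> ?h y" for x y
  proof
    fix j
    show "?h (x \<otimes>\<^bsub>alg_of A\<^esub> y) j = (?h x \<otimes>\<^bsub>alg_of B\<^esub> ?h y) j"
    proof (cases "j \<in> basis B")
      case True
      have "?h (x \<otimes>\<^bsub>alg_of A\<^esub> y) j
          = (\<Sum>l\<in>basis A. \<Sum>i\<in>basis A. \<Sum>i'\<in>basis A. x i * y i' * strc A i i' l * H l j)"
        using True by (simp add: mult_alg_of sum_distrib_right)
      also have "\<dots> = (\<Sum>i\<in>basis A. \<Sum>l\<in>basis A. \<Sum>i'\<in>basis A. x i * y i' * strc A i i' l * H l j)"
        by (rule sum.swap)
      also have "\<dots> = (\<Sum>i\<in>basis A. \<Sum>i'\<in>basis A. \<Sum>l\<in>basis A. x i * y i' * strc A i i' l * H l j)"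
        by (intro sum.cong refl sum.swap)
      also have "\<dots> = (\<Sum>i\<in>basis A. \<Sum>i'\<in>basis A. x i * y i' * (\<Sum>l\<in>basis A. strc A i i' l * H l j))"
        by (simp add: sum_distrib_left mult.assoc)
      also have "\<dots> = (\<Sum>i\<in>basis A. \<Sum>i'\<in>basis A. x i * y i' *
          (\<Sum>j1\<in>basis B. \<Sum>j2\<in>basis B. H i j1 * H i' j2 * strc B j1 j2 j))"
        using HG True by (intro sum.cong refl) (simp add: matrix_iso_def)
      also have "\<dots> = (\<Sum>i\<in>basis A. \<Sum>i'\<in>basis A. \<Sum>j1\<in>basis B. \<Sum>j2\<in>basis B.
          (x i * H i j1) * (y i' * H i' j2) * strc B j1 j2 j)"
        by (simp add: sum_distrib_left mult_ac)
      also have "\<dots> = (\<Sum>j1\<in>basis B. \<Sum>j2\<in>basis B. \<Sum>i\<in>basis A. \<Sum>i'\<in>basis A.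
          (x i * H i j1) * (y i' * H i' j2) * strc B j1 j2 j)"
        by (rule sum_pull4)
      also have "\<dots> = (\<Sum>j1\<in>basis B. \<Sum>j2\<in>basis B. ?h x j1 * ?h y j2 * strc B j1 j2 j)"
        by (simp add: sum_product_scale)
      also have "\<dots> = (?h x \<otimes>\<^bsub>alg_of B\<^esub> ?h y) j"
        using True by (simp add: mult_alg_of)
      finally show ?thesis .
    qed (simp add: mult_alg_of)
  qed
  moreover have "?h \<one>\<^bsub>alg_of A\<^esub> = \<one>\<^bsub>alg_of B\<^esub>"
    using HG by (auto simp: one_alg_of matrix_iso_def)
  moreover have "?h (\<lambda>l. x l + y l) = (\<lambda>l. ?h x l + ?h y l)" for x y
    by (auto simp: sum.distrib distrib_right)
  moreover have "?h (\<lambda>l. c * x l) = (\<lambda>l. c * ?h x l)" for c x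
    by (auto simp: sum_distrib_left mult.assoc)
  moreover have "?g (?h x) = x" if "x \<in> ?CA" for x
  proof
    fix i
    show "?g (?h x) i = x i"
    proof (cases "i \<in> basis A")
      case True
      have "?g (?h x) i = (\<Sum>j\<in>basis B. \<Sum>i'\<in>basis A. x i' * H i' j * G j i)"
        using True by (simp add: sum_distrib_right)
      also have "\<dots> = (\<Sum>i'\<in>basis A. \<Sum>j\<in>basis B. x i' * H i' j * G j i)"
        by (rule sum.swap)
      also have "\<dots> = (\<Sum>i'\<in>basis A. x i' * (\<Sum>j\<in>basis B. H i' j * G j i))"
        by (simp add: sum_distrib_left mult.assoc)
      also have "\<dots> = (\<Sum>i'\<in>basis A. if i' = i then x i' else 0)"
        using HG True by (intro sum.cong refl) (simp add: matrix_iso_def)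
      finally show ?thesis using True fin by simp
    qed (use that in \<open>simp add: carrier_alg_of\<close>)
  qed
  moreover have "?h (?g y) = y" if "y \<in> ?CB" for y
  proof
    fix j
    show "?h (?g y) j = y j"
    proof (cases "j \<in> basis B")
      case True
      have "?h (?g y) j = (\<Sum>i\<in>basis A. \<Sum>j'\<in>basis B. y j' * G j' i * H i j)"
        using True by (simp add: sum_distrib_right)
      also have "\<dots> = (\<Sum>j'\<in>basis B. \<Sum>i\<in>basis A. y j' * G j' i * H i j)"
        by (rule sum.swap)
      also have "\<dots> = (\<Sum>j'\<in>basis B. y j' * (\<Sum>i\<in>basis A. G j' i * H i j))"
        by (simp add: sum_distrib_left mult.assoc)
      also have "\<dots> = (\<Sum>j'\<in>basis B. if j' = j then y j' else 0)"
        using HG True by (intro sum.cong refl) (simp add: matrix_iso_def)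
      finally show ?thesis using True fin by simp
    qed (use that in \<open>simp add: carrier_alg_of\<close>)
  qed
  moreover have "?h x \<in> ?CB" "?g y \<in> ?CA" for x y
    by (auto simp: carrier_alg_of)
  ultimately have "alg_iso A B ?h"
    unfolding alg_iso_def by (intro conjI ballI allI bij_betw_byWitness[of _ ?g]) blast+
  then show ?thesis unfolding alg_isomorphic_iff_alg_iso by blast
qed

lemma basis_tensor [simp]: "basis (tensor A B) = basis A \<times> basis B"
  by (simp add: tensor_def)

lemma strc_tensor: "strc (tensor A B) i j l = strc A (fst i) (fst j) (fst l) * strc B (snd i) (snd j) (snd l)"
  by (simp add: tensor_def case_prod_unfold)

lemma unit_coord_tensor: "unit_coord (tensor A B) i = unit_coord A (fst i) * unit_coord B (snd i)"
  by (simp add: tensor_def case_prod_unfold)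

text \<open>The Kronecker products of the two matrices and of their inverses work: each identity of
  \<open>matrix_iso\<close> is a sum over a product set and factors into the identities for the two
  given isomorphisms.\<close>

lemma alg_isomorphic_tensor:
  fixes A :: "('i, 'a::field) based_algebra" and B :: "('j, 'a) based_algebra"
    and A' :: "('k, 'a) based_algebra" and B' :: "('l, 'a) based_algebra"
  assumes fin: "finite (basis A)" "finite (basis B)" "finite (basis A')" "finite (basis B')"
    and iso: "alg_isomorphic A A'" "alg_isomorphic B B'"
  shows "alg_isomorphic (tensor A B) (tensor A' B')"
proof -
  obtain H G where 1: "matrix_iso A A' H G"
    using alg_isomorphic_imp_matrix_iso fin iso by blast
  obtain K L where 2: "matrix_iso B B' K L"
    using alg_isomorphic_imp_matrix_iso fin iso by blast
  let ?H = "\<lambda>i j. H (fst i) (fst j) * K (snd i) (snd j)"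
  let ?G = "\<lambda>j i. G (fst j) (fst i) * L (snd j) (snd i)"
  have "matrix_iso (tensor A B) (tensor A' B') ?H ?G"
    unfolding matrix_iso_def
  proof (intro conjI ballI)
    fix i i' j assume "i \<in> basis (tensor A B)" "i' \<in> basis (tensor A B)" "j \<in> basis (tensor A' B')"
    then have mem: "fst i \<in> basis A" "snd i \<in> basis B" "fst i' \<in> basis A" "snd i' \<in> basis B"
      "fst j \<in> basis A'" "snd j \<in> basis B'" by auto
    have "(\<Sum>l\<in>basis (tensor A B). strc (tensor A B) i i' l * ?H l j)
        = (\<Sum>l\<in>basis A \<times> basis B. (strc A (fst i) (fst i') (fst l) * H (fst l) (fst j)) *
            (strc B (snd i) (snd i') (snd l) * K (snd l) (snd j)))"
      by (simp add: strc_tensor mult_ac)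
    also have "\<dots> = (\<Sum>l\<in>basis A. strc A (fst i) (fst i') l * H l (fst j)) *
        (\<Sum>l\<in>basis B. strc B (snd i) (snd i') l * K l (snd j))"
      by (rule sum_mult_Times')
    also have "\<dots> = (\<Sum>a\<in>basis A'. \<Sum>b\<in>basis A'. H (fst i) a * H (fst i') b * strc A' a b (fst j)) *
        (\<Sum>c\<in>basis B'. \<Sum>d\<in>basis B'. K (snd i) c * K (snd i') d * strc B' c d (snd j))"
      using 1 2 mem by (simp add: matrix_iso_def)
    also have "\<dots> = (\<Sum>l\<in>basis A' \<times> basis B'. 
        (\<Sum>b\<in>basis A'. H (fst i) (fst l) * H (fst i') b * strc A' (fst l) b (fst j)) *
        (\<Sum>d\<in>basis B'. K (snd i) (snd l) * K (snd i') d * strc B' (snd l) d (snd j)))"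
      by (rule sum_mult_Times'[symmetric])
    also have "\<dots> = (\<Sum>l\<in>basis A' \<times> basis B'. \<Sum>m\<in>basis A' \<times> basis B'.
        (H (fst i) (fst l) * H (fst i') (fst m) * strc A' (fst l) (fst m) (fst j)) *
        (K (snd i) (snd l) * K (snd i') (snd m) * strc B' (snd l) (snd m) (snd j)))"
      by (intro sum.cong refl sum_mult_Times'[symmetric])
    also have "\<dots> = (\<Sum>l\<in>basis (tensor A' B'). \<Sum>m\<in>basis (tensor A' B').
        ?H i l * ?H i' m * strc (tensor A' B') l m j)"
      by (simp add: strc_tensor mult_ac)
    finally show "(\<Sum>l\<in>basis (tensor A B). strc (tensor A B) i i' l * ?H l j) = \<dots>" .
  next
    fix j assume "j \<in> basis (tensor A' B')"
    then have mem: "fst j \<in> basis A'" "snd j \<in> basis B'" by auto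
    have "(\<Sum>i\<in>basis (tensor A B). unit_coord (tensor A B) i * ?H i j) =
        (\<Sum>l\<in>basis A \<times> basis B. (unit_coord A (fst l) * H (fst l) (fst j)) *
          (unit_coord B (snd l) * K (snd l) (snd j)))"
      by (simp add: unit_coord_tensor mult_ac)
    also have "\<dots> = (\<Sum>l\<in>basis A. unit_coord A l * H l (fst j)) * (\<Sum>l\<in>basis B. unit_coord B l * K l (snd j))"
      by (rule sum_mult_Times')
    finally show "(\<Sum>i\<in>basis (tensor A B). unit_coord (tensor A B) i * ?H i j) = unit_coord (tensor A' B') j"
      using 1 2 mem by (simp add: matrix_iso_def unit_coord_tensor)
  next
    fix i i' assume "i \<in> basis (tensor A B)" "i' \<in> basis (tensor A B)"
    then have mem: "fst i \<in> basis A" "snd i \<in> basis B" "fst i' \<in> basis A" "snd i' \<in> basis B" by auto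
    have "(\<Sum>j\<in>basis (tensor A' B'). ?H i j * ?G j i') =
        (\<Sum>l\<in>basis A' \<times> basis B'. (H (fst i) (fst l) * G (fst l) (fst i')) * (K (snd i) (snd l) * L (snd l) (snd i')))"
      by (simp add: mult_ac)
    also have "\<dots> = (\<Sum>l\<in>basis A'. H (fst i) l * G l (fst i')) * (\<Sum>l\<in>basis B'. K (snd i) l * L l (snd i'))"
      by (rule sum_mult_Times')
    finally show "(\<Sum>j\<in>basis (tensor A' B'). ?H i j * ?G j i') = (if i = i' then 1 else 0)"
      using 1 2 mem by (auto simp: matrix_iso_def prod_eq_iff)
  next
    fix i i' assume "i \<in> basis (tensor A' B')" "i' \<in> basis (tensor A' B')"
    then have mem: "fst i \<in> basis A'" "snd i \<in> basis B'" "fst i' \<in> basis A'" "snd i' \<in> basis B'" by auto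
    have "(\<Sum>j\<in>basis (tensor A B). ?G i j * ?H j i') =
        (\<Sum>l\<in>basis A \<times> basis B. (G (fst i) (fst l) * H (fst l) (fst i')) * (L (snd i) (snd l) * K (snd l) (snd i')))"
      by (simp add: mult_ac)
    also have "\<dots> = (\<Sum>l\<in>basis A. G (fst i) l * H l (fst i')) * (\<Sum>l\<in>basis B. L (snd i) l * K l (snd i'))"
      by (rule sum_mult_Times')
    finally show "(\<Sum>j\<in>basis (tensor A B). ?G i j * ?H j i') = (if i = i' then 1 else 0)"
      using 1 2 mem by (auto simp: matrix_iso_def prod_eq_iff)
  qed
  then show ?thesis using fin by (intro matrix_iso_imp_alg_isomorphic) auto
qed

text \<open>Covers all isomorphisms that send the basis vector \<open>i\<close> to
  \<open>d i\<close> times the basis vector \<open>f i\<close>. Rearrangements of tensor factors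
  have \<open>d\<close> constantly 1; only the interchange of the entries of a symbol needs genuine
  factors.\<close>

lemma alg_isomorphic_reindex:
  fixes A :: "('i, 'a::field) based_algebra" and B :: "('j, 'a) based_algebra"
  assumes fin: "finite (basis A)" and f: "bij_betw f (basis A) (basis B)"
    and nz: "\<And>i. i \<in> basis A \<Longrightarrow> d i \<noteq> 0"
    and strc: "\<And>i j l. i \<in> basis A \<Longrightarrow> j \<in> basis A \<Longrightarrow> l \<in> basis A \<Longrightarrow>
      d i * d j * strc B (f i) (f j) (f l) = strc A i j l * d l"
    and unit: "\<And>i. i \<in> basis A \<Longrightarrow> unit_coord B (f i) = unit_coord A i * d i"
  shows "alg_isomorphic A B"
proof -
  have finB: "finite (basis B)" using fin f bij_betw_finite by blast
  have img: "basis B = f ` basis A" and inj: "inj_on f (basis A)"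
    using f by (auto simp: bij_betw_def)
  have eq: "f i = f i' \<longleftrightarrow> i = i'" if "i \<in> basis A" "i' \<in> basis A" for i i'
    using inj that by (auto simp: inj_on_def)
  let ?H = "\<lambda>i j. if j = f i then d i else 0"
  let ?G = "\<lambda>j i. if j = f i then inverse (d i) else 0"
  have "matrix_iso A B ?H ?G"
    unfolding matrix_iso_def
  proof (intro conjI ballI)
    fix i i' j assume i: "i \<in> basis A" "i' \<in> basis A" and "j \<in> basis B"
    then obtain m where j: "j = f m" and m: "m \<in> basis A" by (auto simp: img)
    have "(\<Sum>l\<in>basis A. strc A i i' l * ?H l j) = (\<Sum>l\<in>basis A. if l = m then strc A i i' l * d l else 0)"
      using j m by (intro sum.cong) (auto simp: eq)
    moreover have "(\<Sum>j1\<in>basis B. \<Sum>j2\<in>basis B. ?H i j1 * ?H i' j2 * strc B j1 j2 j) =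
        (\<Sum>j1\<in>basis B. if j1 = f i then (\<Sum>j2\<in>basis B. if j2 = f i' then d i * d i' * strc B j1 j2 j else 0) else 0)"
      by (intro sum.cong refl) (auto intro!: sum.cong)
    ultimately show "(\<Sum>l\<in>basis A. strc A i i' l * ?H l j) =
       (\<Sum>j1\<in>basis B. \<Sum>j2\<in>basis B. ?H i j1 * ?H i' j2 * strc B j1 j2 j)"
      using i m j fin finB strc[OF i m] by (simp add: img)
  next
    fix j assume "j \<in> basis B"
    then obtain m where j: "j = f m" and m: "m \<in> basis A" by (auto simp: img)
    have "(\<Sum>i\<in>basis A. unit_coord A i * ?H i j) = (\<Sum>i\<in>basis A. if i = m then unit_coord A i * d i else 0)"
      using j m by (intro sum.cong) (auto simp: eq)
    then show "(\<Sum>i\<in>basis A. unit_coord A i * ?H i j) = unit_coord B j"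
      using fin m unit[OF m] j by simp
  next
    fix i i' assume i: "i \<in> basis A" "i' \<in> basis A"
    have "(\<Sum>j\<in>basis B. ?H i j * ?G j i') = (\<Sum>j\<in>basis B. if j = f i then (if i = i' then 1 else 0) else 0)"
      using i nz by (intro sum.cong) (auto simp: eq)
    then show "(\<Sum>j\<in>basis B. ?H i j * ?G j i') = (if i = i' then 1 else 0)"
      using i finB by (simp add: img)
  next
    fix j j' assume "j \<in> basis B" "j' \<in> basis B"
    then obtain m m' where j: "j = f m" "j' = f m'" and m: "m \<in> basis A" "m' \<in> basis A" by (auto simp: img)
    have "(\<Sum>i\<in>basis A. ?G j i * ?H i j') = (\<Sum>i\<in>basis A. if i = m then (if m = m' then 1 else 0) else 0)"
      using j m nz by (intro sum.cong) (auto simp: eq)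
    then show "(\<Sum>i\<in>basis A. ?G j i * ?H i j') = (if j = j' then 1 else 0)"
      using fin m j by (simp add: eq)
  qed
  then show ?thesis by (rule matrix_iso_imp_alg_isomorphic[OF fin finB])
qed

section \<open>Matrix algebras and rearrangements of tensor products\<close>

declare alg_isomorphic_trans [trans]

text \<open>Matrices indexed by an arbitrary set: the tensor product of two such algebras is again
  one, over the product set, without any enumeration of pairs by numbers.\<close>

definition matalg :: "'i set \<Rightarrow> ('i \<times> 'i, 'a::field) based_algebra" where
  "matalg I =
     \<lparr>basis = I \<times> I,
      strc = (\<lambda>(i, j) (i', j') u. if j = i' \<and> u = (i, j') then 1 else 0),
      unit_coord = (\<lambda>(i, j). if i = j then 1 else 0)\<rparr>"

lemma sum_rotate3:
  "(\<Sum>i\<in>A. \<Sum>j\<in>B. \<Sum>k\<in>C. F i j k) = (\<Sum>k\<in>C. \<Sum>i\<in>A. \<Sum>j\<in>B. F i j k)"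
proof -
  have "(\<Sum>i\<in>A. \<Sum>j\<in>B. \<Sum>k\<in>C. F i j k) = (\<Sum>i\<in>A. \<Sum>k\<in>C. \<Sum>j\<in>B. F i j k)"
    by (intro sum.cong refl sum.swap)
  also have "\<dots> = (\<Sum>k\<in>C. \<Sum>i\<in>A. \<Sum>j\<in>B. F i j k)"
    by (rule sum.swap)
  finally show ?thesis .
qed

lemma matrix_algebra_eq_matalg: "matrix_algebra n = matalg {..<n}"
  by (simp add: matrix_algebra_def matalg_def)

lemma basis_matalg [simp]: "basis (matalg I) = I \<times> I"
  by (simp add: matalg_def)

lemma basis_matrix_algebra [simp]: "basis (matrix_algebra n) = {..<n} \<times> {..<n}"
  by (simp add: matrix_algebra_def)

lemma strc_matalg: "strc (matalg I) i j l = (if snd i = fst j \<and> l = (fst i, snd j) then 1 else 0)"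
  by (simp add: matalg_def case_prod_unfold)

lemma unit_coord_matalg: "unit_coord (matalg I) i = (if fst i = snd i then 1 else 0)"
  by (simp add: matalg_def case_prod_unfold)

lemma matalg_reindex:
  assumes "finite I" "bij_betw f I J"
  shows "alg_isomorphic (matalg I :: (_, 'a::field) based_algebra) (matalg J)"
proof (rule alg_isomorphic_reindex[where f = "map_prod f f" and d = "\<lambda>_. 1"])
  show "bij_betw (map_prod f f) (basis (matalg I)) (basis (matalg J))"
    using assms bij_betw_map_prod[of f I J f I J] by (simp add: map_prod_def)
  have inj: "f x = f y \<longleftrightarrow> x = y" if "x \<in> I" "y \<in> I" for x y
    using assms that by (auto simp: bij_betw_def inj_on_def)
  show "1 * 1 * strc (matalg J) (map_prod f f i) (map_prod f f j) (map_prod f f l) = strc (matalg I) i j l * (1::'a)"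
    if "i \<in> basis (matalg I)" "j \<in> basis (matalg I)" "l \<in> basis (matalg I)" for i j l
    using that by (auto simp: strc_matalg inj)
  show "unit_coord (matalg J) (map_prod f f i) = unit_coord (matalg I) i * (1::'a)" if "i \<in> basis (matalg I)" for i
    using that by (auto simp: unit_coord_matalg inj)
qed (use assms in auto)

lemma tensor_matalg:
  assumes "finite I" "finite J"
  shows "alg_isomorphic (tensor (matalg I) (matalg J)) (matalg (I \<times> J) :: (_, 'a::field) based_algebra)"
proof (rule alg_isomorphic_reindex[where f = "\<lambda>u. ((fst (fst u), fst (snd u)), (snd (fst u), snd (snd u)))" and d = "\<lambda>_. 1"])
  show "bij_betw (\<lambda>u. ((fst (fst u), fst (snd u)), (snd (fst u), snd (snd u))))
      (basis (tensor (matalg I) (matalg J))) (basis (matalg (I \<times> J)))"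
    by (rule bij_betw_byWitness[where f' = "\<lambda>u. ((fst (fst u), fst (snd u)), (snd (fst u), snd (snd u)))"]) auto
qed (use assms in \<open>auto simp: strc_matalg unit_coord_matalg strc_tensor unit_coord_tensor\<close>)

lemma tensor_matrix_algebra:
  "alg_isomorphic (tensor (matrix_algebra m) (matrix_algebra n)) (matrix_algebra (m * n) :: (_, 'a::field) based_algebra)"
proof -
  obtain f where f: "bij_betw f ({..<m} \<times> {..<n}) {..<m * n}"
    using finite_same_card_bij[of "{..<m} \<times> {..<n}" "{..<m * n}"] by auto
  show ?thesis
    unfolding matrix_algebra_eq_matalg
    by (rule alg_isomorphic_trans[OF tensor_matalg matalg_reindex[OF _ f]]) auto
qed

lemma tensor_assoc:
  assumes "finite (basis A)" "finite (basis B)" "finite (basis C)"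
  shows "alg_isomorphic (tensor (tensor A B) C) (tensor A (tensor B C))"
proof (rule alg_isomorphic_reindex[where f = "\<lambda>u. (fst (fst u), (snd (fst u), snd u))" and d = "\<lambda>_. 1"])
  show "bij_betw (\<lambda>u. (fst (fst u), snd (fst u), snd u)) (basis (tensor (tensor A B) C)) (basis (tensor A (tensor B C)))"
    by (rule bij_betw_byWitness[where f' = "\<lambda>u. ((fst u, fst (snd u)), snd (snd u))"]) auto
qed (use assms in \<open>auto simp: strc_tensor unit_coord_tensor\<close>)

lemma tensor_commute:
  assumes "finite (basis A)" "finite (basis B)"
  shows "alg_isomorphic (tensor A B) (tensor B A)"
proof (rule alg_isomorphic_reindex[where f = "\<lambda>u. (snd u, fst u)" and d = "\<lambda>_. 1"])
  show "bij_betw (\<lambda>u. (snd u, fst u)) (basis (tensor A B)) (basis (tensor B A))"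
    by (rule bij_betw_byWitness[where f' = "\<lambda>u. (snd u, fst u)"]) auto
qed (use assms in \<open>auto simp: strc_tensor unit_coord_tensor\<close>)

lemma tensor_interchange:
  assumes "finite (basis A)" "finite (basis B)" "finite (basis C)" "finite (basis D)"
  shows "alg_isomorphic (tensor (tensor A B) (tensor C D)) (tensor (tensor A C) (tensor B D))"
proof (rule alg_isomorphic_reindex[where f = "\<lambda>u. ((fst (fst u), fst (snd u)), (snd (fst u), snd (snd u)))" and d = "\<lambda>_. 1"])
  show "bij_betw (\<lambda>u. ((fst (fst u), fst (snd u)), (snd (fst u), snd (snd u))))
      (basis (tensor (tensor A B) (tensor C D))) (basis (tensor (tensor A C) (tensor B D)))"
    by (rule bij_betw_byWitness[where f' = "\<lambda>u. ((fst (fst u), fst (snd u)), (snd (fst u), snd (snd u)))"]) auto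
qed (use assms in \<open>auto simp: strc_tensor unit_coord_tensor\<close>)

lemma tensor_matrix_algebra_1:
  assumes "finite (basis A)"
  shows "alg_isomorphic (tensor A (matrix_algebra 1)) A"
proof (rule alg_isomorphic_reindex[where f = fst and d = "\<lambda>_. 1"])
  show "bij_betw fst (basis (tensor A (matrix_algebra 1))) (basis A)"
    by (rule bij_betw_byWitness[where f' = "\<lambda>u. (u, (0, 0))"]) auto
qed (use assms in \<open>auto simp: strc_tensor unit_coord_tensor matrix_algebra_eq_matalg strc_matalg unit_coord_matalg\<close>)

section \<open>Brauer equivalence\<close>

lemma brauer_equivalent_if_alg_isomorphic:
  assumes "finite (basis A)" "finite (basis B)" "alg_isomorphic A B"
  shows "brauer_equivalent A B"
  unfolding brauer_equivalent_def
  using alg_isomorphic_tensor[OF assms(1) _ assms(2) _ assms(3) alg_isomorphic_refl, of "matrix_algebra 1"]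
  by (intro exI[of _ "1::nat"] conjI) auto

lemma brauer_equivalent_sym: "brauer_equivalent A B \<Longrightarrow> brauer_equivalent B A"
  unfolding brauer_equivalent_def using alg_isomorphic_sym by blast

lemma brauer_equivalent_tensor:
  fixes A :: "('i, 'a::field) based_algebra"
  assumes fin: "finite (basis A)" "finite (basis B)" "finite (basis A')" "finite (basis B')"
    and eq: "brauer_equivalent A A'" "brauer_equivalent B B'"
  shows "brauer_equivalent (tensor A B) (tensor A' B')"
proof -
  let ?M = "matrix_algebra :: nat \<Rightarrow> (_, 'a) based_algebra"
  obtain m n where mn: "m > 0" "n > 0" "alg_isomorphic (tensor A (?M m)) (tensor A' (?M n))"
    using eq(1) unfolding brauer_equivalent_def by blast
  obtain r s where rs: "r > 0" "s > 0" "alg_isomorphic (tensor B (?M r)) (tensor B' (?M s))"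
    using eq(2) unfolding brauer_equivalent_def by blast
  have *: "alg_isomorphic (tensor (tensor P Q) (?M (k * l))) (tensor (tensor P (?M k)) (tensor Q (?M l)))"
    if "finite (basis P)" "finite (basis Q)" for P :: "('x, 'a) based_algebra" and Q :: "('y, 'a) based_algebra" and k l
  proof -
    have "alg_isomorphic (tensor (tensor P Q) (?M (k * l))) (tensor (tensor P Q) (tensor (?M k) (?M l)))"
      using that by (intro alg_isomorphic_tensor alg_isomorphic_refl alg_isomorphic_sym[OF tensor_matrix_algebra]) auto
    also have "alg_isomorphic \<dots> (tensor (tensor P (?M k)) (tensor Q (?M l)))"
      using that by (intro tensor_interchange) auto
    finally show ?thesis .
  qed
  note *[OF fin(1,2)]
  also have "alg_isomorphic (tensor (tensor A (?M m)) (tensor B (?M r)))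
      (tensor (tensor A' (?M n)) (tensor B' (?M s)))"
    using fin mn rs by (intro alg_isomorphic_tensor[where A = "tensor A (?M m)" and B = "tensor B (?M r)"]) auto
  also note alg_isomorphic_sym[OF *[OF fin(3,4)]]
  finally show ?thesis
    using mn rs unfolding brauer_equivalent_def by (intro exI[of _ "m * r"] exI[of _ "n * s"] conjI) auto
qed

text \<open>The two isomorphisms carry different matrix factors on \<open>B\<close>. Enlarging the
  first by matrices of size \<open>r\<close> and the second by matrices of size \<open>n\<close>
  gives \<open>B\<close> the same factor in both.\<close>

lemma brauer_equivalent_trans:
  fixes A :: "('i, 'a::field) based_algebra"
  assumes fin: "finite (basis A)" "finite (basis B)" "finite (basis C)"
    and eq: "brauer_equivalent A B" "brauer_equivalent B C"
  shows "brauer_equivalent A C"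
proof -
  let ?M = "matrix_algebra :: nat \<Rightarrow> (_, 'a) based_algebra"
  obtain m n where mn: "m > 0" "n > 0" "alg_isomorphic (tensor A (?M m)) (tensor B (?M n))"
    using eq(1) unfolding brauer_equivalent_def by blast
  obtain r s where rs: "r > 0" "s > 0" "alg_isomorphic (tensor B (?M r)) (tensor C (?M s))"
    using eq(2) unfolding brauer_equivalent_def by blast
  have *: "alg_isomorphic (tensor P (?M (k * l))) (tensor (tensor P (?M k)) (?M l))"
    if "finite (basis P)" for P :: "('x, 'a) based_algebra" and k l
  proof -
    have "alg_isomorphic (tensor P (?M (k * l))) (tensor P (tensor (?M k) (?M l)))"
      using that by (intro alg_isomorphic_tensor alg_isomorphic_refl alg_isomorphic_sym[OF tensor_matrix_algebra]) auto
    also have "alg_isomorphic \<dots> (tensor (tensor P (?M k)) (?M l))"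
      using that by (intro alg_isomorphic_sym[OF tensor_assoc]) auto
    finally show ?thesis .
  qed
  have "alg_isomorphic (tensor A (?M (m * r))) (tensor (tensor A (?M m)) (?M r))"
    by (rule *[OF fin(1)])
  also have "alg_isomorphic \<dots> (tensor (tensor B (?M n)) (?M r))"
    using fin mn by (intro alg_isomorphic_tensor[where A = "tensor A (?M m)"] alg_isomorphic_refl) auto
  also have "alg_isomorphic \<dots> (tensor B (?M (r * n)))"
    unfolding mult.commute[of r n] by (rule alg_isomorphic_sym[OF *[OF fin(2)]])
  also have "alg_isomorphic \<dots> (tensor (tensor B (?M r)) (?M n))"
    by (rule *[OF fin(2)])
  also have "alg_isomorphic \<dots> (tensor (tensor C (?M s)) (?M n))"
    using fin rs by (intro alg_isomorphic_tensor[where A = "tensor B (?M r)"] alg_isomorphic_refl) auto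
  also have "alg_isomorphic \<dots> (tensor C (?M (s * n)))"
    by (rule alg_isomorphic_sym[OF *[OF fin(3)]])
  finally show ?thesis
    using mn rs unfolding brauer_equivalent_def by (intro exI[of _ "m * r"] exI[of _ "s * n"] conjI) auto
qed

definition split_algebra :: "('i, 'a::field) based_algebra \<Rightarrow> bool" where
  "split_algebra A \<longleftrightarrow> brauer_equivalent A (matrix_algebra 1 :: (nat \<times> nat, 'a) based_algebra)"

lemma split_algebra_matrix_algebra:
  assumes "n > 0"
  shows "split_algebra (matrix_algebra n)"
  unfolding split_algebra_def brauer_equivalent_def
  by (rule exI[of _ "1::nat"], rule conjI, simp, rule exI[of _ n], rule conjI, rule assms, rule tensor_commute) auto

lemma split_algebra_if_brauer_equivalent:
  assumes "finite (basis A)" "finite (basis B)" "brauer_equivalent A B" "split_algebra B"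
  shows "split_algebra A"
  using assms(4) unfolding split_algebra_def by (rule brauer_equivalent_trans[OF assms(1,2) _ assms(3), rotated]) simp

lemma split_algebra_cong:
  assumes "finite (basis A)" "finite (basis B)" "alg_isomorphic A B"
  shows "split_algebra A \<longleftrightarrow> split_algebra B"
  using split_algebra_if_brauer_equivalent[OF assms(1,2) brauer_equivalent_if_alg_isomorphic[OF assms]]
    split_algebra_if_brauer_equivalent[OF assms(2,1) brauer_equivalent_if_alg_isomorphic[OF assms(2,1) alg_isomorphic_sym[OF assms(3)]]]
  by blast

lemma split_algebra_if_isomorphic_matalg:
  assumes "finite (basis A)" "finite I" "I \<noteq> {}" "alg_isomorphic A (matalg I)"
  shows "split_algebra A"
proof -
  obtain f where f: "bij_betw f I {..<card I}"
    using assms(2) by (metis card_lessThan finite_lessThan finite_same_card_bij)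
  have "alg_isomorphic A (matrix_algebra (card I))"
    unfolding matrix_algebra_eq_matalg by (rule alg_isomorphic_trans[OF assms(4) matalg_reindex[OF assms(2) f]])
  moreover have "card I > 0" using assms by (simp add: card_gt_0_iff)
  ultimately show ?thesis
    using split_algebra_matrix_algebra[of "card I"] split_algebra_cong[of A "matrix_algebra (card I)"] assms(1) by simp
qed

lemma split_algebra_imp_matrix_algebra:
  fixes A :: "('i, 'a::field) based_algebra"
  assumes "split_algebra A" "finite (basis A)"
  obtains m n where "m > 0" "n > 0"
    "alg_isomorphic (tensor A (matrix_algebra m)) (matrix_algebra n :: (nat \<times> nat, 'a) based_algebra)"
proof -
  let ?M = "matrix_algebra :: nat \<Rightarrow> (_, 'a) based_algebra"
  obtain m n where mn: "m > 0" "n > 0" "alg_isomorphic (tensor A (?M m)) (tensor (?M 1) (?M n))"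
    using assms(1) unfolding split_algebra_def brauer_equivalent_def by blast
  have "alg_isomorphic (tensor (?M 1) (?M n)) (?M n)"
    using tensor_matrix_algebra[of 1 n] by simp
  with mn that alg_isomorphic_trans show ?thesis by blast
qed

text \<open>The Brauer class of a split factor is neutral; this is what removes symbols with second
  entry 1 from a tensor product.\<close>

lemma split_algebra_tensor_right:
  fixes A :: "('i, 'a::field) based_algebra"
  assumes "finite (basis A)" "finite (basis B)" "split_algebra B"
  shows "split_algebra (tensor A B) \<longleftrightarrow> split_algebra A"
proof -
  let ?M = "matrix_algebra 1 :: (_, 'a) based_algebra"
  have fin: "finite (basis (tensor A B))" "finite (basis (tensor A ?M))" using assms by auto
  have "brauer_equivalent (tensor A B) (tensor A ?M)"
    using assms by (intro brauer_equivalent_tensor[OF assms(1,2,1)]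
        brauer_equivalent_if_alg_isomorphic[OF assms(1,1) alg_isomorphic_refl])
      (auto simp: split_algebra_def)
  moreover have "brauer_equivalent (tensor A ?M) A"
    by (rule brauer_equivalent_if_alg_isomorphic[OF fin(2) assms(1) tensor_matrix_algebra_1[OF assms(1)]])
  ultimately have *: "brauer_equivalent (tensor A B) A"
    by (rule brauer_equivalent_trans[OF fin assms(1)])
  show ?thesis
    using split_algebra_if_brauer_equivalent[OF fin(1) assms(1) *]
      split_algebra_if_brauer_equivalent[OF assms(1) fin(1) brauer_equivalent_sym[OF *]] by blast
qed

section \<open>Twisted group algebras with nondegenerate commutator pairing\<close>

text \<open>The twisted group algebra of the finite abelian group \<open>basis A\<close> with
  operation \<open>op\<close> and neutral element \<open>e\<close>, for a normalised 2-cocycle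
  \<open>c\<close>. By \<open>nondeg\<close> no nontrivial group element commutes with all others in
  the algebra, which makes the algebra central simple. Symbol algebras are of this kind for the
  group (Z/p)^2, and the class is closed under tensor products.\<close>

locale weyl_algebra =
  fixes A :: "('i, 'a::field) based_algebra"
    and op :: "'i \<Rightarrow> 'i \<Rightarrow> 'i" and c :: "'i \<Rightarrow> 'i \<Rightarrow> 'a" and e :: 'i
  assumes fin: "finite (basis A)"
    and e_in: "e \<in> basis A"
    and op_in: "i \<in> basis A \<Longrightarrow> j \<in> basis A \<Longrightarrow> op i j \<in> basis A"
    and c_nz: "i \<in> basis A \<Longrightarrow> j \<in> basis A \<Longrightarrow> c i j \<noteq> 0"
    and strc: "i \<in> basis A \<Longrightarrow> j \<in> basis A \<Longrightarrow> l \<in> basis A \<Longrightarrow>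
      strc A i j l = (if l = op i j then c i j else 0)"
    and op_comm: "i \<in> basis A \<Longrightarrow> j \<in> basis A \<Longrightarrow> op i j = op j i"
    and op_assoc: "i \<in> basis A \<Longrightarrow> j \<in> basis A \<Longrightarrow> k \<in> basis A \<Longrightarrow> op (op i j) k = op i (op j k)"
    and op_e: "i \<in> basis A \<Longrightarrow> op e i = i"
    and c_e: "i \<in> basis A \<Longrightarrow> c e i = 1" "i \<in> basis A \<Longrightarrow> c i e = 1"
    and cocycle: "i \<in> basis A \<Longrightarrow> j \<in> basis A \<Longrightarrow> k \<in> basis A \<Longrightarrow>
      c i j * c (op i j) k = c j k * c i (op j k)"
    and op_inv: "i \<in> basis A \<Longrightarrow> \<exists>j\<in>basis A. op j i = e"
    and nondeg: "i \<in> basis A \<Longrightarrow> i \<noteq> e \<Longrightarrow> \<exists>j\<in>basis A. c j i \<noteq> c i j"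
    and unit: "l \<in> basis A \<Longrightarrow> unit_coord A l = (if l = e then 1 else 0)"
begin

abbreviation "R \<equiv> alg_of A"

lemma one_eq: "\<one>\<^bsub>R\<^esub> = unit_vec e"
  using e_in by (auto simp: one_alg_of unit unit_vec_def)

lemma op_cancel:
  assumes "i \<in> basis A" "j \<in> basis A" "k \<in> basis A"
  shows "op i j = op i k \<longleftrightarrow> j = k"
proof
  assume eq: "op i j = op i k"
  obtain m where m: "m \<in> basis A" "op m i = e" using op_inv assms by blast
  have "op (op m i) j = op (op m i) k" using assms m(1) eq by (simp add: op_assoc)
  then show "j = k" using m assms by (simp add: op_e)
qed simp

lemma mult_assoc_alg:
  "(x \<otimes>\<^bsub>R\<^esub> y) \<otimes>\<^bsub>R\<^esub> z = x \<otimes>\<^bsub>R\<^esub> (y \<otimes>\<^bsub>R\<^esub> z)"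
proof
  fix l
  let ?B = "basis A"
  show "((x \<otimes>\<^bsub>R\<^esub> y) \<otimes>\<^bsub>R\<^esub> z) l = (x \<otimes>\<^bsub>R\<^esub> (y \<otimes>\<^bsub>R\<^esub> z)) l"
  proof (cases "l \<in> ?B")
    case True
    have *: "(\<Sum>m\<in>?B. strc A i j m * strc A m k l) = (\<Sum>m\<in>?B. strc A j k m * strc A i m l)"
      if "i \<in> ?B" "j \<in> ?B" "k \<in> ?B" for i j k
    proof -
      have "(\<Sum>m\<in>?B. strc A i j m * strc A m k l) = (\<Sum>m\<in>?B. if m = op i j then c i j * strc A m k l else 0)"
        using that by (intro sum.cong) (auto simp: strc)
      moreover have "(\<Sum>m\<in>?B. strc A j k m * strc A i m l) = (\<Sum>m\<in>?B. if m = op j k then c j k * strc A i m l else 0)"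
        using that by (intro sum.cong) (auto simp: strc)
      ultimately show ?thesis
        using that True fin by (simp add: op_in strc op_assoc cocycle)
    qed
    have "((x \<otimes>\<^bsub>R\<^esub> y) \<otimes>\<^bsub>R\<^esub> z) l
        = (\<Sum>m\<in>?B. \<Sum>k\<in>?B. \<Sum>i\<in>?B. \<Sum>j\<in>?B. x i * y j * strc A i j m * z k * strc A m k l)"
      using True by (simp add: mult_alg_of sum_distrib_right)
    also have "\<dots> = (\<Sum>i\<in>?B. \<Sum>j\<in>?B. \<Sum>m\<in>?B. \<Sum>k\<in>?B. x i * y j * strc A i j m * z k * strc A m k l)"
      by (rule sum_pull4)
    also have "\<dots> = (\<Sum>i\<in>?B. \<Sum>j\<in>?B. \<Sum>k\<in>?B. \<Sum>m\<in>?B. x i * y j * strc A i j m * z k * strc A m k l)"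
      by (intro sum.cong refl sum.swap)
    also have "\<dots> = (\<Sum>i\<in>?B. \<Sum>j\<in>?B. \<Sum>k\<in>?B. x i * y j * z k * (\<Sum>m\<in>?B. strc A i j m * strc A m k l))"
      by (simp add: sum_distrib_left mult_ac)
    also have "\<dots> = (\<Sum>i\<in>?B. \<Sum>j\<in>?B. \<Sum>k\<in>?B. x i * y j * z k * (\<Sum>m\<in>?B. strc A j k m * strc A i m l))"
      by (intro sum.cong refl) (simp add: *)
    also have "\<dots> = (\<Sum>i\<in>?B. \<Sum>j\<in>?B. \<Sum>k\<in>?B. \<Sum>m\<in>?B. x i * (y j * z k * strc A j k m) * strc A i m l)"
      by (simp add: sum_distrib_left mult_ac)
    also have "\<dots> = (\<Sum>i\<in>?B. \<Sum>m\<in>?B. \<Sum>j\<in>?B. \<Sum>k\<in>?B. x i * (y j * z k * strc A j k m) * strc A i m l)"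
      by (intro sum.cong refl sum_rotate3)
    also have "\<dots> = (x \<otimes>\<^bsub>R\<^esub> (y \<otimes>\<^bsub>R\<^esub> z)) l"
      using True by (simp add: mult_alg_of sum_distrib_right sum_distrib_left)
    finally show ?thesis .
  qed (simp add: mult_alg_of)
qed

lemma unit_vec_mult:
  assumes "i \<in> basis A"
  shows "(unit_vec i \<otimes>\<^bsub>R\<^esub> x) l = (\<Sum>j\<in>basis A. if l = op i j then c i j * x j else 0)"
proof -
  have "(\<Sum>i'\<in>basis A. \<Sum>j\<in>basis A. unit_vec i i' * x j * strc A i' j l)
      = (\<Sum>i'\<in>basis A. if i' = i then (\<Sum>j\<in>basis A. x j * strc A i j l) else 0)"
    by (intro sum.cong refl) (auto simp: unit_vec_def)
  also have "\<dots> = (\<Sum>j\<in>basis A. x j * strc A i j l)" using assms fin by simp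
  finally have eq: "(unit_vec i \<otimes>\<^bsub>R\<^esub> x) l = (if l \<in> basis A then \<Sum>j\<in>basis A. x j * strc A i j l else 0)"
    by (simp add: mult_alg_of)
  show ?thesis
  proof (cases "l \<in> basis A")
    case True
    then show ?thesis using assms unfolding eq by (auto simp: strc intro!: sum.cong)
  next
    case False
    then show ?thesis using assms op_in unfolding eq by (auto intro!: sum.neutral)
  qed
qed

lemma mult_unit_vec_right:
  assumes "i \<in> basis A"
  shows "(x \<otimes>\<^bsub>R\<^esub> unit_vec i) l = (\<Sum>j\<in>basis A. if l = op i j then c j i * x j else 0)"
proof -
  have "(\<Sum>j\<in>basis A. \<Sum>i'\<in>basis A. x j * unit_vec i i' * strc A j i' l)
      = (\<Sum>j\<in>basis A. \<Sum>i'\<in>basis A. if i' = i then x j * strc A j i l else 0)"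
    by (intro sum.cong refl) (auto simp: unit_vec_def)
  also have "\<dots> = (\<Sum>j\<in>basis A. x j * strc A j i l)" using assms fin by simp
  finally have eq: "(x \<otimes>\<^bsub>R\<^esub> unit_vec i) l = (if l \<in> basis A then \<Sum>j\<in>basis A. x j * strc A j i l else 0)"
    by (simp add: mult_alg_of)
  show ?thesis
  proof (cases "l \<in> basis A")
    case True
    then show ?thesis using assms unfolding eq by (auto simp: strc op_comm[of _ i] intro!: sum.cong)
  next
    case False
    then show ?thesis using assms op_in unfolding eq by (auto intro!: sum.neutral)
  qed
qed

lemma sum_op: 
  assumes "i \<in> basis A" "j \<in> basis A"
  shows "(\<Sum>k\<in>basis A. if op i j = op i k then f k else (0::'a)) = f j"
proof -
  have "(\<Sum>k\<in>basis A. if op i j = op i k then f k else 0) = (\<Sum>k\<in>basis A. if k = j then f k else 0)"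
    using assms op_cancel by (intro sum.cong) auto
  then show ?thesis using assms fin by simp
qed

lemma unit_vec_mult_op:
  assumes "i \<in> basis A" "j \<in> basis A"
  shows "(unit_vec i \<otimes>\<^bsub>R\<^esub> x) (op i j) = c i j * x j" "(x \<otimes>\<^bsub>R\<^esub> unit_vec i) (op i j) = c j i * x j"
  using assms by (simp_all add: unit_vec_mult mult_unit_vec_right sum_op)

lemma mult_one_alg:
  assumes "x \<in> carrier R"
  shows "\<one>\<^bsub>R\<^esub> \<otimes>\<^bsub>R\<^esub> x = x" "x \<otimes>\<^bsub>R\<^esub> \<one>\<^bsub>R\<^esub> = x"
proof -
  have "(unit_vec e \<otimes>\<^bsub>R\<^esub> x) l = x l \<and> (x \<otimes>\<^bsub>R\<^esub> unit_vec e) l = x l" for l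
  proof (cases "l \<in> basis A")
    case True
    then show ?thesis using unit_vec_mult_op[OF e_in True, of x] by (simp add: op_e c_e)
  next
    case False
    then show ?thesis using assms by (auto simp: mult_alg_of carrier_alg_of)
  qed
  then show "\<one>\<^bsub>R\<^esub> \<otimes>\<^bsub>R\<^esub> x = x" "x \<otimes>\<^bsub>R\<^esub> \<one>\<^bsub>R\<^esub> = x" by (auto simp: one_eq)
qed

lemma ring_alg_of: "ring R"
proof (rule ringI)
  show "abelian_group R"
  proof (rule abelian_groupI)
    show "\<exists>y\<in>carrier R. y \<oplus>\<^bsub>R\<^esub> x = \<zero>\<^bsub>R\<^esub>" if "x \<in> carrier R" for x
      using that by (intro bexI[of _ "\<lambda>l. - x l"]) (auto simp: carrier_alg_of add_alg_of zero_alg_of)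
  qed (auto simp: carrier_alg_of add_alg_of zero_alg_of add_ac)
  show "Group.monoid R"
    by (rule monoidI) (auto simp: mult_closed_alg_of one_closed_alg_of mult_assoc_alg mult_one_alg)
qed (auto simp: mult_alg_of add_alg_of distrib_left distrib_right sum.distrib fun_eq_iff)

lemma smult_in_ideal:
  assumes J: "ideal J R" and x: "x \<in> J"
  shows "(\<lambda>l. d * x l) \<in> J"
proof -
  have xc: "x \<in> carrier R" using J x by (meson additive_subgroup.a_Hcarr ideal_def)
  have "(\<lambda>l. d * unit_vec e l) \<in> carrier R" using e_in by (auto simp: carrier_alg_of unit_vec_def)
  then have "(\<lambda>l. d * unit_vec e l) \<otimes>\<^bsub>R\<^esub> x \<in> J" using J x by (simp add: ideal.I_l_closed)
  also have "(\<lambda>l. d * unit_vec e l) \<otimes>\<^bsub>R\<^esub> x = (\<lambda>l. d * (\<one>\<^bsub>R\<^esub> \<otimes>\<^bsub>R\<^esub> x) l)"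
    by (auto simp: mult_alg_of one_eq sum_distrib_left mult.assoc)
  finally show ?thesis using xc by (simp add: mult_one_alg)
qed

text \<open>Descent on the size of the support. Multiplication by a basis vector moves some support
  element to \<open>e\<close>. Unless the result is a multiple of the unit, a commutator with a
  suitable basis vector kills the coefficient at \<open>e\<close> but, by nondegeneracy, not the
  whole element.\<close>

lemma one_in_nonzero_ideal:
  assumes J: "ideal J R"
  shows "x \<in> J \<Longrightarrow> x \<noteq> (\<lambda>_. 0) \<Longrightarrow> \<one>\<^bsub>R\<^esub> \<in> J"
proof (induction "card {l. x l \<noteq> 0}" arbitrary: x rule: less_induct)
  case less
  have Jc: "y \<in> carrier R" if "y \<in> J" for y
    using J that by (meson additive_subgroup.a_Hcarr ideal_def)
  have supp: "{l. y l \<noteq> 0} \<subseteq> basis A" if "y \<in> J" for y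
    using Jc[OF that] by (auto simp: carrier_alg_of)
  obtain k where k: "x k \<noteq> 0" using less.prems by auto
  have kB: "k \<in> basis A" using supp[OF less.prems(1)] k by auto
  obtain i where i: "i \<in> basis A" "op i k = e" using op_inv[OF kB] by blast
  define y where "y = unit_vec i \<otimes>\<^bsub>R\<^esub> x"
  have yJ: "y \<in> J" unfolding y_def using J less.prems i by (simp add: ideal.I_l_closed unit_vec_in_carrier)
  have ye: "y e \<noteq> 0" using unit_vec_mult_op(1)[OF i(1) kB, of x] i k c_nz[OF i(1) kB] by (simp add: y_def)
  have "{l. y l \<noteq> 0} \<subseteq> op i ` {l. x l \<noteq> 0}"
  proof
    fix l assume "l \<in> {l. y l \<noteq> 0}"
    then have "(\<Sum>j\<in>basis A. if l = op i j then c i j * x j else 0) \<noteq> 0"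
      using i by (simp add: y_def unit_vec_mult)
    then obtain j where "j \<in> basis A" "(if l = op i j then c i j * x j else 0) \<noteq> 0"
      by (rule sum.not_neutral_contains_not_neutral)
    then show "l \<in> op i ` {l. x l \<noteq> 0}" by (auto split: if_splits)
  qed
  moreover have finx: "finite {l. x l \<noteq> 0}" using supp[OF less.prems(1)] fin finite_subset by blast
  ultimately have cy: "card {l. y l \<noteq> 0} \<le> card {l. x l \<noteq> 0}"
    by (intro order_trans[OF card_mono card_image_le]) auto
  show ?case
  proof (cases "\<exists>m. m \<noteq> e \<and> y m \<noteq> 0")
    case False
    then have "\<one>\<^bsub>R\<^esub> = (\<lambda>l. inverse (y e) * y l)"
      using ye by (auto simp: one_eq unit_vec_def fun_eq_iff)
    then show ?thesis using smult_in_ideal[OF J yJ] by simp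
  next
    case True
    then obtain m where m: "m \<noteq> e" "y m \<noteq> 0" by blast
    then have mB: "m \<in> basis A" using supp[OF yJ] by auto
    obtain j where j: "j \<in> basis A" "c j m \<noteq> c m j" using nondeg[OF mB m(1)] by blast
    \<comment> \<open>The commutator with \<open>unit_vec j\<close> multiplies the coefficient at
      \<open>n\<close> by \<open>c j n - c n j\<close> and moves it to \<open>op j n\<close>. The
      factor vanishes for \<open>n = e\<close> and, by the choice of \<open>j\<close>, not for
      \<open>n = m\<close>.\<close>
    define z where "z = (\<lambda>l. (unit_vec j \<otimes>\<^bsub>R\<^esub> y) l + (-1) * (y \<otimes>\<^bsub>R\<^esub> unit_vec j) l)"
    have "unit_vec j \<otimes>\<^bsub>R\<^esub> y \<oplus>\<^bsub>R\<^esub> (\<lambda>l. (-1) * (y \<otimes>\<^bsub>R\<^esub> unit_vec j) l) \<in> J"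
      using J yJ j by (intro additive_subgroup.a_closed[of J R] smult_in_ideal ideal.axioms(1))
        (auto intro: ideal.I_l_closed ideal.I_r_closed unit_vec_in_carrier)
    then have zJ: "z \<in> J" by (simp add: z_def add_alg_of)
    have zl: "z (op j n) = (c j n - c n j) * y n" if "n \<in> basis A" for n
      using unit_vec_mult_op[OF j(1) that, of y] by (simp add: z_def algebra_simps)
    have "z (op j m) \<noteq> 0" using zl[OF mB] m j by simp
    then have znz: "z \<noteq> (\<lambda>_. 0)" by auto
    have "{l. z l \<noteq> 0} \<subseteq> op j ` ({l. y l \<noteq> 0} - {e})"
    proof
      fix l assume "l \<in> {l. z l \<noteq> 0}"
      then have l: "z l \<noteq> 0" by simp
      then have lB: "l \<in> basis A" using supp[OF zJ] by auto
      obtain j' where j': "j' \<in> basis A" "op j' j = e" using op_inv[OF j(1)] by blast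
      have l_eq: "l = op j (op j' l)" 
        using j j' lB by (simp add: op_assoc[symmetric] op_comm[of j j'] op_e)
      have n: "op j' l \<in> basis A" using j' lB op_in by simp
      have "(c j (op j' l) - c (op j' l) j) * y (op j' l) \<noteq> 0" using zl[OF n] l unfolding l_eq[symmetric] by simp
      moreover have "c j e - c e j = 0" using j by (simp add: c_e)
      ultimately have "op j' l \<in> {l. y l \<noteq> 0} - {e}" by auto
      then show "l \<in> op j ` ({l. y l \<noteq> 0} - {e})" using l_eq by blast
    qed
    moreover have finy: "finite {l. y l \<noteq> 0}" using supp[OF yJ] fin finite_subset by blast
    ultimately have "card {l. z l \<noteq> 0} \<le> card ({l. y l \<noteq> 0} - {e})"
      by (intro order_trans[OF card_mono card_image_le]) auto
    also have "\<dots> < card {l. y l \<noteq> 0}"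
      using finy ye by (intro psubset_card_mono) auto
    finally show ?thesis using less.hyps[OF _ zJ znz] cy by simp
  qed
qed

lemma central_simple: "central_simple A"
  unfolding central_simple_def Let_def
proof (intro conjI)
  show "\<one>\<^bsub>R\<^esub> \<noteq> \<zero>\<^bsub>R\<^esub>" by (auto simp: one_eq zero_alg_of unit_vec_def fun_eq_iff)
  show "{z \<in> carrier R. \<forall>x\<in>carrier R. z \<otimes>\<^bsub>R\<^esub> x = x \<otimes>\<^bsub>R\<^esub> z} = {d \<odot>\<^bsub>R\<^esub> \<one>\<^bsub>R\<^esub> |d. True}"
  proof (intro equalityI subsetI)
    fix z assume "z \<in> {z \<in> carrier R. \<forall>x\<in>carrier R. z \<otimes>\<^bsub>R\<^esub> x = x \<otimes>\<^bsub>R\<^esub> z}"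
    then have z: "z \<in> carrier R" "\<And>x. x \<in> carrier R \<Longrightarrow> z \<otimes>\<^bsub>R\<^esub> x = x \<otimes>\<^bsub>R\<^esub> z" by auto
    have "z k = 0" if k: "k \<noteq> e" for k
    proof (cases "k \<in> basis A")
      case True
      obtain j where j: "j \<in> basis A" "c j k \<noteq> c k j" using nondeg[OF True k] by blast
      have "(z \<otimes>\<^bsub>R\<^esub> unit_vec j) (op j k) = (unit_vec j \<otimes>\<^bsub>R\<^esub> z) (op j k)"
        using z(2) j by (simp add: unit_vec_in_carrier)
      then show ?thesis using unit_vec_mult_op[OF j(1) True, of z] j by auto
    qed (use z in \<open>simp add: carrier_alg_of\<close>)
    then have "z = z e \<odot>\<^bsub>R\<^esub> \<one>\<^bsub>R\<^esub>" by (auto simp: one_eq unit_vec_def smult_alg_of fun_eq_iff)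
    then show "z \<in> {d \<odot>\<^bsub>R\<^esub> \<one>\<^bsub>R\<^esub> |d. True}" by blast
  next
    fix z assume "z \<in> {d \<odot>\<^bsub>R\<^esub> \<one>\<^bsub>R\<^esub> |d. True}"
    then obtain d where z: "z = (\<lambda>l. d * \<one>\<^bsub>R\<^esub> l)" by (auto simp: smult_alg_of)
    have "z \<in> carrier R" using one_closed_alg_of[of A] by (auto simp: z carrier_alg_of)
    moreover have "z \<otimes>\<^bsub>R\<^esub> x = x \<otimes>\<^bsub>R\<^esub> z" if x: "x \<in> carrier R" for x
    proof -
      have "z \<otimes>\<^bsub>R\<^esub> x = (\<lambda>l. d * (\<one>\<^bsub>R\<^esub> \<otimes>\<^bsub>R\<^esub> x) l)"
        by (auto simp: z mult_alg_of sum_distrib_left mult.assoc)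
      moreover have "x \<otimes>\<^bsub>R\<^esub> z = (\<lambda>l. d * (x \<otimes>\<^bsub>R\<^esub> \<one>\<^bsub>R\<^esub>) l)"
        by (auto simp: z mult_alg_of sum_distrib_left mult_ac)
      ultimately show ?thesis using x by (simp add: mult_one_alg)
    qed
    ultimately show "z \<in> {z \<in> carrier R. \<forall>x\<in>carrier R. z \<otimes>\<^bsub>R\<^esub> x = x \<otimes>\<^bsub>R\<^esub> z}" by blast
  qed
  show "\<forall>J. ideal J R \<longrightarrow> J = {\<zero>\<^bsub>R\<^esub>} \<or> J = carrier R"
  proof (intro allI impI)
    fix J assume J: "ideal J R"
    have z: "\<zero>\<^bsub>R\<^esub> \<in> J" using J by (simp add: additive_subgroup.zero_closed ideal.axioms(1))
    show "J = {\<zero>\<^bsub>R\<^esub>} \<or> J = carrier R"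
    proof (cases "J = {\<zero>\<^bsub>R\<^esub>}")
      case False
      then obtain x where "x \<in> J" "x \<noteq> \<zero>\<^bsub>R\<^esub>" using z by blast
      then have "\<one>\<^bsub>R\<^esub> \<in> J" using one_in_nonzero_ideal[OF J] by (simp add: zero_alg_of)
      then show ?thesis using J ideal.one_imp_carrier by blast
    qed simp
  qed
qed (simp_all add: fin ring_alg_of)

end

lemma mult_interchange:
  fixes a :: "'a::comm_semiring_0"
  assumes "a * a' = b * b'" "c * c' = d * d'"
  shows "a * c * (a' * c') = b * d * (b' * d')"
proof -
  have "a * c * (a' * c') = (a * a') * (c * c')" by (simp add: mult_ac)
  also have "\<dots> = b * d * (b' * d')" unfolding assms by (simp add: mult_ac)
  finally show ?thesis .
qed

lemma weyl_algebra_tensor: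
  assumes "weyl_algebra A op c e" "weyl_algebra B op' c' e'"
  shows "weyl_algebra (tensor A B) (\<lambda>i j. (op (fst i) (fst j), op' (snd i) (snd j)))
    (\<lambda>i j. c (fst i) (fst j) * c' (snd i) (snd j)) (e, e')"
proof -
  interpret A: weyl_algebra A op c e by fact
  interpret B: weyl_algebra B op' c' e' by fact
  show ?thesis
  proof
    fix i j k assume ijk: "i \<in> basis (tensor A B)" "j \<in> basis (tensor A B)" "k \<in> basis (tensor A B)"
    then have "c (fst i) (fst j) * c (op (fst i) (fst j)) (fst k) = c (fst j) (fst k) * c (fst i) (op (fst j) (fst k))"
      "c' (snd i) (snd j) * c' (op' (snd i) (snd j)) (snd k) = c' (snd j) (snd k) * c' (snd i) (op' (snd j) (snd k))"
      by (auto intro: A.cocycle B.cocycle)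
    then show "c (fst i) (fst j) * c' (snd i) (snd j) *
        (c (fst (op (fst i) (fst j), op' (snd i) (snd j))) (fst k) * c' (snd (op (fst i) (fst j), op' (snd i) (snd j))) (snd k)) =
       c (fst j) (fst k) * c' (snd j) (snd k) *
        (c (fst i) (fst (op (fst j) (fst k), op' (snd j) (snd k))) * c' (snd i) (snd (op (fst j) (fst k), op' (snd j) (snd k))))"
      unfolding fst_conv snd_conv by (rule mult_interchange)
  next
    fix i assume i: "i \<in> basis (tensor A B)"
    then obtain j where "j \<in> basis A" "op j (fst i) = e" using A.op_inv by force
    moreover obtain j' where "j' \<in> basis B" "op' j' (snd i) = e'" using B.op_inv i by force
    ultimately show "\<exists>j\<in>basis (tensor A B). (op (fst j) (fst i), op' (snd j) (snd i)) = (e, e')"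
      by (intro bexI[of _ "(j, j')"]) auto
  next
    fix i assume i: "i \<in> basis (tensor A B)" "i \<noteq> (e, e')"
    then have mem: "fst i \<in> basis A" "snd i \<in> basis B" by auto
    show "\<exists>j\<in>basis (tensor A B). c (fst j) (fst i) * c' (snd j) (snd i) \<noteq> c (fst i) (fst j) * c' (snd i) (snd j)"
    proof (cases "fst i = e")
      case True
      then have "snd i \<noteq> e'" using i by (cases i) auto
      then obtain j where "j \<in> basis B" "c' j (snd i) \<noteq> c' (snd i) j" using B.nondeg mem by blast
      then show ?thesis using True mem A.e_in by (intro bexI[of _ "(e, j)"]) (auto simp: A.c_e)
    next
      case False
      then obtain j where "j \<in> basis A" "c j (fst i) \<noteq> c (fst i) j" using A.nondeg mem by blast
      then show ?thesis using mem B.e_in by (intro bexI[of _ "(j, e')"]) (auto simp: B.c_e)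
    qed
  qed (auto simp: A.fin B.fin A.e_in B.e_in A.op_in B.op_in A.c_nz B.c_nz strc_tensor A.strc B.strc
      A.op_assoc B.op_assoc A.op_e B.op_e A.c_e B.c_e unit_coord_tensor A.unit B.unit
      intro: A.op_comm B.op_comm split: if_splits)
qed

text \<open>Brauer classes are sets of algebras indexed by natural numbers, so an algebra with
  another index type meets its own class only through such a copy.\<close>

lemma weyl_algebra_nat_indexed:
  fixes A :: "('i, 'a::field) based_algebra"
  assumes "weyl_algebra A op c e"
  obtains B :: "(nat, 'a) based_algebra" and op' c' e'
  where "weyl_algebra B op' c' e'" "alg_isomorphic A B"
proof -
  interpret A: weyl_algebra A op c e by fact
  obtain g where g: "bij_betw g {..<card (basis A)} (basis A)"
    using finite_same_card_bij[of "{..<card (basis A)}" "basis A"] A.fin by auto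
  define N where "N = {..<card (basis A)}"
  define f where "f = inv_into N g"
  have gN: "g i \<in> basis A" if "i \<in> N" for i using g that by (auto simp: N_def dest: bij_betw_apply)
  have fg: "f (g i) = i" if "i \<in> N" for i using g that by (auto simp: f_def N_def bij_betw_def inv_into_f_f)
  have gf: "g (f j) = j" "f j \<in> N" if "j \<in> basis A" for j
    using g that f_inv_into_f[of j g N] inv_into_into[of j g N] by (auto simp: f_def N_def bij_betw_def)
  have f_eq: "f x = f y \<longleftrightarrow> x = y" if "x \<in> basis A" "y \<in> basis A" for x y using gf that by metis
  have g_eq: "g x = j \<longleftrightarrow> x = f j" if "x \<in> N" "j \<in> basis A" for x j using gf fg that by metis
  define B :: "(nat, 'a) based_algebra" where
    "B = \<lparr>basis = N, strc = (\<lambda>i j l. strc A (g i) (g j) (g l)), unit_coord = (\<lambda>i. unit_coord A (g i))\<rparr>"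
  have [simp]: "basis B = N" by (simp add: B_def)
  have "weyl_algebra B (\<lambda>i j. f (op (g i) (g j))) (\<lambda>i j. c (g i) (g j)) (f e)"
  proof
    show "\<exists>j\<in>basis B. f (op (g j) (g i)) = f e" if i: "i \<in> basis B" for i
    proof -
      obtain j where "j \<in> basis A" "op j (g i) = e" using A.op_inv[OF gN] i by auto
      then show ?thesis by (intro bexI[of _ "f j"]) (auto simp: gf)
    qed
    show "\<exists>j\<in>basis B. c (g j) (g i) \<noteq> c (g i) (g j)" if i: "i \<in> basis B" "i \<noteq> f e" for i
    proof -
      have "g i \<noteq> e" using i fg A.e_in gf by auto
      then obtain j where "j \<in> basis A" "c j (g i) \<noteq> c (g i) j" using A.nondeg[OF gN] i by auto
      then show ?thesis by (intro bexI[of _ "f j"]) (auto simp: gf)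
    qed
    show "f (op (g i) (g j)) = f (op (g j) (g i))" if "i \<in> basis B" "j \<in> basis B" for i j
      using A.op_comm gN that by simp
    show "strc B i j l = (if l = f (op (g i) (g j)) then c (g i) (g j) else 0)"
      if "i \<in> basis B" "j \<in> basis B" "l \<in> basis B" for i j l
      using that by (simp add: B_def A.strc gN g_eq A.op_in)
    show "unit_coord B l = (if l = f e then 1 else 0)" if "l \<in> basis B" for l
      using that by (simp add: B_def A.unit gN g_eq A.e_in)
  qed (auto simp: N_def[symmetric] gf gN fg A.e_in A.op_in A.c_nz A.op_assoc A.op_e A.c_e A.cocycle,
       simp add: N_def)
  moreover have "alg_isomorphic B A"
    using g by (intro alg_isomorphic_reindex[where f = g and d = "\<lambda>_. 1"]) (auto simp: N_def B_def)
  ultimately show ?thesis using that alg_isomorphic_sym by blast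
qed

section \<open>Brauer classes\<close>

lemma finite_basis_if_central_simple: "central_simple A \<Longrightarrow> finite (basis A)"
  by (simp add: central_simple_def Let_def)

text \<open>A copy of \<open>A\<close> indexed by numbers lies in the class of \<open>A\<close>, so
  equality of the classes yields an equivalence with the trivial algebra. The converse is
  transitivity.\<close>

lemma brauer_class_eq_one_iff:
  assumes "weyl_algebra A op c e"
  shows "brauer_class A = \<one>\<^bsub>Br\<^esub> \<longleftrightarrow> split_algebra A"
proof -
  interpret A: weyl_algebra A op c e by fact
  have one: "\<one>\<^bsub>Br\<^esub> = brauer_class (matrix_algebra 1 :: (_, 'b) based_algebra)"
    by (simp add: Br_def)
  show ?thesis
  proof
    assume eq: "brauer_class A = \<one>\<^bsub>Br\<^esub>"
    obtain B :: "(nat, 'b) based_algebra" and op' c' e' where B: "weyl_algebra B op' c' e'" "alg_isomorphic A B"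
      using weyl_algebra_nat_indexed[OF assms] by blast
    interpret B: weyl_algebra B op' c' e' by fact
    have "B \<in> brauer_class A"
      using brauer_equivalent_if_alg_isomorphic[OF A.fin B.fin B(2)] B.central_simple by (simp add: brauer_class_def)
    then have "B \<in> brauer_class (matrix_algebra 1 :: (_, 'b) based_algebra)"
      unfolding eq one .
    then have "split_algebra B"
      unfolding brauer_class_def split_algebra_def by (auto intro: brauer_equivalent_sym)
    then show "split_algebra A" using split_algebra_cong[OF A.fin B.fin B(2)] by simp
  next
    assume A: "split_algebra A"
    have "brauer_equivalent A B \<longleftrightarrow> brauer_equivalent (matrix_algebra 1 :: (_, 'b) based_algebra) B"
      if "finite (basis B)" for B :: "(nat, 'b) based_algebra"
      using brauer_equivalent_trans[OF A.fin _ that, of "matrix_algebra 1"]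
        brauer_equivalent_trans[OF _ A.fin that, of "matrix_algebra 1"] A brauer_equivalent_sym
      by (auto simp: split_algebra_def)
    then show "brauer_class A = \<one>\<^bsub>Br\<^esub>"
      unfolding one brauer_class_def using finite_basis_if_central_simple by auto
  qed
qed

text \<open>The product of classes is a union over all pairs of representatives. All pairs give the
  same class, and the copies indexed by numbers show that there is at least one pair.\<close>

lemma brauer_class_mult:
  fixes A :: "('i, 'a::field) based_algebra" and B :: "('j, 'a) based_algebra"
  assumes "weyl_algebra A op c e" "weyl_algebra B op' c' e'"
  shows "brauer_class A \<otimes>\<^bsub>Br\<^esub> brauer_class B = brauer_class (tensor A B)"
proof -
  interpret A: weyl_algebra A op c e by fact
  interpret B: weyl_algebra B op' c' e' by fact
  obtain A0 :: "(nat, 'a) based_algebra" and o1 c1 e1 where A0: "weyl_algebra A0 o1 c1 e1" "alg_isomorphic A A0"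
    using weyl_algebra_nat_indexed[OF assms(1)] by blast
  obtain B0 :: "(nat, 'a) based_algebra" and o2 c2 e2 where B0: "weyl_algebra B0 o2 c2 e2" "alg_isomorphic B B0"
    using weyl_algebra_nat_indexed[OF assms(2)] by blast
  interpret A0: weyl_algebra A0 o1 c1 e1 by fact
  interpret B0: weyl_algebra B0 o2 c2 e2 by fact
  have A0m: "A0 \<in> brauer_class A"
    using brauer_equivalent_if_alg_isomorphic[OF A.fin A0.fin A0(2)] A0.central_simple by (simp add: brauer_class_def)
  have B0m: "B0 \<in> brauer_class B"
    using brauer_equivalent_if_alg_isomorphic[OF B.fin B0.fin B0(2)] B0.central_simple by (simp add: brauer_class_def)
  have *: "brauer_class (tensor A' B') = brauer_class (tensor A B)"
    if "A' \<in> brauer_class A" "B' \<in> brauer_class B" for A' B' :: "(nat, 'a) based_algebra"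
  proof -
    have fin: "finite (basis A')" "finite (basis B')" and eq: "brauer_equivalent A A'" "brauer_equivalent B B'"
      using that finite_basis_if_central_simple by (auto simp: brauer_class_def)
    have fin2: "finite (basis (tensor A B))" "finite (basis (tensor A' B'))" using fin A.fin B.fin by auto
    have "brauer_equivalent (tensor A B) (tensor A' B')"
      using brauer_equivalent_tensor[OF A.fin B.fin fin eq] .
    then have "brauer_equivalent (tensor A' B') D \<longleftrightarrow> brauer_equivalent (tensor A B) D"
      if "finite (basis D)" for D :: "(nat, 'a) based_algebra"
      using brauer_equivalent_trans[OF fin2 that] brauer_equivalent_trans[OF fin2(2,1) that]
        brauer_equivalent_sym by blast
    then show ?thesis unfolding brauer_class_def using finite_basis_if_central_simple by blast
  qed
  have "brauer_class A \<otimes>\<^bsub>Br\<^esub> brauer_class B = (\<Union>A'\<in>brauer_class A. \<Union>B'\<in>brauer_class B. brauer_class (tensor A' B'))"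
    by (simp add: Br_def)
  also have "\<dots> = (\<Union>A'\<in>brauer_class A. \<Union>B'\<in>brauer_class B. brauer_class (tensor A B))"
    using * by auto
  also have "\<dots> = brauer_class (tensor A B)" using A0m B0m by auto
  finally show ?thesis .
qed

section \<open>Symbol algebras\<close>

text \<open>The carries in additions modulo \<open>p\<close> form a 2-cocycle: either way of
  bracketing three summands produces the same total carry. In a symbol algebra the carries are the
  exponents of \<open>a\<close> and \<open>b\<close>.\<close>

lemma div_carry:
  fixes s u v p :: nat
  shows "(s + u) div p + ((s + u) mod p + v) div p = (s + u + v) div p"
proof (cases "p = 0")
  case False
  have "(s + u + v) div p = ((s + u) mod p + v + (s + u) div p * p) div p"
    by (metis add.assoc add.commute mod_div_mult_eq)
  also have "\<dots> = (s + u) div p + ((s + u) mod p + v) div p" using False by (rule div_mult_self1)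
  finally show ?thesis ..
qed simp

lemma div_carry_right:
  fixes s u v p :: nat
  shows "(u + v) div p + (s + (u + v) mod p) div p = (s + u + v) div p"
  using div_carry[of u v p s] by (simp add: add_ac)

lemma power_mod_eq:
  fixes z :: "'a::comm_monoid_mult"
  assumes "z ^ p = 1"
  shows "z ^ ((m mod p) * k) = z ^ (m * k)" "z ^ (k * (m mod p)) = z ^ (k * m)"
proof -
  have "z ^ m = z ^ (m mod p)"
    by (metis assms mult_div_mod_eq power_add power_mult power_one mult_1)
  then show "z ^ ((m mod p) * k) = z ^ (m * k)" by (simp add: power_mult)
  then show "z ^ (k * (m mod p)) = z ^ (k * m)" by (simp add: mult.commute)
qed

locale primitive_root =
  fixes p :: nat and \<zeta> :: "'a::field"
  assumes prime_p: "Factorial_Ring.prime p" and odd_p: "odd p" and char_p: "CHAR('a) \<noteq> p"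
    and zeta_p: "\<zeta> ^ p = 1" and zeta_prim: "\<And>n. 0 < n \<Longrightarrow> n < p \<Longrightarrow> \<zeta> ^ n \<noteq> 1"
begin

lemma p_gt_1: "p > 1" using prime_p prime_gt_1_nat by blast
lemma p_pos: "p > 0" using p_gt_1 by simp
lemma zeta_nz: "\<zeta> \<noteq> 0" using zeta_p p_pos by (auto simp: power_0_left)

lemma of_nat_p_nz: "of_nat p \<noteq> (0::'a)"
proof
  assume "of_nat p = (0::'a)"
  then have "CHAR('a) dvd p" by (simp add: of_nat_eq_0_iff_char_dvd)
  then have "CHAR('a) = 1 \<or> CHAR('a) = p" using prime_p unfolding prime_nat_iff by blast
  then show False using char_p by simp
qed

lemma zeta_pow_eq_1_iff: "\<zeta> ^ n = 1 \<longleftrightarrow> p dvd n"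
proof
  assume "\<zeta> ^ n = 1"
  moreover have "\<zeta> ^ n = \<zeta> ^ (n mod p)" using power_mod_eq(1)[OF zeta_p, of n 1] by simp
  ultimately have "n mod p = 0" using zeta_prim[of "n mod p"] p_pos by auto
  then show "p dvd n" by auto
next
  assume "p dvd n"
  then show "\<zeta> ^ n = 1" by (metis dvdE power_mult power_one zeta_p)
qed

abbreviation "symb a b \<equiv> cyclic_algebra p \<zeta> a b"

abbreviation symb_op :: "nat \<times> nat \<Rightarrow> nat \<times> nat \<Rightarrow> nat \<times> nat" where
  "symb_op i j \<equiv> ((fst i + fst j) mod p, (snd i + snd j) mod p)"

abbreviation symb_c :: "'a \<Rightarrow> 'a \<Rightarrow> nat \<times> nat \<Rightarrow> nat \<times> nat \<Rightarrow> 'a" where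
  "symb_c a b i j \<equiv> \<zeta> ^ (snd i * fst j) * a ^ ((fst i + fst j) div p) * b ^ ((snd i + snd j) div p)"

lemma basis_symb [simp]: "basis (symb a b) = {..<p} \<times> {..<p}"
  by (simp add: cyclic_algebra_def)

lemma strc_symb: "strc (symb a b) i j l = (if l = symb_op i j then symb_c a b i j else 0)"
  by (simp add: cyclic_algebra_def case_prod_unfold)

lemma unit_coord_symb: "unit_coord (symb a b) l = (if l = (0, 0) then 1 else 0)"
  by (simp add: cyclic_algebra_def)

text \<open>The commutator pairing of (s, r) and (u, t) is, up to sign, the power of \<zeta> with
  exponent ru - st. It is nondegenerate because \<open>(0, 1)\<close> detects the first exponent and
  \<open>(1, 0)\<close> the second.\<close>

lemma weyl_algebra_symb:
  assumes "a \<noteq> 0" "b \<noteq> 0"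
  shows "weyl_algebra (symb a b) symb_op (symb_c a b) (0, 0)"
proof
  fix i j k :: "nat \<times> nat"
  have "\<zeta> ^ (snd i * fst j) * \<zeta> ^ ((snd i + snd j) mod p * fst k) = \<zeta> ^ (snd j * fst k) * \<zeta> ^ (snd i * ((fst j + fst k) mod p))"
    by (simp add: power_mod_eq[OF zeta_p] power_add[symmetric] algebra_simps)
  moreover have "z ^ ((x + y) div p) * z ^ (((x + y) mod p + w) div p) = z ^ ((y + w) div p) * z ^ ((x + (y + w) mod p) div p)"
    for z :: 'a and x y w
    by (simp add: power_add[symmetric] div_carry div_carry_right)
  note this[of a "fst i" "fst j" "fst k"] this[of b "snd i" "snd j" "snd k"]
  ultimately show "symb_c a b i j * symb_c a b (symb_op i j) k = symb_c a b j k * symb_c a b i (symb_op j k)"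
    unfolding fst_conv snd_conv by (intro mult_interchange)
next
  fix i :: "nat \<times> nat" assume i: "i \<in> basis (symb a b)"
  show "\<exists>j\<in>basis (symb a b). symb_op j i = (0, 0)"
    using i p_pos by (intro bexI[of _ "((p - fst i) mod p, (p - snd i) mod p)"]) (auto simp: mod_simps)
  assume "i \<noteq> (0, 0)"
  show "\<exists>j\<in>basis (symb a b). symb_c a b j i \<noteq> symb_c a b i j"
  proof (cases "snd i = 0")
    case True
    then have "0 < fst i" "fst i < p" using i \<open>i \<noteq> (0, 0)\<close> by (cases i, auto)+
    then show ?thesis using True zeta_prim[of "fst i"] p_gt_1 i by (intro bexI[of _ "(0, 1)"]) auto
  next
    case False
    then have "0 < snd i" "snd i < p" using i by (cases i, auto)+
    then show ?thesis using zeta_prim[of "snd i"] p_gt_1 i assms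
      by (intro bexI[of _ "(1, 0)"]) (auto simp: add.commute)
  qed
qed (use assms zeta_nz p_pos in \<open>auto simp: strc_symb unit_coord_symb add.commute mod_simps add_ac\<close>)

text \<open>Sends i2 of the first algebra to i1 of the second and i1 to the inverse of i2. The
  monomial i2^s i1^r goes to i1^s i2^-r, and \<open>?d\<close> is the coefficient that brings this
  into the monomial basis: a power of \<zeta> from moving i2 to the left, and
  \<open>inverse a\<close> from writing i2^-r with the exponent p - r.\<close>

lemma symb_swap:
  assumes "a \<noteq> 0" "b \<noteq> 0"
  shows "alg_isomorphic (symb b (inverse a)) (symb a b)"
proof (rule alg_isomorphic_reindex)
  let ?q = "\<lambda>r. (p - r) mod p"
  let ?f = "\<lambda>i. (?q (snd i), fst i)"
  let ?d = "\<lambda>i. \<zeta> ^ (fst i * ?q (snd i)) * (if snd i = 0 then 1 else inverse a)"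
  have qq: "?q (?q r) = r" if "r < p" for r using that by (cases "r = 0") auto
  show "bij_betw ?f (basis (symb b (inverse a))) (basis (symb a b))"
    using p_pos by (intro bij_betw_byWitness[where f' = "\<lambda>i. (snd i, ?q (fst i))"]) (auto simp: qq)
  have zq: "\<zeta> ^ (s * ?q r) = inverse (\<zeta> ^ (s * r))" if "r < p" for s r
  proof -
    have "\<zeta> ^ (s * ?q r) * \<zeta> ^ (s * r) = \<zeta> ^ (s * (p - r) + s * r)"
      by (simp only: power_mod_eq(2)[OF zeta_p] power_add)
    also have "s * (p - r) + s * r = p * s" using that by (simp add: diff_mult_distrib2 mult.commute)
    also have "\<zeta> ^ (p * s) = 1" by (simp add: power_mult zeta_p)
    finally show ?thesis by (simp add: field_simps zeta_nz)
  qed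
  fix i j l assume i: "i \<in> basis (symb b (inverse a))" and j: "j \<in> basis (symb b (inverse a))"
    and l: "l \<in> basis (symb b (inverse a))"
  obtain s r u t where ij: "i = (s, r)" "j = (u, t)" by (cases i, cases j)
  have lt: "s < p" "r < p" "u < p" "t < p" using i j ij by auto
  have q_add: "?q r + ?q t = 2 * p - (r + t) \<or> r = 0 \<or> t = 0" using lt by (cases "r = 0"; cases "t = 0") auto
  have mem: "((s + u) mod p, (r + t) mod p) \<in> {..<p} \<times> {..<p}" using p_pos by auto
  have fm: "?f ((s + u) mod p, (r + t) mod p) = symb_op (?f i) (?f j)"
  proof -
    have "[int (?q ((r + t) mod p)) = int (?q r + ?q t)] (mod int p)"
      using lt p_pos by (simp add: cong_def of_nat_mod of_nat_diff mod_simps)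
    then have "?q ((r + t) mod p) mod p = (?q r + ?q t) mod p"
      by (metis cong_int_iff cong_def)
    then show ?thesis by (simp add: ij)
  qed
  have inj: "?f l = ?f m \<longleftrightarrow> l = m" if "m \<in> {..<p} \<times> {..<p}" for m
  proof
    assume "?f l = ?f m"
    then have "?q (?q (snd l)) = ?q (?q (snd m))" "fst l = fst m" by (metis fst_conv snd_conv)+
    then have "snd l = snd m" "fst l = fst m" using l that by (auto simp: qq)
    then show "l = m" by (rule prod_eqI[rotated])
  qed simp
  have leq: "?f l = symb_op (?f i) (?f j) \<longleftrightarrow> l = symb_op i j"
    using inj[OF mem] fm by (simp add: ij)
  have val: "?d i * ?d j * symb_c a b (?f i) (?f j) = symb_c b (inverse a) i j * ?d (symb_op i j)"
  proof -
    have z1: "\<zeta> ^ (s * ?q r) * \<zeta> ^ (u * ?q t) * \<zeta> ^ (s * ?q t) =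
        \<zeta> ^ (r * u) * \<zeta> ^ (((s + u) mod p) * ?q ((r + t) mod p))"
    proof -
      have "\<zeta> ^ (((s + u) mod p) * ?q ((r + t) mod p)) = inverse (\<zeta> ^ ((s + u) * (r + t)))"
        using zq[of "(r + t) mod p" "(s + u) mod p"] p_pos by (simp add: power_mod_eq[OF zeta_p])
      then show ?thesis
        using zq[OF lt(2), of s] zq[OF lt(4), of s] zq[OF lt(4), of u]
        by (simp only:) (simp add: power_add distrib_left distrib_right field_simps zeta_nz)
    qed
    have a1: "(if r = 0 then 1 else inverse a) * (if t = 0 then 1 else inverse a) * a ^ ((?q r + ?q t) div p)
        = inverse a ^ ((r + t) div p) * (if (r + t) mod p = 0 then 1 else inverse a)"
    proof (cases "r = 0 \<or> t = 0")
      case True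
      then show ?thesis using lt by auto
    next
      case False
      then have q: "?q r = p - r" "?q t = p - t" using lt by auto
      \<comment> \<open>The sums r + t and (p - r) + (p - t) add up to 2p, so their carries depend
        on the position of r + t relative to p.\<close>
      consider "r + t < p" | "r + t = p" | "r + t > p" by linarith
      then show ?thesis
      proof cases
        case 1
        then have "(p - r + (p - t)) div p = 1" using False lt by (intro div_nat_eqI) auto
        then show ?thesis using 1 False assms by (simp add: q)
      next
        case 2
        then have "p - r + (p - t) = p" using lt by auto
        then show ?thesis using 2 False assms p_pos by (simp add: q)
      next
        case 3
        then have "(p - r + (p - t)) div p = 0" using lt by auto
        moreover have "(r + t) div p = 1" using 3 lt by (intro div_nat_eqI) auto
        moreover have "(r + t) mod p \<noteq> 0" using 3 lt by (simp add: mod_if)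
        ultimately show ?thesis using False by (simp add: q)
      qed
    qed
    have "?d i * ?d j * symb_c a b (?f i) (?f j) =
        (\<zeta> ^ (s * ?q r) * \<zeta> ^ (u * ?q t) * \<zeta> ^ (s * ?q t)) *
        ((if r = 0 then 1 else inverse a) * (if t = 0 then 1 else inverse a) * a ^ ((?q r + ?q t) div p)) * b ^ ((s + u) div p)"
      by (simp add: ij mult_ac)
    also have "\<dots> = symb_c b (inverse a) i j * ?d (symb_op i j)"
      unfolding z1 a1 by (simp add: ij mult_ac)
    finally show ?thesis .
  qed
  show "?d i * ?d j * strc (symb a b) (?f i) (?f j) (?f l) = strc (symb b (inverse a)) i j l * ?d l"
  proof (cases "l = symb_op i j")
    case True
    have fl: "?f l = symb_op (?f i) (?f j)" using True leq by blast
    have s1: "strc (symb a b) (?f i) (?f j) (?f l) = symb_c a b (?f i) (?f j)"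
      unfolding strc_symb using fl by (rule if_P)
    have s2: "strc (symb b (inverse a)) i j l = symb_c b (inverse a) i j"
      unfolding strc_symb using True by (rule if_P)
    show ?thesis unfolding s1 s2 using val unfolding True .
  next
    case False
    have fl: "?f l \<noteq> symb_op (?f i) (?f j)" using False leq by blast
    have s1: "strc (symb a b) (?f i) (?f j) (?f l) = 0"
      unfolding strc_symb using fl by (rule if_not_P)
    have s2: "strc (symb b (inverse a)) i j l = 0"
      unfolding strc_symb using False by (rule if_not_P)
    show ?thesis unfolding s1 s2 by simp
  qed
next
  fix i assume "i \<in> basis (symb b (inverse a))"
  then show "\<zeta> ^ (fst i * ((p - snd i) mod p)) * (if snd i = 0 then 1 else inverse a) \<noteq> 0"
    using zeta_nz assms by simp
  show "unit_coord (symb a b) ((p - snd i) mod p, fst i) = unit_coord (symb b (inverse a)) i *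
     (\<zeta> ^ (fst i * ((p - snd i) mod p)) * (if snd i = 0 then 1 else inverse a))"
    using \<open>i \<in> basis (symb b (inverse a))\<close> by (cases i) (auto simp: unit_coord_symb)
qed simp

end

section \<open>Subfields of a field and linear systems over them\<close>

definition subfld :: "'b::field set \<Rightarrow> bool" where
  "subfld F \<longleftrightarrow> 0 \<in> F \<and> 1 \<in> F \<and> (\<forall>x\<in>F. \<forall>y\<in>F. x + y \<in> F \<and> x * y \<in> F) \<and> (\<forall>x\<in>F. - x \<in> F \<and> inverse x \<in> F)"

lemma subfldD:
  assumes "subfld F"
  shows "0 \<in> F" "1 \<in> F" "\<And>x y. x \<in> F \<Longrightarrow> y \<in> F \<Longrightarrow> x + y \<in> F" "\<And>x y. x \<in> F \<Longrightarrow> y \<in> F \<Longrightarrow> x * y \<in> F"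
    "\<And>x. x \<in> F \<Longrightarrow> - x \<in> F" "\<And>x. x \<in> F \<Longrightarrow> inverse x \<in> F"
    "\<And>x y. x \<in> F \<Longrightarrow> y \<in> F \<Longrightarrow> x - y \<in> F" "\<And>x y. x \<in> F \<Longrightarrow> y \<in> F \<Longrightarrow> x / y \<in> F"
proof -
  show *: "0 \<in> F" "1 \<in> F" "\<And>x y. x \<in> F \<Longrightarrow> y \<in> F \<Longrightarrow> x + y \<in> F" "\<And>x y. x \<in> F \<Longrightarrow> y \<in> F \<Longrightarrow> x * y \<in> F"
    "\<And>x. x \<in> F \<Longrightarrow> - x \<in> F" "\<And>x. x \<in> F \<Longrightarrow> inverse x \<in> F"
    using assms by (auto simp: subfld_def)
  show "x - y \<in> F" if "x \<in> F" "y \<in> F" for x y using *(3)[OF that(1) *(5)[OF that(2)]] by simp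
  show "x / y \<in> F" if "x \<in> F" "y \<in> F" for x y
    using *(4)[OF that(1) *(6)[OF that(2)]] by (simp add: divide_inverse)
qed

lemma subfld_power: "subfld F \<Longrightarrow> x \<in> F \<Longrightarrow> x ^ n \<in> F"
  by (induction n) (auto simp: subfldD)

lemma subfld_sum: "subfld F \<Longrightarrow> (\<And>i. i \<in> S \<Longrightarrow> f i \<in> F) \<Longrightarrow> sum f S \<in> F"
  by (induction S rule: infinite_finite_induct) (auto simp: subfldD)

lemma subfld_prod: "subfld F \<Longrightarrow> (\<And>i. i \<in> S \<Longrightarrow> f i \<in> F) \<Longrightarrow> prod f S \<in> F"
  by (induction S rule: infinite_finite_induct) (auto simp: subfldD)

lemma subfld_UNIV: "subfld UNIV"
  by (simp add: subfld_def)

lemma subfld_of_nat: "subfld F \<Longrightarrow> of_nat n \<in> F"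
  by (induction n) (auto simp: subfldD)

text \<open>Gaussian elimination with the solution kept in the subfield \<open>F\<close>; this is
  what later produces inverses in F(z) with coefficients in \<open>F\<close>.\<close>

lemma underdetermined_system:
  fixes P :: "'s \<Rightarrow> 'r \<Rightarrow> 'a::field"
  assumes F: "subfld F" and "finite R" "finite S" "card R < card S"
    and "\<And>s r. s \<in> S \<Longrightarrow> r \<in> R \<Longrightarrow> P s r \<in> F"
  shows "\<exists>x. (\<forall>s. x s \<in> F) \<and> (\<exists>s\<in>S. x s \<noteq> 0) \<and> (\<forall>r\<in>R. (\<Sum>s\<in>S. x s * P s r) = 0)"
  using assms(2-)
proof (induction R arbitrary: S P rule: finite_induct)
  case empty
  then obtain s where "s \<in> S" by fastforce
  then show ?case using subfldD(2)[OF F] by (intro exI[of _ "\<lambda>_. 1"]) auto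
next
  case (insert r0 R)
  show ?case
  proof (cases "\<forall>s\<in>S. P s r0 = 0")
    case True
    have "\<exists>x. (\<forall>s. x s \<in> F) \<and> (\<exists>s\<in>S. x s \<noteq> 0) \<and> (\<forall>r\<in>R. (\<Sum>s\<in>S. x s * P s r) = 0)"
      using insert.prems insert.hyps by (intro insert.IH) auto
    then obtain x where "\<forall>s. x s \<in> F" "\<exists>s\<in>S. x s \<noteq> 0" "\<forall>r\<in>R. (\<Sum>s\<in>S. x s * P s r) = 0" by blast
    then show ?thesis using True by (intro exI[of _ x]) auto
  next
    case False
    then obtain s0 where s0: "s0 \<in> S" "P s0 r0 \<noteq> 0" by blast
    \<comment> \<open>The unknown \<open>s0\<close> is eliminated by means of the equation
      \<open>r0\<close>.\<close>
    define Q where "Q s r = P s r - P s r0 / P s0 r0 * P s0 r" for s r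
    have "\<exists>x. (\<forall>s. x s \<in> F) \<and> (\<exists>s\<in>S - {s0}. x s \<noteq> 0) \<and> (\<forall>r\<in>R. (\<Sum>s\<in>S - {s0}. x s * Q s r) = 0)"
    proof (rule insert.IH)
      show "card R < card (S - {s0})" using insert.prems insert.hyps s0 by simp
      show "Q s r \<in> F" if "s \<in> S - {s0}" "r \<in> R" for s r
        unfolding Q_def using that insert.prems(3) s0 by (intro subfldD[OF F]) auto
    qed (use insert.prems in auto)
    then obtain x where x: "\<forall>s. x s \<in> F" "\<exists>s\<in>S - {s0}. x s \<noteq> 0" "\<forall>r\<in>R. (\<Sum>s\<in>S - {s0}. x s * Q s r) = 0" by blast
    define y where "y = - (\<Sum>s\<in>S - {s0}. x s * (P s r0 / P s0 r0))"
    define x' where "x' = x(s0 := y)"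
    have split: "(\<Sum>s\<in>S. x' s * P s r) = y * P s0 r + (\<Sum>s\<in>S - {s0}. x s * P s r)" for r
    proof -
      have "(\<Sum>s\<in>S. x' s * P s r) = x' s0 * P s0 r + (\<Sum>s\<in>S - {s0}. x' s * P s r)"
        using s0 insert.prems by (simp add: sum.remove)
      also have "(\<Sum>s\<in>S - {s0}. x' s * P s r) = (\<Sum>s\<in>S - {s0}. x s * P s r)"
        by (intro sum.cong) (auto simp: x'_def)
      finally show ?thesis by (simp add: x'_def)
    qed
    have eq: "(\<Sum>s\<in>S. x' s * P s r) = (\<Sum>s\<in>S - {s0}. x s * Q s r)" for r
      unfolding split y_def Q_def
      by (simp add: sum_distrib_right sum_distrib_left sum_subtractf right_diff_distrib mult_ac)
    show ?thesis
    proof (intro exI[of _ x'] conjI ballI allI)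
      show "x' s \<in> F" for s
        unfolding x'_def y_def using x s0 insert.prems
        by (auto intro!: subfldD[OF F] subfld_sum[OF F])
      show "\<exists>s\<in>S. x' s \<noteq> 0" using x(2) by (auto simp: x'_def)
      fix r assume "r \<in> insert r0 R"
      then show "(\<Sum>s\<in>S. x' s * P s r) = 0"
        using x(3) s0 unfolding eq by (auto simp: Q_def)
    qed
  qed
qed

text \<open>The right-hand side is added as one more column, at \<open>None\<close>. The enlarged
  system has more unknowns than equations, and in a nontrivial solution the weight of the new column
  cannot vanish, by injectivity.\<close>

lemma injective_imp_surjective_system:
  fixes P :: "'s \<Rightarrow> 'r \<Rightarrow> 'a::field"
  assumes fin: "finite R" "finite S" and card: "card R = card S"
    and inj: "\<And>x. (\<And>r. r \<in> R \<Longrightarrow> (\<Sum>s\<in>S. x s * P s r) = 0) \<Longrightarrow> (\<And>s. s \<in> S \<Longrightarrow> x s = 0)"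
  shows "\<exists>x. \<forall>r\<in>R. (\<Sum>s\<in>S. x s * P s r) = y r"
proof -
  define Q where "Q s r = (case s of None \<Rightarrow> - y r | Some s \<Rightarrow> P s r)" for s r
  let ?S = "insert None (Some ` S)"
  have "\<exists>x. (\<forall>s. x s \<in> UNIV) \<and> (\<exists>s\<in>?S. x s \<noteq> 0) \<and> (\<forall>r\<in>R. (\<Sum>s\<in>?S. x s * Q s r) = 0)"
    using fin card by (intro underdetermined_system) (auto simp: subfld_UNIV card_image)
  then obtain x where x: "\<exists>s\<in>?S. x s \<noteq> 0" "\<forall>r\<in>R. (\<Sum>s\<in>?S. x s * Q s r) = 0" by blast
  have eq: "(\<Sum>s\<in>S. x (Some s) * P s r) = x None * y r" if "r \<in> R" for r
  proof -
    have "(\<Sum>s\<in>?S. x s * Q s r) = x None * Q None r + (\<Sum>s\<in>S. x (Some s) * Q (Some s) r)"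
      using fin by (subst sum.insert) (auto simp: sum.reindex)
    then show ?thesis using x(2) that by (simp add: Q_def)
  qed
  have nz: "x None \<noteq> 0"
  proof
    assume 0: "x None = 0"
    have "x (Some s) = 0" if "s \<in> S" for s
      using inj[of "\<lambda>s. x (Some s)"] eq 0 that by simp
    with 0 x(1) show False by auto
  qed
  show ?thesis
  proof (intro exI ballI)
    fix r assume "r \<in> R"
    have "(\<Sum>s\<in>S. x (Some s) / x None * P s r) = (\<Sum>s\<in>S. x (Some s) * P s r) / x None"
      by (simp add: sum_divide_distrib)
    then show "(\<Sum>s\<in>S. x (Some s) / x None * P s r) = y r"
      using eq[OF \<open>r \<in> R\<close>] nz by simp
  qed
qed

lemma card_basis_le_if_left_inverse:
  fixes H :: "'s \<Rightarrow> 'r \<Rightarrow> 'a::field"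
  assumes "finite S" "finite R"
    and inv: "\<And>s s'. s \<in> S \<Longrightarrow> s' \<in> S \<Longrightarrow> (\<Sum>r\<in>R. H s r * G r s') = (if s = s' then 1 else 0)"
  shows "card S \<le> card R"
proof (rule ccontr)
  assume "\<not> card S \<le> card R"
  then obtain x where x: "\<exists>s\<in>S. x s \<noteq> 0" "\<forall>r\<in>R. (\<Sum>s\<in>S. x s * H s r) = 0"
    using underdetermined_system[OF subfld_UNIV assms(2,1), of H] by auto
  have "x t = 0" if t: "t \<in> S" for t
  proof -
    have "0 = (\<Sum>r\<in>R. (\<Sum>s\<in>S. x s * H s r) * G r t)" using x(2) by simp
    also have "\<dots> = (\<Sum>r\<in>R. \<Sum>s\<in>S. x s * H s r * G r t)" by (simp add: sum_distrib_right)
    also have "\<dots> = (\<Sum>s\<in>S. \<Sum>r\<in>R. x s * H s r * G r t)" by (rule sum.swap)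
    also have "\<dots> = (\<Sum>s\<in>S. x s * (\<Sum>r\<in>R. H s r * G r t))" by (simp add: sum_distrib_left mult.assoc)
    also have "\<dots> = (\<Sum>s\<in>S. if s = t then x s else 0)" using inv t by (intro sum.cong) auto
    finally show ?thesis using assms t by simp
  qed
  with x(1) show False by blast
qed

lemma card_basis_eq_if_alg_isomorphic:
  assumes "finite (basis A)" "finite (basis B)" "alg_isomorphic A B"
  shows "card (basis A) = card (basis B)"
proof -
  obtain H G where "matrix_iso A B H G" using alg_isomorphic_imp_matrix_iso[OF assms] by blast
  then show ?thesis
    unfolding matrix_iso_def
    by (intro antisym card_basis_le_if_left_inverse[of _ _ H G] card_basis_le_if_left_inverse[of _ _ G H])
      (use assms in auto)
qed

lemma mult_matalg:
  assumes "finite I"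
  shows "(x \<otimes>\<^bsub>alg_of (matalg I)\<^esub> y) l = (if l \<in> I \<times> I then \<Sum>m\<in>I. x (fst l, m) * y (m, snd l) else 0)"
proof (cases "l \<in> I \<times> I")
  case True
  have "(\<Sum>i\<in>I \<times> I. \<Sum>j\<in>I \<times> I. x i * y j * strc (matalg I) i j l)
      = (\<Sum>i\<in>I \<times> I. if fst i = fst l then x i * y (snd i, snd l) else 0)"
  proof (intro sum.cong refl)
    fix i assume i: "i \<in> I \<times> I"
    have "(\<Sum>j\<in>I \<times> I. x i * y j * strc (matalg I) i j l)
        = (\<Sum>j\<in>I \<times> I. if j = (snd i, snd l) then (if fst i = fst l then x i * y j else 0) else 0)"
      by (intro sum.cong refl) (auto simp: strc_matalg)
    then show "(\<Sum>j\<in>I \<times> I. x i * y j * strc (matalg I) i j l) = (if fst i = fst l then x i * y (snd i, snd l) else 0)"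
      using i True assms by auto
  qed
  also have "\<dots> = (\<Sum>a\<in>I. \<Sum>m\<in>I. if a = fst l then x (a, m) * y (m, snd l) else 0)"
    unfolding sum_Times by (intro sum.cong refl) (simp only: prod.collapse)
  also have "\<dots> = (\<Sum>a\<in>I. if a = fst l then (\<Sum>m\<in>I. x (a, m) * y (m, snd l)) else 0)"
    by (intro sum.cong refl) auto
  finally show ?thesis using True assms by (auto simp: mult_alg_of)
qed (simp add: mult_alg_of)

context weyl_algebra
begin

lemma sum_strc:
  assumes "i \<in> basis A" "j \<in> basis A"
  shows "(\<Sum>l\<in>basis A. strc A i j l * f l) = c i j * f (op i j)"
proof -
  have "(\<Sum>l\<in>basis A. strc A i j l * f l) = (\<Sum>l\<in>basis A. if l = op i j then c i j * f l else 0)"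
    using assms by (intro sum.cong) (auto simp: strc)
  then show ?thesis using assms fin op_in by simp
qed

text \<open>Simplicity makes a matrix representation injective; if its degree is the square root of the
  dimension of the algebra, it is then surjective.\<close>

lemma alg_isomorphic_matalg_if_representation:
  fixes \<rho> :: "'i \<Rightarrow> 'n \<Rightarrow> 'n \<Rightarrow> 'a"
  assumes I: "finite I" "I \<noteq> {}" and card: "card (basis A) = card I * card I"
    and mult: "\<And>i j a b. i \<in> basis A \<Longrightarrow> j \<in> basis A \<Longrightarrow> a \<in> I \<Longrightarrow> b \<in> I \<Longrightarrow>
      (\<Sum>m\<in>I. \<rho> i a m * \<rho> j m b) = c i j * \<rho> (op i j) a b"
    and one: "\<And>a b. a \<in> I \<Longrightarrow> b \<in> I \<Longrightarrow> \<rho> e a b = (if a = b then 1 else 0)"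
  shows "alg_isomorphic A (matalg I)"
proof -
  let ?B = "basis A" and ?S = "alg_of (matalg I :: (_, 'a) based_algebra)"
  define h where "h x = (\<lambda>l. if l \<in> I \<times> I then \<Sum>i\<in>?B. x i * \<rho> i (fst l) (snd l) else 0)" for x
  have hc: "h x \<in> carrier ?S" for x by (auto simp: h_def carrier_alg_of)
  have h_add: "h (\<lambda>l. x l + y l) = (\<lambda>l. h x l + h y l)" for x y
    by (auto simp: h_def distrib_right sum.distrib)
  have h_smult: "h (\<lambda>l. d * x l) = (\<lambda>l. d * h x l)" for d x
    by (auto simp: h_def sum_distrib_left mult.assoc)
  have h_mult: "h (x \<otimes>\<^bsub>R\<^esub> y) = h x \<otimes>\<^bsub>?S\<^esub> h y" for x y
  proof
    fix l
    show "h (x \<otimes>\<^bsub>R\<^esub> y) l = (h x \<otimes>\<^bsub>?S\<^esub> h y) l"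
    proof (cases "l \<in> I \<times> I")
      case True
      then obtain a b where l: "l = (a, b)" "a \<in> I" "b \<in> I" by auto
      have "h (x \<otimes>\<^bsub>R\<^esub> y) l = (\<Sum>m\<in>?B. \<Sum>i\<in>?B. \<Sum>j\<in>?B. x i * y j * strc A i j m * \<rho> m a b)"
        using l by (simp add: h_def mult_alg_of sum_distrib_right)
      also have "\<dots> = (\<Sum>i\<in>?B. \<Sum>j\<in>?B. \<Sum>m\<in>?B. x i * y j * strc A i j m * \<rho> m a b)"
        by (rule sum_rotate3[symmetric])
      also have "\<dots> = (\<Sum>i\<in>?B. \<Sum>j\<in>?B. x i * y j * (\<Sum>m\<in>?B. strc A i j m * \<rho> m a b))"
        by (simp add: sum_distrib_left mult.assoc)
      also have "\<dots> = (\<Sum>i\<in>?B. \<Sum>j\<in>?B. x i * y j * (\<Sum>m\<in>I. \<rho> i a m * \<rho> j m b))"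
        using l by (intro sum.cong refl) (simp add: sum_strc mult)
      also have "\<dots> = (\<Sum>i\<in>?B. \<Sum>j\<in>?B. \<Sum>m\<in>I. (x i * \<rho> i a m) * (y j * \<rho> j m b))"
        by (simp add: sum_distrib_left mult_ac)
      also have "\<dots> = (\<Sum>m\<in>I. \<Sum>i\<in>?B. \<Sum>j\<in>?B. (x i * \<rho> i a m) * (y j * \<rho> j m b))"
        by (rule sum_rotate3)
      also have "\<dots> = (h x \<otimes>\<^bsub>?S\<^esub> h y) l"
        using l by (simp add: mult_matalg[OF I(1)] h_def sum_product)
      finally show ?thesis .
    qed (simp add: h_def mult_matalg[OF I(1)])
  qed
  have h_one: "h \<one>\<^bsub>R\<^esub> = \<one>\<^bsub>?S\<^esub>"
  proof
    fix l
    have "(\<Sum>i\<in>?B. unit_vec e i * \<rho> i (fst l) (snd l)) = (\<Sum>i\<in>?B. if i = e then \<rho> i (fst l) (snd l) else 0)"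
      by (intro sum.cong) (auto simp: unit_vec_def)
    then show "h \<one>\<^bsub>R\<^esub> l = \<one>\<^bsub>?S\<^esub> l"
      unfolding one_eq using fin e_in one by (auto simp: h_def one_alg_of unit_coord_matalg)
  qed
  have h_zero: "h x = (\<lambda>_. 0)" if "h y = (\<lambda>_. 0)" "x = z \<otimes>\<^bsub>R\<^esub> y \<or> x = y \<otimes>\<^bsub>R\<^esub> z" for x y z
  proof -
    have "w \<otimes>\<^bsub>?S\<^esub> (\<lambda>_. 0) = (\<lambda>_. 0)" "(\<lambda>_. 0) \<otimes>\<^bsub>?S\<^esub> w = (\<lambda>_. 0)" for w
      by (auto simp: mult_alg_of)
    then show ?thesis using that h_mult by auto
  qed
  define J where "J = {x \<in> carrier R. h x = (\<lambda>_. 0)}"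
  have ideal: "ideal J R"
  proof (rule idealI[OF ring_alg_of])
    show "subgroup J (add_monoid R)"
    proof
      show "J \<subseteq> carrier (add_monoid R)" by (auto simp: J_def)
      fix x y assume "x \<in> J" "y \<in> J"
      then show "x \<otimes>\<^bsub>add_monoid R\<^esub> y \<in> J"
        using h_add[of x y] by (auto simp: J_def carrier_alg_of add_alg_of)
    next
      show "\<one>\<^bsub>add_monoid R\<^esub> \<in> J"
        by (auto simp: J_def carrier_alg_of zero_alg_of h_def)
    next
      fix x assume x: "x \<in> J"
      have "inv\<^bsub>add_monoid R\<^esub> x = (\<lambda>l. (-1) * x l)"
        using x ring_alg_of
        by (intro group.inv_equality[OF abelian_group.a_group[OF ring.is_abelian_group]])
          (auto simp: J_def carrier_alg_of add_alg_of zero_alg_of)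
      then show "inv\<^bsub>add_monoid R\<^esub> x \<in> J"
        using x h_smult[of "-1" x] by (auto simp: J_def carrier_alg_of)
    qed
  qed (auto simp: J_def mult_closed_alg_of intro: h_zero)
  have "\<one>\<^bsub>R\<^esub> \<notin> J"
  proof
    assume "\<one>\<^bsub>R\<^esub> \<in> J"
    then have "\<one>\<^bsub>?S\<^esub> = (\<lambda>_. 0)" using h_one by (simp add: J_def)
    moreover obtain a where "a \<in> I" using I by blast
    then have "\<one>\<^bsub>?S\<^esub> (a, a) = 1" by (simp add: one_alg_of unit_coord_matalg)
    ultimately show False by simp
  qed
  then have inj0: "x = (\<lambda>_. 0)" if "x \<in> carrier R" "h x = (\<lambda>_. 0)" for x
    using one_in_nonzero_ideal[OF ideal, of x] that by (auto simp: J_def)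
  have inj: "inj_on h (carrier R)"
  proof (rule inj_onI)
    fix x y assume xy: "x \<in> carrier R" "y \<in> carrier R" "h x = h y"
    have "h (\<lambda>l. x l + (-1) * y l) = (\<lambda>_. 0)"
      using h_add[of x "\<lambda>l. (-1) * y l"] h_smult[of "-1" y] xy(3) by auto
    moreover have "(\<lambda>l. x l + (-1) * y l) \<in> carrier R" using xy by (auto simp: carrier_alg_of)
    ultimately have "(\<lambda>l. x l + (-1) * y l) = (\<lambda>_. 0)" by (intro inj0)
    then have "x l + (-1) * y l = 0" for l by meson
    then show "x = y" by (auto simp: fun_eq_iff)
  qed
  have surj: "\<exists>x\<in>carrier R. h x = y" if y: "y \<in> carrier ?S" for y
  proof -
    have "\<exists>x. \<forall>l\<in>I \<times> I. (\<Sum>i\<in>?B. x i * \<rho> i (fst l) (snd l)) = y l"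
    proof (rule injective_imp_surjective_system)
      fix x s
      assume 0: "\<And>l. l \<in> I \<times> I \<Longrightarrow> (\<Sum>i\<in>?B. x i * \<rho> i (fst l) (snd l)) = 0" and s: "s \<in> ?B"
      let ?x = "\<lambda>i. if i \<in> ?B then x i else 0"
      have "h ?x = (\<lambda>_. 0)" using 0 by (auto simp: h_def)
      then have "?x = (\<lambda>_. 0)" by (intro inj0) (auto simp: carrier_alg_of)
      then have "?x s = 0" by meson
      then show "x s = 0" using s by simp
    qed (use fin I card in auto)
    then obtain x where x: "\<forall>l\<in>I \<times> I. (\<Sum>i\<in>?B. x i * \<rho> i (fst l) (snd l)) = y l" by blast
    let ?x = "\<lambda>i. if i \<in> ?B then x i else 0"
    have "h ?x = y" using x y by (auto simp: h_def carrier_alg_of fun_eq_iff)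
    moreover have "?x \<in> carrier R" by (auto simp: carrier_alg_of)
    ultimately show ?thesis by blast
  qed
  have "bij_betw h (carrier R) (carrier ?S)"
    unfolding bij_betw_def using inj surj hc by blast
  then have "alg_iso A (matalg I) h"
    unfolding alg_iso_def using h_mult h_add h_one h_smult by blast
  then show ?thesis unfolding alg_isomorphic_iff_alg_iso by blast
qed

end

section \<open>Radical extensions inside a field\<close>

definition ext :: "nat \<Rightarrow> 'b::field set \<Rightarrow> 'b \<Rightarrow> 'b set" where
  "ext p F z = {y. \<exists>f. (\<forall>i<p. f i \<in> F) \<and> y = (\<Sum>i<p. f i * z ^ i)}"

text \<open>Given that \<open>z ^ p\<close> lies in \<open>F\<close>, this says that F(z) has degree
  \<open>p\<close> over \<open>F\<close>; then \<open>ext p F z\<close> is F(z).\<close>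

definition radical :: "nat \<Rightarrow> 'b::field set \<Rightarrow> 'b \<Rightarrow> bool" where
  "radical p F z \<longleftrightarrow> z ^ p \<in> F \<and>
    (\<forall>f. (\<forall>i<p. f i \<in> F) \<longrightarrow> (\<Sum>i<p. f i * z ^ i) = 0 \<longrightarrow> (\<forall>i<p. f i = 0))"

lemma radicalD:
  assumes "radical p F z" "\<forall>i<p. f i \<in> F" "(\<Sum>i<p. f i * z ^ i) = 0"
  shows "\<forall>i<p. f i = 0"
  using assms unfolding radical_def by blast

lemma sum_shift_radical:
  fixes z :: "'b::field"
  assumes "p > 0"
  shows "z * (\<Sum>i<p. f i * z ^ i) = (\<Sum>i<p. (if i = 0 then f (p - 1) * z ^ p else f (i - 1)) * z ^ i)"
proof -
  obtain q where q: "p = Suc q" using assms by (cases p) auto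
  have "z * (\<Sum>i<p. f i * z ^ i) = (\<Sum>i<q. f i * z ^ Suc i) + f q * z ^ Suc q"
    by (simp add: q distrib_left sum_distrib_left mult_ac)
  also have "\<dots> = (\<Sum>i<p. (if i = 0 then f (p - 1) * z ^ p else f (i - 1)) * z ^ i)"
    unfolding q sum.lessThan_Suc_shift by simp
  finally show ?thesis .
qed

context
  fixes p :: nat and F :: "'b::field set" and z :: 'b
  assumes F: "subfld F" and p: "p > 1" and zp: "z ^ p \<in> F"
begin

lemma ext_base: "c \<in> F \<Longrightarrow> c \<in> ext p F z"
  unfolding ext_def using p subfldD[OF F]
  by (auto intro!: exI[of _ "\<lambda>i. if i = 0 then c else 0"] simp: if_distrib[of "\<lambda>u. u * _"] cong: if_cong)

lemma ext_add: "x \<in> ext p F z \<Longrightarrow> y \<in> ext p F z \<Longrightarrow> x + y \<in> ext p F z"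
proof -
  assume "x \<in> ext p F z" "y \<in> ext p F z"
  then obtain f g where "\<forall>i<p. f i \<in> F" "x = (\<Sum>i<p. f i * z ^ i)" "\<forall>i<p. g i \<in> F" "y = (\<Sum>i<p. g i * z ^ i)"
    unfolding ext_def by blast
  then show "x + y \<in> ext p F z"
    unfolding ext_def using subfldD[OF F] by (auto intro!: exI[of _ "\<lambda>i. f i + g i"] simp: sum.distrib distrib_right)
qed

lemma ext_scale: "c \<in> F \<Longrightarrow> y \<in> ext p F z \<Longrightarrow> c * y \<in> ext p F z"
proof -
  assume "c \<in> F" "y \<in> ext p F z"
  then obtain g where "c \<in> F" "\<forall>i<p. g i \<in> F" "y = (\<Sum>i<p. g i * z ^ i)"
    unfolding ext_def by blast
  then show "c * y \<in> ext p F z"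
    unfolding ext_def using subfldD[OF F] by (auto intro!: exI[of _ "\<lambda>i. c * g i"] simp: sum_distrib_left mult.assoc)
qed

lemma ext_shift: "y \<in> ext p F z \<Longrightarrow> z * y \<in> ext p F z"
proof -
  assume "y \<in> ext p F z"
  then obtain g where g: "\<forall>i<p. g i \<in> F" "y = (\<Sum>i<p. g i * z ^ i)"
    unfolding ext_def by blast
  have "z * y = (\<Sum>i<p. (if i = 0 then g (p - 1) * z ^ p else g (i - 1)) * z ^ i)"
    unfolding g(2) by (rule sum_shift_radical) (use p in simp)
  then show "z * y \<in> ext p F z"
    unfolding ext_def using subfldD[OF F] g(1) p zp
    by (intro CollectI exI[of _ "\<lambda>i. if i = 0 then g (p - 1) * z ^ p else g (i - 1)"]) auto
qed

lemma ext_power_mult: "y \<in> ext p F z \<Longrightarrow> z ^ i * y \<in> ext p F z"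
  by (induction i) (auto simp: mult.assoc intro: ext_shift)

lemma ext_sum: "(\<And>i. i \<in> S \<Longrightarrow> f i \<in> ext p F z) \<Longrightarrow> sum f S \<in> ext p F z"
  by (induction S rule: infinite_finite_induct) (auto intro: ext_add ext_base subfldD[OF F])

lemma ext_mult: "x \<in> ext p F z \<Longrightarrow> y \<in> ext p F z \<Longrightarrow> x * y \<in> ext p F z"
proof -
  assume x: "x \<in> ext p F z" and y: "y \<in> ext p F z"
  then obtain f where f: "\<forall>i<p. f i \<in> F" "x = (\<Sum>i<p. f i * z ^ i)"
    unfolding ext_def by blast
  have "x * y = (\<Sum>i<p. f i * (z ^ i * y))" unfolding f(2) by (simp add: sum_distrib_right mult.assoc)
  also have "\<dots> \<in> ext p F z" using f(1) y by (intro ext_sum ext_scale ext_power_mult) auto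
  finally show ?thesis .
qed

lemma ext_gen: "z \<in> ext p F z"
  using ext_shift[OF ext_base[OF subfldD(2)[OF F]]] by simp

text \<open>F(z) is generated as a ring by \<open>F\<close> and \<open>z\<close>, so identities
  between additive and multiplicative maps need to be checked only there.\<close>

lemma ext_induct [consumes 1, case_names base gen add mult]:
  assumes y: "y \<in> ext p F z"
    and base: "\<And>c. c \<in> F \<Longrightarrow> Q c" and gen: "Q z"
    and add: "\<And>x y. x \<in> ext p F z \<Longrightarrow> y \<in> ext p F z \<Longrightarrow> Q x \<Longrightarrow> Q y \<Longrightarrow> Q (x + y)"
    and mult: "\<And>x y. x \<in> ext p F z \<Longrightarrow> y \<in> ext p F z \<Longrightarrow> Q x \<Longrightarrow> Q y \<Longrightarrow> Q (x * y)"
  shows "Q y"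
proof -
  obtain f where f: "\<forall>i<p. f i \<in> F" "y = (\<Sum>i<p. f i * z ^ i)"
    using y unfolding ext_def by blast
  have pw: "z ^ i \<in> ext p F z \<and> Q (z ^ i)" for i
    by (induction i) (auto intro: ext_base base subfldD[OF F] ext_mult mult gen ext_gen)
  have "(\<Sum>i<n. f i * z ^ i) \<in> ext p F z \<and> Q (\<Sum>i<n. f i * z ^ i)" if "n \<le> p" for n
    using that
  proof (induction n)
    case 0
    then show ?case using base[of 0] ext_base[of 0] subfldD[OF F] by simp
  next
    case (Suc n)
    then have "f n \<in> F" using f by simp
    then have "f n * z ^ n \<in> ext p F z" "Q (f n * z ^ n)"
      using ext_mult[OF ext_base] mult[OF ext_base _ base] pw[of n] by blast+
    with Suc show ?case by (simp add: add ext_add)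
  qed
  from this[of p] f show ?thesis by simp
qed

text \<open>The \<open>p + 1\<close> elements 1 and \<open>y * z ^ s\<close> with
  \<open>s < p\<close> lie in a space of dimension at most \<open>p\<close>, so they are linearly
  dependent over \<open>F\<close>. As the \<open>z ^ s\<close> are independent and \<open>y\<close>
  is nonzero, 1 occurs in the relation, which exhibits it as a multiple of \<open>y\<close>.\<close>

lemma ext_inverse:
  assumes rad: "radical p F z" and y: "y \<in> ext p F z"
  shows "inverse y \<in> ext p F z"
proof (cases "y = 0")
  case True
  then show ?thesis using ext_base subfldD[OF F] by simp
next
  case False
  have "\<forall>u. \<exists>f. u \<in> ext p F z \<longrightarrow> (\<forall>i<p. f i \<in> F) \<and> u = (\<Sum>i<p. f i * z ^ i)"
    unfolding ext_def by auto
  then obtain cf where cf: "\<And>u i. u \<in> ext p F z \<Longrightarrow> i < p \<Longrightarrow> cf u i \<in> F"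
      "\<And>u. u \<in> ext p F z \<Longrightarrow> u = (\<Sum>i<p. cf u i * z ^ i)"
    by (metis choice_iff)
  \<comment> \<open>The index \<open>p\<close> stands for the element 1.\<close>
  define t where "t s = (if s = p then 1 else y * z ^ s)" for s
  have t: "t s \<in> ext p F z" for s
    using ext_power_mult[OF y, of s] ext_base subfldD[OF F] by (auto simp: t_def mult.commute)
  obtain x where x: "\<forall>s. x s \<in> F" "\<exists>s\<in>{..p}. x s \<noteq> 0" "\<forall>r\<in>{..<p}. (\<Sum>s\<in>{..p}. x s * cf (t s) r) = 0"
    using underdetermined_system[OF F, of "{..<p}" "{..p}" "\<lambda>s r. cf (t s) r"] cf(1)[OF t] by auto
  have "(\<Sum>s\<le>p. x s * t s) = (\<Sum>s\<le>p. x s * (\<Sum>i<p. cf (t s) i * z ^ i))"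
    using cf(2)[OF t] by (intro sum.cong refl) simp
  also have "\<dots> = (\<Sum>i<p. (\<Sum>s\<le>p. x s * cf (t s) i) * z ^ i)"
    by (simp add: sum_distrib_left sum_distrib_right mult.assoc sum.swap[of _ "{..<p}"])
  also have "\<dots> = 0" using x(3) by simp
  finally have rel: "x p + (\<Sum>s<p. x s * (y * z ^ s)) = 0"
    by (simp add: lessThan_Suc_atMost[symmetric] t_def add.commute)
  have eq: "(\<Sum>s<p. x s * (y * z ^ s)) = y * (\<Sum>s<p. x s * z ^ s)"
    by (simp add: sum_distrib_left mult_ac)
  have "x p \<noteq> 0"
  proof
    assume 0: "x p = 0"
    then have "(\<Sum>s<p. x s * z ^ s) = 0" using rel eq False by simp
    then have "\<forall>s<p. x s = 0" using rad x(1) unfolding radical_def by blast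
    with 0 x(2) show False by (metis atMost_iff le_neq_implies_less)
  qed
  have "y * (\<Sum>s<p. x s * z ^ s) = - x p"
    using rel unfolding eq by (simp add: eq_neg_iff_add_eq_0 add.commute)
  then have "- inverse (x p) * (y * (\<Sum>s<p. x s * z ^ s)) = 1" using \<open>x p \<noteq> 0\<close> by simp
  then have "y * (- inverse (x p) * (\<Sum>s<p. x s * z ^ s)) = 1" by (simp add: mult_ac)
  then have "inverse y = (- inverse (x p)) * (\<Sum>s<p. x s * z ^ s)" by (rule inverse_unique)
  also have "\<dots> \<in> ext p F z"
    using x(1) subfldD[OF F] by (intro ext_scale) (auto simp: ext_def)
  finally show ?thesis .
qed

lemma subfld_ext:
  assumes "radical p F z"
  shows "subfld (ext p F z)"
  unfolding subfld_def
  using ext_base ext_add ext_mult ext_inverse[OF assms] ext_scale[of "-1"] subfldD[OF F] by auto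

end

section \<open>Vector space structures over a growing subfield\<close>

definition action :: "'b::field set \<Rightarrow> 'v::ab_group_add set \<Rightarrow> ('b \<Rightarrow> 'v \<Rightarrow> 'v) \<Rightarrow> bool" where
  "action F V \<kappa> \<longleftrightarrow> 0 \<in> V \<and> (\<forall>v\<in>V. \<forall>w\<in>V. v + w \<in> V) \<and> (\<forall>f\<in>F. \<forall>v\<in>V. \<kappa> f v \<in> V) \<and>
    (\<forall>f\<in>F. \<forall>v\<in>V. \<forall>w\<in>V. \<kappa> f (v + w) = \<kappa> f v + \<kappa> f w) \<and>
    (\<forall>f\<in>F. \<forall>g\<in>F. \<forall>v\<in>V. \<kappa> (f + g) v = \<kappa> f v + \<kappa> g v \<and> \<kappa> (f * g) v = \<kappa> f (\<kappa> g v)) \<and>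
    (\<forall>v\<in>V. \<kappa> 1 v = v)"

lemma actionD:
  assumes "action F V \<kappa>"
  shows "0 \<in> V" "\<And>v w. v \<in> V \<Longrightarrow> w \<in> V \<Longrightarrow> v + w \<in> V"
    "\<And>f v. f \<in> F \<Longrightarrow> v \<in> V \<Longrightarrow> \<kappa> f v \<in> V"
    "\<And>f v w. f \<in> F \<Longrightarrow> v \<in> V \<Longrightarrow> w \<in> V \<Longrightarrow> \<kappa> f (v + w) = \<kappa> f v + \<kappa> f w"
    "\<And>f g v. f \<in> F \<Longrightarrow> g \<in> F \<Longrightarrow> v \<in> V \<Longrightarrow> \<kappa> (f + g) v = \<kappa> f v + \<kappa> g v"
    "\<And>f g v. f \<in> F \<Longrightarrow> g \<in> F \<Longrightarrow> v \<in> V \<Longrightarrow> \<kappa> (f * g) v = \<kappa> f (\<kappa> g v)"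
    "\<And>v. v \<in> V \<Longrightarrow> \<kappa> 1 v = v"
  using assms unfolding action_def by blast+

lemma action_zero:
  assumes "action F V \<kappa>" "subfld F"
  shows "f \<in> F \<Longrightarrow> \<kappa> f 0 = 0" "v \<in> V \<Longrightarrow> \<kappa> 0 v = 0"
  using actionD(4)[OF assms(1), of f 0 0] actionD(1)[OF assms(1)] actionD(5)[OF assms(1), of 0 0 v]
    subfldD(1)[OF assms(2)] by auto

lemma action_sum_mem:
  assumes "action F V \<kappa>" "\<And>i. i \<in> S \<Longrightarrow> g i \<in> V"
  shows "sum g S \<in> V"
  using assms(2) by (induction S rule: infinite_finite_induct) (auto intro: actionD[OF assms(1)])

lemma additive_sum:
  assumes "action F V \<kappa>" and add: "\<And>v w. v \<in> V \<Longrightarrow> w \<in> V \<Longrightarrow> T (v + w) = T v + T w"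
    and "\<And>i. i \<in> S \<Longrightarrow> g i \<in> V"
  shows "T (sum g S) = (\<Sum>i\<in>S. T (g i :: 'v::ab_group_add) :: 'v)"
proof -
  have T0: "T 0 = 0" using add[of 0 0] actionD(1)[OF assms(1)] by simp
  show ?thesis
    using assms(3)
    by (induction S rule: infinite_finite_induct) (auto simp: T0 add action_sum_mem[OF assms(1)])
qed

text \<open>F(z) is F[X] modulo X^p - z^p, so an \<open>F\<close>-linear operator \<open>Z\<close>
  whose p-th power is multiplication by \<open>z ^ p\<close> extends the action, with
  \<open>z\<close> acting as \<open>Z\<close>.\<close>

lemma action_extend:
  fixes V :: "'v::ab_group_add set"
  assumes F: "subfld F" and p: "p > 1" and rad: "radical p F z" and act: "action F V \<kappa>"
    and ZV: "\<And>v. v \<in> V \<Longrightarrow> Z v \<in> V"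
    and Zadd: "\<And>v w. v \<in> V \<Longrightarrow> w \<in> V \<Longrightarrow> Z (v + w) = Z v + Z w"
    and Zcomm: "\<And>f v. f \<in> F \<Longrightarrow> v \<in> V \<Longrightarrow> Z (\<kappa> f v) = \<kappa> f (Z v)"
    and Zp: "\<And>v. v \<in> V \<Longrightarrow> (Z ^^ p) v = \<kappa> (z ^ p) v"
  obtains \<kappa>' where "action (ext p F z) V \<kappa>'" "\<And>f v. f \<in> F \<Longrightarrow> v \<in> V \<Longrightarrow> \<kappa>' f v = \<kappa> f v"
    "\<And>v. v \<in> V \<Longrightarrow> \<kappa>' z v = Z v"
proof -
  have zp: "z ^ p \<in> F" using rad by (simp add: radical_def)
  note a = actionD[OF act] and f = subfldD[OF F]
  have ZiV: "(Z ^^ i) v \<in> V" if "v \<in> V" for i v using that by (induction i) (auto intro: ZV)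
  have Ziadd: "(Z ^^ i) (v + w) = (Z ^^ i) v + (Z ^^ i) w" if "v \<in> V" "w \<in> V" for i v w
    using that by (induction i) (auto simp: Zadd ZiV)
  have Zicomm: "(Z ^^ i) (\<kappa> c v) = \<kappa> c ((Z ^^ i) v)" if "c \<in> F" "v \<in> V" for i c v
    using that by (induction i) (auto simp: Zcomm ZiV)
  define E where "E c v = (\<Sum>i<p. \<kappa> (c i) ((Z ^^ i) v))" for c v
  define cf where "cf y = (SOME c. (\<forall>i<p. c i \<in> F) \<and> y = (\<Sum>i<p. c i * z ^ i))" for y
  define \<kappa>' where "\<kappa>' y v = E (cf y) v" for y v
  \<comment> \<open>Coefficients with respect to the powers of \<open>z\<close> are unique by
    \<open>radical\<close>, so any coefficients may be used to compute \<open>\<kappa>'\<close>, not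
    only the chosen ones.\<close>
  have cf: "\<kappa>' y v = E c v" if c: "\<forall>i<p. c i \<in> F" "y = (\<Sum>i<p. c i * z ^ i)" for y c v
  proof -
    have "(\<forall>i<p. cf y i \<in> F) \<and> y = (\<Sum>i<p. cf y i * z ^ i)"
      unfolding cf_def by (rule someI[of _ c]) (use c in blast)
    then have *: "\<forall>i<p. cf y i \<in> F" "y = (\<Sum>i<p. cf y i * z ^ i)" by auto
    have "(\<Sum>i<p. (cf y i - c i) * z ^ i) = 0"
      using *(2) c(2) by (simp add: left_diff_distrib sum_subtractf)
    moreover have "\<forall>i<p. cf y i - c i \<in> F" using * c f by auto
    ultimately have "\<forall>i<p. cf y i - c i = 0" by (intro radicalD[OF rad])
    then have "cf y i = c i" if "i < p" for i using that by simp
    then show ?thesis unfolding \<kappa>'_def E_def by simp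
  qed
  have EV: "E c v \<in> V" if "\<forall>i<p. c i \<in> F" "v \<in> V" for c v
    unfolding E_def using that by (intro action_sum_mem[OF act] a ZiV) auto
  have rep: "\<exists>c. (\<forall>i<p. c i \<in> F) \<and> y = (\<Sum>i<p. c i * z ^ i)" if "y \<in> ext p F z" for y
    using that unfolding ext_def by blast
  have kV: "\<kappa>' y v \<in> V" if "y \<in> ext p F z" "v \<in> V" for y v
  proof -
    obtain c where c: "\<forall>i<p. c i \<in> F" "y = (\<Sum>i<p. c i * z ^ i)" using rep[OF \<open>y \<in> ext p F z\<close>] by blast
    show ?thesis unfolding cf[OF c] by (rule EV[OF c(1) that(2)])
  qed
  have kadd: "\<kappa>' (x + y) v = \<kappa>' x v + \<kappa>' y v" if "x \<in> ext p F z" "y \<in> ext p F z" "v \<in> V" for x y v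
  proof -
    obtain c d where c: "\<forall>i<p. c i \<in> F" "x = (\<Sum>i<p. c i * z ^ i)" "\<forall>i<p. d i \<in> F" "y = (\<Sum>i<p. d i * z ^ i)"
      using rep[OF \<open>x \<in> ext p F z\<close>] rep[OF \<open>y \<in> ext p F z\<close>] by blast
    have "\<kappa>' (x + y) v = E (\<lambda>i. c i + d i) v"
      using c f by (intro cf) (auto simp: sum.distrib distrib_right)
    also have "\<dots> = E c v + E d v"
      using c that by (simp add: E_def a ZiV sum.distrib)
    finally show ?thesis using cf c by simp
  qed
  have kscale: "\<kappa>' (b * y) v = \<kappa> b (\<kappa>' y v)" if "b \<in> F" "y \<in> ext p F z" "v \<in> V" for b y v
  proof -
    obtain c where c: "\<forall>i<p. c i \<in> F" "y = (\<Sum>i<p. c i * z ^ i)" using rep[OF \<open>y \<in> ext p F z\<close>] by blast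
    have "\<kappa>' (b * y) v = E (\<lambda>i. b * c i) v"
      using c f that by (intro cf) (auto simp: sum_distrib_left mult.assoc)
    also have "\<dots> = (\<Sum>i<p. \<kappa> b (\<kappa> (c i) ((Z ^^ i) v)))"
      using c that by (simp add: E_def a ZiV)
    also have "\<dots> = \<kappa> b (E c v)"
      unfolding E_def using c that
      by (intro additive_sum[OF act, symmetric]) (auto simp: a ZiV)
    finally show ?thesis using cf c by simp
  qed
  have kshift: "\<kappa>' (z * y) v = Z (\<kappa>' y v)" if "y \<in> ext p F z" "v \<in> V" for y v
  proof -
    obtain c where c: "\<forall>i<p. c i \<in> F" "y = (\<Sum>i<p. c i * z ^ i)" using rep[OF \<open>y \<in> ext p F z\<close>] by blast
    obtain q where q: "p = Suc q" using p by (cases p) auto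
    let ?d = "\<lambda>i. if i = 0 then c (p - 1) * z ^ p else c (i - 1)"
    have "\<kappa>' (z * y) v = E ?d v"
      using c f zp p by (intro cf) (auto simp: sum_shift_radical)
    also have "\<dots> = \<kappa> (c q * z ^ p) v + (\<Sum>i<q. \<kappa> (c i) ((Z ^^ Suc i) v))"
      unfolding E_def q sum.lessThan_Suc_shift by simp
    also have "\<kappa> (c q * z ^ p) v = \<kappa> (c q) ((Z ^^ Suc q) v)"
      using c zp that q Zp a by simp
    also have "\<kappa> (c q) ((Z ^^ Suc q) v) + (\<Sum>i<q. \<kappa> (c i) ((Z ^^ Suc i) v)) = (\<Sum>i<p. \<kappa> (c i) ((Z ^^ Suc i) v))"
      unfolding q by simp
    also have "\<dots> = (\<Sum>i<p. Z (\<kappa> (c i) ((Z ^^ i) v)))"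
      using c that by (intro sum.cong refl) (simp add: Zcomm ZiV)
    also have "\<dots> = Z (E c v)"
      unfolding E_def using c that by (intro additive_sum[OF act, symmetric]) (auto simp: a ZiV Zadd)
    finally show ?thesis using cf c by simp
  qed
  have kpow: "\<kappa>' (z ^ i * y) v = (Z ^^ i) (\<kappa>' y v)" if "y \<in> ext p F z" "v \<in> V" for i y v
    using that by (induction i) (auto simp: mult.assoc kshift ext_power_mult[OF F p zp])
  have ksum: "\<kappa>' (sum t S) v = (\<Sum>i\<in>S. \<kappa>' (t i) v)"
    if "finite S" "\<And>i. i \<in> S \<Longrightarrow> t i \<in> ext p F z" "v \<in> V" for t v and S :: "nat set"
    using that
  proof (induction S)
    case empty
    have "\<kappa>' 0 v = E (\<lambda>_. 0) v" using f by (intro cf) auto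
    then show ?case using empty by (simp add: E_def action_zero[OF act F] ZiV)
  next
    case (insert i S)
    then show ?case by (simp add: kadd ext_sum[OF F p zp])
  qed
  have kmult: "\<kappa>' (x * y) v = \<kappa>' x (\<kappa>' y v)" if "x \<in> ext p F z" "y \<in> ext p F z" "v \<in> V" for x y v
  proof -
    obtain c where c: "\<forall>i<p. c i \<in> F" "x = (\<Sum>i<p. c i * z ^ i)" using rep[OF \<open>x \<in> ext p F z\<close>] by blast
    have xy: "x * y = (\<Sum>i<p. c i * (z ^ i * y))" unfolding c(2) by (simp add: sum_distrib_right mult.assoc)
    have "\<kappa>' (x * y) v = (\<Sum>i<p. \<kappa>' (c i * (z ^ i * y)) v)"
      unfolding xy using c that
      by (intro ksum) (auto intro!: ext_scale[OF F p zp] ext_power_mult[OF F p zp])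
    also have "\<dots> = E c (\<kappa>' y v)"
      unfolding E_def using c that by (intro sum.cong refl) (simp add: kscale kpow ext_power_mult[OF F p zp])
    finally show ?thesis using cf c by simp
  qed
  have kbase: "\<kappa>' b v = \<kappa> b v" if "b \<in> F" "v \<in> V" for b v
  proof -
    have "\<kappa>' b v = E (\<lambda>i. if i = 0 then b else 0) v"
      using that f p by (intro cf) (auto simp: if_distrib[of "\<lambda>u. u * _"] cong: if_cong)
    also have "\<dots> = (\<Sum>i<p. if i = 0 then \<kappa> b v else 0)"
      unfolding E_def using that by (intro sum.cong refl) (auto simp: action_zero[OF act F] ZiV)
    finally show ?thesis using p by simp
  qed
  have "\<kappa>' y (v + w) = \<kappa>' y v + \<kappa>' y w" if "y \<in> ext p F z" "v \<in> V" "w \<in> V" for y v w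
  proof -
    obtain c where c: "\<forall>i<p. c i \<in> F" "y = (\<Sum>i<p. c i * z ^ i)" using rep[OF \<open>y \<in> ext p F z\<close>] by blast
    show ?thesis
      unfolding cf[OF c] E_def sum.distrib[symmetric] using c that
      by (intro sum.cong refl) (simp add: Ziadd a ZiV)
  qed
  then have "action (ext p F z) V \<kappa>'"
    unfolding action_def using kV kadd kmult a kbase f(2) by auto
  moreover have "\<kappa>' z v = Z v" if "v \<in> V" for v
    using kshift[of 1 v] kbase[of 1 v] that a f ext_base[OF F p zp, of 1] by simp
  ultimately show ?thesis using that kbase by blast
qed

section \<open>Homomorphisms between subfields\<close>

definition fhom :: "'b::field set \<Rightarrow> ('b \<Rightarrow> 'c::field) \<Rightarrow> bool" where
  "fhom F \<tau> \<longleftrightarrow> \<tau> 1 = 1 \<and> (\<forall>x\<in>F. \<forall>y\<in>F. \<tau> (x + y) = \<tau> x + \<tau> y \<and> \<tau> (x * y) = \<tau> x * \<tau> y)"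

lemma fhomD:
  assumes "fhom F \<tau>" "subfld F"
  shows "\<tau> 1 = 1" "\<tau> 0 = 0" "\<And>x y. x \<in> F \<Longrightarrow> y \<in> F \<Longrightarrow> \<tau> (x + y) = \<tau> x + \<tau> y"
    "\<And>x y. x \<in> F \<Longrightarrow> y \<in> F \<Longrightarrow> \<tau> (x * y) = \<tau> x * \<tau> y"
    "\<And>x. x \<in> F \<Longrightarrow> \<tau> (- x) = - \<tau> x" "\<And>x. x \<in> F \<Longrightarrow> \<tau> (inverse x) = inverse (\<tau> x)"
    "\<And>x y. x \<in> F \<Longrightarrow> y \<in> F \<Longrightarrow> \<tau> (x - y) = \<tau> x - \<tau> y"
    "\<And>x. x \<in> F \<Longrightarrow> \<tau> x = 0 \<longleftrightarrow> x = 0"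
    "\<And>x y. x \<in> F \<Longrightarrow> y \<in> F \<Longrightarrow> \<tau> (x / y) = \<tau> x / \<tau> y"
proof -
  note f = subfldD[OF assms(2)]
  show 1: "\<tau> 1 = 1" and add: "\<And>x y. x \<in> F \<Longrightarrow> y \<in> F \<Longrightarrow> \<tau> (x + y) = \<tau> x + \<tau> y"
    and mult: "\<And>x y. x \<in> F \<Longrightarrow> y \<in> F \<Longrightarrow> \<tau> (x * y) = \<tau> x * \<tau> y"
    using assms(1) unfolding fhom_def by blast+
  show 0: "\<tau> 0 = 0" using add[OF f(1) f(1)] unfolding add_0_left by (simp only: add_cancel_right_right)
  show neg: "\<tau> (- x) = - \<tau> x" if "x \<in> F" for x
    using add[OF that f(5)[OF that]] 0 by (simp add: eq_neg_iff_add_eq_0 add.commute)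
  show inv: "\<tau> (inverse x) = inverse (\<tau> x)" if "x \<in> F" for x
  proof (cases "x = 0")
    case False
    have "\<tau> x * \<tau> (inverse x) = 1" using mult[OF that f(6)[OF that]] False 1 by simp
    then show ?thesis by (simp add: inverse_unique)
  qed (simp add: 0)
  show "\<tau> (x - y) = \<tau> x - \<tau> y" if "x \<in> F" "y \<in> F" for x y
    using add[OF that(1) f(5)[OF that(2)]] neg[OF that(2)] by simp
  show "\<tau> x = 0 \<longleftrightarrow> x = 0" if "x \<in> F" for x
  proof
    assume "\<tau> x = 0"
    show "x = 0"
    proof (rule ccontr)
      assume "x \<noteq> 0"
      then have "\<tau> x * \<tau> (inverse x) = 1" using mult[OF that f(6)[OF that]] 1 by simp
      with \<open>\<tau> x = 0\<close> show False by simp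
    qed
  qed (simp add: 0)
  show "\<tau> (x / y) = \<tau> x / \<tau> y" if "x \<in> F" "y \<in> F" for x y
    using mult[OF that(1) f(6)[OF that(2)]] inv[OF that(2)] by (simp add: divide_inverse)
qed

lemma fhom_power: "fhom F \<tau> \<Longrightarrow> subfld F \<Longrightarrow> x \<in> F \<Longrightarrow> \<tau> (x ^ n) = \<tau> x ^ n"
  by (induction n) (auto simp: fhomD subfld_power)

lemma fhom_sum:
  assumes "fhom F \<tau>" "subfld F" "\<And>i. i \<in> S \<Longrightarrow> g i \<in> F"
  shows "\<tau> (sum g S) = (\<Sum>i\<in>S. \<tau> (g i))"
  using assms(3)
  by (induction S rule: infinite_finite_induct) (auto simp: fhomD[OF assms(1,2)] subfld_sum[OF assms(2)])

text \<open>The codomain becomes an \<open>F\<close>-vector space through \<open>\<tau>\<close>, and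
  multiplication by \<open>z'\<close> satisfies the requirements on \<open>Z\<close> in
  \<open>action_extend\<close>. The extended homomorphism is the action on 1.\<close>

lemma fhom_extend:
  fixes F :: "'b::field set" and \<tau> :: "'b \<Rightarrow> 'c::field"
  assumes F: "subfld F" and p: "p > 1" and rad: "radical p F z" and \<tau>: "fhom F \<tau>" and z': "z' ^ p = \<tau> (z ^ p)"
  obtains \<tau>' where "fhom (ext p F z) \<tau>'" "\<And>f. f \<in> F \<Longrightarrow> \<tau>' f = \<tau> f" "\<tau>' z = z'"
proof -
  have zp: "z ^ p \<in> F" using rad by (simp add: radical_def)
  have pw: "((*) z' ^^ n) v = z' ^ n * v" for n v by (induction n) (auto simp: mult.assoc)
  have "action F UNIV (\<lambda>f v. \<tau> f * v)"
    using fhomD[OF \<tau> F] by (simp add: action_def distrib_left distrib_right mult.assoc)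
  then obtain \<kappa> where \<kappa>: "action (ext p F z) UNIV \<kappa>" "\<And>f v. f \<in> F \<Longrightarrow> \<kappa> f v = \<tau> f * v" "\<And>v. \<kappa> z v = z' * v"
    by (rule action_extend[OF F p rad, of UNIV "\<lambda>f v. \<tau> f * v" "\<lambda>v. z' * v"])
      (auto simp: distrib_left mult.left_commute pw z')
  \<comment> \<open>F(z) acts by multiplications, since this holds for \<open>F\<close> and for
    \<open>z\<close>; hence evaluation at 1 is multiplicative.\<close>
  have k: "\<kappa> y v = \<kappa> y 1 * v" if y: "y \<in> ext p F z" for y v
  proof -
    have "\<forall>v. \<kappa> y v = \<kappa> y 1 * v"
    proof (rule ext_induct[OF F p zp y])
      fix x y assume x: "x \<in> ext p F z" "\<forall>v. \<kappa> x v = \<kappa> x 1 * v"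
        and y: "y \<in> ext p F z" "\<forall>v. \<kappa> y v = \<kappa> y 1 * v"
      show "\<forall>v. \<kappa> (x + y) v = \<kappa> (x + y) 1 * v"
      proof
        fix v
        have "\<kappa> (x + y) v = \<kappa> x v + \<kappa> y v" for v using actionD(5)[OF \<kappa>(1) x(1) y(1)] by simp
        moreover have "\<kappa> x v = \<kappa> x 1 * v" "\<kappa> y v = \<kappa> y 1 * v" using x y by blast+
        ultimately show "\<kappa> (x + y) v = \<kappa> (x + y) 1 * v" by (simp add: distrib_right)
      qed
      show "\<forall>v. \<kappa> (x * y) v = \<kappa> (x * y) 1 * v"
      proof
        fix v
        have "\<kappa> (x * y) v = \<kappa> x 1 * (\<kappa> y 1 * v)" for v
        proof -
          have "\<kappa> (x * y) v = \<kappa> x (\<kappa> y v)" using actionD(6)[OF \<kappa>(1) x(1) y(1)] by simp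
          also have "\<dots> = \<kappa> x 1 * \<kappa> y v" using x by blast
          also have "\<kappa> y v = \<kappa> y 1 * v" using y by blast
          finally show ?thesis .
        qed
        from this[of v] this[of 1] show "\<kappa> (x * y) v = \<kappa> (x * y) 1 * v" by (simp add: mult.assoc)
      qed
    qed (simp_all add: \<kappa>(2,3))
    then show ?thesis by blast
  qed
  show ?thesis
  proof (rule that[of "\<lambda>y. \<kappa> y 1"])
    show "fhom (ext p F z) (\<lambda>y. \<kappa> y 1)"
      unfolding fhom_def
    proof (intro conjI ballI)
      show "\<kappa> 1 1 = 1" using actionD(7)[OF \<kappa>(1)] by simp
      fix x y assume xy: "x \<in> ext p F z" "y \<in> ext p F z"
      show "\<kappa> (x + y) 1 = \<kappa> x 1 + \<kappa> y 1" using actionD(5)[OF \<kappa>(1) xy] by simp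
      have "\<kappa> (x * y) 1 = \<kappa> x (\<kappa> y 1)" using actionD(6)[OF \<kappa>(1) xy] by simp
      also have "\<dots> = \<kappa> x 1 * \<kappa> y 1" by (rule k[OF xy(1)])
      finally show "\<kappa> (x * y) 1 = \<kappa> x 1 * \<kappa> y 1" .
    qed
  qed (simp_all add: \<kappa>(2,3))
qed

lemma sum_cyclic_shift:
  fixes g :: "nat \<Rightarrow> 'a::comm_monoid_add"
  assumes "p > 0" "g p = g 0"
  shows "(\<Sum>j<p. g (Suc j)) = (\<Sum>j<p. g j)"
proof -
  obtain q where q: "p = Suc q" using assms by (cases p) auto
  have "(\<Sum>j<p. g (Suc j)) = (\<Sum>j<q. g (Suc j)) + g p" by (simp add: q)
  also have "\<dots> = g 0 + (\<Sum>j<q. g (Suc j))" by (simp add: assms add.commute)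
  also have "\<dots> = (\<Sum>j<p. g j)" unfolding q sum.lessThan_Suc_shift ..
  finally show ?thesis .
qed

lemma sum_powers_root_of_unity:
  fixes w :: "'a::field"
  assumes "w ^ p = 1" "w \<noteq> 1"
  shows "(\<Sum>j<p. w ^ j) = 0"
  using power_diff_1_eq[of w p] assms by simp

section \<open>One cyclic step of Kummer theory\<close>

context primitive_root
begin

lemma zeta_power_inj:
  assumes "i < p" "j < p" "\<zeta> ^ i = \<zeta> ^ j"
  shows "i = j"
proof -
  have *: "i = j" if "i \<le> j" "j < p" "\<zeta> ^ i = \<zeta> ^ j" for i j
  proof -
    have "\<zeta> ^ i * \<zeta> ^ (j - i) = \<zeta> ^ (i + (j - i))" by (simp only: power_add)
    then have "\<zeta> ^ i * \<zeta> ^ (j - i) = \<zeta> ^ i * 1" using that by simp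
    then have "\<zeta> ^ (j - i) = 1" using zeta_nz by simp
    then show ?thesis using zeta_prim[of "j - i"] that by (cases "j - i = 0") auto
  qed
  show ?thesis using *[of i j] *[of j i] assms by (cases "i \<le> j") auto
qed

lemma zeta_power_power_p: "(\<zeta> ^ n) ^ p = 1"
proof -
  have "(\<zeta> ^ n) ^ p = (\<zeta> ^ p) ^ n" by (simp only: power_mult[symmetric] mult.commute)
  then show ?thesis by (simp add: zeta_p)
qed

text \<open>X^p - 1 has at most \<open>p\<close> roots, and the powers of \<zeta> are
  \<open>p\<close> distinct ones.\<close>

lemma root_of_unity_eq_zeta_power:
  assumes "x ^ p = 1"
  obtains j where "j < p" "x = \<zeta> ^ j"
proof -
  let ?q = "monom 1 p - 1 :: 'a poly"
  have deg: "degree ?q \<le> p" by (intro degree_diff_le) (auto simp: degree_monom_le)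
  have nz: "?q \<noteq> 0"
  proof
    assume "?q = 0"
    then have "poly.coeff ?q p = 0" by simp
    then show False using p_pos by simp
  qed
  have roots: "{x. poly ?q x = 0} = {x. x ^ p = 1}" by (simp add: poly_monom)
  have fin: "finite {x::'a. x ^ p = 1}" using poly_roots_finite[OF nz] unfolding roots .
  have "card {x::'a. x ^ p = 1} \<le> p" using card_poly_roots_bound[OF nz] deg unfolding roots by simp
  moreover have "(\<lambda>j. \<zeta> ^ j) ` {..<p} \<subseteq> {x. x ^ p = 1}"
    by (auto simp: zeta_power_power_p)
  moreover have "card ((\<lambda>j. \<zeta> ^ j) ` {..<p}) = p"
    by (subst card_image) (auto simp: inj_on_def intro: zeta_power_inj)
  ultimately have "(\<lambda>j. \<zeta> ^ j) ` {..<p} = {x. x ^ p = 1}"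
    using card_seteq[OF fin] by metis
  then show ?thesis using assms that by blast
qed

context
  fixes E :: "'a set" and s :: "'a \<Rightarrow> 'a" and x :: 'a
  assumes E: "subfld E" and zE: "\<zeta> \<in> E" and sE: "\<And>y. y \<in> E \<Longrightarrow> s y \<in> E" and s: "fhom E s" and sz: "s \<zeta> = \<zeta>"
    and sp: "\<And>y. y \<in> E \<Longrightarrow> (s ^^ p) y = y" and xE: "x \<in> E" and x0: "x \<noteq> 0" and sx: "s x = \<zeta> * x"
begin

text \<open>Each application of \<open>s\<close> multiplies the term of exponent \<open>i\<close> by
  \<zeta>^i. From the \<open>p\<close> relations obtained in this way a discrete Fourier transform
  isolates every single term.\<close>

lemma radical_fixed: "radical p {y \<in> E. s y = y} x"
  unfolding radical_def
proof (intro conjI allI impI)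
  have "s (x ^ p) = x ^ p"
    using fhom_power[OF s E xE, of p] by (simp add: sx power_mult_distrib zeta_p)
  then show "x ^ p \<in> {y \<in> E. s y = y}" using subfld_power[OF E xE] by simp
next
  fix f k assume f: "\<forall>i<p. f i \<in> {y \<in> E. s y = y}" and 0: "(\<Sum>i<p. f i * x ^ i) = 0" and k: "k < p"
  have it: "(\<Sum>i<p. f i * x ^ i * (\<zeta> ^ i) ^ j) = 0" for j
  proof (induction j)
    case (Suc j)
    have "s (\<Sum>i<p. f i * x ^ i * (\<zeta> ^ i) ^ j) = (\<Sum>i<p. s (f i * x ^ i * (\<zeta> ^ i) ^ j))"
      using f xE zE by (intro fhom_sum[OF s E]) (auto intro!: subfldD[OF E] subfld_power[OF E])
    also have "\<dots> = (\<Sum>i<p. f i * x ^ i * (\<zeta> ^ i) ^ Suc j)"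
    proof (intro sum.cong refl)
      fix i assume "i \<in> {..<p}"
      then have "s (f i * x ^ i * (\<zeta> ^ i) ^ j) = f i * (\<zeta> * x) ^ i * (\<zeta> ^ i) ^ j"
        using f xE zE sx sz by (simp add: fhomD[OF s E] fhom_power[OF s E] subfldD[OF E] subfld_power[OF E])
      then show "s (f i * x ^ i * (\<zeta> ^ i) ^ j) = f i * x ^ i * (\<zeta> ^ i) ^ Suc j"
        by (simp add: power_mult_distrib mult_ac)
    qed
    finally show ?case using Suc fhomD(2)[OF s E] by simp
  qed (use 0 in simp)
  have "0 = (\<Sum>j<p. inverse (\<zeta> ^ k) ^ j * (\<Sum>i<p. f i * x ^ i * (\<zeta> ^ i) ^ j))" by (simp add: it)
  also have "\<dots> = (\<Sum>j<p. \<Sum>i<p. f i * x ^ i * (\<zeta> ^ i / \<zeta> ^ k) ^ j)"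
    by (simp add: sum_distrib_left power_divide divide_inverse power_inverse mult_ac power_mult_distrib)
  also have "\<dots> = (\<Sum>i<p. f i * x ^ i * (\<Sum>j<p. (\<zeta> ^ i / \<zeta> ^ k) ^ j))"
    by (subst sum.swap) (simp add: sum_distrib_left)
  also have "\<dots> = (\<Sum>i<p. if i = k then f i * x ^ i * of_nat p else 0)"
  proof (intro sum.cong refl)
    fix i assume i: "i \<in> {..<p}"
    show "f i * x ^ i * (\<Sum>j<p. (\<zeta> ^ i / \<zeta> ^ k) ^ j) = (if i = k then f i * x ^ i * of_nat p else 0)"
    proof (cases "i = k")
      case False
      have "(\<zeta> ^ i / \<zeta> ^ k) ^ p = 1"
        by (simp add: power_divide zeta_power_power_p)
      moreover have "\<zeta> ^ i / \<zeta> ^ k \<noteq> 1" using zeta_power_inj[of i k] i k False zeta_nz by auto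
      ultimately have "(\<Sum>j<p. (\<zeta> ^ i / \<zeta> ^ k) ^ j) = 0" by (rule sum_powers_root_of_unity)
      then show ?thesis using False by (simp only: mult_zero_right if_False)
    qed (simp add: zeta_nz)
  qed
  also have "\<dots> = f k * x ^ k * of_nat p" using k by simp
  finally show "f k = 0" using x0 of_nat_p_nz by simp
qed

text \<open>Lagrange resolvents: \<open>\<pi> i\<close> is multiplied by \<zeta>^i under
  \<open>s\<close>, hence is \<open>x ^ i\<close> times a fixed element, and the sum of all
  resolvents of \<open>y\<close> is \<open>p\<close> times \<open>y\<close>.\<close>

lemma ext_fixed: "ext p {y \<in> E. s y = y} x = E"
proof (intro equalityI subsetI)
  fix y assume "y \<in> ext p {y \<in> E. s y = y} x"
  then obtain f where "\<forall>i<p. f i \<in> {y \<in> E. s y = y}" "y = (\<Sum>i<p. f i * x ^ i)" unfolding ext_def by blast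
  then show "y \<in> E" using xE by (auto intro!: subfld_sum[OF E] subfldD[OF E] subfld_power[OF E])
next
  fix y assume y: "y \<in> E"
  have sjE: "(s ^^ j) y \<in> E" for j using y by (induction j) (auto intro: sE)
  let ?w = "inverse \<zeta>"
  have wE: "?w \<in> E" using subfldD(6)[OF E zE] .
  have sw: "s ?w = ?w" using fhomD(6)[OF s E zE] sz by simp
  have wp: "?w ^ p = 1" using zeta_p by (simp add: power_inverse)
  define \<pi> where "\<pi> i = (\<Sum>j<p. (?w ^ i) ^ j * (s ^^ j) y)" for i
  have \<pi>E: "\<pi> i \<in> E" for i
    unfolding \<pi>_def using zE sjE by (intro subfld_sum[OF E] subfldD[OF E] subfld_power[OF E])
  have s\<pi>: "s (\<pi> i) = \<zeta> ^ i * \<pi> i" for i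
  proof -
    have "s (\<pi> i) = (\<Sum>j<p. s ((?w ^ i) ^ j * (s ^^ j) y))"
      unfolding \<pi>_def using zE sjE by (intro fhom_sum[OF s E] subfldD[OF E] subfld_power[OF E])
    also have "\<dots> = (\<Sum>j<p. \<zeta> ^ i * ((?w ^ i) ^ Suc j * (s ^^ Suc j) y))"
    proof (intro sum.cong refl)
      fix j
      have "s ((?w ^ i) ^ j * (s ^^ j) y) = (?w ^ i) ^ j * (s ^^ Suc j) y"
        using wE sjE sw by (simp add: fhomD[OF s E] fhom_power[OF s E] subfld_power[OF E])
      then show "s ((?w ^ i) ^ j * (s ^^ j) y) = \<zeta> ^ i * ((?w ^ i) ^ Suc j * (s ^^ Suc j) y)"
        using zeta_nz by (simp add: power_inverse)
    qed
    also have "\<dots> = \<zeta> ^ i * (\<Sum>j<p. (?w ^ i) ^ Suc j * (s ^^ Suc j) y)" by (simp add: sum_distrib_left)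
    also have "(\<Sum>j<p. (?w ^ i) ^ Suc j * (s ^^ Suc j) y) = \<pi> i"
    proof -
      have "(?w ^ i) ^ p = 1" by (simp only: power_mult[symmetric] mult.commute[of i]) (simp only: power_mult wp power_one)
      then show ?thesis
        unfolding \<pi>_def using sp[OF y] p_pos by (intro sum_cyclic_shift[of p "\<lambda>j. (?w ^ i) ^ j * (s ^^ j) y"]) auto
    qed
    finally show ?thesis .
  qed
  define f where "f i = inverse (of_nat p) * \<pi> i / x ^ i" for i
  have nE: "inverse (of_nat p) \<in> E" using subfldD(6)[OF E subfld_of_nat[OF E]] .
  have sn: "s (of_nat n) = of_nat n" for n
    using subfld_of_nat[OF E] by (induction n) (auto simp: fhomD[OF s E] subfldD[OF E])
  have "f i \<in> {y \<in> E. s y = y}" for i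
  proof -
    have "f i \<in> E" unfolding f_def using \<pi>E subfld_of_nat[OF E] xE by (intro subfldD[OF E] subfld_power[OF E])
    moreover have "s (f i) = inverse (s (of_nat p)) * s (\<pi> i) / s x ^ i"
      unfolding f_def using \<pi>E nE xE subfld_of_nat[OF E]
      by (simp add: fhomD[OF s E] fhom_power[OF s E] subfldD[OF E] subfld_power[OF E])
    then have "s (f i) = f i"
      unfolding f_def by (simp add: sn s\<pi> sx power_mult_distrib zeta_nz)
    ultimately show ?thesis by simp
  qed
  moreover have "y = (\<Sum>i<p. f i * x ^ i)"
  proof -
    have "(\<Sum>i<p. f i * x ^ i) = inverse (of_nat p) * (\<Sum>i<p. \<pi> i)"
      using x0 by (simp add: f_def sum_distrib_left)
    also have "(\<Sum>i<p. \<pi> i) = (\<Sum>j<p. (\<Sum>i<p. (?w ^ j) ^ i) * (s ^^ j) y)"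
      unfolding \<pi>_def by (subst sum.swap) (simp add: sum_distrib_right sum_distrib_left power_mult[symmetric] mult.commute)
    also have "\<dots> = (\<Sum>j<p. if j = 0 then of_nat p * y else 0)"
    proof (intro sum.cong refl)
      fix j assume j: "j \<in> {..<p}"
      show "(\<Sum>i<p. (?w ^ j) ^ i) * (s ^^ j) y = (if j = 0 then of_nat p * y else 0)"
      proof (cases "j = 0")
        case False
        have "(?w ^ j) ^ p = 1" by (simp only: power_mult[symmetric] mult.commute[of j]) (simp only: power_mult wp power_one)
        moreover have "?w ^ j \<noteq> 1" using zeta_prim[of j] j False by (simp add: power_inverse)
        ultimately have "(\<Sum>i<p. (?w ^ j) ^ i) = 0" by (rule sum_powers_root_of_unity)
        then show ?thesis using False by (simp only: mult_zero_left if_False)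
      qed simp
    qed
    also have "\<dots> = of_nat p * y" using p_pos by simp
    finally show ?thesis using of_nat_p_nz by simp
  qed
  ultimately have "(\<forall>i<p. f i \<in> {y \<in> E. s y = y}) \<and> y = (\<Sum>i<p. f i * x ^ i)" by blast
  then show "y \<in> ext p {y \<in> E. s y = y} x"
    unfolding ext_def by - (rule CollectI, rule exI)
qed

end

end

text \<open>If the powers of \<open>z\<close> were dependent, the constant coefficient of the minimal polynomial, a product
  of \<open>d < p\<close> conjugates, would put \<open>z\<^sup>d\<close> and hence \<open>z\<close> into the field.\<close>

lemma radical_if_not_mem:
  fixes \<zeta> z :: "'b::alg_closed_field"
  assumes pr: "primitive_root p \<zeta>" and F: "subfld F" and zF: "\<zeta> \<in> F" and zp: "z ^ p \<in> F" and z: "z \<notin> F"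
  shows "radical p F z"
proof (rule ccontr)
  interpret primitive_root p \<zeta> by fact
  note f = subfldD[OF F]
  assume "\<not> radical p F z"
  then obtain c k where c: "\<forall>i<p. c i \<in> F" "(\<Sum>i<p. c i * z ^ i) = 0" "k < p" "c k \<noteq> 0"
    using zp unfolding radical_def by blast
  \<comment> \<open>Candidates for the minimal polynomial of \<open>z\<close> over \<open>F\<close>;
    the assumed dependence supplies one of degree below \<open>p\<close>.\<close>
  define V where "V q \<longleftrightarrow> q \<noteq> 0 \<and> (\<forall>i. poly.coeff q i \<in> F) \<and> poly q z = 0" for q :: "'b poly"
  define g0 where "g0 = (\<Sum>i<p. monom (c i) i)"
  have cg0: "poly.coeff g0 i = (if i < p then c i else 0)" for i
    by (simp add: g0_def coeff_sum)
  have "V g0"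
    unfolding V_def
  proof (intro conjI allI)
    show "g0 \<noteq> 0" using c(3,4) cg0[of k] by auto
    show "poly g0 z = 0" using c(2) by (simp add: g0_def poly_sum poly_monom)
  qed (use c(1) f in \<open>auto simp: cg0\<close>)
  have "degree g0 < p" using p_pos by (intro degree_lessI) (auto simp: cg0)
  define g1 where "g1 = (ARG_MIN degree q. V q)"
  have g1: "V g1" "\<And>q. V q \<Longrightarrow> degree g1 \<le> degree q"
    using arg_min_nat_lemma[of V g0 degree] \<open>V g0\<close> by (auto simp: g1_def)
  define g where "g = smult (inverse (lead_coeff g1)) g1"
  have lc: "lead_coeff g = 1" and deg: "degree g = degree g1" and gF: "poly.coeff g i \<in> F" and gz: "poly g z = 0" for i
    using g1(1) f by (auto simp: g_def V_def)
  have degp: "degree g < p" using g1(2)[OF \<open>V g0\<close>] \<open>degree g0 < p\<close> deg by simp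
  have dvd: "g dvd q" if "\<forall>i. poly.coeff q i \<in> F" "poly q z = 0" for q
    using that
  proof (induction "degree q" arbitrary: q rule: less_induct)
    case less
    show ?case
    proof (cases "q = 0")
      case False
      then have "V q" using less.prems by (simp add: V_def)
      then have dle: "degree g \<le> degree q" using g1(2) deg by simp
      define m where "m = monom (lead_coeff q) (degree q - degree g)"
      define q' where "q' = q - m * g"
      have q'F: "\<forall>i. poly.coeff q' i \<in> F"
        using less.prems gF f by (auto simp: q'_def m_def coeff_monom_mult)
      have q'z: "poly q' z = 0" using less.prems gz by (simp add: q'_def)
      have "g dvd q'"
      proof (cases "degree q' < degree q")
        case True
        then show ?thesis using less.hyps q'F q'z by blast
      next
        case False
        have dm: "degree (m * g) \<le> degree q"
          using dle degree_monom_le[of "lead_coeff q" "degree q - degree g"] degree_mult_le[of m g]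
          unfolding m_def by linarith
        have "poly.coeff q' (degree q) = 0"
          using lc dle by (simp add: q'_def m_def coeff_monom_mult)
        moreover have "degree q' \<le> degree q"
          unfolding q'_def using dm by (intro degree_diff_le) auto
        ultimately have "q' = 0" using False by (metis leading_coeff_0_iff le_neq_implies_less)
        then show ?thesis by simp
      qed
      then have "g dvd q' + m * g" by (intro dvd_add) auto
      then show ?thesis by (simp add: q'_def)
    qed simp
  qed
  let ?h = "monom 1 p - [:z ^ p:]"
  have gh: "g dvd ?h"
    using f zp by (intro dvd) (auto simp: poly_monom coeff_pCons split: nat.split)
  have g0: "g \<noteq> 0" using lc by auto
  obtain A where A: "size A = degree g" "g = (\<Prod>x\<in>#A. [:-x, 1:])"
    using alg_closed_imp_factorization[OF g0] lc by auto
  have roots: "r ^ p = z ^ p" if "r \<in># A" for r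
  proof -
    have "[:- r, 1:] dvd g" unfolding A(2) using that by (intro dvd_prod_mset) auto
    then have "poly ?h r = 0" using gh by (meson dvd_trans poly_eq_0_iff_dvd)
    then show ?thesis by (simp add: poly_monom)
  qed
  define w where "w = poly g 0"
  have wF: "w \<in> F" using gF[of 0] by (simp add: w_def poly_0_coeff_0)
  \<comment> \<open>All roots of \<open>g\<close> have the p-th power \<open>z ^ p\<close>, so the
    constant coefficient \<open>w\<close> agrees with a power of \<open>- z\<close> up to a p-th
    root of unity. As \<open>p\<close> is odd, the signs can be pulled inside the p-th
    powers.\<close>
  have "poly (\<Prod>x\<in>#B. [:-x, 1:]) 0 ^ p = (\<Prod>x\<in>#B. (- x) ^ p)" for B :: "'b multiset"
  proof (induction B)
    case (add x B)
    have "poly (\<Prod>x\<in>#add_mset x B. [:- x, 1:]) 0 ^ p = ((- x) * poly (\<Prod>x\<in>#B. [:- x, 1:]) 0) ^ p" by simp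
    then show ?case unfolding power_mult_distrib using add by simp
  qed simp
  then have "w ^ p = (\<Prod>x\<in>#A. (- x) ^ p)"
    unfolding w_def A(2) .
  also have "image_mset (\<lambda>x. (- x) ^ p) A = image_mset (\<lambda>x. - (z ^ p)) A"
    using roots odd_p by (intro image_mset_cong) simp
  also have "(\<Prod>x\<in>#A. - (z ^ p)) = (- (z ^ p)) ^ degree g" using A(1) by simp
  also have "\<dots> = ((- z) ^ p) ^ degree g" using odd_p by (simp add: power_minus_odd)
  also have "\<dots> = ((- z) ^ degree g) ^ p" by (simp only: power_mult[symmetric] mult.commute)
  finally have wz: "w ^ p = ((- z) ^ degree g) ^ p" .
  have z0: "z \<noteq> 0" using z f by auto
  have "(w / (- z) ^ degree g) ^ p = 1" using wz z0 by (simp add: power_divide)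
  then obtain j where "w / (- z) ^ degree g = \<zeta> ^ j" by (rule root_of_unity_eq_zeta_power)
  then have "(- z) ^ degree g = w / \<zeta> ^ j" using z0 zeta_nz by (simp add: field_simps)
  then have nzF: "(- z) ^ degree g \<in> F" using wF zF f subfld_power[OF F] by simp
  have zdF: "z ^ degree g \<in> F"
  proof -
    have "z ^ degree g = (-1) ^ degree g * (- z) ^ degree g" by (simp flip: power_mult_distrib)
    then show ?thesis using nzF f subfld_power[OF F] by simp
  qed
  have "degree g > 0"
  proof (rule ccontr)
    assume "\<not> degree g > 0"
    then have "g = 1" using A by auto
    then show False using gz by simp
  qed
  \<comment> \<open>The degree of \<open>g\<close> is positive and less than \<open>p\<close>; by
    Bezout \<open>z\<close> is a product of powers of \<open>z ^ degree g\<close> and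
    \<open>z ^ p\<close>.\<close>
  then have "coprime (degree g) p"
    using degp prime_p by (metis coprime_commute nat_dvd_not_less prime_imp_coprime_nat)
  then obtain u v where uv: "degree g * u = p * v + 1"
    using bezout_nat[of "degree g" p] \<open>degree g > 0\<close> by auto
  have "(z ^ degree g) ^ u = (z ^ p) ^ v * z" unfolding power_mult[symmetric] uv by simp
  then have "z = (z ^ degree g) ^ u / (z ^ p) ^ v" using z0 by simp
  then have "z \<in> F" using zdF zp f subfld_power[OF F] by metis
  with z show False ..
qed

section \<open>Representations of based algebras\<close>

definition scl :: "'a::field \<Rightarrow> ('n \<Rightarrow> 'a) \<Rightarrow> 'n \<Rightarrow> 'a" where
  "scl c v = (\<lambda>i. c * v i)"

text \<open>The space k^n as functions that vanish from \<open>n\<close> on; for all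
  \<open>n\<close> its elements share one type with pointwise addition, as \<open>action\<close>
  demands.\<close>

definition vecs :: "nat \<Rightarrow> (nat \<Rightarrow> 'a::field) set" where
  "vecs n = {v. \<forall>i. n \<le> i \<longrightarrow> v i = 0}"

lemma sum_apply: "(sum f S) r = (\<Sum>s\<in>S. f s r)"
  by (induction S rule: infinite_finite_induct) auto

lemma scl_simps [simp]:
  "scl c (v + w) = scl c v + scl c w" "scl c (scl d v) = scl (c * d) v" "scl 1 v = v" "scl 0 v = 0" "scl c 0 = 0"
  "scl (c + d) v = scl c v + scl d v"
  by (auto simp: scl_def fun_eq_iff algebra_simps)

lemma vecs_closed: "0 \<in> vecs n" "v \<in> vecs n \<Longrightarrow> w \<in> vecs n \<Longrightarrow> v + w \<in> vecs n" "v \<in> vecs n \<Longrightarrow> scl c v \<in> vecs n"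
  by (auto simp: vecs_def scl_def)

definition lin_op :: "nat \<Rightarrow> ((nat \<Rightarrow> 'a::field) \<Rightarrow> nat \<Rightarrow> 'a) \<Rightarrow> bool" where
  "lin_op n T \<longleftrightarrow> (\<forall>v\<in>vecs n. T v \<in> vecs n) \<and> (\<forall>v\<in>vecs n. \<forall>w\<in>vecs n. T (v + w) = T v + T w) \<and>
    (\<forall>c. \<forall>v\<in>vecs n. T (scl c v) = scl c (T v))"

lemma lin_opD:
  assumes "lin_op n T"
  shows "v \<in> vecs n \<Longrightarrow> T v \<in> vecs n" "v \<in> vecs n \<Longrightarrow> w \<in> vecs n \<Longrightarrow> T (v + w) = T v + T w"
    "v \<in> vecs n \<Longrightarrow> T (scl c v) = scl c (T v)"
  using assms by (auto simp: lin_op_def)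

definition alg_rep :: "('i, 'a::field) based_algebra \<Rightarrow> nat \<Rightarrow> (('i \<Rightarrow> 'a) \<Rightarrow> (nat \<Rightarrow> 'a) \<Rightarrow> nat \<Rightarrow> 'a) \<Rightarrow> bool" where
  "alg_rep A n \<psi> \<longleftrightarrow>
    (\<forall>u\<in>carrier (alg_of A). lin_op n (\<psi> u) \<and>
      (\<forall>v\<in>vecs n. (\<forall>u'\<in>carrier (alg_of A). \<psi> (u \<otimes>\<^bsub>alg_of A\<^esub> u') v = \<psi> u (\<psi> u' v)
          \<and> \<psi> (\<lambda>l. u l + u' l) v = \<psi> u v + \<psi> u' v) \<and>
        (\<forall>c. \<psi> (\<lambda>l. c * u l) v = scl c (\<psi> u v)))) \<and>
    (\<forall>v\<in>vecs n. \<psi> \<one>\<^bsub>alg_of A\<^esub> v = v)"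

lemma alg_repD:
  assumes "alg_rep A n \<psi>"
  shows "u \<in> carrier (alg_of A) \<Longrightarrow> lin_op n (\<psi> u)"
    "u \<in> carrier (alg_of A) \<Longrightarrow> u' \<in> carrier (alg_of A) \<Longrightarrow> v \<in> vecs n \<Longrightarrow>
      \<psi> (u \<otimes>\<^bsub>alg_of A\<^esub> u') v = \<psi> u (\<psi> u' v)"
    "u \<in> carrier (alg_of A) \<Longrightarrow> u' \<in> carrier (alg_of A) \<Longrightarrow> v \<in> vecs n \<Longrightarrow>
      \<psi> (\<lambda>l. u l + u' l) v = \<psi> u v + \<psi> u' v"
    "u \<in> carrier (alg_of A) \<Longrightarrow> v \<in> vecs n \<Longrightarrow> \<psi> (\<lambda>l. c * u l) v = scl c (\<psi> u v)"
    "v \<in> vecs n \<Longrightarrow> \<psi> \<one>\<^bsub>alg_of A\<^esub> v = v"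
  using assms unfolding alg_rep_def by blast+

lemma alg_rep_if_iso_matrix_algebra:
  assumes "alg_iso A (matrix_algebra n) \<phi>"
  shows "alg_rep A n (\<lambda>u v i. if i < n then \<Sum>j<n. \<phi> u (i, j) * v j else 0)"
proof -
  let ?\<psi> = "\<lambda>u v i. if i < n then \<Sum>j<n. \<phi> u (i, j) * v j else 0"
  have mult: "\<phi> (u \<otimes>\<^bsub>alg_of A\<^esub> u') (i, j) = (\<Sum>m<n. \<phi> u (i, m) * \<phi> u' (m, j))"
    if "u \<in> carrier (alg_of A)" "u' \<in> carrier (alg_of A)" "i < n" "j < n" for u u' i j
    using assms that by (simp add: alg_iso_def matrix_algebra_eq_matalg mult_matalg)
  have one: "\<phi> \<one>\<^bsub>alg_of A\<^esub> (i, j) = (if i = j then 1 else 0)" if "i < n" "j < n" for i j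
    using assms that by (simp add: alg_iso_def matrix_algebra_eq_matalg one_alg_of unit_coord_matalg)
  show ?thesis
    unfolding alg_rep_def
  proof (intro conjI ballI allI)
    fix u assume u: "u \<in> carrier (alg_of A)"
    show "lin_op n (?\<psi> u)"
      by (auto simp: lin_op_def vecs_def scl_def fun_eq_iff sum.distrib distrib_left distrib_right sum_distrib_left mult_ac)
    fix v
    show "?\<psi> (\<lambda>l. c * u l) v = scl c (?\<psi> u v)" for c
      using assms u by (auto simp: alg_iso_def scl_def fun_eq_iff sum_distrib_left mult_ac)
    fix u' assume u': "u' \<in> carrier (alg_of A)"
    show "?\<psi> (\<lambda>l. u l + u' l) v = ?\<psi> u v + ?\<psi> u' v"
      using assms u u' by (auto simp: alg_iso_def fun_eq_iff sum.distrib distrib_right)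
    show "?\<psi> (u \<otimes>\<^bsub>alg_of A\<^esub> u') v = ?\<psi> u (?\<psi> u' v)"
    proof
      fix i
      show "?\<psi> (u \<otimes>\<^bsub>alg_of A\<^esub> u') v i = ?\<psi> u (?\<psi> u' v) i"
      proof (cases "i < n")
        case True
        have "(\<Sum>j<n. \<phi> (u \<otimes>\<^bsub>alg_of A\<^esub> u') (i, j) * v j) = (\<Sum>j<n. \<Sum>m<n. \<phi> u (i, m) * (\<phi> u' (m, j) * v j))"
          using True by (intro sum.cong refl) (simp add: mult[OF u u'] sum_distrib_right mult.assoc)
        also have "\<dots> = (\<Sum>m<n. \<Sum>j<n. \<phi> u (i, m) * (\<phi> u' (m, j) * v j))" by (rule sum.swap)
        also have "\<dots> = (\<Sum>m<n. \<phi> u (i, m) * (\<Sum>j<n. \<phi> u' (m, j) * v j))" by (simp add: sum_distrib_left)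
        finally show ?thesis using True by simp
      qed simp
    qed
  next
    fix v :: "nat \<Rightarrow> 'b" assume v: "v \<in> vecs n"
    show "?\<psi> \<one>\<^bsub>alg_of A\<^esub> v = v"
    proof
      fix i
      have "(\<Sum>j<n. \<phi> \<one>\<^bsub>alg_of A\<^esub> (i, j) * v j) = (\<Sum>j<n. if j = i then v j else 0)" if "i < n"
        using that by (intro sum.cong refl) (simp add: one)
      then show "?\<psi> \<one>\<^bsub>alg_of A\<^esub> v i = v i" using v by (auto simp: vecs_def)
    qed
  qed
qed

text \<open>The elementary tensor of \<open>u\<close> and \<open>w\<close>.\<close>

definition pure :: "('i \<Rightarrow> 'a::field) \<Rightarrow> ('j \<Rightarrow> 'a) \<Rightarrow> 'i \<times> 'j \<Rightarrow> 'a" where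
  "pure u w = (\<lambda>l. u (fst l) * w (snd l))"

definition unital :: "('i, 'a::field) based_algebra \<Rightarrow> bool" where
  "unital A \<longleftrightarrow> (\<forall>u\<in>carrier (alg_of A). \<one>\<^bsub>alg_of A\<^esub> \<otimes>\<^bsub>alg_of A\<^esub> u = u \<and> u \<otimes>\<^bsub>alg_of A\<^esub> \<one>\<^bsub>alg_of A\<^esub> = u)"

lemma unitalD:
  assumes "unital A"
  shows "u \<in> carrier (alg_of A) \<Longrightarrow> \<one>\<^bsub>alg_of A\<^esub> \<otimes>\<^bsub>alg_of A\<^esub> u = u"
    "u \<in> carrier (alg_of A) \<Longrightarrow> u \<otimes>\<^bsub>alg_of A\<^esub> \<one>\<^bsub>alg_of A\<^esub> = u"
    "\<one>\<^bsub>alg_of A\<^esub> \<otimes>\<^bsub>alg_of A\<^esub> \<one>\<^bsub>alg_of A\<^esub> = \<one>\<^bsub>alg_of A\<^esub>"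
  using assms one_closed_alg_of[of A] by (auto simp: unital_def)

lemma unital_weyl_algebra: "weyl_algebra A op c e \<Longrightarrow> unital A"
  unfolding unital_def by (intro ballI conjI weyl_algebra.mult_one_alg)

lemma unital_matrix_algebra: "unital (matrix_algebra n)"
proof -
  have "(\<Sum>m<n. (if i = m then 1 else 0) * f m) = f i" "(\<Sum>m<n. f m * (if m = i then 1 else 0)) = f i"
    if "i < n" for i and f :: "nat \<Rightarrow> 'a"
    using that by (simp_all add: if_distrib[of "\<lambda>u. u * _"] if_distrib[of "\<lambda>u. _ * u"] cong: if_cong)
  then show ?thesis
    by (auto simp: unital_def matrix_algebra_eq_matalg mult_matalg one_alg_of unit_coord_matalg carrier_alg_of fun_eq_iff)
qed

lemma pure_in_carrier:
  "u \<in> carrier (alg_of A) \<Longrightarrow> w \<in> carrier (alg_of B) \<Longrightarrow> pure u w \<in> carrier (alg_of (tensor A B))"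
  by (auto simp: carrier_alg_of pure_def)

lemma pure_one: "pure \<one>\<^bsub>alg_of A\<^esub> \<one>\<^bsub>alg_of B\<^esub> = \<one>\<^bsub>alg_of (tensor A B)\<^esub>"
  by (auto simp: pure_def one_alg_of unit_coord_tensor fun_eq_iff)

lemma pure_mult:
  fixes A :: "('i, 'a::field) based_algebra" and B :: "('j, 'a) based_algebra"
  shows "pure u w \<otimes>\<^bsub>alg_of (tensor A B)\<^esub> pure u' w' = pure (u \<otimes>\<^bsub>alg_of A\<^esub> u') (w \<otimes>\<^bsub>alg_of B\<^esub> w')"
proof
  fix l :: "'i \<times> 'j"
  show "(pure u w \<otimes>\<^bsub>alg_of (tensor A B)\<^esub> pure u' w') l = pure (u \<otimes>\<^bsub>alg_of A\<^esub> u') (w \<otimes>\<^bsub>alg_of B\<^esub> w') l"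
  proof (cases "l \<in> basis A \<times> basis B")
    case True
    let ?f = "\<lambda>i j. u i * u' j * strc A i j (fst l)" and ?g = "\<lambda>i j. w i * w' j * strc B i j (snd l)"
    have "(pure u w \<otimes>\<^bsub>alg_of (tensor A B)\<^esub> pure u' w') l
        = (\<Sum>i\<in>basis A \<times> basis B. \<Sum>j\<in>basis A \<times> basis B. ?f (fst i) (fst j) * ?g (snd i) (snd j))"
      using True by (simp add: mult_alg_of strc_tensor pure_def mem_Times_iff mult_ac)
    also have "\<dots> = (\<Sum>i\<in>basis A \<times> basis B. (\<Sum>j\<in>basis A. ?f (fst i) j) * (\<Sum>j\<in>basis B. ?g (snd i) j))"
      by (intro sum.cong refl sum_mult_Times')
    also have "\<dots> = (\<Sum>i\<in>basis A. \<Sum>j\<in>basis A. ?f i j) * (\<Sum>i\<in>basis B. \<Sum>j\<in>basis B. ?g i j)"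
      by (rule sum_mult_Times')
    also have "\<dots> = pure (u \<otimes>\<^bsub>alg_of A\<^esub> u') (w \<otimes>\<^bsub>alg_of B\<^esub> w') l"
      using True by (simp add: mult_alg_of pure_def mem_Times_iff)
    finally show ?thesis .
  next
    case False
    then show ?thesis by (auto simp: mult_alg_of pure_def mem_Times_iff)
  qed
qed

text \<open>Restriction along the embedding of a tensor factor, \<open>u\<close> mapping to
  \<open>u\<close> tensor 1. By \<open>alg_rep_commute\<close> the operators of the two factors
  commute.\<close>

lemma alg_rep_left:
  fixes A :: "('i, 'a::field) based_algebra" and B :: "('j, 'a) based_algebra"
  assumes rep: "alg_rep (tensor A B) n \<psi>" and B: "unital B"
  shows "alg_rep A n (\<lambda>u. \<psi> (pure u \<one>\<^bsub>alg_of B\<^esub>))"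
proof -
  let ?o = "\<one>\<^bsub>alg_of B\<^esub>"
  note r = alg_repD[OF rep] and pc = pure_in_carrier[OF _ one_closed_alg_of, of _ A B]
  show ?thesis
    unfolding alg_rep_def
  proof (intro conjI ballI allI)
    fix u assume u: "u \<in> carrier (alg_of A)"
    show "lin_op n (\<psi> (pure u ?o))" by (rule r(1)[OF pc[OF u]])
    fix v :: "nat \<Rightarrow> 'a" assume v: "v \<in> vecs n"
    have "pure (\<lambda>l. c * u l) ?o = (\<lambda>l. c * pure u ?o l)" for c by (simp add: pure_def mult.assoc)
    then show "\<psi> (pure (\<lambda>l. c * u l) ?o) v = scl c (\<psi> (pure u ?o) v)" for c
      using r(4)[OF pc[OF u] v] by simp
    fix u' assume u': "u' \<in> carrier (alg_of A)"
    have "pure (\<lambda>l. u l + u' l) ?o = (\<lambda>l. pure u ?o l + pure u' ?o l)" by (simp add: pure_def distrib_right)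
    then show "\<psi> (pure (\<lambda>l. u l + u' l) ?o) v = \<psi> (pure u ?o) v + \<psi> (pure u' ?o) v"
      using r(3)[OF pc[OF u] pc[OF u'] v] by simp
    show "\<psi> (pure (u \<otimes>\<^bsub>alg_of A\<^esub> u') ?o) v = \<psi> (pure u ?o) (\<psi> (pure u' ?o) v)"
      using r(2)[OF pc[OF u] pc[OF u'] v] unfolding pure_mult unitalD(3)[OF B] .
  next
    fix v :: "nat \<Rightarrow> 'a" assume v: "v \<in> vecs n"
    show "\<psi> (pure \<one>\<^bsub>alg_of A\<^esub> ?o) v = v" using r(5)[OF v] unfolding pure_one .
  qed
qed

lemma alg_rep_right:
  fixes A :: "('i, 'a::field) based_algebra" and B :: "('j, 'a) based_algebra"
  assumes rep: "alg_rep (tensor A B) n \<psi>" and A: "unital A"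
  shows "alg_rep B n (\<lambda>u. \<psi> (pure \<one>\<^bsub>alg_of A\<^esub> u))"
proof -
  let ?o = "\<one>\<^bsub>alg_of A\<^esub>"
  note r = alg_repD[OF rep] and pc = pure_in_carrier[OF one_closed_alg_of, of _ B A]
  show ?thesis
    unfolding alg_rep_def
  proof (intro conjI ballI allI)
    fix u assume u: "u \<in> carrier (alg_of B)"
    show "lin_op n (\<psi> (pure ?o u))" by (rule r(1)[OF pc[OF u]])
    fix v :: "nat \<Rightarrow> 'a" assume v: "v \<in> vecs n"
    have "pure ?o (\<lambda>l. c * u l) = (\<lambda>l. c * pure ?o u l)" for c by (simp add: pure_def mult_ac)
    then show "\<psi> (pure ?o (\<lambda>l. c * u l)) v = scl c (\<psi> (pure ?o u) v)" for c
      using r(4)[OF pc[OF u] v] by simp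
    fix u' assume u': "u' \<in> carrier (alg_of B)"
    have "pure ?o (\<lambda>l. u l + u' l) = (\<lambda>l. pure ?o u l + pure ?o u' l)" by (simp add: pure_def distrib_left)
    then show "\<psi> (pure ?o (\<lambda>l. u l + u' l)) v = \<psi> (pure ?o u) v + \<psi> (pure ?o u') v"
      using r(3)[OF pc[OF u] pc[OF u'] v] by simp
    show "\<psi> (pure ?o (u \<otimes>\<^bsub>alg_of B\<^esub> u')) v = \<psi> (pure ?o u) (\<psi> (pure ?o u') v)"
      using r(2)[OF pc[OF u] pc[OF u'] v] unfolding pure_mult unitalD(3)[OF A] .
  next
    fix v :: "nat \<Rightarrow> 'a" assume v: "v \<in> vecs n"
    show "\<psi> (pure ?o \<one>\<^bsub>alg_of B\<^esub>) v = v" using r(5)[OF v] unfolding pure_one .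
  qed
qed

lemma alg_rep_commute:
  assumes rep: "alg_rep (tensor A B) n \<psi>" and A: "unital A" and B: "unital B"
    and u: "u \<in> carrier (alg_of A)" and w: "w \<in> carrier (alg_of B)" and v: "v \<in> vecs n"
  shows "\<psi> (pure u \<one>\<^bsub>alg_of B\<^esub>) (\<psi> (pure \<one>\<^bsub>alg_of A\<^esub> w) v) = \<psi> (pure \<one>\<^bsub>alg_of A\<^esub> w) (\<psi> (pure u \<one>\<^bsub>alg_of B\<^esub>) v)"
proof -
  note pc = pure_in_carrier[OF u one_closed_alg_of[of B]] pure_in_carrier[OF one_closed_alg_of[of A] w]
  show ?thesis
    using alg_repD(2)[OF rep pc(1) pc(2) v] alg_repD(2)[OF rep pc(2) pc(1) v]
    unfolding pure_mult unitalD(1,2)[OF A u] unitalD(1,2)[OF B w] by simp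
qed

lemma alg_rep_power:
  assumes rep: "alg_rep A n \<psi>" and u: "u \<in> carrier (alg_of A)" and v: "v \<in> vecs n"
  shows "(\<psi> u ^^ k) v = \<psi> (u [^]\<^bsub>alg_of A\<^esub> k) v"
  using v
proof (induction k arbitrary: v)
  case 0
  then show ?case using alg_repD(5)[OF rep] by simp
next
  case (Suc k)
  have uk: "u [^]\<^bsub>alg_of A\<^esub> k \<in> carrier (alg_of A)"
    by (cases k) (auto simp: one_closed_alg_of mult_closed_alg_of)
  have "(\<psi> u ^^ Suc k) v = (\<psi> u ^^ k) (\<psi> u v)" by (simp only: funpow_Suc_right comp_apply)
  also have "\<dots> = \<psi> (u [^]\<^bsub>alg_of A\<^esub> k) (\<psi> u v)"
    by (rule Suc.IH[OF lin_opD(1)[OF alg_repD(1)[OF rep u] Suc.prems]])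
  also have "\<dots> = \<psi> (u [^]\<^bsub>alg_of A\<^esub> k \<otimes>\<^bsub>alg_of A\<^esub> u) v"
    using alg_repD(2)[OF rep uk u Suc.prems] by simp
  finally show ?case by simp
qed

context primitive_root
begin

lemma symb_gens_in_carrier:
  "unit_vec (0, 1) \<in> carrier (alg_of (symb a b))" "unit_vec (1, 0) \<in> carrier (alg_of (symb a b))"
  using p_gt_1 by (auto intro!: unit_vec_in_carrier)

lemma symb_rep_relations:
  assumes rep: "alg_rep (symb a b) n \<psi>" and v: "v \<in> vecs n"
  defines "P \<equiv> \<psi> (unit_vec (0, 1))" and "Q \<equiv> \<psi> (unit_vec (1, 0))"
  shows "(Q ^^ p) v = scl a v" "(P ^^ p) v = scl b v" "P (Q v) = scl \<zeta> (Q (P v))"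
proof -
  let ?A = "symb a b"
  note rel = cyclic_algebra_relations[where \<zeta> = \<zeta> and a = a and b = b, OF p_gt_1]
  note g = symb_gens_in_carrier[of a b]
  have sm: "\<psi> (c \<odot>\<^bsub>alg_of ?A\<^esub> u) v = scl c (\<psi> u v)" if "u \<in> carrier (alg_of ?A)" for c u
    using alg_repD(4)[OF rep that v] unfolding smult_alg_of .
  show "(Q ^^ p) v = scl a v"
    unfolding Q_def alg_rep_power[OF rep g(2) v] rel(2) using sm[OF one_closed_alg_of] alg_repD(5)[OF rep v] by simp
  show "(P ^^ p) v = scl b v"
    unfolding P_def alg_rep_power[OF rep g(1) v] rel(1) using sm[OF one_closed_alg_of] alg_repD(5)[OF rep v] by simp
  have "P (Q v) = \<psi> (unit_vec (0, 1) \<otimes>\<^bsub>alg_of ?A\<^esub> unit_vec (1, 0)) v"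
    unfolding P_def Q_def using alg_repD(2)[OF rep g v] by simp
  also have "\<dots> = scl \<zeta> (\<psi> (unit_vec (1, 0) \<otimes>\<^bsub>alg_of ?A\<^esub> unit_vec (0, 1)) v)"
    unfolding rel(3) by (rule sm[OF mult_closed_alg_of])
  also have "\<dots> = scl \<zeta> (Q (P v))"
    unfolding P_def Q_def using alg_repD(2)[OF rep g(2,1) v] by simp
  finally show "P (Q v) = scl \<zeta> (Q (P v))" .
qed

end

section \<open>Kummer extensions of degree \<open>p\<^sup>3\<close>\<close>

lemma primitive_root_to_ac:
  assumes "primitive_root p (\<zeta> :: 'a::field)"
  shows "primitive_root p (to_ac \<zeta>)"
proof -
  interpret primitive_root p \<zeta> by fact
  show ?thesis
  proof
    show "CHAR('a alg_closure) \<noteq> p" using char_p by simp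
    show "to_ac \<zeta> ^ p = 1" using zeta_p by (simp flip: to_ac_power)
    show "to_ac \<zeta> ^ n \<noteq> 1" if "0 < n" "n < p" for n
      using zeta_prim[OF that] by (simp flip: to_ac_power)
  qed (rule prime_p odd_p)+
qed

lemma fhom_prod:
  assumes "fhom F \<tau>" "subfld F" "\<And>i. i \<in> S \<Longrightarrow> g i \<in> F"
  shows "\<tau> (prod g S) = (\<Prod>i\<in>S. \<tau> (g i))"
  using assms(3)
  by (induction S rule: infinite_finite_induct) (auto simp: fhomD[OF assms(1,2)] subfld_prod[OF assms(2)])

lemma funpow_mem: "(\<And>y. y \<in> K \<Longrightarrow> f y \<in> K) \<Longrightarrow> y \<in> K \<Longrightarrow> (f ^^ n) y \<in> K"
  by (induction n) auto

lemma funpow_commute_on: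
  assumes f: "\<And>y. y \<in> K \<Longrightarrow> f y \<in> K" and g: "\<And>y. y \<in> K \<Longrightarrow> g y \<in> K"
    and fg: "\<And>y. y \<in> K \<Longrightarrow> f (g y) = g (f y)" and y: "y \<in> K"
  shows "(f ^^ r) ((g ^^ t) y) = (g ^^ t) ((f ^^ r) y)"
proof -
  have 1: "f ((g ^^ t) y) = (g ^^ t) (f y)" if "y \<in> K" for y
    using that by (induction t) (auto simp: fg funpow_mem[of K g, OF g])
  show ?thesis
    by (induction r) (auto simp: 1 funpow_mem[of K f, OF f y])
qed

text \<open>\<open>K\<close> is k(x 0, x 1, x 2), and the \<open>s i\<close> generate its Galois
  group over k. The degree p^3 is not postulated: it follows from the eigenvalues in
  \<open>s_x\<close> and from \<open>fixed\<close>. In the application \<open>s 0\<close>,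
  \<open>s 1\<close>, \<open>s 2\<close> are the actions of \<alpha>1, \<alpha>2, \<alpha>.\<close>

locale kummer3 = primitive_root p \<zeta> for p and \<zeta> :: "'a::field" +
  fixes K :: "'a alg_closure set" and x :: "nat \<Rightarrow> 'a alg_closure"
    and s :: "nat \<Rightarrow> 'a alg_closure \<Rightarrow> 'a alg_closure" and a :: "nat \<Rightarrow> 'a"
  assumes K: "subfld K" and base: "to_ac c \<in> K"
    and sK: "i < 3 \<Longrightarrow> y \<in> K \<Longrightarrow> s i y \<in> K"
    and s_hom: "i < 3 \<Longrightarrow> fhom K (s i)"
    and s_base: "i < 3 \<Longrightarrow> s i (to_ac c) = to_ac c"
    and s_order: "i < 3 \<Longrightarrow> y \<in> K \<Longrightarrow> (s i ^^ p) y = y"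
    and s_comm: "i < 3 \<Longrightarrow> j < 3 \<Longrightarrow> y \<in> K \<Longrightarrow> s i (s j y) = s j (s i y)"
    and xK: "i < 3 \<Longrightarrow> x i \<in> K" and x_nz: "i < 3 \<Longrightarrow> x i \<noteq> 0"
    and x_pow: "i < 3 \<Longrightarrow> x i ^ p = to_ac (a i)"
    and s_x: "i < 3 \<Longrightarrow> j < 3 \<Longrightarrow> s i (x j) = (if i = j then to_ac \<zeta> * x j else x j)"
    and fixed: "y \<in> K \<Longrightarrow> (\<And>i. i < 3 \<Longrightarrow> s i y = y) \<Longrightarrow> y \<in> range to_ac"
begin

sublocale ac: primitive_root p "to_ac \<zeta>"
  by (rule primitive_root_to_ac) unfold_locales

lemma a_nz: "i < 3 \<Longrightarrow> a i \<noteq> 0"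
  using x_pow[of i] x_nz[of i] by (metis power_not_zero to_ac_0)

lemma s_scale: "i < 3 \<Longrightarrow> y \<in> K \<Longrightarrow> s i (to_ac c * y) = to_ac c * s i y"
  using fhomD(4)[OF s_hom K base] s_base by simp

text \<open>Described through fixed elements, this is visibly a field stable under all
  \<open>s i\<close>; by \<open>Fn_step\<close> it is the field generated over k by the
  \<open>x i\<close> with \<open>i < n\<close>.\<close>

definition Fn :: "nat \<Rightarrow> 'a alg_closure set" where
  "Fn n = {y \<in> K. \<forall>i. n \<le> i \<and> i < 3 \<longrightarrow> s i y = y}"

lemma Fn_K: "y \<in> Fn n \<Longrightarrow> y \<in> K" by (simp add: Fn_def)

lemma Fn_3: "Fn 3 = K" by (auto simp: Fn_def)

lemma Fn_0: "Fn 0 = range to_ac"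
  using fixed base s_base by (auto simp: Fn_def)

lemma Fn_mono: "m \<le> n \<Longrightarrow> Fn m \<subseteq> Fn n" by (auto simp: Fn_def)

lemma Fn_Suc: "n < 3 \<Longrightarrow> Fn n = {y \<in> Fn (Suc n). s n y = y}"
proof -
  assume "n < 3"
  then have "n \<le> i \<and> i < 3 \<longleftrightarrow> i = n \<or> (Suc n \<le> i \<and> i < 3)" for i by auto
  then show ?thesis unfolding Fn_def by auto
qed

lemma subfld_Fn: "subfld (Fn n)"
  unfolding subfld_def Fn_def using subfldD[OF K] fhomD[OF s_hom K] by auto

lemma base_Fn: "to_ac c \<in> Fn n"
  using base s_base by (simp add: Fn_def)

lemma s_Fn: "i < 3 \<Longrightarrow> y \<in> Fn n \<Longrightarrow> s i y \<in> Fn n"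
  using sK s_comm[of _ i y] by (auto simp: Fn_def)

lemma fhom_Fn: "i < 3 \<Longrightarrow> fhom (Fn n) (s i)"
  using s_hom[of i] unfolding fhom_def Fn_def by auto

lemma x_Fn: "i < n \<Longrightarrow> n \<le> 3 \<Longrightarrow> x i \<in> Fn n"
  using xK s_x by (auto simp: Fn_def)

lemma Fn_step:
  assumes "n < 3"
  shows "radical p (Fn n) (x n)" "ext p (Fn n) (x n) = Fn (Suc n)"
proof -
  have *: "subfld (Fn (Suc n))" "to_ac \<zeta> \<in> Fn (Suc n)" "\<And>y. y \<in> Fn (Suc n) \<Longrightarrow> s n y \<in> Fn (Suc n)"
    "fhom (Fn (Suc n)) (s n)" "s n (to_ac \<zeta>) = to_ac \<zeta>" "\<And>y. y \<in> Fn (Suc n) \<Longrightarrow> (s n ^^ p) y = y"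
    "x n \<in> Fn (Suc n)" "x n \<noteq> 0" "s n (x n) = to_ac \<zeta> * x n"
    using assms subfld_Fn base_Fn s_Fn fhom_Fn s_base s_order[OF _ Fn_K] x_Fn x_nz s_x by auto
  show "radical p (Fn n) (x n)" unfolding Fn_Suc[OF assms] by (rule ac.radical_fixed[OF *])
  show "ext p (Fn n) (x n) = Fn (Suc n)" unfolding Fn_Suc[OF assms] by (rule ac.ext_fixed[OF *])
qed

lemma x_pow_Fn: "n < 3 \<Longrightarrow> x n ^ p \<in> Fn n"
  using x_pow base_Fn by simp

abbreviation "Box \<equiv> {..<p} \<times> ({..<p} \<times> {..<p})"

text \<open>The exponents are listed from the top of the tower downwards, so that sums over
  \<open>Box\<close> nest in the order in which the roots are adjoined.\<close>

definition mon :: "nat \<times> nat \<times> nat \<Rightarrow> 'a alg_closure" where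
  "mon b = x 2 ^ fst b * (x 1 ^ fst (snd b) * x 0 ^ snd (snd b))"

lemma mon_K: "mon b \<in> K"
  unfolding mon_def using xK by (intro subfldD[OF K] subfld_power[OF K]) auto

lemma mon_sum:
  "(\<Sum>b\<in>Box. c b * mon b) =
    (\<Sum>l<p. (\<Sum>j<p. (\<Sum>i<p. c (l, j, i) * x 0 ^ i) * x 1 ^ j) * x 2 ^ l)"
proof -
  have "(\<Sum>b\<in>Box. c b * mon b) = (\<Sum>l<p. \<Sum>b\<in>{..<p} \<times> {..<p}. c (l, b) * mon (l, b))"
    by (simp add: sum.cartesian_product)
  also have "\<dots> = (\<Sum>l<p. \<Sum>j<p. \<Sum>i<p. c (l, j, i) * mon (l, j, i))"
    by (simp add: sum.cartesian_product)
  also have "\<dots> = (\<Sum>l<p. (\<Sum>j<p. (\<Sum>i<p. c (l, j, i) * x 0 ^ i) * x 1 ^ j) * x 2 ^ l)"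
    by (simp add: mon_def sum_distrib_right sum_distrib_left mult_ac)
  finally show ?thesis .
qed

lemma mon_independent:
  assumes "(\<Sum>b\<in>Box. to_ac (c b) * mon b) = 0" "b \<in> Box"
  shows "c b = 0"
proof -
  let ?A = "\<lambda>l j. \<Sum>i<p. to_ac (c (l, j, i)) * x 0 ^ i"
  let ?B = "\<lambda>l. \<Sum>j<p. ?A l j * x 1 ^ j"
  have A: "?A l j \<in> Fn 1" for l j
    using x_Fn[of 0 1] base_Fn by (intro subfld_sum[OF subfld_Fn] subfldD[OF subfld_Fn] subfld_power[OF subfld_Fn]) auto
  have Ax: "?A l j * x 1 ^ j \<in> Fn 2" for l j
    using A[of l j] Fn_mono[of 1 2] x_Fn[of 1 2]
    by (intro subfldD(4)[OF subfld_Fn] subfld_power[OF subfld_Fn]) auto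
  have B: "?B l \<in> Fn 2" for l
    by (rule subfld_sum[OF subfld_Fn Ax])
  obtain l j i where b: "b = (l, j, i)" "l < p" "j < p" "i < p" using assms(2) by auto
  have 0: "(\<Sum>l<p. ?B l * x 2 ^ l) = 0" using assms(1) unfolding mon_sum .
  have "\<forall>l<p. ?B l = 0" by (rule radicalD[OF Fn_step(1)[of 2] _ 0]) (use B in auto)
  then have 1: "?B l = 0" using b by blast
  have "\<forall>j<p. ?A l j = 0" by (rule radicalD[OF Fn_step(1)[of 1] _ 1]) (use A in auto)
  then have 2: "?A l j = 0" using b by blast
  have "\<forall>i<p. to_ac (c (l, j, i)) = 0" by (rule radicalD[OF Fn_step(1)[of 0] _ 2]) (use base_Fn in auto)
  then show ?thesis using b by simp
qed

lemma mon_span: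
  assumes "y \<in> K"
  shows "\<exists>c. y = (\<Sum>b\<in>Box. to_ac (c b) * mon b)"
proof -
  have e: "\<exists>f. (\<forall>i<p. f i \<in> Fn n) \<and> y = (\<Sum>i<p. f i * x n ^ i)" if "y \<in> Fn (Suc n)" "n < 3" for y n
    using that Fn_step(2)[of n] unfolding ext_def by blast
  have e3: "Suc 2 = 3" "Suc 1 = 2" "Suc 0 = 1" by auto
  have e2: "\<exists>f. (\<forall>i<p. f i \<in> Fn 2) \<and> y = (\<Sum>i<p. f i * x 2 ^ i)" if "y \<in> K" for y
    using e[of y 2] that unfolding e3 Fn_3 by simp
  have e1: "\<exists>f. (\<forall>i<p. f i \<in> Fn 1) \<and> y = (\<Sum>i<p. f i * x 1 ^ i)" if "y \<in> Fn 2" for y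
    using e[of y 1] that unfolding e3 by simp
  have e0: "\<exists>f. (\<forall>i<p. f i \<in> Fn 0) \<and> y = (\<Sum>i<p. f i * x 0 ^ i)" if "y \<in> Fn 1" for y
    using e[of y 0] that unfolding e3 by simp
  obtain f where f: "\<forall>i<p. f i \<in> Fn 2" "y = (\<Sum>i<p. f i * x 2 ^ i)"
    using e2[OF assms] by blast
  have "\<forall>l. \<exists>g. l < p \<longrightarrow> (\<forall>i<p. g i \<in> Fn 1) \<and> f l = (\<Sum>i<p. g i * x 1 ^ i)"
    using e1 f(1) by blast
  from choice[OF this] obtain g where g: "\<And>l. l < p \<Longrightarrow> (\<forall>i<p. g l i \<in> Fn 1) \<and> f l = (\<Sum>i<p. g l i * x 1 ^ i)"
    by blast
  have "\<forall>lj. \<exists>h. fst lj < p \<and> snd lj < p \<longrightarrow> (\<forall>i<p. h i \<in> Fn 0) \<and> g (fst lj) (snd lj) = (\<Sum>i<p. h i * x 0 ^ i)"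
    using e0 g by blast
  from choice[OF this] obtain h where h: "\<And>lj. fst lj < p \<and> snd lj < p \<Longrightarrow>
      (\<forall>i<p. h lj i \<in> Fn 0) \<and> g (fst lj) (snd lj) = (\<Sum>i<p. h lj i * x 0 ^ i)"
    by blast
  define c where "c b = of_ac (h (fst b, fst (snd b)) (snd (snd b)))" for b
  have c: "to_ac (c (l, j, i)) = h (l, j) i" if "l < p" "j < p" "i < p" for l j i
    unfolding c_def using h[of "(l, j)"] that Fn_0 to_ac_of_ac by auto
  have "y = (\<Sum>l<p. (\<Sum>j<p. (\<Sum>i<p. to_ac (c (l, j, i)) * x 0 ^ i) * x 1 ^ j) * x 2 ^ l)"
    unfolding f(2)
  proof (intro sum.cong refl)
    fix l assume "l \<in> {..<p}"
    then have l: "l < p" by simp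
    have "f l = (\<Sum>j<p. g l j * x 1 ^ j)" using g[OF l] by blast
    also have "\<dots> = (\<Sum>j<p. (\<Sum>i<p. to_ac (c (l, j, i)) * x 0 ^ i) * x 1 ^ j)"
    proof (intro sum.cong refl)
      fix j assume "j \<in> {..<p}"
      then have j: "j < p" by simp
      have "g l j = (\<Sum>i<p. h (l, j) i * x 0 ^ i)" using h[of "(l, j)"] l j by simp
      then show "g l j * x 1 ^ j = (\<Sum>i<p. to_ac (c (l, j, i)) * x 0 ^ i) * x 1 ^ j"
        using c[OF l j] by simp
    qed
    finally show "f l * x 2 ^ l = (\<Sum>j<p. (\<Sum>i<p. to_ac (c (l, j, i)) * x 0 ^ i) * x 1 ^ j) * x 2 ^ l" by simp
  qed
  then show ?thesis by (intro exI[of _ c]) (simp only: mon_sum)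
qed

text \<open>Semilinearity with respect to \<sigma> propagates from the generators \<open>x j\<close>
  through the tower. With the identity as \<sigma> it gives linearity of operators that commute with
  the \<open>Q j\<close>; with \<open>s i\<close> it describes the operators
  \<open>P i\<close>.\<close>

lemma semilinear_on_Fn:
  assumes n: "n \<le> 3" and act: "action (Fn n) (vecs N) \<kappa>"
    and kc: "\<And>c v. v \<in> vecs N \<Longrightarrow> \<kappa> (to_ac c) v = scl c v"
    and kx: "\<And>j v. j < n \<Longrightarrow> v \<in> vecs N \<Longrightarrow> \<kappa> (x j) v = Q j v"
    and Y: "lin_op N Y" and YX: "\<And>j v. j < n \<Longrightarrow> v \<in> vecs N \<Longrightarrow> Y (Q j v) = \<kappa> (\<sigma> (x j)) (Y v)"
    and \<sigma>: "fhom K \<sigma>" "\<And>j y. y \<in> Fn j \<Longrightarrow> \<sigma> y \<in> Fn j" "\<And>c. \<sigma> (to_ac c) = to_ac c"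
    and f: "f \<in> Fn n" and v: "v \<in> vecs N"
  shows "Y (\<kappa> f v) = \<kappa> (\<sigma> f) (Y v)"
proof -
  note ad = actionD[OF act] and Yd = lin_opD[OF Y]
  have "\<forall>f\<in>Fn m. \<forall>v\<in>vecs N. Y (\<kappa> f v) = \<kappa> (\<sigma> f) (Y v)" if "m \<le> n" for m
    using that
  proof (induction m)
    case 0
    show ?case using Fn_0 kc Yd \<sigma>(3) by auto
  next
    case (Suc m)
    then have m: "m < 3" "m < n" and sub: "Fn (Suc m) \<subseteq> Fn n" using n Fn_mono by auto
    show ?case
    proof
      fix f assume "f \<in> Fn (Suc m)"
      then have fe: "f \<in> ext p (Fn m) (x m)" using Fn_step(2)[OF m(1)] by simp
      show "\<forall>v\<in>vecs N. Y (\<kappa> f v) = \<kappa> (\<sigma> f) (Y v)"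
      proof (rule ext_induct[OF subfld_Fn p_gt_1 x_pow_Fn[OF m(1)] fe])
        show "\<forall>v\<in>vecs N. Y (\<kappa> c v) = \<kappa> (\<sigma> c) (Y v)" if "c \<in> Fn m" for c
          using Suc.IH Suc.prems that by simp
        show "\<forall>v\<in>vecs N. Y (\<kappa> (x m) v) = \<kappa> (\<sigma> (x m)) (Y v)"
          using kx[OF m(2)] YX[OF m(2)] by simp
      next
        fix g h assume g: "g \<in> ext p (Fn m) (x m)" "\<forall>v\<in>vecs N. Y (\<kappa> g v) = \<kappa> (\<sigma> g) (Y v)"
          and h: "h \<in> ext p (Fn m) (x m)" "\<forall>v\<in>vecs N. Y (\<kappa> h v) = \<kappa> (\<sigma> h) (Y v)"
        have gh: "g \<in> Fn n" "h \<in> Fn n" using g(1) h(1) Fn_step(2)[OF m(1)] sub by auto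
        note sgh = \<sigma>(2)[OF gh(1)] \<sigma>(2)[OF gh(2)] and K2 = Fn_K[OF gh(1)] Fn_K[OF gh(2)]
        show "\<forall>v\<in>vecs N. Y (\<kappa> (g + h) v) = \<kappa> (\<sigma> (g + h)) (Y v)"
        proof
          fix v :: "nat \<Rightarrow> 'a" assume v: "v \<in> vecs N"
          have "Y (\<kappa> (g + h) v) = Y (\<kappa> g v) + Y (\<kappa> h v)"
            unfolding ad(5)[OF gh v] by (rule Yd(2)[OF ad(3)[OF gh(1) v] ad(3)[OF gh(2) v]])
          also have "\<dots> = \<kappa> (\<sigma> g) (Y v) + \<kappa> (\<sigma> h) (Y v)" using g(2) h(2) v by simp
          also have "\<dots> = \<kappa> (\<sigma> (g + h)) (Y v)"
            unfolding fhomD(3)[OF \<sigma>(1) K K2] ad(5)[OF sgh Yd(1)[OF v]] ..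
          finally show "Y (\<kappa> (g + h) v) = \<kappa> (\<sigma> (g + h)) (Y v)" .
        qed
        show "\<forall>v\<in>vecs N. Y (\<kappa> (g * h) v) = \<kappa> (\<sigma> (g * h)) (Y v)"
        proof
          fix v :: "nat \<Rightarrow> 'a" assume v: "v \<in> vecs N"
          have "Y (\<kappa> (g * h) v) = Y (\<kappa> g (\<kappa> h v))" unfolding ad(6)[OF gh v] ..
          also have "\<dots> = \<kappa> (\<sigma> g) (Y (\<kappa> h v))" using g(2) ad(3)[OF gh(2) v] by blast
          also have "Y (\<kappa> h v) = \<kappa> (\<sigma> h) (Y v)" using h(2) v by blast
          also have "\<kappa> (\<sigma> g) (\<kappa> (\<sigma> h) (Y v)) = \<kappa> (\<sigma> (g * h)) (Y v)"
            unfolding fhomD(4)[OF \<sigma>(1) K K2] ad(6)[OF sgh Yd(1)[OF v]] ..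
          finally show "Y (\<kappa> (g * h) v) = \<kappa> (\<sigma> (g * h)) (Y v)" .
        qed
      qed
    qed
  qed
  then show ?thesis using f v by blast
qed

lemma fhom_id: "fhom K (\<lambda>y. y)" by (simp add: fhom_def)

text \<open>Commuting operators that satisfy the equations of the \<open>x i\<close> turn the space
  into a vector space over the fields of the tower, one field at a time by
  \<open>action_extend\<close>.\<close>

lemma action_on_vecs:
  assumes Q: "\<And>i. i < 3 \<Longrightarrow> lin_op N (Q i)"
    and Xp: "\<And>i v. i < 3 \<Longrightarrow> v \<in> vecs N \<Longrightarrow> (Q i ^^ p) v = scl (a i) v"
    and XX: "\<And>i j v. i < 3 \<Longrightarrow> j < 3 \<Longrightarrow> v \<in> vecs N \<Longrightarrow> Q i (Q j v) = Q j (Q i v)"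
    and n: "n \<le> 3"
  shows "\<exists>\<kappa>. action (Fn n) (vecs N) \<kappa> \<and> (\<forall>c. \<forall>v\<in>vecs N. \<kappa> (to_ac c) v = scl c v) \<and>
    (\<forall>j<n. \<forall>v\<in>vecs N. \<kappa> (x j) v = Q j v)"
  using n
proof (induction n)
  case 0
  have "action (Fn 0) (vecs N) (\<lambda>f. scl (of_ac f))"
    unfolding action_def Fn_0 using vecs_closed
    by (auto simp flip: to_ac_add to_ac_mult)
  then show ?case by (intro exI[of _ "\<lambda>f. scl (of_ac f)"]) auto
next
  case (Suc n)
  then obtain \<kappa> where act: "action (Fn n) (vecs N) \<kappa>" and kc: "\<And>c v. v \<in> vecs N \<Longrightarrow> \<kappa> (to_ac c) v = scl c v"
    and kx: "\<And>j v. j < n \<Longrightarrow> v \<in> vecs N \<Longrightarrow> \<kappa> (x j) v = Q j v" by auto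
  have n: "n < 3" "n \<le> 3" using Suc.prems by auto
  note Xd = lin_opD[OF Q[OF n(1)]]
  obtain \<kappa>' where k': "action (ext p (Fn n) (x n)) (vecs N) \<kappa>'"
    "\<And>f v. f \<in> Fn n \<Longrightarrow> v \<in> vecs N \<Longrightarrow> \<kappa>' f v = \<kappa> f v" "\<And>v. v \<in> vecs N \<Longrightarrow> \<kappa>' (x n) v = Q n v"
  proof (rule action_extend[OF subfld_Fn p_gt_1 Fn_step(1)[OF n(1)] act Xd(1,2)])
    \<comment> \<open>The new operator must commute with all scalars from \<open>Fn n\<close>, not
      only with the old operators.\<close>
    show "Q n (\<kappa> f v) = \<kappa> f (Q n v)" if f: "f \<in> Fn n" and v: "v \<in> vecs N" for f v
    proof (rule semilinear_on_Fn[OF n(2) act kc kx Q[OF n(1)] _ fhom_id _ _ f v])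
      show "Q n (Q j v) = \<kappa> (x j) (Q n v)" if "j < n" "v \<in> vecs N" for j v
        using that n XX kx Xd(1) by simp
    qed simp_all
    show "(Q n ^^ p) v = \<kappa> (x n ^ p) v" if "v \<in> vecs N" for v
using that Xp n kc x_pow by simp
  qed (assumption, assumption, assumption, rule that)
  have "\<kappa>' (x j) v = Q j v" if "j < Suc n" "v \<in> vecs N" for j v
    using that k' kx x_Fn[of j n] n by (cases "j = n") auto
  then show ?case
    using k'(1,2) kc base_Fn unfolding Fn_step(2)[OF n(1)] by (intro exI[of _ \<kappa>']) auto
qed

section \<open>Norms and symmetric cocycles\<close>

definition nrm :: "nat \<Rightarrow> 'a alg_closure \<Rightarrow> nat \<Rightarrow> 'a alg_closure" where
  "nrm i h k = (\<Prod>j<k. (s i ^^ j) h)"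

lemma nrm_K: "i < 3 \<Longrightarrow> h \<in> K \<Longrightarrow> nrm i h k \<in> K"
  unfolding nrm_def using sK by (intro subfld_prod[OF K] funpow_mem) auto

lemma nrm_Suc: "i < 3 \<Longrightarrow> h \<in> K \<Longrightarrow> nrm i h (Suc k) = h * s i (nrm i h k)"
  unfolding nrm_def prod.lessThan_Suc_shift
  using sK by (subst fhom_prod[OF s_hom K]) (auto intro: funpow_mem)

text \<open>Here \<open>nrm i (h i) p\<close> is the norm of \<open>h i\<close> to the fixed field
  of \<open>s i\<close>. The conditions say that the operators sending \<open>y\<close> to
  \<open>h i * s i y\<close> on \<open>K\<close> commute and that their p-th powers are the
  multiplications by \<open>w i\<close>. Together with the multiplications by the \<open>x i\<close>
  they satisfy the relations of three commuting symbol algebras.\<close>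

definition hsys :: "(nat \<Rightarrow> 'a alg_closure) \<Rightarrow> (nat \<Rightarrow> 'a) \<Rightarrow> bool" where
  "hsys h w \<longleftrightarrow> (\<forall>i<3. h i \<in> K \<and> h i \<noteq> 0 \<and> nrm i (h i) p = to_ac (w i)) \<and>
    (\<forall>i<3. \<forall>j<3. h i * s i (h j) = h j * s j (h i))"

text \<open>The image of a primitive idempotent of the matrix factor is a one-dimensional space over \<open>K\<close>:
  the translates of one vector already span the whole representation space.\<close>

lemma hsys_if_operators:
  fixes Q P :: "nat \<Rightarrow> (nat \<Rightarrow> 'a) \<Rightarrow> nat \<Rightarrow> 'a" and E :: "nat \<Rightarrow> nat \<Rightarrow> (nat \<Rightarrow> 'a) \<Rightarrow> nat \<Rightarrow> 'a"
  assumes m: "m > 0" and N: "N = p * (p * p) * m"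
    and Q: "\<And>i. i < 3 \<Longrightarrow> lin_op N (Q i)" and P: "\<And>i. i < 3 \<Longrightarrow> lin_op N (P i)"
    and E: "\<And>k l. k < m \<Longrightarrow> l < m \<Longrightarrow> lin_op N (E k l)"
    and Xp: "\<And>i v. i < 3 \<Longrightarrow> v \<in> vecs N \<Longrightarrow> (Q i ^^ p) v = scl (a i) v"
    and Pp: "\<And>i v. i < 3 \<Longrightarrow> v \<in> vecs N \<Longrightarrow> (P i ^^ p) v = scl (w i) v"
    and XX: "\<And>i j v. i < 3 \<Longrightarrow> j < 3 \<Longrightarrow> v \<in> vecs N \<Longrightarrow> Q i (Q j v) = Q j (Q i v)"
    and PP: "\<And>i j v. i < 3 \<Longrightarrow> j < 3 \<Longrightarrow> v \<in> vecs N \<Longrightarrow> P i (P j v) = P j (P i v)"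
    and PX: "\<And>i j v. i < 3 \<Longrightarrow> j < 3 \<Longrightarrow> v \<in> vecs N \<Longrightarrow> P i (Q j v) = (if i = j then scl \<zeta> (Q j (P i v)) else Q j (P i v))"
    and EX: "\<And>i k l v. i < 3 \<Longrightarrow> k < m \<Longrightarrow> l < m \<Longrightarrow> v \<in> vecs N \<Longrightarrow> E k l (Q i v) = Q i (E k l v)"
    and EP: "\<And>i k l v. i < 3 \<Longrightarrow> k < m \<Longrightarrow> l < m \<Longrightarrow> v \<in> vecs N \<Longrightarrow> E k l (P i v) = P i (E k l v)"
    and EE: "\<And>k l k' l' v. k < m \<Longrightarrow> l < m \<Longrightarrow> k' < m \<Longrightarrow> l' < m \<Longrightarrow> v \<in> vecs N \<Longrightarrow>
      E k l (E k' l' v) = (if l = k' then E k l' v else 0)"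
    and Esum: "\<And>v. v \<in> vecs N \<Longrightarrow> (\<Sum>k<m. E k k v) = v"
    and w: "\<And>i. i < 3 \<Longrightarrow> w i \<noteq> 0"
  shows "\<exists>h. hsys h w"
proof -
  have "\<exists>\<kappa>. action (Fn 3) (vecs N) \<kappa> \<and> (\<forall>c. \<forall>v\<in>vecs N. \<kappa> (to_ac c) v = scl c v) \<and>
    (\<forall>j<3. \<forall>v\<in>vecs N. \<kappa> (x j) v = Q j v)"
    by (rule action_on_vecs[OF Q Xp XX]) auto
  then obtain \<kappa> where act3: "action (Fn 3) (vecs N) \<kappa>" and kc: "\<And>c v. v \<in> vecs N \<Longrightarrow> \<kappa> (to_ac c) v = scl c v"
    and kx: "\<And>j v. j < 3 \<Longrightarrow> v \<in> vecs N \<Longrightarrow> \<kappa> (x j) v = Q j v" by blast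
  have act: "action K (vecs N) \<kappa>" using act3 unfolding Fn_3 .
  note ad = actionD[OF act] and f = subfldD[OF K]
  have Ek: "E k l (\<kappa> f v) = \<kappa> f (E k l v)" if "k < m" "l < m" "f \<in> K" "v \<in> vecs N" for k l f v
  proof (rule semilinear_on_Fn[OF order_refl act3 kc kx E[OF that(1,2)] _ fhom_id _ _ _ that(4)])
    show "E k l (Q j v) = \<kappa> (x j) (E k l v)" if "j < 3" "v \<in> vecs N" for j v
      using EX[OF that(1) \<open>k < m\<close> \<open>l < m\<close> that(2)] kx[OF that(1) lin_opD(1)[OF E[OF \<open>k < m\<close> \<open>l < m\<close>] that(2)]] by simp
  qed (use that in \<open>simp_all add: Fn_3\<close>)
  have Pk: "P i (\<kappa> f v) = \<kappa> (s i f) (P i v)" if "i < 3" "f \<in> K" "v \<in> vecs N" for i f v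
  proof (rule semilinear_on_Fn[OF order_refl act3 kc kx P[OF that(1)] _ s_hom[OF that(1)] _ _ _ that(3)])
    show "P i (Q j v) = \<kappa> (s i (x j)) (P i v)" if "j < 3" "v \<in> vecs N" for j v
    proof -
      have Pv: "P i v \<in> vecs N" by (rule lin_opD(1)[OF P[OF \<open>i < 3\<close>] that(2)])
      have "\<kappa> (to_ac \<zeta> * x j) (P i v) = scl \<zeta> (Q j (P i v))"
        unfolding ad(6)[OF base xK[OF that(1)] Pv] kx[OF that(1) Pv]
        by (rule kc[OF lin_opD(1)[OF Q[OF that(1)] Pv]])
      then show ?thesis
        unfolding s_x[OF \<open>i < 3\<close> that(1)] PX[OF \<open>i < 3\<close> that] using kx[OF that(1) Pv] by (cases "i = j") auto
    qed
  qed (use that s_Fn s_base in \<open>simp_all add: Fn_3\<close>)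
  have kinj: "f = 0" if "\<kappa> f v = 0" "f \<in> K" "v \<in> vecs N" "v \<noteq> 0" for f v
  proof (rule ccontr)
    assume f0: "f \<noteq> 0"
    have "v = \<kappa> (inverse f * f) v" using ad(7)[OF that(3)] f0 by simp
    also have "\<dots> = \<kappa> (inverse f) (\<kappa> f v)" by (rule ad(6)[OF f(6)[OF that(2)] that(2,3)])
    also have "\<dots> = 0" unfolding that(1) by (rule action_zero(1)[OF act K f(6)[OF that(2)]])
    finally show False using that(4) by simp
  qed
  have kinj2: "f = g" if "\<kappa> f v = \<kappa> g v" "f \<in> K" "g \<in> K" "v \<in> vecs N" "v \<noteq> 0" for f g v
  proof -
    have "\<kappa> (f - g) v + \<kappa> g v = \<kappa> (f - g + g) v" by (rule ad(5)[OF f(7)[OF that(2,3)] that(3,4), symmetric])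
    then have "\<kappa> (f - g) v = 0" using that(1) by simp
    then have "f - g = 0" by (rule kinj[OF _ f(7)[OF that(2,3)] that(4,5)])
    then show ?thesis by simp
  qed
  have ksum: "\<kappa> (sum f S) v = (\<Sum>b\<in>S. \<kappa> (f b) v)" if "\<And>b. b \<in> S \<Longrightarrow> f b \<in> K" "v \<in> vecs N"
    for f and S :: "(nat \<times> nat \<times> nat) set" and v
    using that(1)
    by (induction S rule: infinite_finite_induct)
      (auto simp: action_zero(2)[OF act K that(2)] ad(5)[OF _ _ that(2)] subfld_sum[OF K])
  have "N > 0" using N m p_pos by simp
  define u :: "nat \<Rightarrow> 'a" where "u = (\<lambda>i. if i = 0 then 1 else 0)"
  have u: "u \<in> vecs N" "u \<noteq> 0" using \<open>N > 0\<close> by (auto simp: u_def vecs_def fun_eq_iff)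
  obtain k where k: "k < m" "E k k u \<noteq> 0"
  proof -
    have "(\<Sum>k<m. E k k u) \<noteq> 0" using Esum[OF u(1)] u(2) by simp
    then obtain k where "k \<in> {..<m}" "E k k u \<noteq> 0" by (rule sum.not_neutral_contains_not_neutral)
    then show ?thesis using that by simp
  qed
  \<comment> \<open>\<open>E 0 k\<close> moves the nonzero vector \<open>E k k u\<close> into the
    image of the idempotent \<open>E 0 0\<close>; \<open>E k 0\<close> moves it back, so
    \<open>v0\<close> is nonzero.\<close>
  define v0 where "v0 = E 0 k u"
  have v0: "v0 \<in> vecs N" unfolding v0_def by (rule lin_opD(1)[OF E[OF m k(1)] u(1)])
  have "E k 0 v0 = E k k u" unfolding v0_def using EE[OF k(1) m m k(1) u(1)] by simp
  then have v0_nz: "v0 \<noteq> 0"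
    using k(2) additive_sum[OF act, of "E k 0" "{}" "\<lambda>_. 0"] lin_opD(2)[OF E[OF k(1) m]] by auto
  have Ev0: "E 0 0 v0 = v0" unfolding v0_def using EE[OF m m m k(1) u(1)] by simp
  have kv: "\<kappa> f v0 \<in> vecs N" if "f \<in> K" for f by (rule ad(3)[OF that v0])
  have EEk: "E 0 k' (E k'' 0 (\<kappa> f v0)) = (if k' = k'' then \<kappa> f v0 else 0)" if "f \<in> K" "k' < m" "k'' < m" for f k' k''
  proof -
    have "E 0 k' (E k'' 0 (\<kappa> f v0)) = (if k' = k'' then E 0 0 (\<kappa> f v0) else 0)"
      by (rule EE[OF m that(2,3) m kv[OF that(1)]])
    also have "E 0 0 (\<kappa> f v0) = \<kappa> f v0" using Ek[OF m m that(1) v0] Ev0 by simp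
    finally show ?thesis .
  qed
  \<comment> \<open>These are \<open>N\<close> vectors: the translates, under the matrix units of
    the first column, of a k-basis of the K-line through \<open>v0\<close>. They are independent
    because \<open>E 0 k'\<close> recovers the part with first index \<open>k'\<close>.\<close>
  define t where "t kb = E (fst kb) 0 (\<kappa> (mon (snd kb)) v0)" for kb
  have tV: "t kb \<in> vecs N" if "kb \<in> {..<m} \<times> Box" for kb
    unfolding t_def using that by (intro lin_opD(1)[OF E[OF _ m]] kv mon_K) auto
  have apply_E: "E 0 k' (\<Sum>kb\<in>{..<m} \<times> Box. scl (c kb) (t kb)) = \<kappa> (\<Sum>b\<in>Box. to_ac (c (k', b)) * mon b) v0"
    if k': "k' < m" for k' c
  proof -
    note Ed = lin_opD[OF E[OF m k']]
    have "E 0 k' (\<Sum>kb\<in>{..<m} \<times> Box. scl (c kb) (t kb)) = (\<Sum>kb\<in>{..<m} \<times> Box. E 0 k' (scl (c kb) (t kb)))"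
      by (rule additive_sum[OF act Ed(2) vecs_closed(3)[OF tV]])
    also have "\<dots> = (\<Sum>kb\<in>{..<m} \<times> Box. if k' = fst kb then scl (c kb) (\<kappa> (mon (snd kb)) v0) else 0)"
    proof (intro sum.cong refl)
      fix kb assume kb: "kb \<in> {..<m} \<times> Box"
      have "E 0 k' (scl (c kb) (t kb)) = scl (c kb) (E 0 k' (t kb))" by (rule Ed(3)[OF tV[OF kb]])
      also have "E 0 k' (t kb) = (if k' = fst kb then \<kappa> (mon (snd kb)) v0 else 0)"
        unfolding t_def using kb by (intro EEk mon_K k') auto
      finally show "E 0 k' (scl (c kb) (t kb)) = (if k' = fst kb then scl (c kb) (\<kappa> (mon (snd kb)) v0) else 0)"
        by (cases "k' = fst kb") (simp_all add: scl_def fun_eq_iff)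
    qed
    also have "\<dots> = (\<Sum>k<m. \<Sum>b\<in>Box. if k' = k then scl (c (k, b)) (\<kappa> (mon b) v0) else 0)"
      unfolding sum_Times[of _ Box "{..<m}"] by (intro sum.cong refl) simp
    also have "\<dots> = (\<Sum>k<m. if k' = k then \<Sum>b\<in>Box. scl (c (k, b)) (\<kappa> (mon b) v0) else 0)"
      by (intro sum.cong refl) auto
    also have "\<dots> = (\<Sum>b\<in>Box. scl (c (k', b)) (\<kappa> (mon b) v0))"
      using k' by (subst sum.delta') auto
    also have "\<dots> = (\<Sum>b\<in>Box. \<kappa> (to_ac (c (k', b)) * mon b) v0)"
    proof (intro sum.cong refl)
      fix b
      show "scl (c (k', b)) (\<kappa> (mon b) v0) = \<kappa> (to_ac (c (k', b)) * mon b) v0"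
        unfolding ad(6)[OF base mon_K v0] by (rule kc[OF kv[OF mon_K], symmetric])
    qed
    also have "\<dots> = \<kappa> (\<Sum>b\<in>Box. to_ac (c (k', b)) * mon b) v0"
      by (rule ksum[symmetric]) (auto intro: subfldD(4)[OF K] base mon_K v0)
    finally show ?thesis .
  qed
  \<comment> \<open>Being independent and \<open>N\<close> in number, the vectors
    \<open>t kb\<close> span the space; applying \<open>E 0 0\<close> to an expansion of
    \<open>z\<close> leaves only a K-multiple of \<open>v0\<close>.\<close>
  have one_dim: "\<exists>h\<in>K. z = \<kappa> h v0" if z: "z \<in> vecs N" "E 0 0 z = z" for z
  proof -
    have "\<exists>c. \<forall>r\<in>{..<N}. (\<Sum>kb\<in>{..<m} \<times> Box. c kb * t kb r) = z r"
    proof (rule injective_imp_surjective_system)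
      show "card {..<N} = card ({..<m} \<times> Box)" by (simp add: N card_cartesian_product)
      fix c kb assume 0: "\<And>r. r \<in> {..<N} \<Longrightarrow> (\<Sum>kb\<in>{..<m} \<times> Box. c kb * t kb r) = 0" and kb: "kb \<in> {..<m} \<times> Box"
      have "(\<Sum>kb\<in>{..<m} \<times> Box. scl (c kb) (t kb)) = 0"
      proof
        fix r
        show "(\<Sum>kb\<in>{..<m} \<times> Box. scl (c kb) (t kb)) r = 0 r"
        proof (cases "r < N")
          case True
          then show ?thesis using 0[of r] by (simp add: sum_apply scl_def)
        next
          case False
          then have "t kb r = 0" if "kb \<in> {..<m} \<times> Box" for kb using tV[OF that] by (simp add: vecs_def)
          then show ?thesis by (simp add: sum_apply scl_def)
        qed
      qed
      then have "E (0::nat) (fst kb) (\<Sum>kb\<in>{..<m} \<times> Box. scl (c kb) (t kb)) = 0"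
        using kb additive_sum[OF act, of "E 0 (fst kb)" "{}" "\<lambda>_. 0"] lin_opD(2)[OF E[OF m]] by auto
      then have "\<kappa> (\<Sum>b\<in>Box. to_ac (c (fst kb, b)) * mon b) v0 = 0"
        using apply_E[of "fst kb" c] kb by (simp add: mem_Times_iff)
      then have "(\<Sum>b\<in>Box. to_ac (c (fst kb, b)) * mon b) = 0"
        by (rule kinj[OF _ _ v0 v0_nz]) (intro subfld_sum[OF K] subfldD(4)[OF K] base mon_K)
      then have "c (fst kb, snd kb) = 0" using mon_independent[of "\<lambda>b. c (fst kb, b)" "snd kb"] kb by auto
      then show "c kb = 0" by simp
    qed auto
    then obtain c where c: "\<And>r. r < N \<Longrightarrow> (\<Sum>kb\<in>{..<m} \<times> Box. c kb * t kb r) = z r" by auto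
    have zs: "z = (\<Sum>kb\<in>{..<m} \<times> Box. scl (c kb) (t kb))"
    proof
      fix r
      show "z r = (\<Sum>kb\<in>{..<m} \<times> Box. scl (c kb) (t kb)) r"
      proof (cases "r < N")
        case True
        then show ?thesis using c[of r] by (simp add: sum_apply scl_def)
      next
        case False
        then have "t kb r = 0" if "kb \<in> {..<m} \<times> Box" for kb using tV[OF that] by (simp add: vecs_def)
        then show ?thesis using z(1) False by (simp add: sum_apply scl_def vecs_def)
      qed
    qed
    have "z = E 0 0 z" using z(2) by simp
    also have "\<dots> = \<kappa> (\<Sum>b\<in>Box. to_ac (c (0, b)) * mon b) v0" unfolding zs by (rule apply_E[OF m])
    finally show ?thesis by (intro bexI) (auto intro!: subfld_sum[OF K] subfldD(4)[OF K] base mon_K)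
  qed
  \<comment> \<open>\<open>P i\<close> commutes with \<open>E 0 0\<close> and hence preserves the
    K-line through \<open>v0\<close>; the factor by which it moves \<open>v0\<close> is
    \<open>h i\<close>.\<close>
  have "\<exists>h. i < 3 \<longrightarrow> h \<in> K \<and> P i v0 = \<kappa> h v0" for i
  proof (cases "i < 3")
    case True
    have "E 0 0 (P i v0) = P i v0" using EP[OF True m m v0] Ev0 by simp
    then show ?thesis using one_dim[OF lin_opD(1)[OF P[OF True] v0]] by blast
  qed simp
  then obtain h where h: "\<And>i. i < 3 \<Longrightarrow> h i \<in> K" "\<And>i. i < 3 \<Longrightarrow> P i v0 = \<kappa> (h i) v0" by metis
  have Ppow: "(P i ^^ k) v0 = \<kappa> (nrm i (h i) k) v0" if i: "i < 3" for i k
  proof (induction k)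
    case 0
    show ?case using ad(7)[OF v0] by (simp add: nrm_def)
  next
    case (Suc k)
    note nK = nrm_K[OF i h(1)[OF i]]
    have "(P i ^^ Suc k) v0 = P i (\<kappa> (nrm i (h i) k) v0)" using Suc by simp
    also have "\<dots> = \<kappa> (s i (nrm i (h i) k)) (\<kappa> (h i) v0)" unfolding Pk[OF i nK v0] h(2)[OF i] ..
    also have "\<dots> = \<kappa> (s i (nrm i (h i) k) * h i) v0" by (rule ad(6)[OF sK[OF i nK] h(1)[OF i] v0, symmetric])
    finally show ?case unfolding nrm_Suc[OF i h(1)[OF i]] by (simp add: mult.commute)
  qed
  have nrm: "nrm i (h i) p = to_ac (w i)" if i: "i < 3" for i
    using Ppow[OF i, of p] Pp[OF i v0] kc[OF v0] kinj2[OF _ nrm_K[OF i h(1)[OF i]] base v0 v0_nz] by simp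
  have hnz: "h i \<noteq> 0" if i: "i < 3" for i
  proof
    assume 0: "h i = 0"
    obtain q where q: "p = Suc q" using p_pos by (cases p) auto
    have "nrm i (h i) p = 0" unfolding q nrm_Suc[OF i h(1)[OF i]] by (simp add: 0)
    then show False using nrm[OF i] w[OF i] by simp
  qed
  have comm: "h i * s i (h j) = h j * s j (h i)" if i: "i < 3" and j: "j < 3" for i j
  proof -
    have PPh: "P i (P j v0) = \<kappa> (s i (h j) * h i) v0" if i: "i < 3" and j: "j < 3" for i j
      unfolding h(2)[OF j] Pk[OF i h(1)[OF j] v0] h(2)[OF i]
      by (rule ad(6)[OF sK[OF i h(1)[OF j]] h(1)[OF i] v0, symmetric])
    have "s i (h j) * h i = s j (h i) * h j"
      using PPh[OF i j] PPh[OF j i] PP[OF i j v0]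
      by (intro kinj2[OF _ _ _ v0 v0_nz]) (auto intro!: subfldD(4)[OF K] sK h(1) i j)
    then show ?thesis by (simp add: mult.commute)
  qed
  show ?thesis unfolding hsys_def using h(1) hnz nrm comm by blast
qed

end

lemma alg_rep_zero:
  assumes "alg_rep A n \<psi>" "v \<in> vecs n"
  shows "\<psi> (\<lambda>l. 0) v = 0"
  using alg_repD(4)[OF assms(1) one_closed_alg_of assms(2), of 0] by simp

lemma alg_rep_sum:
  assumes rep: "alg_rep A n \<psi>" and v: "v \<in> vecs n" and u: "\<And>k. k \<in> S \<Longrightarrow> u k \<in> carrier (alg_of A)"
  shows "\<psi> (\<lambda>l. \<Sum>k\<in>S. u k l) v = (\<Sum>k\<in>S. \<psi> (u k) v)"
  using u
proof (induction S rule: infinite_finite_induct)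
  case (insert k S)
  have c: "(\<lambda>l. \<Sum>k\<in>S. u k l) \<in> carrier (alg_of A)" using insert.prems by (auto simp: carrier_alg_of)
  have "\<psi> (\<lambda>l. \<Sum>k\<in>insert k S. u k l) v = \<psi> (\<lambda>l. u k l + (\<Sum>k\<in>S. u k l)) v"
    using insert.hyps by simp
  also have "\<dots> = \<psi> (u k) v + \<psi> (\<lambda>l. \<Sum>k\<in>S. u k l) v"
    by (rule alg_repD(3)[OF rep _ c v]) (use insert.prems in simp)
  finally show ?case using insert by simp
qed (simp_all add: alg_rep_zero[OF rep v])

section \<open>Splitting of symbols and of products of three symbols\<close>

context primitive_root
begin

text \<open>The algebra acts on k[X] modulo X^p - a: i2 multiplies by X and i1 sends X^j to
  \<zeta>^j X^j. \<open>\<rho>\<close> gives the matrices of the monomials in the basis of powers of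
  X, the exponent of \<open>a\<close> being the carry.\<close>

lemma split_algebra_symb_one:
  assumes "a \<noteq> 0"
  shows "split_algebra (symb a 1)"
proof -
  interpret W: weyl_algebra "symb a 1" symb_op "symb_c a 1" "(0, 0)"
    by (rule weyl_algebra_symb) (use assms in auto)
  define \<rho> where "\<rho> g i j = (if i = (j + fst g) mod p then \<zeta> ^ (snd g * j) * a ^ ((j + fst g) div p) else 0)"
    for g :: "nat \<times> nat" and i j :: nat
  have "alg_isomorphic (symb a 1) (matalg {..<p})"
  proof (rule W.alg_isomorphic_matalg_if_representation[where \<rho> = \<rho>])
    fix g h :: "nat \<times> nat" and i j :: nat
    assume gh: "g \<in> basis (symb a 1)" "h \<in> basis (symb a 1)" and ij: "i \<in> {..<p}" "j \<in> {..<p}"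
    let ?m = "(j + fst h) mod p"
    have "(\<Sum>m<p. \<rho> g i m * \<rho> h m j) = (\<Sum>m<p. if m = ?m then \<rho> g i m * (\<zeta> ^ (snd h * j) * a ^ ((j + fst h) div p)) else 0)"
      by (intro sum.cong refl) (simp add: \<rho>_def)
    also have "\<dots> = \<rho> g i ?m * (\<zeta> ^ (snd h * j) * a ^ ((j + fst h) div p))"
      using p_pos by simp
    also have "\<dots> = symb_c a 1 g h * \<rho> (symb_op g h) i j"
    proof -
      have idx: "(?m + fst g) mod p = (j + (fst g + fst h) mod p) mod p"
        by (simp add: mod_simps add_ac)
      have z: "\<zeta> ^ (snd g * ?m) * \<zeta> ^ (snd h * j) = \<zeta> ^ (snd g * fst h) * \<zeta> ^ ((snd g + snd h) mod p * j)"
        by (simp add: power_mod_eq[OF zeta_p] power_add[symmetric] distrib_left distrib_right add_ac)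
      have aa: "a ^ ((?m + fst g) div p) * a ^ ((j + fst h) div p) =
          a ^ ((fst g + fst h) div p) * a ^ ((j + (fst g + fst h) mod p) div p)"
        using div_carry[of j "fst h" p "fst g"] div_carry_right[of "fst g" "fst h" p j]
        by (simp add: power_add[symmetric] add_ac)
      show ?thesis
      proof (cases "i = (?m + fst g) mod p")
        case True
        have "\<rho> g i ?m * (\<zeta> ^ (snd h * j) * a ^ ((j + fst h) div p))
            = (\<zeta> ^ (snd g * ?m) * \<zeta> ^ (snd h * j)) * (a ^ ((?m + fst g) div p) * a ^ ((j + fst h) div p))"
          using True by (simp add: \<rho>_def mult_ac)
        also have "\<dots> = symb_c a 1 g h * \<rho> (symb_op g h) i j"
          unfolding z aa using True unfolding idx by (simp add: \<rho>_def mult_ac)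
        finally show ?thesis .
      next
        case False
        then have "\<rho> g i ?m = 0" by (simp add: \<rho>_def)
        moreover have "\<rho> (symb_op g h) i j = 0" using False unfolding idx by (simp add: \<rho>_def)
        ultimately show ?thesis by simp
      qed
    qed
    finally show "(\<Sum>m<p. \<rho> g i m * \<rho> h m j) = symb_c a 1 g h * \<rho> (symb_op g h) i j" .
  next
    fix i j assume "i \<in> {..<p}" "j \<in> {..<p}"
    then show "\<rho> (0, 0) i j = (if i = j then 1 else 0)" by (simp add: \<rho>_def)
  qed (use p_pos in \<open>auto simp: card_cartesian_product\<close>)
  then show ?thesis
    using p_pos by (intro split_algebra_if_isomorphic_matalg[of _ "{..<p}"]) auto
qed

end

context kummer3
begin

abbreviation triple :: "(nat \<Rightarrow> 'a) \<Rightarrow> ((nat \<times> nat) \<times> (nat \<times> nat) \<times> nat \<times> nat, 'a) based_algebra" where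
  "triple w \<equiv> tensor (symb (a 0) (w 0)) (tensor (symb (a 1) (w 1)) (symb (a 2) (w 2)))"

lemma less_3: "(i::nat) < 3 \<Longrightarrow> i = 0 \<or> i = 1 \<or> i = 2" by auto

lemma weyl_symb_i:
  "i < 3 \<Longrightarrow> w i \<noteq> 0 \<Longrightarrow> weyl_algebra (symb (a i) (w i)) symb_op (symb_c (a i) (w i)) (0, 0)"
  by (rule weyl_algebra_symb[OF a_nz])

text \<open>A splitting makes the tensor product of \<open>triple w\<close> with some matrix algebra
  a full matrix algebra of degree \<open>n\<close>, and comparison of dimensions gives n = p^3 m.
  The images of the generators of the three symbols and of the matrix units are the operators
  required by \<open>hsys_if_operators\<close>.\<close>

lemma hsys_if_split:
  assumes split: "split_algebra (triple w)" and w: "\<And>i. i < 3 \<Longrightarrow> w i \<noteq> 0"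
  shows "\<exists>h. hsys h w"
proof -
  have fin: "finite (basis (triple w))" by simp
  obtain m n where mn: "m > 0" "n > 0"
    "alg_isomorphic (tensor (triple w) (matrix_algebra m)) (matrix_algebra n :: (nat \<times> nat, 'a) based_algebra)"
    by (rule split_algebra_imp_matrix_algebra[OF split fin])
  let ?M = "matrix_algebra m :: (nat \<times> nat, 'a) based_algebra"
  let ?S = "\<lambda>i. symb (a i) (w i)"
  have "card (basis (tensor (triple w) ?M)) = card (basis (matrix_algebra n :: (nat \<times> nat, 'a) based_algebra))"
    by (rule card_basis_eq_if_alg_isomorphic[OF _ _ mn(3)]) auto
  then have "(p * (p * p) * m) ^ 2 = n ^ 2"
    by (simp add: card_cartesian_product power2_eq_square mult_ac)
  then have n: "n = p * (p * p) * m" by (simp only: power2_eq_iff_nonneg zero_le)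
  obtain \<phi> where "alg_iso (tensor (triple w) ?M) (matrix_algebra n) \<phi>"
    using mn(3) unfolding alg_isomorphic_iff_alg_iso by blast
  note alg_rep_if_iso_matrix_algebra[OF this]
  then obtain \<psi> where \<psi>: "alg_rep (tensor (triple w) ?M) n \<psi>" by blast
  have W: "weyl_algebra (?S i) symb_op (symb_c (a i) (w i)) (0, 0)" if "i < 3" for i
    by (rule weyl_symb_i[of i w, OF that w[OF that]])
  have l3: "(0::nat) < 3" "(1::nat) < 3" "(2::nat) < 3" by simp_all
  note W12 = weyl_algebra_tensor[OF W[OF l3(2)] W[OF l3(3)]]
  note WT = weyl_algebra_tensor[OF W[OF l3(1)] W12]
  have u: "unital (?S 0)" "unital (?S 1)" "unital (?S 2)"
    using unital_weyl_algebra[OF W] by auto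
  have u12: "unital (tensor (?S 1) (?S 2))" and uT: "unital (triple w)"
    by (rule unital_weyl_algebra[OF W12], rule unital_weyl_algebra[OF WT])
  have uM: "unital ?M" by (rule unital_matrix_algebra)
  let ?o = "\<lambda>i. \<one>\<^bsub>alg_of (?S i)\<^esub>"
  define \<psi>T where "\<psi>T t = \<psi> (pure t \<one>\<^bsub>alg_of ?M\<^esub>)" for t
  define \<psi>M where "\<psi>M t = \<psi> (pure \<one>\<^bsub>alg_of (triple w)\<^esub> t)" for t
  define \<psi>U where "\<psi>U t = \<psi>T (pure (?o 0) t)" for t
  define \<psi>0 where "\<psi>0 t = \<psi>T (pure t \<one>\<^bsub>alg_of (tensor (?S 1) (?S 2))\<^esub>)" for t
  define \<psi>1 where "\<psi>1 t = \<psi>U (pure t (?o 2))" for t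
  define \<psi>2 where "\<psi>2 t = \<psi>U (pure (?o 1) t)" for t
  have rT: "alg_rep (triple w) n \<psi>T" unfolding \<psi>T_def by (rule alg_rep_left[OF \<psi> uM])
  have rM: "alg_rep ?M n \<psi>M" unfolding \<psi>M_def by (rule alg_rep_right[OF \<psi> uT])
  have rU: "alg_rep (tensor (?S 1) (?S 2)) n \<psi>U" unfolding \<psi>U_def by (rule alg_rep_right[OF rT u(1)])
  have r0: "alg_rep (?S 0) n \<psi>0" unfolding \<psi>0_def by (rule alg_rep_left[OF rT u12])
  have r1: "alg_rep (?S 1) n \<psi>1" unfolding \<psi>1_def by (rule alg_rep_left[OF rU u(3)])
  have r2: "alg_rep (?S 2) n \<psi>2" unfolding \<psi>2_def by (rule alg_rep_right[OF rU u(2)])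
  define \<psi>s where "\<psi>s i = (if i = 0 then \<psi>0 else if i = 1 then \<psi>1 else \<psi>2)" for i :: nat
  have rs: "alg_rep (?S i) n (\<psi>s i)" if "i < 3" for i
    using less_3[OF that] r0 r1 r2 by (auto simp: \<psi>s_def)
  \<comment> \<open>The bases of the three symbol algebras do not depend on the entries, so one name
    serves for all three carriers.\<close>
  have C: "carrier (alg_of (?S i)) = carrier (alg_of (?S 0))" for i by (simp add: carrier_alg_of)
  let ?C = "carrier (alg_of (?S 0))"
  have oC: "?o i \<in> ?C" for i by (subst C[of i, symmetric]) (rule one_closed_alg_of)
  have cMT: "\<psi>T t (\<psi>M b v) = \<psi>M b (\<psi>T t v)"
    if "t \<in> carrier (alg_of (triple w))" "b \<in> carrier (alg_of ?M)" "v \<in> vecs n" for t b v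
    unfolding \<psi>T_def \<psi>M_def by (rule alg_rep_commute[OF \<psi> uT uM that])
  have c0U: "\<psi>0 t (\<psi>U b v) = \<psi>U b (\<psi>0 t v)"
    if "t \<in> ?C" "b \<in> carrier (alg_of (tensor (?S 1) (?S 2)))" "v \<in> vecs n" for t b v
    unfolding \<psi>0_def \<psi>U_def by (rule alg_rep_commute[OF rT u(1) u12 that])
  have c12: "\<psi>1 t (\<psi>2 b v) = \<psi>2 b (\<psi>1 t v)" if "t \<in> ?C" "b \<in> ?C" "v \<in> vecs n" for t b v
    unfolding \<psi>1_def \<psi>2_def using that C by (intro alg_rep_commute[OF rU u(2,3)]) auto
  have p12: "pure t b \<in> carrier (alg_of (tensor (?S 1) (?S 2)))" if "t \<in> ?C" "b \<in> ?C" for t b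
    using that C[of 1] C[of 2] by (intro pure_in_carrier) auto
  have comm: "\<psi>s i t (\<psi>s j b v) = \<psi>s j b (\<psi>s i t v)" if "i < 3" "j < 3" "i \<noteq> j" "t \<in> ?C" "b \<in> ?C" "v \<in> vecs n" for i j t b v
  proof -
    have *: "\<psi>s i t (\<psi>s j b v) = \<psi>s j b (\<psi>s i t v)" if "i < j" "i < 3" "j < 3" "t \<in> ?C" "b \<in> ?C" "v \<in> vecs n" for i j t b v
    proof -
      consider "i = 0" "j = 1" | "i = 0" "j = 2" | "i = 1" "j = 2" using \<open>i < j\<close> \<open>i < 3\<close> \<open>j < 3\<close> by linarith
      then show ?thesis
      proof cases
        case 1
        then show ?thesis using c0U[OF that(4) p12[OF that(5) oC] that(6)] by (simp add: \<psi>s_def \<psi>1_def)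
      next
        case 2
        then show ?thesis using c0U[OF that(4) p12[OF oC that(5)] that(6)] by (simp add: \<psi>s_def \<psi>2_def)
      next
        case 3
        then show ?thesis using c12[OF that(4-6)] by (simp add: \<psi>s_def)
      qed
    qed
    show ?thesis
      using *[of i j t b v] *[of j i b t v] that by (cases "i < j") auto
  qed
  have commM: "\<psi>M b (\<psi>s i t v) = \<psi>s i t (\<psi>M b v)" if "i < 3" "t \<in> ?C" "b \<in> carrier (alg_of ?M)" "v \<in> vecs n" for i t b v
  proof -
    consider "i = 0" | "i = 1" | "i = 2" using \<open>i < 3\<close> by linarith
    then show ?thesis
    proof cases
      case 1
      then show ?thesis
        using cMT[OF pure_in_carrier[OF that(2) one_closed_alg_of] that(3,4)] by (simp add: \<psi>s_def \<psi>0_def)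
    next
      case 2
      then show ?thesis
        using cMT[OF pure_in_carrier[OF oC p12[OF that(2) oC]] that(3,4)] by (simp add: \<psi>s_def \<psi>1_def \<psi>U_def)
    next
      case 3
      then show ?thesis
        using cMT[OF pure_in_carrier[OF oC p12[OF oC that(2)]] that(3,4)] by (simp add: \<psi>s_def \<psi>2_def \<psi>U_def)
    qed
  qed
  have gC: "unit_vec (0, 1) \<in> ?C" "unit_vec (1, 0) \<in> ?C" by (rule symb_gens_in_carrier)+
  have gS: "unit_vec (0, 1) \<in> carrier (alg_of (?S i))" "unit_vec (1, 0) \<in> carrier (alg_of (?S i))" for i
    by (rule symb_gens_in_carrier)+
  have eM: "unit_vec (k, l) \<in> carrier (alg_of ?M)" if "k < m" "l < m" for k l
    using that by (intro unit_vec_in_carrier) auto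
  show ?thesis
  proof (rule hsys_if_operators[OF mn(1) n, of "\<lambda>i. \<psi>s i (unit_vec (1, 0))" "\<lambda>i. \<psi>s i (unit_vec (0, 1))" "\<lambda>k l. \<psi>M (unit_vec (k, l))" w])
    show "lin_op n (\<psi>s i (unit_vec (1, 0)))" "lin_op n (\<psi>s i (unit_vec (0, 1)))" if "i < 3" for i
      using alg_repD(1)[OF rs[OF that]] gS by auto
    show "lin_op n (\<psi>M (unit_vec (k, l)))" if "k < m" "l < m" for k l
      by (rule alg_repD(1)[OF rM eM[OF that]])
    show "(\<psi>s i (unit_vec (1, 0)) ^^ p) v = scl (a i) v" "(\<psi>s i (unit_vec (0, 1)) ^^ p) v = scl (w i) v"
      if "i < 3" "v \<in> vecs n" for i v
      by (rule symb_rep_relations(1)[OF rs[OF that(1)] that(2)], rule symb_rep_relations(2)[OF rs[OF that(1)] that(2)])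
    fix i j :: nat and v :: "nat \<Rightarrow> 'a" assume i: "i < 3" and j: "j < 3" and v: "v \<in> vecs n"
    show "\<psi>s i (unit_vec (1, 0)) (\<psi>s j (unit_vec (1, 0)) v) = \<psi>s j (unit_vec (1, 0)) (\<psi>s i (unit_vec (1, 0)) v)"
      using comm[OF i j _ gC(2) gC(2) v] by (cases "i = j") auto
    show "\<psi>s i (unit_vec (0, 1)) (\<psi>s j (unit_vec (0, 1)) v) = \<psi>s j (unit_vec (0, 1)) (\<psi>s i (unit_vec (0, 1)) v)"
      using comm[OF i j _ gC(1) gC(1) v] by (cases "i = j") auto
    show "\<psi>s i (unit_vec (0, 1)) (\<psi>s j (unit_vec (1, 0)) v) =
      (if i = j then scl \<zeta> (\<psi>s j (unit_vec (1, 0)) (\<psi>s i (unit_vec (0, 1)) v))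
       else \<psi>s j (unit_vec (1, 0)) (\<psi>s i (unit_vec (0, 1)) v))"
      using comm[OF i j _ gC(1) gC(2) v] symb_rep_relations(3)[OF rs[OF i] v] by (cases "i = j") auto
  next
    fix i k l :: nat and v :: "nat \<Rightarrow> 'a" assume i: "i < 3" and k: "k < m" "l < m" and v: "v \<in> vecs n"
    show "\<psi>M (unit_vec (k, l)) (\<psi>s i (unit_vec (1, 0)) v) = \<psi>s i (unit_vec (1, 0)) (\<psi>M (unit_vec (k, l)) v)"
      by (rule commM[OF i gC(2) eM[OF k] v])
    show "\<psi>M (unit_vec (k, l)) (\<psi>s i (unit_vec (0, 1)) v) = \<psi>s i (unit_vec (0, 1)) (\<psi>M (unit_vec (k, l)) v)"
      by (rule commM[OF i gC(1) eM[OF k] v])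
  next
    fix k l k' l' :: nat and v :: "nat \<Rightarrow> 'a" assume k: "k < m" "l < m" "k' < m" "l' < m" and v: "v \<in> vecs n"
    have "unit_vec (k, l) \<otimes>\<^bsub>alg_of ?M\<^esub> unit_vec (k', l') = (if l = k' then unit_vec (k, l') else (\<lambda>_. 0))"
      using k by (subst mult_unit_vec) (auto simp: matrix_algebra_eq_matalg strc_matalg unit_vec_def fun_eq_iff)
    then show "\<psi>M (unit_vec (k, l)) (\<psi>M (unit_vec (k', l')) v) = (if l = k' then \<psi>M (unit_vec (k, l')) v else 0)"
      using alg_repD(2)[OF rM eM[OF k(1,2)] eM[OF k(3,4)] v] alg_rep_zero[OF rM v] by (cases "l = k'") simp_all
  next
    fix v :: "nat \<Rightarrow> 'a" assume v: "v \<in> vecs n"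
    have "(\<Sum>k<m. unit_vec (k, k) l) = (\<one>\<^bsub>alg_of ?M\<^esub> l :: 'a)" for l
    proof -
      have "(\<Sum>k<m. unit_vec (k, k) l) = (\<Sum>k<m. if k = fst l then (if fst l = snd l then 1 else 0) else (0::'a))"
        by (intro sum.cong refl) (auto simp: unit_vec_def prod_eq_iff)
      then show ?thesis
        by (auto simp: one_alg_of matrix_algebra_eq_matalg unit_coord_matalg mem_Times_iff)
    qed
    then have "\<one>\<^bsub>alg_of ?M\<^esub> = (\<lambda>l. \<Sum>k<m. unit_vec (k, k) l)" by (simp add: fun_eq_iff)
    then show "(\<Sum>k<m. \<psi>M (unit_vec (k, k)) v) = v"
      using alg_repD(5)[OF rM v] alg_rep_sum[OF rM v, of "{..<m}" "\<lambda>k. unit_vec (k, k)"] eM by simp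
  qed (rule w)
qed

text \<open>The operators built from \<open>h\<close> and the multiplications by the
  \<open>x i\<close> represent \<open>triple w\<close> on \<open>K\<close>. The algebra has
  dimension p^6 and \<open>K\<close> has dimension p^3 over k, so the algebra is the full matrix
  algebra indexed by \<open>Box\<close>.\<close>

lemma split_if_hsys:
  assumes h: "hsys h w" and w: "\<And>i. i < 3 \<Longrightarrow> w i \<noteq> 0"
  shows "split_algebra (triple w)"
proof -
  note f = subfldD[OF K]
  have l3: "(0::nat) < 3" "(1::nat) < 3" "(2::nat) < 3" by simp_all
  have hK: "h i \<in> K" if "i < 3" for i using h that by (simp add: hsys_def)
  define P where "P i y = h i * s i y" for i y
  have PK: "P i y \<in> K" if "i < 3" "y \<in> K" for i y unfolding P_def using that hK sK f by simp
  have Padd: "P i (y + z) = P i y + P i z" if "i < 3" "y \<in> K" "z \<in> K" for i y z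
    using that by (simp add: P_def fhomD[OF s_hom K] distrib_left)
  have Pscale: "P i (to_ac c * y) = to_ac c * P i y" if "i < 3" "y \<in> K" for i y c
    using that by (simp add: P_def s_scale)
  have PP: "P i (P j y) = P j (P i y)" if "i < 3" "j < 3" "y \<in> K" for i j y
  proof -
    have "P i (P j y) = h i * s i (h j) * s i (s j y)"
      using that hK sK by (simp add: P_def fhomD[OF s_hom K] mult_ac)
    also have "\<dots> = h j * s j (h i) * s j (s i y)"
      using h that s_comm by (simp add: hsys_def)
    also have "\<dots> = P j (P i y)"
      using that hK sK by (simp add: P_def fhomD[OF s_hom K] mult_ac)
    finally show ?thesis .
  qed
  have Px: "P i (x j * y) = (if i = j then to_ac \<zeta> * (x j * P i y) else x j * P i y)" if "i < 3" "j < 3" "y \<in> K" for i j y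
    using that xK by (simp add: P_def fhomD[OF s_hom K] s_x mult_ac)
  have PrK: "(P i ^^ r) y \<in> K" if "i < 3" "y \<in> K" for i r y by (rule funpow_mem) (use that PK in auto)
  have Pradd: "(P i ^^ r) (y + z) = (P i ^^ r) y + (P i ^^ r) z" if "i < 3" "y \<in> K" "z \<in> K" for i r y z
    using that by (induction r) (auto simp: Padd PrK)
  have Prscale: "(P i ^^ r) (to_ac c * y) = to_ac c * (P i ^^ r) y" if "i < 3" "y \<in> K" for i r y c
    using that by (induction r) (auto simp: Pscale PrK)
  have PrPr: "(P i ^^ r) ((P j ^^ t) y) = (P j ^^ t) ((P i ^^ r) y)" if "i < 3" "j < 3" "y \<in> K" for i j r t y
    by (rule funpow_commute_on[of K]) (use that PK PP in auto)
  have Prx: "(P i ^^ r) (x j * y) = x j * (P i ^^ r) y" if "i < 3" "j < 3" "i \<noteq> j" "y \<in> K" for i j r y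
    using that by (induction r) (auto simp: Px PrK)
  have Prxx: "(P i ^^ r) (x i * y) = to_ac (\<zeta> ^ r) * (x i * (P i ^^ r) y)" if i: "i < 3" "y \<in> K" for i r y
  proof (induction r)
    case (Suc r)
    have xP: "x i * (P i ^^ r) y \<in> K" using i xK PrK f by simp
    have "(P i ^^ Suc r) (x i * y) = P i (to_ac (\<zeta> ^ r) * (x i * (P i ^^ r) y))" using Suc by simp
    also have "\<dots> = to_ac (\<zeta> ^ r) * P i (x i * (P i ^^ r) y)" by (rule Pscale[OF i(1) xP])
    also have "P i (x i * (P i ^^ r) y) = to_ac \<zeta> * (x i * P i ((P i ^^ r) y))"
      using Px[OF i(1,1) PrK[OF i]] by simp
    finally show ?case by simp
  qed simp
  have xuK: "x i ^ u * y \<in> K" if "i < 3" "y \<in> K" for i u y using that xK f subfld_power[OF K] by simp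
  have Prxu: "(P i ^^ r) (x j ^ u * y) = (if i = j then to_ac (\<zeta> ^ (r * u)) else 1) * (x j ^ u * (P i ^^ r) y)"
    if ij: "i < 3" "j < 3" "y \<in> K" for i j r u y
  proof (induction u)
    case (Suc u)
    have "(P i ^^ r) (x j ^ Suc u * y) = (P i ^^ r) (x j * (x j ^ u * y))" by (simp add: mult.assoc)
    also have "\<dots> = (if i = j then to_ac (\<zeta> ^ r) else 1) * (x j * (P i ^^ r) (x j ^ u * y))"
      using Prxx[OF ij(1), of "x j ^ u * y" r] Prx[OF ij(1,2) _ xuK[OF ij(2,3)], of r] xuK[OF ij(2,3), of u]
      by (cases "i = j") auto
    finally show ?case unfolding Suc by (simp add: power_add mult_ac)
  qed simp
  have Pnrm: "(P i ^^ k) y = nrm i (h i) k * (s i ^^ k) y" if i: "i < 3" "y \<in> K" for i k y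
  proof (induction k)
    case (Suc k)
    have "(s i ^^ k) y \<in> K" by (rule funpow_mem) (use i sK in auto)
    then show ?case
      using Suc i nrm_K[OF i(1) hK[OF i(1)]]
      by (simp add: P_def nrm_Suc[OF i(1) hK[OF i(1)]] fhomD[OF s_hom K] mult_ac)
  qed (simp add: nrm_def)
  have Pp: "(P i ^^ p) y = to_ac (w i) * y" if "i < 3" "y \<in> K" for i y
    using Pnrm[OF that, of p] h s_order that by (simp add: hsys_def)
  \<comment> \<open>Reducing an exponent modulo \<open>p\<close> costs a power of \<open>w i\<close>
    whose exponent is the carry, as in the structure constants of the symbol algebra.\<close>
  have Pmod: "(P i ^^ n) y = to_ac (w i ^ (n div p)) * (P i ^^ (n mod p)) y" if i: "i < 3" "y \<in> K" for i n y
  proof -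
    have "(P i ^^ (p * q)) y = to_ac (w i ^ q) * y" if "y \<in> K" for q y
    proof (induction q)
      case (Suc q)
      have "(P i ^^ (p * Suc q)) y = (P i ^^ p) ((P i ^^ (p * q)) y)" by (simp add: funpow_add)
      also have "\<dots> = to_ac (w i) * (to_ac (w i ^ q) * y)"
        unfolding Suc by (intro Pp f(4) base that i)
      finally show ?case by simp
    qed simp
    from this[OF PrK[OF i]] show ?thesis
      by (metis comp_apply funpow_add mult_div_mod_eq)
  qed
  \<comment> \<open>The operator of the monomial i2^s i1^r in the symbol with index
    \<open>i\<close>.\<close>
  define Q where "Q i g y = x i ^ fst g * (P i ^^ snd g) y" for i :: nat and g :: "nat \<times> nat" and y
  have QK: "Q i g y \<in> K" if "i < 3" "y \<in> K" for i g y
    unfolding Q_def using that by (intro xuK PrK)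
  have Qadd: "Q i g (y + z) = Q i g y + Q i g z" if "i < 3" "y \<in> K" "z \<in> K" for i g y z
    using that by (simp add: Q_def Pradd distrib_left)
  have Qscale: "Q i g (to_ac c * y) = to_ac c * Q i g y" if "i < 3" "y \<in> K" for i g y c
    unfolding Q_def Prscale[OF that] by (simp only: mult.left_commute)
  have Qcomm: "Q i g (Q j g' y) = Q j g' (Q i g y)" if "i < 3" "j < 3" "i \<noteq> j" "y \<in> K" for i j g g' y
    using that by (simp add: Q_def Prxu PrK PrPr[of i j] mult_ac)
  have QQ: "Q i g (Q i g' y) = to_ac (symb_c (a i) (w i) g g') * Q i (symb_op g g') y" if i: "i < 3" "y \<in> K" for i g g' y
  proof -
    have xm: "x i ^ k = to_ac (a i ^ (k div p)) * x i ^ (k mod p)" for k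
    proof -
      have "x i ^ k = (x i ^ p) ^ (k div p) * x i ^ (k mod p)" by (simp flip: power_mult power_add)
      then show ?thesis using x_pow[OF i(1)] by simp
    qed
    have "Q i g (Q i g' y) = to_ac (\<zeta> ^ (snd g * fst g')) * (x i ^ (fst g + fst g') * (P i ^^ (snd g + snd g')) y)"
    proof -
      have "(P i ^^ snd g) (x i ^ fst g' * (P i ^^ snd g') y)
          = to_ac (\<zeta> ^ (snd g * fst g')) * (x i ^ fst g' * (P i ^^ snd g) ((P i ^^ snd g') y))"
        using Prxu[OF i(1,1) PrK[OF i]] by simp
      also have "(P i ^^ snd g) ((P i ^^ snd g') y) = (P i ^^ (snd g + snd g')) y"
        by (simp add: funpow_add)
      finally show ?thesis by (simp add: Q_def power_add mult_ac)
    qed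
    also have "\<dots> = to_ac (symb_c (a i) (w i) g g') * Q i (symb_op g g') y"
      unfolding xm[of "fst g + fst g'"] Pmod[OF i, of "snd g + snd g'"] by (simp add: Q_def mult_ac)
    finally show ?thesis .
  qed
  define Q3 where "Q3 g y = Q 0 (fst g) (Q 1 (fst (snd g)) (Q 2 (snd (snd g)) y))" for g y
  have Q3K: "Q3 g y \<in> K" if "y \<in> K" for g y unfolding Q3_def using that QK by simp
  have Q3add: "Q3 g (y + z) = Q3 g y + Q3 g z" if "y \<in> K" "z \<in> K" for g y z
    using that by (simp add: Q3_def Qadd QK)
  have Q3scale: "Q3 g (to_ac c * y) = to_ac c * Q3 g y" if "y \<in> K" for g y c
    using that by (simp add: Q3_def Qscale QK)
  \<comment> \<open>Group operation and cocycle of \<open>triple w\<close> in the form that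
    \<open>weyl_algebra_tensor\<close> provides.\<close>
  define op where "op g g' = (symb_op (fst g) (fst g'), symb_op (fst (snd g)) (fst (snd g')), symb_op (snd (snd g)) (snd (snd g')))"
    for g g' :: "(nat \<times> nat) \<times> (nat \<times> nat) \<times> nat \<times> nat"
  define cc where "cc g g' = symb_c (a 0) (w 0) (fst g) (fst g') * (symb_c (a 1) (w 1) (fst (snd g)) (fst (snd g')) *
      symb_c (a 2) (w 2) (snd (snd g)) (snd (snd g')))"
    for g g' :: "(nat \<times> nat) \<times> (nat \<times> nat) \<times> nat \<times> nat"
  have Q3Q3: "Q3 g (Q3 g' y) = to_ac (cc g g') * Q3 (op g g') y" if y: "y \<in> K" for g g' y
  proof -
    have 2: "Q 2 b (Q 0 c z) = Q 0 c (Q 2 b z)" "Q 1 b (Q 0 c z) = Q 0 c (Q 1 b z)" "Q 2 b (Q 1 c z) = Q 1 c (Q 2 b z)"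
      if "z \<in> K" for b c z using Qcomm that by simp_all
    have "Q3 g (Q3 g' y) = Q 0 (fst g) (Q 0 (fst g') (Q 1 (fst (snd g)) (Q 1 (fst (snd g')) (Q 2 (snd (snd g)) (Q 2 (snd (snd g')) y)))))"
      unfolding Q3_def using y by (simp only: 2 QK l3)
    also have "\<dots> = Q 0 (fst g) (Q 0 (fst g') (Q 1 (fst (snd g)) (Q 1 (fst (snd g'))
        (to_ac (symb_c (a 2) (w 2) (snd (snd g)) (snd (snd g'))) * Q 2 (snd (snd (op g g'))) y))))"
      unfolding QQ[OF l3(3) y] by (simp add: op_def)
    also have "\<dots> = Q 0 (fst g) (Q 0 (fst g') (to_ac (symb_c (a 2) (w 2) (snd (snd g)) (snd (snd g'))) *
        (to_ac (symb_c (a 1) (w 1) (fst (snd g)) (fst (snd g'))) *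
          Q 1 (fst (snd (op g g'))) (Q 2 (snd (snd (op g g'))) y))))"
      using y by (simp only: Qscale QK l3 QQ op_def fst_conv snd_conv)
    also have "\<dots> = to_ac (symb_c (a 2) (w 2) (snd (snd g)) (snd (snd g'))) *
        (to_ac (symb_c (a 1) (w 1) (fst (snd g)) (fst (snd g'))) * (to_ac (symb_c (a 0) (w 0) (fst g) (fst g')) *
          Q 0 (fst (op g g')) (Q 1 (fst (snd (op g g'))) (Q 2 (snd (snd (op g g'))) y))))"
      using y by (simp only: Qscale QK l3 QQ f(4) base op_def fst_conv snd_conv)
    also have "\<dots> = to_ac (cc g g') * Q3 (op g g') y"
      unfolding cc_def Q3_def to_ac_mult by (simp only: mult_ac)
    finally show ?thesis .
  qed
  \<comment> \<open>Coordinates with respect to the basis \<open>mon\<close>; the entries of the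
    representing matrices are read off from them.\<close>
  define cf where "cf y = (SOME c. y = (\<Sum>b\<in>Box. to_ac (c b) * mon b))" for y
  have cf: "y = (\<Sum>b\<in>Box. to_ac (cf y b) * mon b)" if "y \<in> K" for y
    unfolding cf_def by (rule someI_ex[OF mon_span[OF that]])
  have uniq: "c b = d b" if "(\<Sum>b\<in>Box. to_ac (c b) * mon b) = (\<Sum>b\<in>Box. to_ac (d b) * mon b)" "b \<in> Box" for c d b
  proof -
    have "(\<Sum>b\<in>Box. to_ac (c b - d b) * mon b) = 0"
      using that(1) by (simp add: left_diff_distrib sum_subtractf)
    then have "c b - d b = 0" using mon_independent[of "\<lambda>b. c b - d b" b] that(2) by blast
    then show ?thesis by simp
  qed
  have Q3sum: "Q3 g (\<Sum>b\<in>S. to_ac (c b) * mon b) = (\<Sum>b\<in>S. to_ac (c b) * Q3 g (mon b))" for g c and S :: "(nat \<times> nat \<times> nat) set"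
  proof (induction S rule: infinite_finite_induct)
    case (insert b S)
    have "(\<Sum>b\<in>S. to_ac (c b) * mon b) \<in> K" by (intro subfld_sum[OF K] f(4) base mon_K)
    then show ?case using insert by (simp add: Q3add Q3scale mon_K base f)
  qed (use Q3scale[OF f(1), of g 0] in simp_all)
  let ?wc = "\<lambda>i j. symb_c (a 0) (w 0) (fst i) (fst j) * (symb_c (a 1) (w 1) (fst (snd i)) (fst (snd j)) *
      symb_c (a 2) (w 2) (snd (snd i)) (snd (snd j)))"
  have W: "weyl_algebra (triple w) op cc ((0, 0), (0, 0), (0, 0))"
    using weyl_algebra_tensor[OF weyl_symb_i[of 0 w] weyl_algebra_tensor[OF weyl_symb_i[of 1 w] weyl_symb_i[of 2 w]]] w
    unfolding op_def[abs_def] cc_def[abs_def] by simp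
  interpret W: weyl_algebra "triple w" op cc "((0, 0), (0, 0), (0, 0))" by (rule W)
  have "alg_isomorphic (triple w) (matalg Box)"
  proof (rule W.alg_isomorphic_matalg_if_representation[where \<rho> = "\<lambda>g b b'. cf (Q3 g (mon b')) b"])
    show "card (basis (triple w)) = card Box * card Box" by (simp add: card_cartesian_product)
    show "Box \<noteq> {}" using p_pos by auto
    fix g g' b b' assume b: "b \<in> Box" "b' \<in> Box"
    let ?r = "\<lambda>g b b'. cf (Q3 g (mon b')) b"
    have "Q3 g (Q3 g' (mon b')) = Q3 g (\<Sum>m\<in>Box. to_ac (?r g' m b') * mon m)"
      using cf[OF Q3K[OF mon_K], of g' b'] by simp
    also have "\<dots> = (\<Sum>m\<in>Box. to_ac (?r g' m b') * Q3 g (mon m))" by (rule Q3sum)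
    also have "\<dots> = (\<Sum>m\<in>Box. to_ac (?r g' m b') * (\<Sum>d\<in>Box. to_ac (?r g d m) * mon d))"
      using cf[OF Q3K[OF mon_K], of g] by simp
    also have "\<dots> = (\<Sum>m\<in>Box. \<Sum>d\<in>Box. to_ac (?r g d m * ?r g' m b') * mon d)"
      by (simp add: sum_distrib_left mult_ac)
    also have "\<dots> = (\<Sum>d\<in>Box. to_ac (\<Sum>m\<in>Box. ?r g d m * ?r g' m b') * mon d)"
      by (subst sum.swap) (simp only: to_ac_sum sum_distrib_right)
    finally have 1: "Q3 g (Q3 g' (mon b')) = (\<Sum>d\<in>Box. to_ac (\<Sum>m\<in>Box. ?r g d m * ?r g' m b') * mon d)" .
    have "Q3 g (Q3 g' (mon b')) = to_ac (cc g g') * (\<Sum>d\<in>Box. to_ac (?r (op g g') d b') * mon d)"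
      unfolding Q3Q3[OF mon_K] using cf[OF Q3K[OF mon_K], of "op g g'" b'] by simp
    also have "\<dots> = (\<Sum>d\<in>Box. to_ac (cc g g' * ?r (op g g') d b') * mon d)"
      by (simp add: sum_distrib_left mult_ac)
    finally show "(\<Sum>m\<in>Box. ?r g b m * ?r g' m b') = cc g g' * ?r (op g g') b b'"
      unfolding 1 by (rule uniq[OF _ b(1)])
  next
    fix b b' assume b: "b \<in> Box" "b' \<in> Box"
    have "Q3 ((0, 0), (0, 0), (0, 0)) (mon b') = mon b'" by (simp add: Q3_def Q_def)
    also have "\<dots> = (\<Sum>d\<in>Box. to_ac (if d = b' then 1 else 0) * mon d)"
    proof -
      have "(\<Sum>d\<in>Box. to_ac (if d = b' then 1 else 0) * mon d) = (\<Sum>d\<in>Box. if d = b' then mon d else 0)"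
        by (intro sum.cong refl) auto
      then show ?thesis using b(2) by (simp only: sum.delta finite_cartesian_product finite_lessThan if_True)
    qed
    finally have e: "Q3 ((0, 0), (0, 0), (0, 0)) (mon b') = (\<Sum>d\<in>Box. to_ac (if d = b' then 1 else 0) * mon d)" .
    have "(\<Sum>d\<in>Box. to_ac (cf (Q3 ((0, 0), (0, 0), (0, 0)) (mon b')) d) * mon d) = (\<Sum>d\<in>Box. to_ac (if d = b' then 1 else 0) * mon d)"
      by (rule trans[OF cf[OF Q3K[OF mon_K], symmetric] e])
    then show "cf (Q3 ((0, 0), (0, 0), (0, 0)) (mon b')) b = (if b = b' then 1 else 0)"
      by (rule uniq[OF _ b(1)])
  qed simp
  then show ?thesis
    by (rule split_algebra_if_isomorphic_matalg[rotated 3]) (use p_pos in auto)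
qed

end

section \<open>Cocycle conditions as conditions on symbols\<close>

context primitive_root
begin

lemma symbol_class_eq_one_iff:
  assumes "b \<noteq> 0" "b' \<noteq> 0"
  shows "symbol_class p \<zeta> b b' = \<one>\<^bsub>Br\<^esub> \<longleftrightarrow> split_algebra (symb b b')"
  unfolding symbol_class_def by (rule brauer_class_eq_one_iff[OF weyl_algebra_symb[OF assms]])

lemma symbol_class_mult_eq_one_iff:
  assumes "b \<noteq> 0" "b' \<noteq> 0" "d \<noteq> 0" "d' \<noteq> 0"
  shows "symbol_class p \<zeta> b b' \<otimes>\<^bsub>Br\<^esub> symbol_class p \<zeta> d d' = \<one>\<^bsub>Br\<^esub>
    \<longleftrightarrow> split_algebra (tensor (symb b b') (symb d d'))"
proof -
  note W = weyl_algebra_symb[OF assms(1,2)] weyl_algebra_symb[OF assms(3,4)]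
  show ?thesis
    unfolding symbol_class_def brauer_class_mult[OF W]
    by (rule brauer_class_eq_one_iff[OF weyl_algebra_tensor[OF W]])
qed

end

context kummer3
begin

lemma s_hom_1: "fhom K (s 1)"
  by (rule s_hom) simp

lemma nrm_mult:
  assumes "i < 3" "h \<in> K" "y \<in> K"
  shows "nrm i (h * y) k = nrm i h k * nrm i y k"
proof (induction k)
  case (Suc k)
  then show ?case
    using assms nrm_K[of i] subfldD(4)[OF K] by (simp add: nrm_Suc fhomD[OF s_hom K] mult_ac)
qed (simp add: nrm_def)

lemma nrm_fixed:
  assumes "s i y = y"
  shows "nrm i y k = y ^ k"
proof -
  have "(s i ^^ j) y = y" for j by (induction j) (simp_all add: assms)
  then show ?thesis by (simp add: nrm_def)
qed

text \<open>The cocycle condition for a central extension of the group of exponent \<open>p\<close> and rank 3 by \<open>\<mu>\<^sub>p\<close>,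
  in which only the generators 0 and 2 fail to commute and the \<open>p\<close>-th powers of the generators are \<open>w\<^sub>i\<close>.\<close>

definition obs :: "'a \<Rightarrow> 'a \<Rightarrow> 'a \<Rightarrow> bool" where
  "obs w0 w1 w2 \<longleftrightarrow> (\<exists>f :: nat \<Rightarrow> 'a alg_closure. (\<forall>i<3. f i \<in> K \<and> f i \<noteq> 0) \<and>
    nrm 0 (f 0) p = to_ac w0 \<and> nrm 1 (f 1) p = to_ac w1 \<and> nrm 2 (f 2) p = to_ac w2 \<and>
    f 0 * s 0 (f 2) = to_ac \<zeta> * (f 2 * s 2 (f 0)) \<and>
    f 0 * s 0 (f 1) = f 1 * s 1 (f 0) \<and> f 1 * s 1 (f 2) = f 2 * s 2 (f 1))"

lemma all_less_3: "(\<forall>i<3. R i) \<longleftrightarrow> R 0 \<and> R 1 \<and> R (2::nat)"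
  by (auto simp: less_Suc_eq numeral_eq_Suc)

lemma hsys_iff:
  "hsys h w \<longleftrightarrow> (\<forall>i<3. h i \<in> K \<and> h i \<noteq> 0) \<and>
    nrm 0 (h 0) p = to_ac (w 0) \<and> nrm 1 (h 1) p = to_ac (w 1) \<and> nrm 2 (h 2) p = to_ac (w 2) \<and>
    h 0 * s 0 (h 2) = h 2 * s 2 (h 0) \<and>
    h 0 * s 0 (h 1) = h 1 * s 1 (h 0) \<and> h 1 * s 1 (h 2) = h 2 * s 2 (h 1)"
  unfolding hsys_def all_less_3 by auto

text \<open>The element \<open>x 2\<close> is fixed by \<open>s 0\<close> and \<open>s 1\<close> and
  multiplied by \<zeta> under \<open>s 2\<close>. Replacing \<open>f 0\<close> by
  \<open>f 0 * x 2\<close> therefore removes the factor \<zeta> from its commutation rule with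
  \<open>f 2\<close> and changes its norm by the p-th power of \<open>x 2\<close>, which is
  \<open>a 2\<close>.\<close>

lemma obs_iff_hsys:
  "obs w0 w1 w2 \<longleftrightarrow> (\<exists>h. hsys h (\<lambda>i. if i = 0 then w0 * a 2 else if i = 1 then w1 else w2))"
proof
  have x2: "x 2 \<in> K" "x 2 \<noteq> 0" "s 0 (x 2) = x 2" "s 1 (x 2) = x 2" "s 2 (x 2) = to_ac \<zeta> * x 2"
    using xK x_nz s_x by auto
  have ix2: "inverse (x 2) \<in> K" "s 0 (inverse (x 2)) = inverse (x 2)" "s 1 (inverse (x 2)) = inverse (x 2)"
    "s 2 (inverse (x 2)) = inverse (to_ac \<zeta>) * inverse (x 2)"
    using x2 subfldD(6)[OF K x2(1)] fhomD(6)[OF s_hom K x2(1)] by auto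
  have z: "to_ac \<zeta> \<noteq> 0" using zeta_nz by simp
  {
    assume "obs w0 w1 w2"
    then obtain f :: "nat \<Rightarrow> 'a alg_closure" where f: "\<forall>i<3. f i \<in> K \<and> f i \<noteq> 0"
      "nrm 0 (f 0) p = to_ac w0" "nrm 1 (f 1) p = to_ac w1" "nrm 2 (f 2) p = to_ac w2"
      "f 0 * s 0 (f 2) = to_ac \<zeta> * (f 2 * s 2 (f 0))"
      "f 0 * s 0 (f 1) = f 1 * s 1 (f 0)" "f 1 * s 1 (f 2) = f 2 * s 2 (f 1)" unfolding obs_def by blast
    have fK: "f 0 \<in> K" "f 1 \<in> K" "f 2 \<in> K" using f(1) by auto
    define h where "h i = (if i = 0 then f 0 * x 2 else f i)" for i :: nat
    have h: "h 0 = f 0 * x 2" "h 1 = f 1" "h 2 = f 2" by (simp_all add: h_def)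
    have "hsys h (\<lambda>i. if i = 0 then w0 * a 2 else if i = 1 then w1 else w2)"
      unfolding hsys_iff
    proof (intro conjI)
      show "\<forall>i<3. h i \<in> K \<and> h i \<noteq> 0" using f(1) x2 subfldD(4)[OF K] by (simp add: h_def)
      show "nrm 0 (h 0) p = to_ac (if 0 = 0 then w0 * a 2 else if 0 = 1 then w1 else w2)"
        using nrm_mult[of 0 "f 0" "x 2" p] nrm_fixed[OF x2(3), of p] f(2) x_pow[of 2] fK x2 by (simp add: h)
      have "h 0 * s 0 (h 2) = (f 0 * s 0 (f 2)) * x 2" by (simp add: h mult_ac)
      also have "\<dots> = h 2 * s 2 (h 0)"
        unfolding f(5) using fK x2 by (simp add: h fhomD[OF s_hom K] mult_ac)
      finally show "h 0 * s 0 (h 2) = h 2 * s 2 (h 0)" .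
      have "h 0 * s 0 (h 1) = (f 0 * s 0 (f 1)) * x 2" by (simp only: h mult_ac)
      also have "\<dots> = h 1 * s 1 (h 0)"
        unfolding f(6) h fhomD(4)[OF s_hom_1 K fK(1) x2(1)] x2(4) by (simp only: mult_ac)
      finally show "h 0 * s 0 (h 1) = h 1 * s 1 (h 0)" .
    qed (use f in \<open>simp_all add: h_def\<close>)
    then show "\<exists>h. hsys h (\<lambda>i. if i = 0 then w0 * a 2 else if i = 1 then w1 else w2)" by blast
  }
  {
    assume "\<exists>h. hsys h (\<lambda>i. if i = 0 then w0 * a 2 else if i = 1 then w1 else w2)"
    then obtain h :: "nat \<Rightarrow> 'a alg_closure" where h: "\<forall>i<3. h i \<in> K \<and> h i \<noteq> 0"
      "nrm 0 (h 0) p = to_ac (w0 * a 2)" "nrm 1 (h 1) p = to_ac w1" "nrm 2 (h 2) p = to_ac w2"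
      "h 0 * s 0 (h 2) = h 2 * s 2 (h 0)"
      "h 0 * s 0 (h 1) = h 1 * s 1 (h 0)" "h 1 * s 1 (h 2) = h 2 * s 2 (h 1)" unfolding hsys_iff by auto
    have hK: "h 0 \<in> K" "h 1 \<in> K" "h 2 \<in> K" using h(1) by auto
    define f where "f i = (if i = 0 then h 0 * inverse (x 2) else h i)" for i :: nat
    have f: "f 0 = h 0 * inverse (x 2)" "f 1 = h 1" "f 2 = h 2" by (simp_all add: f_def)
    show "obs w0 w1 w2"
      unfolding obs_def
    proof (intro exI[of _ f] conjI)
      show "\<forall>i<3. f i \<in> K \<and> f i \<noteq> 0" using h(1) ix2 x2 subfldD(4)[OF K] by (simp add: f_def)
      have "to_ac (w0 * a 2) * inverse (x 2) ^ p = to_ac w0"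
        using x_pow[of 2] a_nz[of 2] by (simp add: power_inverse)
      then show "nrm 0 (f 0) p = to_ac w0"
        using nrm_mult[of 0 "h 0" "inverse (x 2)" p] nrm_fixed[OF ix2(2), of p] h(2) hK ix2 by (simp add: f)
      have "f 0 * s 0 (f 2) = (h 0 * s 0 (h 2)) * inverse (x 2)" by (simp add: f mult_ac)
      also have "\<dots> = to_ac \<zeta> * (f 2 * s 2 (f 0))"
        unfolding h(5) using hK ix2 z by (simp add: f fhomD[OF s_hom K] mult_ac)
      finally show "f 0 * s 0 (f 2) = to_ac \<zeta> * (f 2 * s 2 (f 0))" .
      have "f 0 * s 0 (f 1) = (h 0 * s 0 (h 1)) * inverse (x 2)" by (simp only: f mult_ac)
      also have "\<dots> = f 1 * s 1 (f 0)"
        unfolding h(6) f fhomD(4)[OF s_hom_1 K hK(1) ix2(1)] ix2(3) by (simp only: mult_ac)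
      finally show "f 0 * s 0 (f 1) = f 1 * s 1 (f 0)" .
    qed (use h in \<open>simp_all add: f_def\<close>)
  }
qed

text \<open>Here the factor \<zeta> is absorbed at the other end: \<open>f 2\<close> is divided by
  \<open>x 0\<close>. When only the norm of \<open>f 2\<close> is prescribed to be nontrivial, this
  leaves a single symbol with second entry different from 1 in the triple product, whereas a change
  of \<open>f 0\<close> would leave two.\<close>

lemma obs_iff_hsys':
  "obs 1 1 w2 \<longleftrightarrow> (\<exists>h. hsys h (\<lambda>i. if i = 2 then w2 / a 0 else 1))"
proof
  have x0: "x 0 \<in> K" "x 0 \<noteq> 0" "s 0 (x 0) = to_ac \<zeta> * x 0" "s 1 (x 0) = x 0" "s 2 (x 0) = x 0"
    using xK x_nz s_x by auto
  have ix0: "inverse (x 0) \<in> K" "s 0 (inverse (x 0)) = inverse (to_ac \<zeta>) * inverse (x 0)"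
    "s 1 (inverse (x 0)) = inverse (x 0)" "s 2 (inverse (x 0)) = inverse (x 0)"
    using x0 subfldD(6)[OF K x0(1)] fhomD(6)[OF s_hom K x0(1)] by auto
  have z: "to_ac \<zeta> \<noteq> 0" using zeta_nz by simp
  {
    assume "obs 1 1 w2"
    then obtain f :: "nat \<Rightarrow> 'a alg_closure" where f: "\<forall>i<3. f i \<in> K \<and> f i \<noteq> 0"
      "nrm 0 (f 0) p = to_ac 1" "nrm 1 (f 1) p = to_ac 1" "nrm 2 (f 2) p = to_ac w2"
      "f 0 * s 0 (f 2) = to_ac \<zeta> * (f 2 * s 2 (f 0))"
      "f 0 * s 0 (f 1) = f 1 * s 1 (f 0)" "f 1 * s 1 (f 2) = f 2 * s 2 (f 1)" unfolding obs_def by blast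
    have fK: "f 0 \<in> K" "f 1 \<in> K" "f 2 \<in> K" using f(1) by auto
    define h where "h i = (if i = 2 then f 2 * inverse (x 0) else f i)" for i :: nat
    have h: "h 0 = f 0" "h 1 = f 1" "h 2 = f 2 * inverse (x 0)" by (simp_all add: h_def)
    have "hsys h (\<lambda>i. if i = 2 then w2 / a 0 else 1)"
      unfolding hsys_iff
    proof (intro conjI)
      show "\<forall>i<3. h i \<in> K \<and> h i \<noteq> 0" using f(1) x0 ix0 subfldD(4)[OF K] by (simp add: h_def)
      show "nrm 2 (h 2) p = to_ac (if (2::nat) = 2 then w2 / a 0 else 1)"
        using nrm_mult[of 2 "f 2" "inverse (x 0)" p] nrm_fixed[OF ix0(4), of p] f(4) x_pow[of 0] fK ix0
        by (simp add: h power_inverse divide_inverse)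
      have "h 0 * s 0 (h 2) = (f 0 * s 0 (f 2)) * (inverse (to_ac \<zeta>) * inverse (x 0))"
        using fK ix0 by (simp add: h fhomD[OF s_hom K] mult_ac)
      also have "\<dots> = h 2 * s 2 (h 0)" unfolding f(5) using z by (simp add: h mult_ac)
      finally show "h 0 * s 0 (h 2) = h 2 * s 2 (h 0)" .
      have "h 1 * s 1 (h 2) = (f 1 * s 1 (f 2)) * inverse (x 0)"
        unfolding h fhomD(4)[OF s_hom_1 K fK(3) ix0(1)] ix0(3) by (simp only: mult_ac)
      also have "\<dots> = h 2 * s 2 (h 1)" unfolding f(7) by (simp only: h mult_ac)
      finally show "h 1 * s 1 (h 2) = h 2 * s 2 (h 1)" .
    qed (use f in \<open>simp_all add: h_def\<close>)
    then show "\<exists>h. hsys h (\<lambda>i. if i = 2 then w2 / a 0 else 1)" by blast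
  }
  {
    assume "\<exists>h. hsys h (\<lambda>i. if i = 2 then w2 / a 0 else 1)"
    then obtain h :: "nat \<Rightarrow> 'a alg_closure" where h: "\<forall>i<3. h i \<in> K \<and> h i \<noteq> 0"
      "nrm 0 (h 0) p = to_ac 1" "nrm 1 (h 1) p = to_ac 1" "nrm 2 (h 2) p = to_ac (w2 / a 0)"
      "h 0 * s 0 (h 2) = h 2 * s 2 (h 0)"
      "h 0 * s 0 (h 1) = h 1 * s 1 (h 0)" "h 1 * s 1 (h 2) = h 2 * s 2 (h 1)" unfolding hsys_iff by auto
    have hK: "h 0 \<in> K" "h 1 \<in> K" "h 2 \<in> K" using h(1) by auto
    define f where "f i = (if i = 2 then h 2 * x 0 else h i)" for i :: nat
    have f: "f 0 = h 0" "f 1 = h 1" "f 2 = h 2 * x 0" by (simp_all add: f_def)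
    show "obs 1 1 w2"
      unfolding obs_def
    proof (intro exI[of _ f] conjI)
      show "\<forall>i<3. f i \<in> K \<and> f i \<noteq> 0" using h(1) x0 subfldD(4)[OF K] by (simp add: f_def)
      show "nrm 2 (f 2) p = to_ac w2"
        using nrm_mult[of 2 "h 2" "x 0" p] nrm_fixed[OF x0(5), of p] h(4) x_pow[of 0] a_nz[of 0] hK x0
        by (simp add: f)
      have "f 0 * s 0 (f 2) = to_ac \<zeta> * ((h 0 * s 0 (h 2)) * x 0)"
        using hK x0 by (simp add: f fhomD[OF s_hom K] mult_ac)
      also have "\<dots> = to_ac \<zeta> * (f 2 * s 2 (f 0))" unfolding h(5) by (simp add: f mult_ac)
      finally show "f 0 * s 0 (f 2) = to_ac \<zeta> * (f 2 * s 2 (f 0))" .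
      have "f 1 * s 1 (f 2) = (h 1 * s 1 (h 2)) * x 0"
        unfolding f fhomD(4)[OF s_hom_1 K hK(3) x0(1)] x0(4) by (simp only: mult_ac)
      also have "\<dots> = f 2 * s 2 (f 1)" unfolding h(7) by (simp only: f mult_ac)
      finally show "f 1 * s 1 (f 2) = f 2 * s 2 (f 1)" .
    qed (use h in \<open>simp_all add: f_def\<close>)
  }
qed

lemma ex_hsys_iff_split:
  assumes "\<And>i. i < 3 \<Longrightarrow> w i \<noteq> 0"
  shows "(\<exists>h. hsys h w) \<longleftrightarrow> split_algebra (triple w)"
  using hsys_if_split[of w] split_if_hsys[of _ w] assms by blast

lemma split_triple_iff:
  assumes "split_algebra (symb (a 2) (w 2))"
  shows "split_algebra (triple w) \<longleftrightarrow> split_algebra (tensor (symb (a 0) (w 0)) (symb (a 1) (w 1)))"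
proof -
  have "split_algebra (triple w) \<longleftrightarrow> split_algebra (tensor (tensor (symb (a 0) (w 0)) (symb (a 1) (w 1))) (symb (a 2) (w 2)))"
    by (intro split_algebra_cong alg_isomorphic_sym[OF tensor_assoc]) auto
  also have "\<dots> \<longleftrightarrow> split_algebra (tensor (symb (a 0) (w 0)) (symb (a 1) (w 1)))"
    by (rule split_algebra_tensor_right) (use assms in auto)
  finally show ?thesis .
qed

text \<open>With trivial norm at index 2 the third symbol has second entry 1 and splits off.\<close>

lemma obs_iff_split_two:
  assumes "w0 \<noteq> 0" "w1 \<noteq> 0"
  shows "obs w0 w1 1 \<longleftrightarrow> split_algebra (tensor (symb (a 0) (w0 * a 2)) (symb (a 1) w1))"
proof -
  let ?w = "\<lambda>i::nat. if i = 0 then w0 * a 2 else if i = 1 then w1 else 1"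
  have "obs w0 w1 1 \<longleftrightarrow> split_algebra (triple ?w)"
    unfolding obs_iff_hsys by (rule ex_hsys_iff_split) (use assms a_nz[of 2] in auto)
  also have "\<dots> \<longleftrightarrow> split_algebra (tensor (symb (a 0) (?w 0)) (symb (a 1) (?w 1)))"
    by (rule split_triple_iff) (use split_algebra_symb_one a_nz[of 2] in simp)
  finally show ?thesis by simp
qed

lemma obs_iff_split_one:
  assumes "w0 \<noteq> 0"
  shows "obs w0 1 1 \<longleftrightarrow> split_algebra (symb (a 0) (w0 * a 2))"
proof -
  have "obs w0 1 1 \<longleftrightarrow> split_algebra (tensor (symb (a 0) (w0 * a 2)) (symb (a 1) 1))"
    by (rule obs_iff_split_two) (use assms in auto)
  also have "\<dots> \<longleftrightarrow> split_algebra (symb (a 0) (w0 * a 2))"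
    by (rule split_algebra_tensor_right) (use split_algebra_symb_one a_nz[of 1] in auto)
  finally show ?thesis .
qed

text \<open>The remaining symbol has the entries \<open>a 2\<close> and \<open>w2 / a 0\<close>;
  \<open>symb_swap\<close> rewrites it with \<open>a 2\<close> in second place. For w2 = \<zeta>
  this is the element whose first entry carries \<zeta>^-1.\<close>

lemma obs_iff_split_swapped:
  assumes "w2 \<noteq> 0"
  shows "obs 1 1 w2 \<longleftrightarrow> split_algebra (symb (inverse w2 * a 0) (a 2))"
proof -
  let ?w = "\<lambda>i::nat. if i = 2 then w2 / a 0 else 1"
  have a: "a 0 \<noteq> 0" "a 1 \<noteq> 0" "a 2 \<noteq> 0" using a_nz by auto
  have "obs 1 1 w2 \<longleftrightarrow> split_algebra (triple ?w)"
    unfolding obs_iff_hsys' by (rule ex_hsys_iff_split) (use assms a in auto)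
  also have "\<dots> \<longleftrightarrow> split_algebra (tensor (tensor (symb (a 1) (?w 1)) (symb (a 2) (?w 2))) (symb (a 0) (?w 0)))"
    by (intro split_algebra_cong tensor_commute) auto
  also have "\<dots> \<longleftrightarrow> split_algebra (tensor (symb (a 1) (?w 1)) (symb (a 2) (?w 2)))"
    by (rule split_algebra_tensor_right) (use split_algebra_symb_one a in auto)
  also have "\<dots> \<longleftrightarrow> split_algebra (tensor (symb (a 2) (?w 2)) (symb (a 1) (?w 1)))"
    by (intro split_algebra_cong tensor_commute) auto
  also have "\<dots> \<longleftrightarrow> split_algebra (symb (a 2) (?w 2))"
    by (rule split_algebra_tensor_right) (use split_algebra_symb_one a in auto)
  also have "\<dots> \<longleftrightarrow> split_algebra (symb (inverse w2 * a 0) (a 2))"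
    using symb_swap[of "inverse w2 * a 0" "a 2"] assms a
    by (intro split_algebra_cong) (auto simp: field_simps)
  finally show ?thesis .
qed

end

text \<open>Exchanges the roles of \<alpha>1 and \<alpha>2. In the condition for \<beta>2 it is
  \<alpha>2 that fails to commute with \<alpha>, while \<open>obs\<close> has the generators 0 and 2
  in this position.\<close>

definition swap01 :: "nat \<Rightarrow> nat" where
  "swap01 i = (if i = 0 then 1 else if i = 1 then 0 else i)"

lemma kummer3_swap:
  assumes "kummer3 p \<zeta> K x s a"
  shows "kummer3 p \<zeta> K (x \<circ> swap01) (s \<circ> swap01) (a \<circ> swap01)"
proof -
  interpret kummer3 p \<zeta> K x s a by fact
  have t: "swap01 i < 3" if "i < 3" for i using that by (auto simp: swap01_def)
  have inj: "swap01 i = swap01 j \<longleftrightarrow> i = j" for i j by (auto simp: swap01_def)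
  have sur: "\<exists>j<3. i = swap01 j" if "i < 3" for i
    using that by (intro exI[of _ "swap01 i"]) (auto simp: swap01_def)
  show ?thesis
  proof unfold_locales
    show "y \<in> range to_ac" if "y \<in> K" "\<And>i. i < 3 \<Longrightarrow> (s \<circ> swap01) i y = y" for y
      using fixed[OF that(1)] that(2) sur by (metis comp_apply)
  qed (use K base sK s_hom s_base s_order s_comm xK x_nz x_pow s_x t inj in auto)
qed

section \<open>Normal forms\<close>

text \<open>The defining relations of the groups are stated pointwise for functions, so that the same normal forms serve
  for left translations of the abstract group and for automorphisms of a field.\<close>

locale pc_ops =
  fixes Y :: "'y set" and A1 A2 A B1 B2 :: "'y \<Rightarrow> 'y" and p c1 d1 c2 d2 c d :: nat
  assumes p_pos: "p > 0"
    and mem: "y \<in> Y \<Longrightarrow> A1 y \<in> Y" "y \<in> Y \<Longrightarrow> A2 y \<in> Y" "y \<in> Y \<Longrightarrow> A y \<in> Y" "y \<in> Y \<Longrightarrow> B1 y \<in> Y" "y \<in> Y \<Longrightarrow> B2 y \<in> Y"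
    and comm: "y \<in> Y \<Longrightarrow> A1 (A y) = A (A1 (B1 y))" "y \<in> Y \<Longrightarrow> A2 (A y) = A (A2 (B2 y))" "y \<in> Y \<Longrightarrow> A1 (A2 y) = A2 (A1 y)"
    and central: "y \<in> Y \<Longrightarrow> B1 (A1 y) = A1 (B1 y)" "y \<in> Y \<Longrightarrow> B1 (A2 y) = A2 (B1 y)" "y \<in> Y \<Longrightarrow> B1 (A y) = A (B1 y)"
      "y \<in> Y \<Longrightarrow> B2 (A1 y) = A1 (B2 y)" "y \<in> Y \<Longrightarrow> B2 (A2 y) = A2 (B2 y)" "y \<in> Y \<Longrightarrow> B2 (A y) = A (B2 y)"
      "y \<in> Y \<Longrightarrow> B2 (B1 y) = B1 (B2 y)"
    and B_pow: "y \<in> Y \<Longrightarrow> (B1 ^^ p) y = y" "y \<in> Y \<Longrightarrow> (B2 ^^ p) y = y"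
    and A_pow: "y \<in> Y \<Longrightarrow> (A1 ^^ p) y = (B1 ^^ c1) ((B2 ^^ d1) y)" "y \<in> Y \<Longrightarrow> (A2 ^^ p) y = (B1 ^^ c2) ((B2 ^^ d2) y)"
      "y \<in> Y \<Longrightarrow> (A ^^ p) y = (B1 ^^ c) ((B2 ^^ d) y)"
begin

lemma pow_mem:
  assumes "y \<in> Y"
  shows "(A1 ^^ n) y \<in> Y" "(A2 ^^ n) y \<in> Y" "(A ^^ n) y \<in> Y" "(B1 ^^ n) y \<in> Y" "(B2 ^^ n) y \<in> Y"
  using funpow_mem[of Y, OF _ assms] mem by blast+

lemma pow_add:
  "(A1 ^^ m) ((A1 ^^ n) y) = (A1 ^^ (m + n)) y" "(A2 ^^ m) ((A2 ^^ n) y) = (A2 ^^ (m + n)) y"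
  "(A ^^ m) ((A ^^ n) y) = (A ^^ (m + n)) y" "(B1 ^^ m) ((B1 ^^ n) y) = (B1 ^^ (m + n)) y"
  "(B2 ^^ m) ((B2 ^^ n) y) = (B2 ^^ (m + n)) y"
  by (simp_all add: funpow_add)

lemma pow_central:
  assumes "y \<in> Y"
  shows "(B1 ^^ m) ((A1 ^^ n) y) = (A1 ^^ n) ((B1 ^^ m) y)" "(B1 ^^ m) ((A2 ^^ n) y) = (A2 ^^ n) ((B1 ^^ m) y)"
    "(B1 ^^ m) ((A ^^ n) y) = (A ^^ n) ((B1 ^^ m) y)"
    "(B2 ^^ m) ((A1 ^^ n) y) = (A1 ^^ n) ((B2 ^^ m) y)" "(B2 ^^ m) ((A2 ^^ n) y) = (A2 ^^ n) ((B2 ^^ m) y)"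
    "(B2 ^^ m) ((A ^^ n) y) = (A ^^ n) ((B2 ^^ m) y)" "(B2 ^^ m) ((B1 ^^ n) y) = (B1 ^^ n) ((B2 ^^ m) y)"
    "(A2 ^^ m) ((A1 ^^ n) y) = (A1 ^^ n) ((A2 ^^ m) y)"
  by (rule funpow_commute_on[of Y, OF _ _ _ assms]; use mem central comm in simp)+

lemma B_mult: "y \<in> Y \<Longrightarrow> (B1 ^^ (p * q)) y = y" "y \<in> Y \<Longrightarrow> (B2 ^^ (p * q)) y = y"
  by (induction q) (simp_all add: funpow_add B_pow)

lemma B_mod: "y \<in> Y \<Longrightarrow> (B1 ^^ n) y = (B1 ^^ (n mod p)) y" "y \<in> Y \<Longrightarrow> (B2 ^^ n) y = (B2 ^^ (n mod p)) y"
proof -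
  assume y: "y \<in> Y"
  show "(B1 ^^ n) y = (B1 ^^ (n mod p)) y"
    using pow_add(4)[of "n mod p" "p * (n div p)" y] B_mult(1)[OF y] by simp
  show "(B2 ^^ n) y = (B2 ^^ (n mod p)) y"
    using pow_add(5)[of "n mod p" "p * (n div p)" y] B_mult(2)[OF y] by simp
qed

text \<open>The inverses of \<open>B1\<close> and \<open>B2\<close> are written as their powers with
  exponent \<open>p - 1\<close>, so that all exponents are natural numbers.\<close>

lemma A_comm: "y \<in> Y \<Longrightarrow> A (A1 y) = A1 (A ((B1 ^^ (p - 1)) y))" "y \<in> Y \<Longrightarrow> A (A2 y) = A2 (A ((B2 ^^ (p - 1)) y))"
proof -
  assume y: "y \<in> Y"
  have 1: "B1 ((B1 ^^ (p - 1)) y) = y" "B2 ((B2 ^^ (p - 1)) y) = y"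
    using B_pow[OF y] p_pos by (metis Suc_diff_1 comp_apply funpow.simps(2))+
  show "A (A1 y) = A1 (A ((B1 ^^ (p - 1)) y))" "A (A2 y) = A2 (A ((B2 ^^ (p - 1)) y))"
    using comm(1,2)[OF pow_mem(4)[OF y]] comm(1,2)[OF pow_mem(5)[OF y]] 1 by simp_all
qed

lemma A_comm_pow1: "y \<in> Y \<Longrightarrow> A ((A1 ^^ i) y) = (A1 ^^ i) (A ((B1 ^^ ((p - 1) * i)) y))"
proof (induction i arbitrary: y)
  case (Suc i)
  have "A ((A1 ^^ Suc i) y) = A ((A1 ^^ i) (A1 y))" by (simp add: funpow_swap1)
  also have "\<dots> = (A1 ^^ i) (A ((B1 ^^ ((p - 1) * i)) (A1 y)))" by (rule Suc.IH) (use Suc.prems mem in simp)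
  also have "(B1 ^^ ((p - 1) * i)) (A1 y) = A1 ((B1 ^^ ((p - 1) * i)) y)"
    using pow_central(1)[OF Suc.prems, of "(p - 1) * i" 1] by simp
  also have "A (A1 ((B1 ^^ ((p - 1) * i)) y)) = A1 (A ((B1 ^^ (p - 1)) ((B1 ^^ ((p - 1) * i)) y)))"
    by (rule A_comm(1)[OF pow_mem(4)[OF Suc.prems]])
  also have "(A1 ^^ i) (A1 (A ((B1 ^^ (p - 1)) ((B1 ^^ ((p - 1) * i)) y)))) = (A1 ^^ Suc i) (A ((B1 ^^ ((p - 1) * Suc i)) y))"
    unfolding pow_add by (simp add: funpow_swap1)
  finally show ?case .
qed simp

lemma A_comm_pow2: "y \<in> Y \<Longrightarrow> A ((A2 ^^ i) y) = (A2 ^^ i) (A ((B2 ^^ ((p - 1) * i)) y))"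
proof (induction i arbitrary: y)
  case (Suc i)
  have "A ((A2 ^^ Suc i) y) = A ((A2 ^^ i) (A2 y))" by (simp add: funpow_swap1)
  also have "\<dots> = (A2 ^^ i) (A ((B2 ^^ ((p - 1) * i)) (A2 y)))" by (rule Suc.IH) (use Suc.prems mem in simp)
  also have "(B2 ^^ ((p - 1) * i)) (A2 y) = A2 ((B2 ^^ ((p - 1) * i)) y)"
    using pow_central(5)[OF Suc.prems, of "(p - 1) * i" 1] by simp
  also have "A (A2 ((B2 ^^ ((p - 1) * i)) y)) = A2 (A ((B2 ^^ (p - 1)) ((B2 ^^ ((p - 1) * i)) y)))"
    by (rule A_comm(2)[OF pow_mem(5)[OF Suc.prems]])
  also have "(A2 ^^ i) (A2 (A ((B2 ^^ (p - 1)) ((B2 ^^ ((p - 1) * i)) y)))) = (A2 ^^ Suc i) (A ((B2 ^^ ((p - 1) * Suc i)) y))"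
    unfolding pow_add by (simp add: funpow_swap1)
  finally show ?case .
qed simp

lemma A_pow_comm1: "y \<in> Y \<Longrightarrow> (A ^^ l) ((A1 ^^ i) y) = (A1 ^^ i) ((A ^^ l) ((B1 ^^ ((p - 1) * i * l)) y))"
proof (induction l)
  case (Suc l)
  have yB: "(B1 ^^ ((p - 1) * i * l)) y \<in> Y" by (rule pow_mem(4)[OF Suc.prems])
  have "(A ^^ Suc l) ((A1 ^^ i) y) = A ((A1 ^^ i) ((A ^^ l) ((B1 ^^ ((p - 1) * i * l)) y)))" using Suc by simp
  also have "\<dots> = (A1 ^^ i) (A ((B1 ^^ ((p - 1) * i)) ((A ^^ l) ((B1 ^^ ((p - 1) * i * l)) y))))"
    by (rule A_comm_pow1[OF pow_mem(3)[OF yB]])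
  also have "(B1 ^^ ((p - 1) * i)) ((A ^^ l) ((B1 ^^ ((p - 1) * i * l)) y)) = (A ^^ l) ((B1 ^^ ((p - 1) * i * Suc l)) y)"
    unfolding pow_central(3)[OF yB] pow_add by simp
  finally show ?case by simp
qed simp

lemma A_pow_comm2: "y \<in> Y \<Longrightarrow> (A ^^ l) ((A2 ^^ i) y) = (A2 ^^ i) ((A ^^ l) ((B2 ^^ ((p - 1) * i * l)) y))"
proof (induction l)
  case (Suc l)
  have yB: "(B2 ^^ ((p - 1) * i * l)) y \<in> Y" by (rule pow_mem(5)[OF Suc.prems])
  have "(A ^^ Suc l) ((A2 ^^ i) y) = A ((A2 ^^ i) ((A ^^ l) ((B2 ^^ ((p - 1) * i * l)) y)))" using Suc by simp
  also have "\<dots> = (A2 ^^ i) (A ((B2 ^^ ((p - 1) * i)) ((A ^^ l) ((B2 ^^ ((p - 1) * i * l)) y))))"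
    by (rule A_comm_pow2[OF pow_mem(3)[OF yB]])
  also have "(B2 ^^ ((p - 1) * i)) ((A ^^ l) ((B2 ^^ ((p - 1) * i * l)) y)) = (A ^^ l) ((B2 ^^ ((p - 1) * i * Suc l)) y)"
    unfolding pow_central(6)[OF yB] pow_add by simp
  finally show ?case by simp
qed simp

definition nf :: "nat \<times> nat \<times> nat \<times> nat \<times> nat \<Rightarrow> 'y \<Rightarrow> 'y" where
  "nf v y = (case v of (i, j, l, s, t) \<Rightarrow> (A1 ^^ i) ((A2 ^^ j) ((A ^^ l) ((B1 ^^ s) ((B2 ^^ t) y)))))"

end

text \<open>The product of two normal forms before reduction. Moving \<open>A ^^ l\<close> past
  \<open>A1 ^^ i'\<close> leaves a factor \<open>B1\<close> with exponent
  \<open>(p - 1) * i' * l\<close>, and likewise for \<open>A2\<close> and \<open>B2\<close>.\<close>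

definition nf_mult :: "nat \<Rightarrow> nat \<times> nat \<times> nat \<times> nat \<times> nat \<Rightarrow> nat \<times> nat \<times> nat \<times> nat \<times> nat \<Rightarrow> nat \<times> nat \<times> nat \<times> nat \<times> nat" where
  "nf_mult p v w = (case v of (i, j, l, s, t) \<Rightarrow> case w of (i', j', l', s', t') \<Rightarrow>
     (i + i', j + j', l + l', s + s' + (p - 1) * i' * l, t + t' + (p - 1) * j' * l))"

text \<open>Each full block of \<open>p\<close> factors \<open>A1\<close>, \<open>A2\<close> or
  \<open>A\<close> is replaced by the powers of \<open>B1\<close> and \<open>B2\<close> that the
  relations prescribe; all exponents are then reduced modulo \<open>p\<close>.\<close>

definition nf_red :: "nat \<Rightarrow> nat \<Rightarrow> nat \<Rightarrow> nat \<Rightarrow> nat \<Rightarrow> nat \<Rightarrow> nat \<Rightarrow> nat \<times> nat \<times> nat \<times> nat \<times> nat \<Rightarrow> nat \<times> nat \<times> nat \<times> nat \<times> nat" where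
  "nf_red p c1 d1 c2 d2 c d v = (case v of (i, j, l, s, t) \<Rightarrow>
     (i mod p, j mod p, l mod p,
      (c1 * (i div p) + c2 * (j div p) + c * (l div p) + s) mod p,
      (d1 * (i div p) + d2 * (j div p) + d * (l div p) + t) mod p))"

abbreviation nf_box :: "nat \<Rightarrow> (nat \<times> nat \<times> nat \<times> nat \<times> nat) set" where
  "nf_box p \<equiv> {..<p} \<times> {..<p} \<times> {..<p} \<times> {..<p} \<times> {..<p}"

lemma nf_red_in_box: "p > 0 \<Longrightarrow> nf_red p c1 d1 c2 d2 c d v \<in> nf_box p"
  by (auto simp: nf_red_def split: prod.splits)

context pc_ops
begin

lemma nf_mem: "y \<in> Y \<Longrightarrow> nf v y \<in> Y"
  by (simp add: nf_def pow_mem split: prod.splits)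

lemma nf_nf:
  assumes "y \<in> Y"
  shows "nf v (nf w y) = nf (nf_mult p v w) y"
proof -
  obtain i j l s t i' j' l' s' t' where vw: "v = (i, j, l, s, t)" "w = (i', j', l', s', t')"
    by (metis prod_cases5)
  show ?thesis
    using assms by (simp add: vw nf_def nf_mult_def pow_mem pow_central A_pow_comm1 A_pow_comm2 pow_add add_ac mult_ac)
qed

lemma A1_div: "y \<in> Y \<Longrightarrow> (A1 ^^ n) y = (A1 ^^ (n mod p)) ((B1 ^^ (c1 * (n div p))) ((B2 ^^ (d1 * (n div p))) y))"
proof -
  assume y: "y \<in> Y"
  have "(A1 ^^ (p * q)) y = (B1 ^^ (c1 * q)) ((B2 ^^ (d1 * q)) y)" for q
  proof (induction q)
    case (Suc q)
    have "(A1 ^^ (p * Suc q)) y = (A1 ^^ p) ((A1 ^^ (p * q)) y)" unfolding pow_add by simp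
    also have "\<dots> = (B1 ^^ c1) ((B2 ^^ d1) ((B1 ^^ (c1 * q)) ((B2 ^^ (d1 * q)) y)))"
      unfolding Suc using y by (intro A_pow pow_mem)
    finally show ?case using y by (simp add: pow_central pow_mem pow_add add_ac)
  qed simp
  then show ?thesis using pow_add(1)[of "n mod p" "p * (n div p)" y] by simp
qed

lemma A2_div: "y \<in> Y \<Longrightarrow> (A2 ^^ n) y = (A2 ^^ (n mod p)) ((B1 ^^ (c2 * (n div p))) ((B2 ^^ (d2 * (n div p))) y))"
proof -
  assume y: "y \<in> Y"
  have "(A2 ^^ (p * q)) y = (B1 ^^ (c2 * q)) ((B2 ^^ (d2 * q)) y)" for q
  proof (induction q)
    case (Suc q)
    have "(A2 ^^ (p * Suc q)) y = (A2 ^^ p) ((A2 ^^ (p * q)) y)" unfolding pow_add by simp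
    also have "\<dots> = (B1 ^^ c2) ((B2 ^^ d2) ((B1 ^^ (c2 * q)) ((B2 ^^ (d2 * q)) y)))"
      unfolding Suc using y by (intro A_pow pow_mem)
    finally show ?case using y by (simp add: pow_central pow_mem pow_add add_ac)
  qed simp
  then show ?thesis using pow_add(2)[of "n mod p" "p * (n div p)" y] by simp
qed

lemma A_div: "y \<in> Y \<Longrightarrow> (A ^^ n) y = (A ^^ (n mod p)) ((B1 ^^ (c * (n div p))) ((B2 ^^ (d * (n div p))) y))"
proof -
  assume y: "y \<in> Y"
  have "(A ^^ (p * q)) y = (B1 ^^ (c * q)) ((B2 ^^ (d * q)) y)" for q
  proof (induction q)
    case (Suc q)
    have "(A ^^ (p * Suc q)) y = (A ^^ p) ((A ^^ (p * q)) y)" unfolding pow_add by simp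
    also have "\<dots> = (B1 ^^ c) ((B2 ^^ d) ((B1 ^^ (c * q)) ((B2 ^^ (d * q)) y)))"
      unfolding Suc using y by (intro A_pow pow_mem)
    finally show ?case using y by (simp add: pow_central pow_mem pow_add add_ac)
  qed simp
  then show ?thesis using pow_add(3)[of "n mod p" "p * (n div p)" y] by simp
qed

lemma nf_red:
  assumes y: "y \<in> Y"
  shows "nf v y = nf (nf_red p c1 d1 c2 d2 c d v) y"
proof -
  obtain i j l s t where v: "v = (i, j, l, s, t)" by (metis prod_cases5)
  have "nf v y = (A1 ^^ i) ((A2 ^^ j) ((A ^^ l) ((B1 ^^ s) ((B2 ^^ t) y))))" by (simp add: v nf_def)
  also have "\<dots> = (A1 ^^ (i mod p)) ((B1 ^^ (c1 * (i div p))) ((B2 ^^ (d1 * (i div p)))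
     ((A2 ^^ (j mod p)) ((B1 ^^ (c2 * (j div p))) ((B2 ^^ (d2 * (j div p)))
     ((A ^^ (l mod p)) ((B1 ^^ (c * (l div p))) ((B2 ^^ (d * (l div p))) ((B1 ^^ s) ((B2 ^^ t) y))))))))))"
    using y by (simp only: A1_div[symmetric] A2_div[symmetric] A_div[symmetric] pow_mem)
  also have "\<dots> = (A1 ^^ (i mod p)) ((A2 ^^ (j mod p)) ((A ^^ (l mod p))
     ((B1 ^^ (c1 * (i div p) + c2 * (j div p) + c * (l div p) + s)) ((B2 ^^ (d1 * (i div p) + d2 * (j div p) + d * (l div p) + t)) y))))"
    using y by (simp only: pow_central pow_mem pow_add add.assoc)
  also have "\<dots> = nf (nf_red p c1 d1 c2 d2 c d v) y"
    using y B_mod(2)[OF y, of "d1 * (i div p) + d2 * (j div p) + d * (l div p) + t"]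
      B_mod(1)[OF pow_mem(5)[OF y], of "c1 * (i div p) + c2 * (j div p) + c * (l div p) + s"]
    by (simp add: v nf_def nf_red_def)
  finally show ?thesis .
qed

end

section \<open>Normal forms in the groups\<close>

lemma commutator_eqD:
  assumes "group G" "x \<in> carrier G" "y \<in> carrier G" "commutator G x y = z"
  shows "x \<otimes>\<^bsub>G\<^esub> y = y \<otimes>\<^bsub>G\<^esub> (x \<otimes>\<^bsub>G\<^esub> z)"
proof -
  interpret group G by fact
  have "u \<otimes>\<^bsub>G\<^esub> (inv\<^bsub>G\<^esub> u \<otimes>\<^bsub>G\<^esub> v) = v" if "u \<in> carrier G" "v \<in> carrier G" for u v
    using that by (simp add: m_assoc[symmetric])
  then show ?thesis using assms(2-4) by (auto simp: commutator_def m_assoc)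
qed

lemma funpow_left_mult:
  assumes "group G" "x \<in> carrier G" "y \<in> carrier G"
  shows "((\<lambda>y. x \<otimes>\<^bsub>G\<^esub> y) ^^ n) y = x [^]\<^bsub>G\<^esub> n \<otimes>\<^bsub>G\<^esub> y"
proof -
  interpret group G by fact
  show ?thesis
  proof (induction n)
    case (Suc n)
    then show ?case using assms(2,3) nat_pow_Suc2[OF assms(2), of n] by (simp add: m_assoc del: nat_pow_Suc)
  qed (use assms in simp)
qed

text \<open>All groups of the theorem are instances and differ only in the six exponents:
  \<open>c1\<close>, \<open>c2\<close>, \<open>c\<close> are those of \<beta>1, and
  \<open>d1\<close>, \<open>d2\<close>, \<open>d\<close> those of \<beta>2.\<close>

locale phi4 = group G for G (structure) +
  fixes p :: nat and \<alpha> \<alpha>1 \<alpha>2 \<beta>1 \<beta>2 and c1 d1 c2 d2 c d :: nat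
  assumes gens: "Phi4_generators p G \<alpha> \<alpha>1 \<alpha>2 \<beta>1 \<beta>2" and p_gt_1: "p > 1"
    and pow1: "\<alpha>1 [^] p = \<beta>1 [^] c1 \<otimes> \<beta>2 [^] d1"
    and pow2: "\<alpha>2 [^] p = \<beta>1 [^] c2 \<otimes> \<beta>2 [^] d2"
    and pow3: "\<alpha> [^] p = \<beta>1 [^] c \<otimes> \<beta>2 [^] d"
begin

lemma in_carrier: "\<alpha> \<in> carrier G" "\<alpha>1 \<in> carrier G" "\<alpha>2 \<in> carrier G" "\<beta>1 \<in> carrier G" "\<beta>2 \<in> carrier G"
  using gens by (auto simp: Phi4_generators_def)

lemma order_G: "Coset.order G = p ^ 5" and gen_G: "generate G {\<alpha>, \<alpha>1, \<alpha>2, \<beta>1, \<beta>2} = carrier G"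
  and beta_pow: "\<beta>1 [^] p = \<one>" "\<beta>2 [^] p = \<one>"
  using gens by (auto simp: Phi4_generators_def)

lemma rels:
  "\<alpha>1 \<otimes> \<alpha> = \<alpha> \<otimes> (\<alpha>1 \<otimes> \<beta>1)" "\<alpha>2 \<otimes> \<alpha> = \<alpha> \<otimes> (\<alpha>2 \<otimes> \<beta>2)" "\<alpha>1 \<otimes> \<alpha>2 = \<alpha>2 \<otimes> \<alpha>1"
  "\<alpha>1 \<otimes> \<beta>1 = \<beta>1 \<otimes> \<alpha>1" "\<alpha>2 \<otimes> \<beta>1 = \<beta>1 \<otimes> \<alpha>2" "\<alpha> \<otimes> \<beta>1 = \<beta>1 \<otimes> \<alpha>"
  "\<alpha>1 \<otimes> \<beta>2 = \<beta>2 \<otimes> \<alpha>1" "\<alpha>2 \<otimes> \<beta>2 = \<beta>2 \<otimes> \<alpha>2" "\<alpha> \<otimes> \<beta>2 = \<beta>2 \<otimes> \<alpha>" "\<beta>1 \<otimes> \<beta>2 = \<beta>2 \<otimes> \<beta>1"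
proof -
  have C: "commutator G \<alpha>1 \<alpha> = \<beta>1" "commutator G \<alpha>2 \<alpha> = \<beta>2" "commutator G \<alpha>1 \<alpha>2 = \<one>"
    "commutator G \<alpha>1 \<beta>1 = \<one>" "commutator G \<alpha>2 \<beta>1 = \<one>" "commutator G \<alpha> \<beta>1 = \<one>"
    "commutator G \<alpha>1 \<beta>2 = \<one>" "commutator G \<alpha>2 \<beta>2 = \<one>" "commutator G \<alpha> \<beta>2 = \<one>" "commutator G \<beta>1 \<beta>2 = \<one>"
    using gens by (auto simp: Phi4_generators_def)
  note D = commutator_eqD[OF is_group]
  show "\<alpha>1 \<otimes> \<alpha> = \<alpha> \<otimes> (\<alpha>1 \<otimes> \<beta>1)" "\<alpha>2 \<otimes> \<alpha> = \<alpha> \<otimes> (\<alpha>2 \<otimes> \<beta>2)" "\<alpha>1 \<otimes> \<alpha>2 = \<alpha>2 \<otimes> \<alpha>1"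
    "\<alpha>1 \<otimes> \<beta>1 = \<beta>1 \<otimes> \<alpha>1" "\<alpha>2 \<otimes> \<beta>1 = \<beta>1 \<otimes> \<alpha>2" "\<alpha> \<otimes> \<beta>1 = \<beta>1 \<otimes> \<alpha>"
    "\<alpha>1 \<otimes> \<beta>2 = \<beta>2 \<otimes> \<alpha>1" "\<alpha>2 \<otimes> \<beta>2 = \<beta>2 \<otimes> \<alpha>2" "\<alpha> \<otimes> \<beta>2 = \<beta>2 \<otimes> \<alpha>" "\<beta>1 \<otimes> \<beta>2 = \<beta>2 \<otimes> \<beta>1"
    using C[THEN D[rotated 2]] in_carrier by simp_all
qed

abbreviation "mul g \<equiv> (\<lambda>y. g \<otimes> y)"

sublocale ops: pc_ops "carrier G" "mul \<alpha>1" "mul \<alpha>2" "mul \<alpha>" "mul \<beta>1" "mul \<beta>2" p c1 d1 c2 d2 c d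
proof -
  have as: "u \<otimes> (v \<otimes> y) = u \<otimes> v \<otimes> y" if "u \<in> carrier G" "v \<in> carrier G" "y \<in> carrier G" for u v y
    using that by (simp add: m_assoc)
  note fp = funpow_left_mult[OF is_group]
  show "pc_ops (carrier G) (mul \<alpha>1) (mul \<alpha>2) (mul \<alpha>) (mul \<beta>1) (mul \<beta>2) p c1 d1 c2 d2 c d"
  proof
    show "p > 0" using p_gt_1 by simp
    fix y assume y: "y \<in> carrier G"
    note i = in_carrier y
    show "\<alpha>1 \<otimes> y \<in> carrier G" "\<alpha>2 \<otimes> y \<in> carrier G" "\<alpha> \<otimes> y \<in> carrier G" "\<beta>1 \<otimes> y \<in> carrier G" "\<beta>2 \<otimes> y \<in> carrier G"
      using i by simp_all
    show "\<alpha>1 \<otimes> (\<alpha> \<otimes> y) = \<alpha> \<otimes> (\<alpha>1 \<otimes> (\<beta>1 \<otimes> y))" "\<alpha>2 \<otimes> (\<alpha> \<otimes> y) = \<alpha> \<otimes> (\<alpha>2 \<otimes> (\<beta>2 \<otimes> y))"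
      "\<alpha>1 \<otimes> (\<alpha>2 \<otimes> y) = \<alpha>2 \<otimes> (\<alpha>1 \<otimes> y)"
      using i as rels(1-3) by simp_all
    show "\<beta>1 \<otimes> (\<alpha>1 \<otimes> y) = \<alpha>1 \<otimes> (\<beta>1 \<otimes> y)" "\<beta>1 \<otimes> (\<alpha>2 \<otimes> y) = \<alpha>2 \<otimes> (\<beta>1 \<otimes> y)" "\<beta>1 \<otimes> (\<alpha> \<otimes> y) = \<alpha> \<otimes> (\<beta>1 \<otimes> y)"
      "\<beta>2 \<otimes> (\<alpha>1 \<otimes> y) = \<alpha>1 \<otimes> (\<beta>2 \<otimes> y)" "\<beta>2 \<otimes> (\<alpha>2 \<otimes> y) = \<alpha>2 \<otimes> (\<beta>2 \<otimes> y)" "\<beta>2 \<otimes> (\<alpha> \<otimes> y) = \<alpha> \<otimes> (\<beta>2 \<otimes> y)"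
      "\<beta>2 \<otimes> (\<beta>1 \<otimes> y) = \<beta>1 \<otimes> (\<beta>2 \<otimes> y)"
      using i as rels(4-10) by simp_all
    show "(mul \<beta>1 ^^ p) y = y" "(mul \<beta>2 ^^ p) y = y"
      using i by (simp_all add: fp beta_pow)
    show "(mul \<alpha>1 ^^ p) y = (mul \<beta>1 ^^ c1) ((mul \<beta>2 ^^ d1) y)"
      "(mul \<alpha>2 ^^ p) y = (mul \<beta>1 ^^ c2) ((mul \<beta>2 ^^ d2) y)"
      "(mul \<alpha> ^^ p) y = (mul \<beta>1 ^^ c) ((mul \<beta>2 ^^ d) y)"
      using i by (simp_all add: fp pow1 pow2 pow3 m_assoc)
  qed
qed

definition \<phi> :: "nat \<times> nat \<times> nat \<times> nat \<times> nat \<Rightarrow> 'a" where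
  "\<phi> v = ops.nf v \<one>"

lemma phi_in: "\<phi> v \<in> carrier G" unfolding \<phi>_def by (rule ops.nf_mem) simp

lemma nf_eq_phi: "y \<in> carrier G \<Longrightarrow> ops.nf v y = \<phi> v \<otimes> y"
  using in_carrier
  by (simp add: \<phi>_def ops.nf_def funpow_left_mult[OF is_group] m_assoc split: prod.splits)

lemma phi_mult: "\<phi> v \<otimes> \<phi> w = \<phi> (nf_red p c1 d1 c2 d2 c d (nf_mult p v w))"
proof -
  have "\<phi> v \<otimes> \<phi> w = ops.nf v (\<phi> w)" by (rule nf_eq_phi[OF phi_in, symmetric])
  also have "\<dots> = ops.nf (nf_mult p v w) \<one>" unfolding \<phi>_def by (rule ops.nf_nf) simp
  also have "\<dots> = ops.nf (nf_red p c1 d1 c2 d2 c d (nf_mult p v w)) \<one>" by (rule ops.nf_red) simp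
  finally show ?thesis by (simp add: \<phi>_def)
qed

lemma phi_gens: "\<phi> (1, 0, 0, 0, 0) = \<alpha>1" "\<phi> (0, 1, 0, 0, 0) = \<alpha>2" "\<phi> (0, 0, 1, 0, 0) = \<alpha>"
  "\<phi> (0, 0, 0, 1, 0) = \<beta>1" "\<phi> (0, 0, 0, 0, 1) = \<beta>2" "\<phi> (0, 0, 0, 0, 0) = \<one>"
  using in_carrier by (simp_all add: \<phi>_def ops.nf_def)

text \<open>The normal forms are closed under products and contain the generators, so they exhaust
  the finite group \<open>G\<close>. There are p^5 exponent vectors, as many as elements of
  \<open>G\<close>, so each element has exactly one.\<close>

lemma phi_bij: "bij_betw \<phi> (nf_box p) (carrier G)"
proof -
  have p: "p > 0" using p_gt_1 by simp
  have fin: "finite (carrier G)" using order_G p by (intro card_ge_0_finite) (simp add: Coset.order_def)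
  have sub: "\<phi> ` nf_box p \<subseteq> carrier G" using phi_in by blast
  have box: "\<phi> v \<in> \<phi> ` nf_box p" for v
    using ops.nf_red[of \<one> v] nf_red_in_box[OF p] unfolding \<phi>_def by (metis imageI one_closed)
  have "subgroup (\<phi> ` nf_box p) G"
  proof (rule subgroupI)
    show "\<phi> ` nf_box p \<subseteq> carrier G" by (rule sub)
    show "\<phi> ` nf_box p \<noteq> {}" using p by auto
    show mult: "x \<otimes> y \<in> \<phi> ` nf_box p" if "x \<in> \<phi> ` nf_box p" "y \<in> \<phi> ` nf_box p" for x y
    proof -
      from that obtain v w where "x = \<phi> v" "y = \<phi> w" by blast
      then show ?thesis using phi_mult[of v w] box by simp
    qed
    \<comment> \<open>In a finite group the inverse is a power, so closure under products
      suffices.\<close>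
    show "inv x \<in> \<phi> ` nf_box p" if x: "x \<in> \<phi> ` nf_box p" for x
    proof -
      have xG: "x \<in> carrier G" by (rule subsetD[OF sub x])
      have pw: "x [^] (n::nat) \<in> \<phi> ` nf_box p" for n
      proof (induction n)
        case 0
        then show ?case using box[of "(0, 0, 0, 0, 0)"] by (simp add: phi_gens)
      next
        case (Suc n)
        then show ?case using mult x by simp
      qed
      have "x [^] (Coset.order G - 1) \<otimes> x = x [^] Suc (Coset.order G - 1)" by simp
      also have "Suc (Coset.order G - 1) = Coset.order G" using order_G p by simp
      finally have "x [^] (Coset.order G - 1) \<otimes> x = \<one>" using pow_order_eq_1[OF xG] by simp
      then have "inv x = x [^] (Coset.order G - 1)" using xG by (intro inv_equality) auto
      then show ?thesis using pw by simp
    qed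
  qed
  moreover have "{\<alpha>, \<alpha>1, \<alpha>2, \<beta>1, \<beta>2} \<subseteq> \<phi> ` nf_box p"
    using box[of "(1, 0, 0, 0, 0)"] box[of "(0, 1, 0, 0, 0)"] box[of "(0, 0, 1, 0, 0)"]
      box[of "(0, 0, 0, 1, 0)"] box[of "(0, 0, 0, 0, 1)"]
    unfolding phi_gens by simp
  ultimately have "carrier G \<subseteq> \<phi> ` nf_box p"
    using gen_G generate_subgroup_incl by blast
  then have img: "\<phi> ` nf_box p = carrier G" using sub by blast
  have "card (nf_box p) = p ^ 5" by (simp add: card_cartesian_product power_def numeral_eq_Suc)
  then have "inj_on \<phi> (nf_box p)"
    using order_G img by (intro eq_card_imp_inj_on) (simp_all add: Coset.order_def)
  then show ?thesis using img by (simp add: bij_betw_def)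
qed

end

section \<open>Galois groups\<close>

text \<open>Artin's argument: from the relation at \<open>z * y\<close> subtract
  \<open>\<chi> k z\<close> times the relation at \<open>y\<close>. This removes
  \<open>\<chi> k\<close> and multiplies the coefficient of each other \<open>\<chi> i\<close> by a
  difference that is nonzero for suitable \<open>z\<close>.\<close>

lemma dedekind_independence:
  fixes \<chi> :: "'i \<Rightarrow> 'b::field \<Rightarrow> 'c::field"
  assumes "finite S" and "1 \<in> E" and closed: "\<And>y z. y \<in> E \<Longrightarrow> z \<in> E \<Longrightarrow> y * z \<in> E"
    and "\<And>i. i \<in> S \<Longrightarrow> \<chi> i 1 = 1"
    and "\<And>i y z. i \<in> S \<Longrightarrow> y \<in> E \<Longrightarrow> z \<in> E \<Longrightarrow> \<chi> i (y * z) = \<chi> i y * \<chi> i z"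
    and "\<And>i j. i \<in> S \<Longrightarrow> j \<in> S \<Longrightarrow> i \<noteq> j \<Longrightarrow> \<exists>y\<in>E. \<chi> i y \<noteq> \<chi> j y"
    and "\<And>y. y \<in> E \<Longrightarrow> (\<Sum>i\<in>S. c i * \<chi> i y) = 0" and "i \<in> S"
  shows "c i = 0"
  using assms(1,4-8)
proof (induction S arbitrary: c i rule: finite_induct)
  case (insert k S)
  have sum0: "c k * \<chi> k y + (\<Sum>i\<in>S. c i * \<chi> i y) = 0" if "y \<in> E" for y
    using insert.prems(4)[OF that] insert.hyps by simp
  have z: "c i = 0" if i: "i \<in> S" for i
  proof -
    have *: "c i * (\<chi> i z - \<chi> k z) = 0" if z: "z \<in> E" for z
    proof (rule insert.IH[OF _ _ _ _ i])
      fix y assume y: "y \<in> E"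
      have "(\<Sum>i\<in>S. c i * (\<chi> i z - \<chi> k z) * \<chi> i y)
          = (\<Sum>i\<in>S. c i * \<chi> i (z * y)) - \<chi> k z * (\<Sum>i\<in>S. c i * \<chi> i y)"
        using y z insert.prems(2)
        by (simp add: sum_distrib_left flip: sum_subtractf) (intro sum.cong, auto simp: algebra_simps)
      also have "\<dots> = 0"
      proof -
        have "(\<Sum>i\<in>S. c i * \<chi> i (z * y)) = - (c k * (\<chi> k z * \<chi> k y))"
          using sum0[OF closed[OF z y]] insert.prems(2)[of k z y] z y by (simp add: eq_neg_iff_add_eq_0 add.commute)
        moreover have "(\<Sum>i\<in>S. c i * \<chi> i y) = - (c k * \<chi> k y)"
          using sum0[OF y] by (simp add: eq_neg_iff_add_eq_0 add.commute)
        ultimately show ?thesis by simp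
      qed
      finally show "(\<Sum>i\<in>S. c i * (\<chi> i z - \<chi> k z) * \<chi> i y) = 0" .
    qed (use insert.prems in auto)
    obtain z where z: "z \<in> E" "\<chi> i z \<noteq> \<chi> k z" using insert.prems(3)[of i k] i insert.hyps by auto
    show ?thesis using *[OF z(1)] z(2) by simp
  qed
  moreover have "c k = 0" using sum0[OF \<open>1 \<in> E\<close>] z insert.prems(1)[of k] by simp
  ultimately show ?case using insert.prems(5) by auto
qed simp

lemma subfield_iff_subfld: "subfield M ring_of_type_algebra \<longleftrightarrow> subfld (M :: 'b::field set)"
proof -
  interpret R: field "ring_of_type_algebra :: 'b ring" by (rule field_from_type_algebra)
  let ?R = "ring_of_type_algebra :: 'b ring"
  have [simp]: "x \<otimes>\<^bsub>?R\<^esub> y = x * y" "x \<oplus>\<^bsub>?R\<^esub> y = x + y" "\<zero>\<^bsub>?R\<^esub> = 0" "\<one>\<^bsub>?R\<^esub> = 1" "carrier ?R = UNIV" for x y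
    by (simp_all add: ring_of_type_algebra_def)
  have neg: "\<ominus>\<^bsub>?R\<^esub> x = - x" for x
    by (rule R.minus_equality) simp_all
  have inv: "inv\<^bsub>?R\<^esub> x = inverse x" if "x \<noteq> 0" for x
    by (rule R.comm_inv_char) (use that in simp_all)
  show ?thesis
  proof
    assume M: "subfield M ?R"
    note E = subringE[OF subfieldE(1)[OF M]]
    have "inverse x \<in> M" if "x \<in> M" for x
      using R.subfield_m_inv(1)[OF M, of x] that inv E(2) by (cases "x = 0") auto
    then show "subfld M" unfolding subfld_def using E neg by auto
  next
    assume M: "subfld M"
    show "subfield M ?R"
      by (rule R.subfieldI', rule R.subringI) (use subfldD[OF M] neg inv in auto)
  qed
qed

lemma carrier_galois_group:
  "\<sigma> \<in> carrier (galois_group M k) \<longleftrightarrow>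
    \<sigma> \<in> extensional M \<and> bij_betw \<sigma> M M \<and> fhom M \<sigma> \<and> (\<forall>x\<in>k. \<sigma> x = x)"
  by (auto simp: galois_group_def Let_def ring_iso_def ring_hom_def fhom_def ring_of_type_algebra_def
      bij_betw_def)

lemma mult_galois_group:
  assumes "\<sigma> \<in> carrier (galois_group M k)" "\<tau> \<in> carrier (galois_group M k)"
  shows "\<sigma> \<otimes>\<^bsub>galois_group M k\<^esub> \<tau> = compose M \<sigma> \<tau>"
  using assms unfolding carrier_galois_group by (simp add: galois_group_def Let_def BijGroup_def Bij_def)

lemma compose_galois_group:
  assumes "subfld M" "k \<subseteq> M" "\<sigma> \<in> carrier (galois_group M k)" "\<tau> \<in> carrier (galois_group M k)"
  shows "compose M \<sigma> \<tau> \<in> carrier (galois_group M k)"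
proof -
  have "\<tau> y \<in> M" if "y \<in> M" for y
    using assms(4) that unfolding carrier_galois_group by (auto dest: bij_betwE)
  moreover have "bij_betw (compose M \<sigma> \<tau>) M M"
    using assms(3,4) unfolding carrier_galois_group by (auto intro: bij_betw_compose)
  ultimately show ?thesis
    using assms subfldD[OF assms(1)] unfolding carrier_galois_group fhom_def compose_def
    by (auto simp: subset_iff)
qed

text \<open>A faithful action of a finite group on \<open>M\<close> by automorphisms with fixed
  field k. In contrast to the members of \<open>galois_group\<close>, the maps \<open>act g\<close>
  may take any values outside \<open>M\<close>, which spares restrictions in every
  composition.\<close>

locale galois_action = group G for G :: "('g, 'm) monoid_scheme" (structure) +
  fixes M :: "'a::field alg_closure set" and act :: "'g \<Rightarrow> 'a alg_closure \<Rightarrow> 'a alg_closure"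
  assumes M: "subfld M" and base_M: "to_ac z \<in> M"
    and fin: "finite (carrier G)"
    and act_hom: "g \<in> carrier G \<Longrightarrow> fhom M (act g)"
    and act_mem: "g \<in> carrier G \<Longrightarrow> y \<in> M \<Longrightarrow> act g y \<in> M"
    and act_mult: "g \<in> carrier G \<Longrightarrow> h \<in> carrier G \<Longrightarrow> y \<in> M \<Longrightarrow> act (g \<otimes> h) y = act g (act h y)"
    and act_inj: "g \<in> carrier G \<Longrightarrow> h \<in> carrier G \<Longrightarrow> (\<And>y. y \<in> M \<Longrightarrow> act g y = act h y) \<Longrightarrow> g = h"
    and act_base: "g \<in> carrier G \<Longrightarrow> act g (to_ac z) = to_ac z"
    and act_fixed: "y \<in> M \<Longrightarrow> (\<And>g. g \<in> carrier G \<Longrightarrow> act g y = y) \<Longrightarrow> y \<in> range to_ac"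
begin

text \<open>\<open>act \<one>\<close> is idempotent, and as a homomorphism of fields it is
  injective.\<close>

lemma act_one:
  assumes "y \<in> M"
  shows "act \<one> y = y"
proof -
  have "act \<one> (act \<one> y - y) = 0"
    using act_mult[of \<one> \<one> y] fhomD(7)[OF act_hom M, of \<one> "act \<one> y" y] act_mem assms by simp
  then show ?thesis
    using fhomD(8)[OF act_hom M, of \<one> "act \<one> y - y"] act_mem assms subfldD(7)[OF M] by simp
qed

lemma act_nat_pow: "g \<in> carrier G \<Longrightarrow> y \<in> M \<Longrightarrow> act (g [^] (n::nat)) y = (act g ^^ n) y"
proof (induction n arbitrary: y)
  case (Suc n)
  then show ?case using act_mem by (simp add: act_mult funpow_swap1)
qed (simp add: act_one)

text \<open>Restriction to \<open>M\<close> maps \<open>G\<close> injectively into the Galois group,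
  and surjectivity is Artin's theorem on fixed fields. Algebraicity over k comes from the ambient
  algebraic closure.\<close>

lemma realizable: "realizable TYPE('a) G"
proof -
  let ?k = "range (to_ac :: 'a \<Rightarrow> _)"
  let ?\<Gamma> = "galois_group M ?k"
  define r where "r g = restrict (act g) M" for g
  have bij: "bij_betw (act g) M M" if g: "g \<in> carrier G" for g
    using g act_mem act_mult[of g "inv g"] act_mult[of "inv g" g] act_one
    by (intro bij_betw_byWitness[where f' = "act (inv g)"]) auto
  have r: "r g \<in> carrier ?\<Gamma>" if g: "g \<in> carrier G" for g
  proof -
    have "fhom M (r g)" using act_hom[OF g] subfldD[OF M] by (simp add: fhom_def r_def)
    moreover have "bij_betw (r g) M M" using bij[OF g] bij_betw_cong[of M "r g" "act g" M] by (simp add: r_def)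
    ultimately show ?thesis
      unfolding carrier_galois_group by (auto simp: r_def base_M act_base[OF g])
  qed
  have surj: "\<exists>g\<in>carrier G. \<sigma> = r g" if \<sigma>: "\<sigma> \<in> carrier ?\<Gamma>" for \<sigma>
  proof (rule ccontr)
    \<comment> \<open>The trace \<open>T = (\<Sum>g. act g)\<close> takes values in the base field, so \<open>\<sigma> \<circ> T = T\<close>; if \<open>\<sigma>\<close> were not among
      the automorphisms \<open>act g\<close>, this would be a relation between distinct automorphisms.\<close>
    assume n: "\<not> (\<exists>g\<in>carrier G. \<sigma> = r g)"
    have s: "\<sigma> \<in> extensional M" "bij_betw \<sigma> M M" "fhom M \<sigma>" "\<And>z. \<sigma> (to_ac z) = to_ac z"
      using \<sigma> unfolding carrier_galois_group by auto
    have sm: "\<And>y. y \<in> M \<Longrightarrow> \<sigma> y \<in> M" using s(2) by (auto dest: bij_betwE)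
    \<comment> \<open>The family consists of all \<open>act g\<close>, marked \<open>True\<close>,
      and all compositions of \<sigma> with them, marked \<open>False\<close>. The relation between
      them has the coefficients 1 and -1.\<close>
    define \<chi> where "\<chi> i y = (if snd i then act (fst i) y else \<sigma> (act (fst i) y))" for i y
    have key: "\<exists>y\<in>M. act g y \<noteq> \<sigma> (act h y)" if gh: "g \<in> carrier G" "h \<in> carrier G" for g h
    proof (rule ccontr)
      assume "\<not> (\<exists>y\<in>M. act g y \<noteq> \<sigma> (act h y))"
      then have e: "act g y = \<sigma> (act h y)" if "y \<in> M" for y using that by blast
      have "\<sigma> y = act (g \<otimes> inv h) y" if y: "y \<in> M" for y
        using e[OF act_mem[OF _ y, of "inv h"]] act_mult[of h "inv h" y] act_mult[of g "inv h" y] act_one[OF y] gh y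
        by simp
      then have "\<sigma> = r (g \<otimes> inv h)" using s(1) unfolding r_def by (intro extensionalityI[of _ M]) auto
      then show False using n gh by auto
    qed
    have tr: "(\<Sum>g\<in>carrier G. act g y) \<in> range to_ac" if y: "y \<in> M" for y
    proof (rule act_fixed)
      show "(\<Sum>g\<in>carrier G. act g y) \<in> M" using y by (intro subfld_sum[OF M] act_mem)
      fix h assume h: "h \<in> carrier G"
      have "act h (\<Sum>g\<in>carrier G. act g y) = (\<Sum>g\<in>carrier G. act (h \<otimes> g) y)"
        using y h by (subst fhom_sum[OF act_hom M]) (auto simp: act_mem act_mult)
      also have "\<dots> = (\<Sum>g\<in>carrier G. act g y)"
        by (rule sum.reindex_bij_witness[where i = "\<lambda>g. inv h \<otimes> g" and j = "\<lambda>g. h \<otimes> g"])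
          (use h in \<open>auto simp: m_assoc[symmetric]\<close>)
      finally show "act h (\<Sum>g\<in>carrier G. act g y) = (\<Sum>g\<in>carrier G. act g y)" .
    qed
    have "(if snd i then 1 else - 1) = (0 :: 'a alg_closure)" if i: "i \<in> carrier G \<times> UNIV" for i
    proof (rule dedekind_independence[where \<chi> = \<chi> and E = M and S = "carrier G \<times> UNIV", OF _ _ _ _ _ _ _ i])
      show "finite (carrier G \<times> (UNIV :: bool set))" using fin by simp
      show "1 \<in> M" "\<And>y z. y \<in> M \<Longrightarrow> z \<in> M \<Longrightarrow> y * z \<in> M" using subfldD[OF M] by auto
      show "\<chi> i 1 = 1" if "i \<in> carrier G \<times> UNIV" for i
        using that fhomD(1)[OF act_hom M] fhomD(1)[OF s(3) M] by (auto simp: \<chi>_def)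
      show "\<chi> i (y * z) = \<chi> i y * \<chi> i z" if "i \<in> carrier G \<times> UNIV" "y \<in> M" "z \<in> M" for i y z
        using that fhomD(4)[OF act_hom M] fhomD(4)[OF s(3) M] act_mem by (auto simp: \<chi>_def)
      show "\<exists>y\<in>M. \<chi> i y \<noteq> \<chi> j y" if i: "i \<in> carrier G \<times> UNIV" and j: "j \<in> carrier G \<times> UNIV" and "i \<noteq> j" for i j
      proof -
        obtain g a h b where ij: "i = (g, a)" "j = (h, b)" "g \<in> carrier G" "h \<in> carrier G" using i j by auto
        have 1: "\<exists>y\<in>M. act g y \<noteq> act h y" if "g \<noteq> h" using act_inj[OF ij(3,4)] that by blast
        then have 2: "\<exists>y\<in>M. \<sigma> (act g y) \<noteq> \<sigma> (act h y)" if "g \<noteq> h"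
          using that bij_betw_imp_inj_on[OF s(2)] ij act_mem inj_on_eq_iff by metis
        have 3: "\<exists>y\<in>M. \<sigma> (act g y) \<noteq> act h y" using key[OF ij(4,3)] by metis
        show ?thesis using 1 2 3 key[OF ij(3,4)] \<open>i \<noteq> j\<close> ij
          by (cases a; cases b) (auto simp: \<chi>_def)
      qed
      fix y assume y: "y \<in> M"
      have "(\<Sum>i\<in>carrier G \<times> UNIV. (if snd i then 1 else - 1) * \<chi> i y)
          = (\<Sum>g\<in>carrier G. \<Sum>b\<in>UNIV. (if b then 1 else - 1) * \<chi> (g, b) y)"
        by (simp add: sum.cartesian_product split_def)
      also have "\<dots> = (\<Sum>g\<in>carrier G. act g y) - (\<Sum>g\<in>carrier G. \<sigma> (act g y))"
        by (simp add: UNIV_bool \<chi>_def sum_subtractf)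
      also have "(\<Sum>g\<in>carrier G. \<sigma> (act g y)) = \<sigma> (\<Sum>g\<in>carrier G. act g y)"
        using act_mem[OF _ y] by (subst fhom_sum[OF s(3) M]) auto
      also have "\<dots> = (\<Sum>g\<in>carrier G. act g y)" using tr[OF y] s(4) by auto
      finally show "(\<Sum>i\<in>carrier G \<times> UNIV. (if snd i then 1 else - 1) * \<chi> i y) = 0" by simp
    qed
    from this[of "(\<one>, True)"] show False by simp
  qed
  have "r \<in> iso G ?\<Gamma>"
  proof -
    have "r (g \<otimes> h) = r g \<otimes>\<^bsub>?\<Gamma>\<^esub> r h" if "g \<in> carrier G" "h \<in> carrier G" for g h
      using that r unfolding mult_galois_group[OF r[OF that(1)] r[OF that(2)]]
      by (auto simp: r_def compose_def act_mult act_mem fun_eq_iff)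
    moreover have "inj_on r (carrier G)"
    proof (rule inj_onI, rule act_inj)
      show "act g y = act h y" if "r g = r h" "y \<in> M" for g h y
        using fun_cong[OF that(1), of y] that(2) by (simp add: r_def)
    qed
    moreover have "r ` carrier G = carrier ?\<Gamma>" using r surj by blast
    ultimately show ?thesis using r by (simp add: iso_def hom_def bij_betw_def)
  qed
  then have "?\<Gamma> \<cong> G" by (intro iso_sym) (auto simp: is_iso_def)
  moreover have "galois_extension M ?k"
  proof -
    have kfld: "subfld ?k"
      unfolding subfld_def image_iff by (simp flip: to_ac_add to_ac_mult to_ac_minus to_ac_inverse)
    have alg: "\<exists>f :: 'a alg_closure poly. f \<noteq> 0 \<and> (\<forall>i. poly.coeff f i \<in> ?k) \<and> poly f y = 0" for y
    proof -
      obtain q where "q \<noteq> 0" "poly (map_poly to_ac q) y = 0"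
        using alg_closure_algebraic[of y] by blast
      then show ?thesis
        by (intro exI[of _ "map_poly to_ac q"]) (auto simp: coeff_map_poly map_poly_eq_0_iff)
    qed
    have "y \<in> ?k" if "y \<in> M" "\<forall>\<sigma>\<in>carrier ?\<Gamma>. \<sigma> y = y" for y
    proof (rule act_fixed[OF that(1)])
      show "act g y = y" if "g \<in> carrier G" for g
        using \<open>\<forall>\<sigma>\<in>carrier ?\<Gamma>. \<sigma> y = y\<close> r[OF that] \<open>y \<in> M\<close> by (auto simp: r_def)
    qed
    then have "{y \<in> M. \<forall>\<sigma>\<in>carrier ?\<Gamma>. \<sigma> y = y} = ?k"
      using base_M by (auto simp: carrier_galois_group)
    then show ?thesis
      unfolding galois_extension_def subfield_iff_subfld using kfld M base_M alg by auto
  qed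
  ultimately show ?thesis unfolding realizable_def by blast
qed

end

lemma galois_action_if_realizable:
  assumes "group G" "finite (carrier G)" "realizable TYPE('a::field) G"
  shows "\<exists>M act. galois_action G (M :: 'a alg_closure set) act"
proof -
  interpret group G by fact
  let ?k = "range (to_ac :: 'a \<Rightarrow> _)"
  obtain M :: "'a alg_closure set" and h where gal: "galois_extension M ?k" and h: "h \<in> iso (galois_group M ?k) G"
    using assms(3) unfolding realizable_def is_iso_def by blast
  let ?\<Gamma> = "galois_group M ?k"
  have M: "subfld M" and kM: "?k \<subseteq> M" and fix_eq: "{x \<in> M. \<forall>\<sigma>\<in>carrier ?\<Gamma>. \<sigma> x = x} = ?k"
    using gal unfolding galois_extension_def subfield_iff_subfld by auto
  have hb: "bij_betw h (carrier ?\<Gamma>) (carrier G)" and hh: "h \<in> hom ?\<Gamma> G" using h by (auto simp: iso_def)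
  define act where "act = inv_into (carrier ?\<Gamma>) h"
  have a: "act g \<in> carrier ?\<Gamma>" "h (act g) = g" if "g \<in> carrier G" for g
    using that hb unfolding act_def by (auto simp: bij_betw_def inv_into_into f_inv_into_f)
  have ah: "act (h \<sigma>) = \<sigma>" "h \<sigma> \<in> carrier G" if "\<sigma> \<in> carrier ?\<Gamma>" for \<sigma>
    using that hb unfolding act_def by (auto simp: bij_betw_def)
  have mult: "act (g \<otimes>\<^bsub>G\<^esub> g') = compose M (act g) (act g')" if "g \<in> carrier G" "g' \<in> carrier G" for g g'
  proof -
    have c: "compose M (act g) (act g') \<in> carrier ?\<Gamma>" by (rule compose_galois_group[OF M kM]) (use a that in auto)
    have "h (compose M (act g) (act g')) = g \<otimes>\<^bsub>G\<^esub> g'"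
      using hom_mult[OF hh a(1)[OF that(1)] a(1)[OF that(2)]] a(2) that
      unfolding mult_galois_group[OF a(1)[OF that(1)] a(1)[OF that(2)]] by simp
    then show ?thesis using ah(1)[OF c] by simp
  qed
  have "galois_action G M act"
  proof
    show "act g (to_ac z) = to_ac z" "fhom M (act g)" if "g \<in> carrier G" for g z
      using a(1)[OF that] by (auto simp: carrier_galois_group)
    show "act g y \<in> M" if "g \<in> carrier G" "y \<in> M" for g y
      using a(1)[OF that(1)] that(2) by (auto simp: carrier_galois_group dest: bij_betwE)
    show "act (g \<otimes>\<^bsub>G\<^esub> g') y = act g (act g' y)" if "g \<in> carrier G" "g' \<in> carrier G" "y \<in> M" for g g' y
      using mult[OF that(1,2)] that(3) by (simp add: compose_def)
    show "g = g'" if g: "g \<in> carrier G" "g' \<in> carrier G" "\<And>y. y \<in> M \<Longrightarrow> act g y = act g' y" for g g'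
    proof -
      have "act g = act g'" using a(1)[OF g(1)] a(1)[OF g(2)] g(3)
        by (intro extensionalityI[of _ M]) (auto simp: carrier_galois_group)
      then show ?thesis using a(2) g by metis
    qed
    show "y \<in> ?k" if y: "y \<in> M" "\<And>g. g \<in> carrier G \<Longrightarrow> act g y = y" for y
    proof -
      have "\<sigma> y = y" if "\<sigma> \<in> carrier ?\<Gamma>" for \<sigma> using y(2)[OF ah(2)[OF that]] ah(1)[OF that] by simp
      then show ?thesis using fix_eq y(1) by blast
    qed
  qed (use M kM assms(2) in auto)
  then show ?thesis by blast
qed

section \<open>From a realization to a Kummer extension\<close>

lemma fhom_power_int:
  assumes "fhom F \<tau>" "subfld F" "x \<in> F"
  shows "\<tau> (x powi n) = \<tau> x powi n"
  using assms by (simp add: power_int_def fhom_power fhomD(6) subfldD(6))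

lemma subfld_power_int: "subfld F \<Longrightarrow> x \<in> F \<Longrightarrow> x powi n \<in> F"
  by (simp add: power_int_def subfld_power subfldD(6))

lemma to_ac_power_int: "to_ac (c powi n) = to_ac c powi n"
  by (simp add: power_int_def)

lemma (in primitive_root) zeta_power_int_eq_1: "\<zeta> powi n = 1 \<Longrightarrow> int p dvd n"
proof -
  assume 1: "\<zeta> powi n = 1"
  have "\<zeta> ^ nat \<bar>n\<bar> = 1" using 1 zeta_nz by (cases "n \<ge> 0") (auto simp: power_int_def field_simps)
  then show ?thesis using zeta_pow_eq_1_iff by (simp add: nat_dvd_iff[symmetric] int_dvd_int_iff dvd_nat_abs_iff)
qed

text \<open>If a product of powers of the \<open>a i\<close> is a p-th power in k, the product of
  the same powers of the \<open>x i\<close> lies in k, because k contains the p-th roots of unity.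
  But \<open>s i\<close> multiplies it by \<zeta> to the power of the exponent at
  \<open>x i\<close>, so \<open>p\<close> divides all exponents.\<close>

lemma (in kummer3) independent: "independent_mod_powers p (a 0) (a 1) (a 2)"
  unfolding independent_mod_powers_def
proof (intro conjI allI impI)
  show "a 0 \<noteq> 0" "a 1 \<noteq> 0" "a 2 \<noteq> 0" by (simp_all add: a_nz)
  fix e0 e1 e2 :: int
  assume "\<exists>c. c \<noteq> 0 \<and> a 0 powi e0 * a 1 powi e1 * a 2 powi e2 = c ^ p"
  then obtain c where c: "c \<noteq> 0" "a 0 powi e0 * a 1 powi e1 * a 2 powi e2 = c ^ p" by blast
  define z where "z = x 0 powi e0 * x 1 powi e1 * x 2 powi e2"
  have xp: "(x i powi e) ^ p = to_ac (a i powi e)" if "i < 3" for i e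
    using x_pow[OF that] by (simp add: to_ac_power_int flip: x_pow[OF that])
      (simp add: power_int_power power_int_power' mult.commute)
  have "z ^ p = to_ac c ^ p"
    unfolding z_def power_mult_distrib by (simp add: xp flip: to_ac_power c(2))
  then have "(z / to_ac c) ^ p = 1" using c(1) by (simp add: power_divide)
  then obtain j where "z / to_ac c = to_ac \<zeta> ^ j" using ac.root_of_unity_eq_zeta_power by metis
  then have z: "z = to_ac (\<zeta> ^ j * c)" using c(1) by (simp add: field_simps)
  have znz: "z \<noteq> 0" unfolding z_def by (simp add: x_nz)
  have sx: "s i (x j powi e) = (if i = j then to_ac \<zeta> powi e * x j powi e else x j powi e)" if "i < 3" "j < 3" for i j e
    using fhom_power_int[OF s_hom K xK] s_x[OF that] that by (simp add: power_int_mult_distrib)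
  have xe: "x j powi e \<in> K" if "j < 3" for j e using that by (intro subfld_power_int K xK)
  have sz: "s i z = (if i = 0 then to_ac \<zeta> powi e0 else if i = 1 then to_ac \<zeta> powi e1 else to_ac \<zeta> powi e2) * z"
    if i: "i < 3" for i
    unfolding z_def using i by (auto simp: fhomD(4)[OF s_hom K] subfldD(4)[OF K] xe sx)
  have "s i z = z" if "i < 3" for i unfolding z by (rule s_base[OF that])
  then show "int p dvd e0" "int p dvd e1" "int p dvd e2"
    using sz[of 0] sz[of 1] sz[of 2] znz by (auto intro: ac.zeta_power_int_eq_1)
qed

text \<open>The family \<open>s i y / y\<close> is the witness. Its partial norms telescope, so its
  norm compares the p-th iterate of \<open>s i\<close> at \<open>y\<close> with \<open>y\<close>,
  and its commutation rules are those of the \<open>s i\<close> at \<open>y\<close>.\<close>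

lemma (in kummer3) obsI:
  assumes M: "subfld M" "K \<subseteq> M" and hom: "\<And>i. i < 3 \<Longrightarrow> fhom M (s i)"
    and sM: "\<And>i y. i < 3 \<Longrightarrow> y \<in> M \<Longrightarrow> s i y \<in> M" and y: "y \<in> M" "y \<noteq> 0"
    and f: "\<And>i. i < 3 \<Longrightarrow> s i y / y \<in> K"
    and w: "(s 0 ^^ p) y = to_ac w0 * y" "(s 1 ^^ p) y = to_ac w1 * y" "(s 2 ^^ p) y = to_ac w2 * y"
    and c: "s 0 (s 2 y) = to_ac \<zeta> * s 2 (s 0 y)" "s 0 (s 1 y) = s 1 (s 0 y)" "s 1 (s 2 y) = s 2 (s 1 y)"
  shows "obs w0 w1 w2"
proof -
  define f where "f i = s i y / y" for i
  have fK: "f i \<in> K" if "i < 3" for i using assms(7) that by (simp add: f_def)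
  have sf: "s i (f j) = s i (s j y) / s i y" "s i y \<noteq> 0" if "i < 3" "j < 3" for i j
    unfolding f_def using fhomD(9)[OF hom M(1)] fhomD(8)[OF hom M(1)] sM y that by auto
  have n: "nrm i (f i) k * y = (s i ^^ k) y" if i: "i < 3" for i k
  proof -
    have pw: "(s i ^^ j) (f i) = (s i ^^ Suc j) y / (s i ^^ j) y \<and> (s i ^^ j) y \<noteq> 0 \<and> (s i ^^ j) y \<in> M" for j
    proof (induction j)
      case (Suc j)
      then have "(s i ^^ Suc j) y \<in> M" using sM i by simp
      then show ?case using Suc fhomD(9)[OF hom[OF i] M(1)] fhomD(8)[OF hom[OF i] M(1)] sM[OF i] by simp
    qed (use y f_def in auto)
    show ?thesis
    proof (induction k)
      case (Suc k)
      have "nrm i (f i) (Suc k) * y = (nrm i (f i) k * y) * (s i ^^ k) (f i)" by (simp add: nrm_def mult_ac)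
      also have "\<dots> = (s i ^^ Suc k) y" using pw[of k] unfolding Suc by simp
      finally show ?case .
    qed (simp add: nrm_def)
  qed
  have fnz: "f i \<noteq> 0" if "i < 3" for i using sf(2)[OF that that] y by (simp add: f_def)
  show ?thesis unfolding obs_def
  proof (intro exI[of _ f] conjI)
    show "\<forall>i<3. f i \<in> K \<and> f i \<noteq> 0" using fK fnz by blast
    show "nrm 0 (f 0) p = to_ac w0" "nrm 1 (f 1) p = to_ac w1" "nrm 2 (f 2) p = to_ac w2"
      using n[of 0 p] n[of 1 p] n[of 2 p] w y(2) by auto
    have q: "f i * s i (f j) = s i (s j y) / y" if "i < 3" "j < 3" for i j
      using sf[OF that] unfolding f_def by (simp add: f_def)
    show "f 0 * s 0 (f 2) = to_ac \<zeta> * (f 2 * s 2 (f 0))" "f 0 * s 0 (f 1) = f 1 * s 1 (f 0)"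
      "f 1 * s 1 (f 2) = f 2 * s 2 (f 1)"
      using q c by simp_all
  qed
qed

text \<open>The resolvent, the sum over \<open>H\<close> of \<open>inverse (w g)\<close> times the
  image of \<open>t\<close> under \<open>g\<close>, has the required eigenvalues for every
  \<open>t\<close>; by independence of the automorphisms it is nonzero for some
  \<open>t\<close>.\<close>

lemma (in galois_action) eigenvector:
  assumes H: "H \<subseteq> carrier G" "H \<noteq> {}" "\<And>g h. g \<in> H \<Longrightarrow> h \<in> H \<Longrightarrow> g \<otimes> h \<in> H"
    and w: "\<And>h. h \<in> H \<Longrightarrow> w h \<noteq> 0" "\<And>g h. g \<in> H \<Longrightarrow> h \<in> H \<Longrightarrow> w (g \<otimes> h) = w g * w h"
  obtains x where "x \<in> M" "x \<noteq> 0" "\<And>h. h \<in> H \<Longrightarrow> act h x = to_ac (w h) * x"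
proof -
  have fH: "finite H" using fin H(1) by (rule finite_subset[rotated])
  have "\<exists>t\<in>M. (\<Sum>g\<in>H. to_ac (inverse (w g)) * act g t) \<noteq> 0"
  proof (rule ccontr)
    assume "\<not> ?thesis"
    then have 0: "\<And>t. t \<in> M \<Longrightarrow> (\<Sum>g\<in>H. to_ac (inverse (w g)) * act g t) = 0" by blast
    obtain g where g: "g \<in> H" using H(2) by blast
    have "to_ac (inverse (w g)) = 0"
    proof (rule dedekind_independence[OF fH _ _ _ _ _ 0 g, of M])
      show "\<exists>y\<in>M. act i y \<noteq> act j y" if "i \<in> H" "j \<in> H" "i \<noteq> j" for i j
        using act_inj[of i j] that H(1) by blast
    qed (use subfldD[OF M] fhomD[OF act_hom M] H(1) in auto)
    then show False using w(1)[OF g] by simp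
  qed
  then obtain t where t: "t \<in> M" "(\<Sum>g\<in>H. to_ac (inverse (w g)) * act g t) \<noteq> 0" by blast
  define x where "x = (\<Sum>g\<in>H. to_ac (inverse (w g)) * act g t)"
  show ?thesis
  proof
    have m: "to_ac (inverse (w g)) * act g t \<in> M" if "g \<in> H" for g
      using that H(1) t(1) by (intro subfldD(4)[OF M] base_M act_mem) auto
    show "x \<in> M" unfolding x_def by (rule subfld_sum[OF M m])
    show "x \<noteq> 0" using t(2) by (simp add: x_def)
    fix h assume h: "h \<in> H"
    have inj: "inj_on (\<lambda>g. h \<otimes> g) H" using H(1) h by (intro inj_onI) (metis l_cancel subsetD)
    have img: "(\<lambda>g. h \<otimes> g) ` H = H" using endo_inj_surj[OF fH _ inj] H(3) h by auto
    have "act h x = (\<Sum>g\<in>H. act h (to_ac (inverse (w g)) * act g t))"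
      unfolding x_def using H(1) h m by (intro fhom_sum[OF act_hom M]) auto
    also have "\<dots> = (\<Sum>g\<in>H. to_ac (w h) * (to_ac (inverse (w (h \<otimes> g))) * act (h \<otimes> g) t))"
    proof (rule sum.cong)
      fix g assume g: "g \<in> H"
      then have gh: "g \<in> carrier G" "h \<in> carrier G" using H(1) h by auto
      have "act h (to_ac (inverse (w g)) * act g t) = to_ac (inverse (w g)) * act (h \<otimes> g) t"
        using fhomD(4)[OF act_hom[OF gh(2)] M base_M act_mem[OF gh(1) t(1)]] act_base[OF gh(2)] act_mult[OF gh(2,1) t(1)]
        by metis
      then show "act h (to_ac (inverse (w g)) * act g t)
          = to_ac (w h) * (to_ac (inverse (w (h \<otimes> g))) * act (h \<otimes> g) t)"
        using w(1)[OF h] w(2)[OF h g] by simp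
    qed simp
    also have "\<dots> = to_ac (w h) * (\<Sum>g\<in>(\<lambda>g. h \<otimes> g) ` H. to_ac (inverse (w g)) * act g t)"
      by (simp add: sum_distrib_left sum.reindex[OF inj])
    finally show "act h x = to_ac (w h) * x" unfolding img x_def .
  qed
qed

context phi4
begin

definition coord :: "'a \<Rightarrow> nat \<times> nat \<times> nat \<times> nat \<times> nat" where
  "coord = inv_into (nf_box p) \<phi>"

lemma coord_phi: "v \<in> nf_box p \<Longrightarrow> coord (\<phi> v) = v"
  using phi_bij by (auto simp: coord_def bij_betw_def)

lemma phi_coord: "g \<in> carrier G \<Longrightarrow> coord g \<in> nf_box p" "g \<in> carrier G \<Longrightarrow> \<phi> (coord g) = g"
  using phi_bij unfolding coord_def by (auto simp: bij_betw_def f_inv_into_f inv_into_into)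

lemma coord_mult:
  assumes "g \<in> carrier G" "h \<in> carrier G"
  shows "coord (g \<otimes> h) = nf_red p c1 d1 c2 d2 c d (nf_mult p (coord g) (coord h))"
  using phi_mult[of "coord g" "coord h"] phi_coord assms coord_phi[OF nf_red_in_box] p_gt_1 by simp

lemma coord_gens: "coord \<alpha>1 = (1, 0, 0, 0, 0)" "coord \<alpha>2 = (0, 1, 0, 0, 0)" "coord \<alpha> = (0, 0, 1, 0, 0)"
  "coord \<beta>1 = (0, 0, 0, 1, 0)" "coord \<beta>2 = (0, 0, 0, 0, 1)"
  using p_gt_1 coord_phi[of "(1, 0, 0, 0, 0)"] coord_phi[of "(0, 1, 0, 0, 0)"] coord_phi[of "(0, 0, 1, 0, 0)"]
    coord_phi[of "(0, 0, 0, 1, 0)"] coord_phi[of "(0, 0, 0, 0, 1)"]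
  unfolding phi_gens by simp_all

end

locale phi4_action = galois_action G M act + phi4 G p \<alpha> \<alpha>1 \<alpha>2 \<beta>1 \<beta>2 c1 d1 c2 d2 c d + primitive_root p \<zeta>
  for G :: "('g, 'm) monoid_scheme" (structure) and M and act :: "'g \<Rightarrow> 'a::field alg_closure \<Rightarrow> 'a alg_closure"
    and p \<alpha> \<alpha>1 \<alpha>2 \<beta>1 \<beta>2 c1 d1 c2 d2 c d and \<zeta> :: 'a
begin

lemma zeta_mod_add: "\<zeta> ^ ((m + n) mod p) = \<zeta> ^ m * \<zeta> ^ n"
  using power_mod_eq(1)[OF zeta_p, of "m + n" 1] by (simp add: power_add)

lemma eigenvector_of_G:
  assumes "\<And>v w. \<pi> (nf_red p c1 d1 c2 d2 c d (nf_mult p v w)) = (\<pi> v + \<pi> w) mod p"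
  obtains x where "x \<in> M" "x \<noteq> 0" "\<And>g. g \<in> carrier G \<Longrightarrow> act g x = to_ac \<zeta> ^ \<pi> (coord g) * x"
proof -
  obtain x where "x \<in> M" "x \<noteq> 0" "\<And>g. g \<in> carrier G \<Longrightarrow> act g x = to_ac (\<zeta> ^ \<pi> (coord g)) * x"
    by (rule eigenvector[where H = "carrier G" and w = "\<lambda>g. \<zeta> ^ \<pi> (coord g)"])
      (auto simp: zeta_nz coord_mult assms zeta_mod_add)
  then show thesis using that by simp
qed

text \<open>The first three exponents add modulo \<open>p\<close> under multiplication, since
  commutators and p-th powers of generators affect only the exponents of \<beta>1 and \<beta>2. They
  define characters of \<open>G\<close> whose eigenvectors are the Kummer generators.\<close>

lemma eigenvectors_x:
  obtains x :: "nat \<Rightarrow> 'a alg_closure" where "\<And>i. x i \<in> M" "\<And>i. x i \<noteq> 0"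
    "\<And>g i. g \<in> carrier G \<Longrightarrow> act g (x i) = to_ac \<zeta> ^ (if i = 0 then fst (coord g)
       else if i = 1 then fst (snd (coord g)) else fst (snd (snd (coord g)))) * x i"
proof -
  obtain x0 where x0: "x0 \<in> M" "x0 \<noteq> 0" "\<And>g. g \<in> carrier G \<Longrightarrow> act g x0 = to_ac \<zeta> ^ fst (coord g) * x0"
    by (rule eigenvector_of_G[of fst]) (auto simp: nf_red_def nf_mult_def split: prod.splits)
  obtain x1 where x1: "x1 \<in> M" "x1 \<noteq> 0" "\<And>g. g \<in> carrier G \<Longrightarrow> act g x1 = to_ac \<zeta> ^ fst (snd (coord g)) * x1"
    by (rule eigenvector_of_G[of "\<lambda>v. fst (snd v)"]) (auto simp: nf_red_def nf_mult_def split: prod.splits)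
  obtain x2 where x2: "x2 \<in> M" "x2 \<noteq> 0" "\<And>g. g \<in> carrier G \<Longrightarrow> act g x2 = to_ac \<zeta> ^ fst (snd (snd (coord g))) * x2"
    by (rule eigenvector_of_G[of "\<lambda>v. fst (snd (snd v))"]) (auto simp: nf_red_def nf_mult_def split: prod.splits)
  show thesis
    by (rule that[of "\<lambda>i. if i = 0 then x0 else if i = 1 then x1 else x2"]) (use x0 x1 x2 in auto)
qed

text \<open>As \<beta>1 and \<beta>2 are commutators, a character that is nontrivial on them does
  not extend to \<open>G\<close>; hence the eigenvector is taken for the central subgroup
  \<open>H\<close> that they generate.\<close>

lemma eigenvector_y:
  obtains y where "y \<in> M" "y \<noteq> 0" "act \<beta>1 y = to_ac (\<zeta> ^ m) * y" "act \<beta>2 y = to_ac (\<zeta> ^ n) * y"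
proof -
  define \<pi> where "\<pi> v = (case v of (i, j, l, s, t) \<Rightarrow> m * s + n * t)" for v :: "nat \<times> nat \<times> nat \<times> nat \<times> nat"
  define H where "H = {g \<in> carrier G. \<exists>s t. coord g = (0, 0, 0, s, t)}"
  have \<beta>: "\<beta>1 \<in> H" "\<beta>2 \<in> H" using coord_gens in_carrier by (auto simp: H_def)
  have zm: "\<zeta> ^ (k * (j mod p)) = \<zeta> ^ (k * j)" for k j by (rule power_mod_eq(2)[OF zeta_p])
  have H: "H \<subseteq> carrier G" "H \<noteq> {}" using \<beta> by (auto simp: H_def)
  have HH: "g \<otimes> h \<in> H" if "g \<in> H" "h \<in> H" for g h
    using that by (auto simp: H_def coord_mult nf_red_def nf_mult_def)
  have w: "\<zeta> ^ \<pi> (coord (g \<otimes> h)) = \<zeta> ^ \<pi> (coord g) * \<zeta> ^ \<pi> (coord h)" if "g \<in> H" "h \<in> H" for g h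
    using that by (auto simp: H_def coord_mult nf_red_def nf_mult_def \<pi>_def power_add zm distrib_left)
  have nz: "\<zeta> ^ n \<noteq> 0" for n using zeta_nz by simp
  have "\<exists>y\<in>M. y \<noteq> 0 \<and> (\<forall>h\<in>H. act h y = to_ac (\<zeta> ^ \<pi> (coord h)) * y)"
    by (rule eigenvector[where H = H and w = "\<lambda>g. \<zeta> ^ \<pi> (coord g)", OF H HH nz w]) auto
  then obtain y where y: "y \<in> M" "y \<noteq> 0" "\<And>h. h \<in> H \<Longrightarrow> act h y = to_ac (\<zeta> ^ \<pi> (coord h)) * y"
    by blast
  show thesis
    by (rule that[of y]) (use y(1,2) y(3)[OF \<beta>(1)] y(3)[OF \<beta>(2)] in \<open>simp_all add: coord_gens \<pi>_def\<close>)
qed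

sublocale act: pc_ops M "act \<alpha>1" "act \<alpha>2" "act \<alpha>" "act \<beta>1" "act \<beta>2" p c1 d1 c2 d2 c d
proof
  fix y assume y: "y \<in> M"
  note m = act_mult[OF _ _ y, symmetric] and i = in_carrier
  show "act \<alpha>1 y \<in> M" "act \<alpha>2 y \<in> M" "act \<alpha> y \<in> M" "act \<beta>1 y \<in> M" "act \<beta>2 y \<in> M"
    using i y act_mem by auto
  have as: "act g (act h (act h' y)) = act (g \<otimes> (h \<otimes> h')) y" if "g \<in> carrier G" "h \<in> carrier G" "h' \<in> carrier G" for g h h'
    using that y act_mem by (simp add: act_mult)
  show "act \<alpha>1 (act \<alpha> y) = act \<alpha> (act \<alpha>1 (act \<beta>1 y))" "act \<alpha>2 (act \<alpha> y) = act \<alpha> (act \<alpha>2 (act \<beta>2 y))"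
    using i by (simp_all add: as m rels(1,2))
  show "act \<alpha>1 (act \<alpha>2 y) = act \<alpha>2 (act \<alpha>1 y)"
    "act \<beta>1 (act \<alpha>1 y) = act \<alpha>1 (act \<beta>1 y)" "act \<beta>1 (act \<alpha>2 y) = act \<alpha>2 (act \<beta>1 y)"
    "act \<beta>1 (act \<alpha> y) = act \<alpha> (act \<beta>1 y)"
    "act \<beta>2 (act \<alpha>1 y) = act \<alpha>1 (act \<beta>2 y)" "act \<beta>2 (act \<alpha>2 y) = act \<alpha>2 (act \<beta>2 y)"
    "act \<beta>2 (act \<alpha> y) = act \<alpha> (act \<beta>2 y)" "act \<beta>2 (act \<beta>1 y) = act \<beta>1 (act \<beta>2 y)"
    using i by (simp_all only: m rels(3-10))
  show "(act \<beta>1 ^^ p) y = y" "(act \<beta>2 ^^ p) y = y"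
    using i y by (simp_all add: beta_pow act_one flip: act_nat_pow)
  have bp: "(act \<beta>1 ^^ k) ((act \<beta>2 ^^ l) y) = act (\<beta>1 [^] k \<otimes> \<beta>2 [^] l) y" for k l
    using i y act_mem by (simp add: act_mult flip: act_nat_pow)
  show "(act \<alpha>1 ^^ p) y = (act \<beta>1 ^^ c1) ((act \<beta>2 ^^ d1) y)"
    "(act \<alpha>2 ^^ p) y = (act \<beta>1 ^^ c2) ((act \<beta>2 ^^ d2) y)"
    "(act \<alpha> ^^ p) y = (act \<beta>1 ^^ c) ((act \<beta>2 ^^ d) y)"
    unfolding bp using i y by (simp_all flip: act_nat_pow pow1 pow2 pow3)
qed (rule p_pos)

lemma act_phi: "y \<in> M \<Longrightarrow> act (\<phi> v) y = act.nf v y"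
proof -
  assume y: "y \<in> M"
  obtain i j l s t where v: "v = (i, j, l, s, t)" by (metis prod_cases5)
  have "\<phi> v = \<alpha>1 [^] i \<otimes> (\<alpha>2 [^] j \<otimes> (\<alpha> [^] l \<otimes> (\<beta>1 [^] s \<otimes> \<beta>2 [^] t)))"
    using in_carrier by (simp add: \<phi>_def v ops.nf_def funpow_left_mult[OF is_group])
  then show ?thesis
    using y in_carrier by (simp add: v act.nf_def act_mult act_mem act.pow_mem act_nat_pow)
qed

text \<open>\<open>K\<close> is the fixed field of \<beta>1 and \<beta>2. The character with values
  \<zeta> at \<beta>1 and 1 at \<beta>2 has an eigenvector \<open>y\<close> that yields the
  condition with the exponents of \<beta>1; the character with these values exchanged has an
  eigenvector \<open>z\<close> that yields the one for \<beta>2.\<close>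

lemma kummer3_if_action:
  "\<exists>K x s a. kummer3 p \<zeta> K x s a \<and> kummer3.obs p \<zeta> K s (\<zeta> ^ c1) (\<zeta> ^ c2) (\<zeta> ^ c) \<and>
    kummer3.obs p \<zeta> K (s \<circ> swap01) (\<zeta> ^ d2) (\<zeta> ^ d1) (\<zeta> ^ d)"
proof -
  obtain x :: "nat \<Rightarrow> 'a alg_closure" where x: "\<And>i. x i \<in> M" "\<And>i. x i \<noteq> 0"
    and actx: "\<And>g i. g \<in> carrier G \<Longrightarrow> act g (x i) = to_ac \<zeta> ^ (if i = 0 then fst (coord g)
       else if i = 1 then fst (snd (coord g)) else fst (snd (snd (coord g)))) * x i"
    by (rule eigenvectors_x) blast
  define \<gamma> where "\<gamma> i = (if i = 0 then \<alpha>1 else if i = 1 then \<alpha>2 else \<alpha>)" for i :: nat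
  define s where "s i = act (\<gamma> i)" for i
  define K where "K = {y \<in> M. act \<beta>1 y = y \<and> act \<beta>2 y = y}"
  define a where "a i = of_ac (x i ^ p)" for i
  have \<gamma>: "\<gamma> i \<in> carrier G" for i using in_carrier by (simp add: \<gamma>_def)
  have s_eq: "s 0 = act \<alpha>1" "s 1 = act \<alpha>2" "s (Suc 0) = act \<alpha>2" "s 2 = act \<alpha>" by (simp_all add: s_def \<gamma>_def)
  have lt3: "i = 0 \<or> i = 1 \<or> i = 2" if "i < 3" for i :: nat using that by auto
  have sM: "s i y \<in> M" if "y \<in> M" for i y unfolding s_def by (rule act_mem[OF \<gamma> that])
  have sh: "fhom M (s i)" for i unfolding s_def by (rule act_hom[OF \<gamma>])
  have K_sub: "K \<subseteq> M" by (auto simp: K_def)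
  have K: "subfld K"
    unfolding subfld_def K_def using subfldD[OF M] fhomD[OF act_hom M] in_carrier by auto
  have xK: "x i \<in> K" if "i < 3" for i
    using lt3[OF that] x actx in_carrier by (auto simp: K_def coord_gens)
  have b_gamma: "act \<beta>1 (s i y) = s i (act \<beta>1 y)" "act \<beta>2 (s i y) = s i (act \<beta>2 y)" if "y \<in> M" for i y
    using act.central[OF that] by (simp_all add: s_def \<gamma>_def)
  have sK: "s i y \<in> K" if "y \<in> K" for i y
    using that sM b_gamma by (simp add: K_def)
  have order: "(s i ^^ p) y = y" if "y \<in> K" for i y
  proof -
    have y: "y \<in> M" "act \<beta>1 y = y" "act \<beta>2 y = y" using that by (auto simp: K_def)
    have "(act \<beta>1 ^^ m) y = y" "(act \<beta>2 ^^ m) y = y" for m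
      using y(2,3) by (induction m) simp_all
    then show ?thesis using act.A_pow[OF y(1)] by (simp add: s_def \<gamma>_def)
  qed
  have pow_base: "x i ^ p \<in> range to_ac" if "i < 3" for i
  proof (rule act_fixed)
    show "x i ^ p \<in> M" by (rule subfld_power[OF M x(1)])
    fix g assume g: "g \<in> carrier G"
    obtain n where "act g (x i) = to_ac \<zeta> ^ n * x i" using actx[OF g, of i] by blast
    then show "act g (x i ^ p) = x i ^ p"
      using fhom_power[OF act_hom[OF g] M x(1)[of i], of p]
        primitive_root.zeta_power_power_p[OF primitive_root_to_ac[OF primitive_root_axioms], of n]
      by (simp only: power_mult_distrib mult_1_left)
  qed
  have kum: "kummer3 p \<zeta> K x s a"
  proof
    show "subfld K" by (rule K)
    show "to_ac z \<in> K" for z using base_M act_base in_carrier by (simp add: K_def)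
    show "s i y \<in> K" if "y \<in> K" for i y by (rule sK[OF that])
    show "fhom K (s i)" for i using sh[of i] K_sub unfolding fhom_def by blast
    show "s i (to_ac z) = to_ac z" for i z unfolding s_def by (rule act_base[OF \<gamma>])
    show "(s i ^^ p) y = y" if "y \<in> K" for i y by (rule order[OF that])
    show "s i (s j y) = s j (s i y)" if "i < 3" "j < 3" "y \<in> K" for i j y
    proof -
      have "y \<in> M" "act \<beta>1 y = y" "act \<beta>2 y = y" using that by (auto simp: K_def)
      then show ?thesis using lt3[OF that(1)] lt3[OF that(2)] act.comm[of y] by (auto simp: s_eq)
    qed
    show "x i \<in> K" "x i \<noteq> 0" if "i < 3" for i using xK[OF that] x(2) by auto
    show "x i ^ p = to_ac (a i)" if "i < 3" for i
      unfolding a_def by (rule to_ac_of_ac[OF pow_base[OF that], symmetric])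
    show "s i (x j) = (if i = j then to_ac \<zeta> * x j else x j)" if "i < 3" "j < 3" for i j
      using lt3[OF that(1)] lt3[OF that(2)] actx in_carrier by (auto simp: s_eq coord_gens)
    show "y \<in> range to_ac" if y: "y \<in> K" "\<And>i. i < 3 \<Longrightarrow> s i y = y" for y
    proof (rule act_fixed)
      show "y \<in> M" using y(1) K_sub by blast
      have f: "act \<alpha>1 y = y" "act \<alpha>2 y = y" "act \<alpha> y = y" "act \<beta>1 y = y" "act \<beta>2 y = y"
        using y(1) y(2)[of 0] y(2)[of 1] y(2)[of 2] by (auto simp: K_def s_eq)
      have "(act \<alpha>1 ^^ m) y = y" "(act \<alpha>2 ^^ m) y = y" "(act \<alpha> ^^ m) y = y" "(act \<beta>1 ^^ m) y = y" "(act \<beta>2 ^^ m) y = y" for m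
        using f by (induction m) simp_all
      then have "act.nf v y = y" for v by (simp add: act.nf_def split: prod.splits)
      then show "act g y = y" if "g \<in> carrier G" for g
        using act_phi[OF \<open>y \<in> M\<close>, of "coord g"] phi_coord(2)[OF that] by simp
    qed
  qed
  \<comment> \<open>Since \<beta>1 and \<beta>2 are central, they multiply \<open>s i y\<close> by
    the same constants as \<open>y\<close>, so the quotient is fixed.\<close>
  have q: "s i y / y \<in> K" if y: "y \<in> M" "y \<noteq> 0" and e: "act \<beta>1 y = to_ac b1 * y" "act \<beta>2 y = to_ac b2 * y" for i y b1 b2
  proof -
    have "s i (to_ac b * y) = to_ac b * s i y" for b
      using fhomD(4)[OF sh M base_M y(1)] act_base[OF \<gamma>] by (simp add: s_def)
    moreover have "to_ac b1 \<noteq> 0" "to_ac b2 \<noteq> 0"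
      using fhomD(8)[OF act_hom M y(1)] in_carrier y(2) e by (metis mult_zero_left)+
    ultimately show ?thesis
      using fhomD(9)[OF act_hom M sM[OF y(1)] y(1)] in_carrier b_gamma[OF y(1)] e subfldD(8)[OF M sM[OF y(1)] y(1)]
      by (simp add: K_def)
  qed
  have e_pow: "(act \<beta>1 ^^ m) ((act \<beta>2 ^^ n) y) = to_ac (b1 ^ m * b2 ^ n) * y"
    if y: "y \<in> M" and e: "act \<beta>1 y = to_ac b1 * y" "act \<beta>2 y = to_ac b2 * y" for y b1 b2 m n
  proof -
    have l: "act g (to_ac z * y) = to_ac z * act g y" if "g \<in> carrier G" for g z
      using fhomD(4)[OF act_hom[OF that] M base_M y] act_base[OF that] by simp
    have 2: "(act \<beta>2 ^^ n) y = to_ac (b2 ^ n) * y" for n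
      using e l in_carrier by (induction n) (simp_all del: to_ac_power add: mult_ac)
    have 1: "(act \<beta>1 ^^ m) (to_ac z * y) = to_ac (b1 ^ m * z) * y" for m z
      using e l in_carrier by (induction m) (simp_all del: to_ac_power to_ac_mult add: mult_ac, simp_all)
    show ?thesis unfolding 2 1 ..
  qed
  obtain y where y: "y \<in> M" "y \<noteq> 0" "act \<beta>1 y = to_ac (\<zeta> ^ 1) * y" "act \<beta>2 y = to_ac (\<zeta> ^ 0) * y"
    by (rule eigenvector_y)
  obtain z where z: "z \<in> M" "z \<noteq> 0" "act \<beta>1 z = to_ac (\<zeta> ^ 0) * z" "act \<beta>2 z = to_ac (\<zeta> ^ 1) * z"
    by (rule eigenvector_y)
  have lin: "s i (to_ac b * y) = to_ac b * s i y" if "y \<in> M" for i b y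
    using fhomD(4)[OF sh M base_M that] act_base[OF \<gamma>] by (simp add: s_def)
  have "kummer3.obs p \<zeta> K s (\<zeta> ^ c1) (\<zeta> ^ c2) (\<zeta> ^ c)"
  proof (rule kummer3.obsI[OF kum M K_sub sh sM y(1,2) q[OF y]])
    show "(s 0 ^^ p) y = to_ac (\<zeta> ^ c1) * y" "(s 1 ^^ p) y = to_ac (\<zeta> ^ c2) * y" "(s 2 ^^ p) y = to_ac (\<zeta> ^ c) * y"
      unfolding s_eq act.A_pow[OF y(1)] e_pow[OF y(1,3,4)] by simp_all
    \<comment> \<open>Only \<beta>1 moves \<open>y\<close>: this puts the factor \<zeta> into the
      rule for \<alpha>1 and \<alpha>, and none into that for \<alpha>2 and \<alpha>.\<close>
    have "s 0 (s 2 y) = s 2 (s 0 (to_ac \<zeta> * y))" using act.comm(1)[OF y(1)] y(3) by (simp add: s_eq)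
    then show "s 0 (s 2 y) = to_ac \<zeta> * s 2 (s 0 y)" by (simp add: lin y(1) sM)
    show "s 0 (s 1 y) = s 1 (s 0 y)" using act.comm(3)[OF y(1)] by (simp add: s_eq)
    show "s 1 (s 2 y) = s 2 (s 1 y)" using act.comm(2)[OF y(1)] y(4) by (simp add: s_eq)
  qed
  moreover have "kummer3.obs p \<zeta> K (s \<circ> swap01) (\<zeta> ^ d2) (\<zeta> ^ d1) (\<zeta> ^ d)"
  proof (rule kummer3.obsI[OF kummer3_swap[OF kum] M K_sub _ _ z(1,2)])
    have sw: "(s \<circ> swap01) 0 = act \<alpha>2" "(s \<circ> swap01) 1 = act \<alpha>1" "(s \<circ> swap01) 2 = act \<alpha>"
      by (simp_all add: swap01_def s_eq)
    show "fhom M ((s \<circ> swap01) i)" for i using sh by simp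
    show "(s \<circ> swap01) i y \<in> M" if "y \<in> M" for i y using sM[OF that] by simp
    show "(s \<circ> swap01) i z / z \<in> K" for i using q[OF z] by simp
    show "((s \<circ> swap01) 0 ^^ p) z = to_ac (\<zeta> ^ d2) * z" "((s \<circ> swap01) 1 ^^ p) z = to_ac (\<zeta> ^ d1) * z"
      "((s \<circ> swap01) 2 ^^ p) z = to_ac (\<zeta> ^ d) * z"
      unfolding sw act.A_pow[OF z(1)] e_pow[OF z(1,3,4)] by simp_all
    have "s 1 (s 2 z) = s 2 (s 1 (to_ac \<zeta> * z))" using act.comm(2)[OF z(1)] z(4) by (simp add: s_eq)
    then show "(s \<circ> swap01) 0 ((s \<circ> swap01) 2 z) = to_ac \<zeta> * (s \<circ> swap01) 2 ((s \<circ> swap01) 0 z)"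
      unfolding sw using lin[OF z(1), of 1] lin[OF sM[OF z(1)], of 2 _ 1] by (simp add: s_eq)
    show "(s \<circ> swap01) 0 ((s \<circ> swap01) 1 z) = (s \<circ> swap01) 1 ((s \<circ> swap01) 0 z)"
      unfolding sw using act.comm(3)[OF z(1)] by simp
    show "(s \<circ> swap01) 1 ((s \<circ> swap01) 2 z) = (s \<circ> swap01) 2 ((s \<circ> swap01) 1 z)"
      unfolding sw using act.comm(1)[OF z(1)] z(3) by simp
  qed
  ultimately show ?thesis using kum by blast
qed

end

section \<open>Construction of Kummer extensions\<close>

lemma fhom_comp:
  assumes "fhom E \<sigma>" "fhom E \<tau>" "\<And>y. y \<in> E \<Longrightarrow> \<tau> y \<in> E"
  shows "fhom E (\<lambda>y. \<sigma> (\<tau> y))"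
  using assms unfolding fhom_def by simp

lemma fhom_funpow:
  assumes "fhom E \<tau>" "\<And>y. y \<in> E \<Longrightarrow> \<tau> y \<in> E"
  shows "fhom E (\<tau> ^^ n)"
proof (induction n)
  case (Suc n)
  then show ?case using fhom_comp[OF assms(1) Suc] funpow_mem[of E \<tau>, OF assms(2)] by (simp add: comp_def)
qed (simp add: fhom_def)

lemma fhom_eq_on_ext:
  assumes F: "subfld F" and p: "p > 1" and rad: "radical p F z"
    and "fhom (ext p F z) \<sigma>" "fhom (ext p F z) \<tau>" "\<And>f. f \<in> F \<Longrightarrow> \<sigma> f = \<tau> f" "\<sigma> z = \<tau> z" "y \<in> ext p F z"
  shows "\<sigma> y = \<tau> y"
proof -
  have zp: "z ^ p \<in> F" using rad by (simp add: radical_def)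
  have E: "subfld (ext p F z)" by (rule subfld_ext[OF F p zp rad])
  note D = fhomD[OF assms(4) E] fhomD[OF assms(5) E]
  show ?thesis
    by (rule ext_induct[OF F p zp assms(8)]) (auto simp: assms(6,7) D)
qed

text \<open>Compare coefficients: \<open>\<tau>\<close> multiplies the coefficient of
  \<open>z ^ i\<close> by \<zeta>^i, which differs from 1 for 0 < i < p.\<close>

lemma (in primitive_root) mem_if_fixed_in_ext:
  assumes F: "subfld F" and z: "\<zeta> \<in> F" and rad: "radical p F z"
    and hom: "fhom (ext p F z) \<tau>" and id: "\<And>f. f \<in> F \<Longrightarrow> \<tau> f = f" and tz: "\<tau> z = \<zeta> * z"
    and y: "y \<in> ext p F z" "\<tau> y = y"
  shows "y \<in> F"
proof -
  have zp: "z ^ p \<in> F" using rad by (simp add: radical_def)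
  have E: "subfld (ext p F z)" by (rule subfld_ext[OF F p_gt_1 zp rad])
  note b = ext_base[OF F p_gt_1 zp] and g = ext_gen[OF F p_gt_1 zp]
  obtain f where f: "\<forall>i<p. f i \<in> F" "y = (\<Sum>i<p. f i * z ^ i)" using y(1) unfolding ext_def by blast
  have m: "f i * z ^ i \<in> ext p F z" if "i < p" for i
    using that f(1) by (intro subfldD(4)[OF E] subfld_power[OF E] b g) auto
  have "\<tau> y = (\<Sum>i<p. \<tau> (f i * z ^ i))" unfolding f(2) using m by (intro fhom_sum[OF hom E]) auto
  also have "\<dots> = (\<Sum>i<p. f i * \<zeta> ^ i * z ^ i)"
  proof (rule sum.cong)
    fix i assume "i \<in> {..<p}"
    then have i: "f i \<in> F" using f(1) by simp
    show "\<tau> (f i * z ^ i) = f i * \<zeta> ^ i * z ^ i"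
      using fhomD(4)[OF hom E b[OF i] subfld_power[OF E g]] fhom_power[OF hom E g] id[OF i] tz
      by (simp add: power_mult_distrib)
  qed simp
  finally have "(\<Sum>i<p. (f i * \<zeta> ^ i - f i) * z ^ i) = 0"
    using y(2) f(2) by (simp add: left_diff_distrib sum_subtractf)
  then have 0: "\<forall>i<p. f i * \<zeta> ^ i - f i = 0"
    by (rule radicalD[OF rad, rotated]) (use f(1) subfldD[OF F] subfld_power[OF F z] in auto)
  have "f i = 0" if "i < p" "i \<noteq> 0" for i
    using 0 zeta_prim[of i] that by (auto simp: algebra_simps)
  then have "y = (\<Sum>i<p. if i = 0 then f 0 else 0)" unfolding f(2) by (intro sum.cong) auto
  also have "\<dots> = f 0" using p_pos by simp
  finally show ?thesis using f(1) p_pos by simp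
qed

text \<open>\<open>u * z\<close> is a p-th root of the image of \<open>z ^ p\<close>, so
  \<open>fhom_extend\<close> applies; as this root lies in F(z), the extension maps F(z) to
  itself.\<close>

lemma fhom_extend_ext:
  assumes F: "subfld F" and p: "p > 1" and rad: "radical p F z" and \<tau>: "fhom F \<tau>"
    and tF: "\<And>f. f \<in> F \<Longrightarrow> \<tau> f \<in> F" and u: "u \<in> F" "\<tau> (z ^ p) = u ^ p * z ^ p"
  obtains \<tau>' where "fhom (ext p F z) \<tau>'" "\<And>f. f \<in> F \<Longrightarrow> \<tau>' f = \<tau> f" "\<tau>' z = u * z"
    "\<And>y. y \<in> ext p F z \<Longrightarrow> \<tau>' y \<in> ext p F z"
proof -
  have zp: "z ^ p \<in> F" using rad by (simp add: radical_def)
  have "(u * z) ^ p = \<tau> (z ^ p)" using u(2) by (simp add: power_mult_distrib)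
  then obtain \<tau>' where t: "fhom (ext p F z) \<tau>'" "\<And>f. f \<in> F \<Longrightarrow> \<tau>' f = \<tau> f" "\<tau>' z = u * z"
    by (rule fhom_extend[OF F p rad \<tau>]) blast
  note E = subfld_ext[OF F p zp rad] and b = ext_base[OF F p zp] and g = ext_gen[OF F p zp]
  have "\<tau>' y \<in> ext p F z" if "y \<in> ext p F z" for y
    by (rule ext_induct[OF F p zp that]) (auto simp: t(2,3) fhomD[OF t(1) E] subfldD[OF E] ext_scale[OF F p zp u(1) g] intro: b tF)
  then show thesis using t that by blast
qed

text \<open>The analogue of \<open>kummer3\<close> for \<open>n\<close> roots, as needed for an
  induction that adjoins them one at a time.\<close>

definition kummer_tower where
  "kummer_tower p \<zeta> n K x s (a :: nat \<Rightarrow> 'a::field) \<longleftrightarrow>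
    subfld K \<and> range to_ac \<subseteq> K \<and>
    (\<forall>i<n. fhom K (s i) \<and> (\<forall>y\<in>K. s i y \<in> K \<and> (s i ^^ p) y = y) \<and> (\<forall>c. s i (to_ac c) = to_ac c) \<and>
      x i \<in> K \<and> x i \<noteq> 0 \<and> x i ^ p = to_ac (a i)) \<and>
    (\<forall>i<n. \<forall>j<n. (\<forall>y\<in>K. s i (s j y) = s j (s i y)) \<and> s i (x j) = (if i = j then to_ac \<zeta> * x j else x j)) \<and>
    (\<forall>y\<in>K. (\<forall>i<n. s i y = y) \<longrightarrow> y \<in> range to_ac)"

context primitive_root
begin

lemma subfld_range_to_ac: "subfld (range to_ac)"
  unfolding subfld_def image_iff
  by (auto simp flip: to_ac_add to_ac_mult to_ac_minus to_ac_inverse intro: exI[of _ 0] exI[of _ 1])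

interpretation ac: primitive_root p "to_ac \<zeta>"
  by (rule primitive_root_to_ac) unfold_locales

text \<open>A p-th root \<open>z\<close> of \<open>a n\<close> is adjoined. Each old automorphism is
  extended so as to fix \<open>z\<close>, and the new one fixes \<open>K\<close> and multiplies
  \<open>z\<close> by \<zeta>. Independence of the \<open>a i\<close> ensures that \<open>z\<close>
  is not in \<open>K\<close>.\<close>

lemma kummer_tower_step:
  assumes K: "kummer_tower p \<zeta> n K x s a" and a: "a n \<noteq> 0"
    and indep: "\<And>c e. a n \<noteq> c ^ p * (\<Prod>i<n. a i ^ e i)"
  shows "\<exists>K x s. kummer_tower p \<zeta> (Suc n) K x s a"
proof -
  have fld: "subfld K" and base: "\<And>c. to_ac c \<in> K"
    and s: "\<And>i. i < n \<Longrightarrow> fhom K (s i)" "\<And>i y. i < n \<Longrightarrow> y \<in> K \<Longrightarrow> s i y \<in> K"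
      "\<And>i y. i < n \<Longrightarrow> y \<in> K \<Longrightarrow> (s i ^^ p) y = y" "\<And>i c. i < n \<Longrightarrow> s i (to_ac c) = to_ac c"
    and x: "\<And>i. i < n \<Longrightarrow> x i \<in> K" "\<And>i. i < n \<Longrightarrow> x i \<noteq> 0" "\<And>i. i < n \<Longrightarrow> x i ^ p = to_ac (a i)"
    and comm: "\<And>i j y. i < n \<Longrightarrow> j < n \<Longrightarrow> y \<in> K \<Longrightarrow> s i (s j y) = s j (s i y)"
    and sx: "\<And>i j. i < n \<Longrightarrow> j < n \<Longrightarrow> s i (x j) = (if i = j then to_ac \<zeta> * x j else x j)"
    and fix_base: "\<And>y. y \<in> K \<Longrightarrow> (\<And>i. i < n \<Longrightarrow> s i y = y) \<Longrightarrow> y \<in> range to_ac"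
    using K unfolding kummer_tower_def by auto
  obtain z :: "'a alg_closure" where z: "z ^ p = to_ac (a n)" using nth_root_exists[of p] p_pos by metis
  have znz: "z \<noteq> 0" using z a p_pos by (auto simp: zero_power)
  have zK: "z \<notin> K"
  proof
    assume zK: "z \<in> K"
    have "\<exists>e. s i z = to_ac \<zeta> ^ e * z" if i: "i < n" for i
    proof -
      have "s i z ^ p = z ^ p" using fhom_power[OF s(1)[OF i] fld zK, of p] s(4)[OF i] z by simp
      then have "(s i z / z) ^ p = 1" using znz by (simp add: power_divide)
      then obtain e where "s i z / z = to_ac \<zeta> ^ e" using ac.root_of_unity_eq_zeta_power by metis
      then show ?thesis using znz by (auto simp: field_simps)
    qed
    then obtain e where e: "\<And>i. i < n \<Longrightarrow> s i z = to_ac \<zeta> ^ e i * z" by metis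
    \<comment> \<open>If \<open>z\<close> is in \<open>K\<close>, it is an eigenvector of all
      \<open>s i\<close>. The monomial \<open>w\<close> has the same eigenvalues, so
      \<open>z / w\<close> lies in k, and \<open>a n\<close> becomes a product of the kind excluded
      by \<open>indep\<close>.\<close>
    define w where "w = (\<Prod>i<n. x i ^ e i)"
    have wK: "w \<in> K" unfolding w_def by (intro subfld_prod[OF fld] subfld_power[OF fld] x(1)) auto
    have wnz: "w \<noteq> 0" unfolding w_def using x(2) by simp
    have "s i w = to_ac \<zeta> ^ e i * w" if i: "i < n" for i
    proof -
      have "s i w = (\<Prod>j<n. s i (x j ^ e j))"
        unfolding w_def by (intro fhom_prod[OF s(1)[OF i] fld] subfld_power[OF fld] x(1)) auto
      also have "\<dots> = (\<Prod>j<n. (if j = i then to_ac \<zeta> ^ e i else 1) * x j ^ e j)"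
        using fhom_power[OF s(1)[OF i] fld x(1)] sx[OF i] by (intro prod.cong) (auto simp: power_mult_distrib)
      also have "\<dots> = to_ac \<zeta> ^ e i * w" using i by (simp add: prod.distrib w_def)
      finally show ?thesis .
    qed
    then have "s i (z / w) = z / w" if "i < n" for i
      using fhomD(9)[OF s(1)[OF that] fld zK wK] e[OF that] that ac.zeta_nz by simp
    then obtain c where "z / w = to_ac c" using fix_base[OF subfldD(8)[OF fld zK wK]] by auto
    then have "z ^ p = to_ac c ^ p * w ^ p" using wnz by (metis nonzero_eq_divide_eq power_mult_distrib)
    also have "w ^ p = to_ac (\<Prod>i<n. a i ^ e i)"
      unfolding w_def to_ac_prod prod_power_distrib
      by (intro prod.cong) (auto simp: x(3) simp flip: power_mult, simp add: mult.commute[of _ p] power_mult x(3))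
    finally have "to_ac (a n) = to_ac (c ^ p * (\<Prod>i<n. a i ^ e i))" by (simp add: z)
    then show False using indep by (simp only: to_ac_eq_iff)
  qed
  have rad: "radical p K z"
    by (rule radical_if_not_mem[OF primitive_root_to_ac[OF primitive_root_axioms] fld base _ zK]) (simp add: z base)
  define E where "E = ext p K z"
  have zp: "z ^ p \<in> K" by (simp add: z base)
  have E: "subfld E" unfolding E_def by (rule subfld_ext[OF fld p_gt_1 zp rad])
  have KE: "y \<in> E" if "y \<in> K" for y unfolding E_def by (rule ext_base[OF fld p_gt_1 zp that])
  have zE: "z \<in> E" unfolding E_def by (rule ext_gen[OF fld p_gt_1 zp])
  \<comment> \<open>\<open>r i\<close> is the restriction to \<open>K\<close> of the automorphism
    with index \<open>i\<close>, and \<open>\<epsilon> i\<close> is its factor on \<open>z\<close>.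
    This treats the old indices and the new index \<open>n\<close> uniformly.\<close>
  define \<epsilon> where "\<epsilon> i = (if i = n then to_ac \<zeta> else 1)" for i
  define r where "r i = (if i = n then (\<lambda>y. y) else s i)" for i
  have r: "fhom K (r i)" "\<And>y. y \<in> K \<Longrightarrow> r i y \<in> K" "\<And>c. r i (to_ac c) = to_ac c" if "i < Suc n" for i
    using that s by (auto simp: r_def fhom_def less_Suc_eq)
  have "\<exists>\<tau>. fhom E \<tau> \<and> (\<forall>f\<in>K. \<tau> f = r i f) \<and> \<tau> z = \<epsilon> i * z \<and> (\<forall>y\<in>E. \<tau> y \<in> E)" if i: "i < Suc n" for i
  proof -
    have e: "\<epsilon> i \<in> K" "r i (z ^ p) = \<epsilon> i ^ p * z ^ p"
      using base[of \<zeta>] base[of 1] r(3)[OF i] z ac.zeta_p by (auto simp: \<epsilon>_def)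
    show ?thesis unfolding E_def
      by (rule fhom_extend_ext[OF fld p_gt_1 rad r(1,2)[OF i] e]) auto
  qed
  then obtain t where "\<forall>i<Suc n. fhom E (t i) \<and> (\<forall>f\<in>K. t i f = r i f) \<and> t i z = \<epsilon> i * z \<and> (\<forall>y\<in>E. t i y \<in> E)"
    by metis
  then have t: "\<And>i. i < Suc n \<Longrightarrow> fhom E (t i)" "\<And>i f. i < Suc n \<Longrightarrow> f \<in> K \<Longrightarrow> t i f = r i f"
    "\<And>i. i < Suc n \<Longrightarrow> t i z = \<epsilon> i * z" "\<And>i y. i < Suc n \<Longrightarrow> y \<in> E \<Longrightarrow> t i y \<in> E" by auto
  have eqI: "\<sigma> y = \<tau> y" if "fhom E \<sigma>" "fhom E \<tau>" "\<And>f. f \<in> K \<Longrightarrow> \<sigma> f = \<tau> f" "\<sigma> z = \<tau> z" "y \<in> E" for \<sigma> \<tau> :: "'a alg_closure \<Rightarrow> 'a alg_closure" and y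
    by (rule fhom_eq_on_ext[OF fld p_gt_1 rad, folded E_def, OF that])
  have t_base: "t i (to_ac c) = to_ac c" if "i < Suc n" for i c using t(2)[OF that base] r(3)[OF that] by simp
  have te: "t i (\<epsilon> j * z) = \<epsilon> j * (\<epsilon> i * z)" if "i < Suc n" for i j
    using fhomD(4)[OF t(1)[OF that] E KE[OF base] zE, of \<zeta>] t(3)[OF that] t_base[OF that] by (simp add: \<epsilon>_def)
  have order: "(t i ^^ p) y = y" if i: "i < Suc n" and y: "y \<in> E" for i y
  proof (rule eqI[of "t i ^^ p" "\<lambda>y. y", OF fhom_funpow _ _ _ y])
    show "fhom E (t i)" "\<And>y. y \<in> E \<Longrightarrow> t i y \<in> E" using t i by auto
    show "fhom E (\<lambda>y. y)" by (simp add: fhom_def)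
    show "(t i ^^ p) f = f" if f: "f \<in> K" for f
    proof -
      have "(t i ^^ m) f = (r i ^^ m) f \<and> (r i ^^ m) f \<in> K" for m
        by (induction m) (use f t(2)[OF i] r(2)[OF i] in auto)
      moreover have "(r i ^^ p) f = f"
      proof (cases "i = n")
        case True
        have "((\<lambda>y. y) ^^ m) f = f" for m by (induction m) auto
        then show ?thesis using True by (simp add: r_def)
      next
        case False
        then show ?thesis using i f s(3) by (simp add: r_def)
      qed
      ultimately show ?thesis by simp
    qed
    have "(t i ^^ m) z = \<epsilon> i ^ m * z" for m
    proof (induction m)
      case (Suc m)
      have "t i (\<epsilon> i ^ m * z) = \<epsilon> i ^ m * (\<epsilon> i * z)"
      proof -
        have "\<exists>e. \<epsilon> i = to_ac e" unfolding \<epsilon>_def by (metis to_ac_1)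
        then obtain e where e: "\<epsilon> i ^ m = to_ac (e ^ m)" by auto
        show ?thesis unfolding e fhomD(4)[OF t(1)[OF i] E KE[OF base] zE] t_base[OF i] t(3)[OF i] ..
      qed
      then show ?case using Suc by (simp add: mult_ac)
    qed simp
    then show "(t i ^^ p) z = z" using ac.zeta_p by (simp add: \<epsilon>_def)
  qed
  have tcomm: "t i (t j y) = t j (t i y)" if ij: "i < Suc n" "j < Suc n" and y: "y \<in> E" for i j y
  proof (rule eqI[OF _ _ _ _ y])
    show "fhom E (\<lambda>y. t i (t j y))" "fhom E (\<lambda>y. t j (t i y))" using t ij by (auto intro: fhom_comp)
    show "t i (t j f) = t j (t i f)" if "f \<in> K" for f
      using that ij t(2) r(2) comm[of i j f] by (auto simp: r_def less_Suc_eq)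
    show "t i (t j z) = t j (t i z)" using t(3) te ij by (simp add: mult.left_commute)
  qed
  define x' where "x' i = (if i = n then z else x i)" for i
  have x': "x' i \<in> E" "x' i \<noteq> 0" "x' i ^ p = to_ac (a i)" if "i < Suc n" for i
    using that x KE zE znz z by (auto simp: x'_def less_Suc_eq)
  have tx: "t i (x' j) = (if i = j then to_ac \<zeta> * x' j else x' j)" if "i < Suc n" "j < Suc n" for i j
    using that t(2)[OF that(1)] x(1) t(3)[OF that(1)] sx[of i j] by (auto simp: x'_def r_def \<epsilon>_def less_Suc_eq)
  have "y \<in> range to_ac" if y: "y \<in> E" "\<forall>i<Suc n. t i y = y" for y
  proof -
    have "y \<in> K"
    proof (rule ac.mem_if_fixed_in_ext[OF fld base rad, of "t n"])
      show "fhom (ext p K z) (t n)" "t n z = to_ac \<zeta> * z" "y \<in> ext p K z" "t n y = y" "\<And>f. f \<in> K \<Longrightarrow> t n f = f"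
        using t[of n] y by (auto simp: E_def \<epsilon>_def r_def)
    qed
    moreover have "s i y = y" if "i < n" for i
      using y(2) t(2)[of i y] \<open>y \<in> K\<close> that by (auto simp: r_def)
    ultimately show ?thesis by (rule fix_base)
  qed
  then have "kummer_tower p \<zeta> (Suc n) E x' t a"
    unfolding kummer_tower_def using E KE base t(1,4) order t_base x' tcomm tx by auto
  then show ?thesis by blast
qed

lemma kummer_tower_exists:
  assumes "\<And>i. i < N \<Longrightarrow> a i \<noteq> 0" "\<And>n c e. n < N \<Longrightarrow> a n \<noteq> c ^ p * (\<Prod>i<n. a i ^ e i)" "n \<le> N"
  shows "\<exists>K x s. kummer_tower p \<zeta> n K x s a"
  using assms(3)
proof (induction n)
  case 0
  show ?case using subfld_range_to_ac unfolding kummer_tower_def by auto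
next
  case (Suc n)
  then obtain K x s where "kummer_tower p \<zeta> n K x s a" by auto
  then show ?case by (rule kummer_tower_step) (use Suc.prems assms in auto)
qed

lemma kummer3_if_independent:
  assumes "independent_mod_powers p a0 a1 a2"
  obtains K x s a where "kummer3 p \<zeta> K x s a" "a 0 = a0" "a 1 = a1" "a 2 = a2"
proof -
  define a where "a i = (if i = 0 then a0 else if i = 1 then a1 else a2)" for i :: nat
  have nz: "a0 \<noteq> 0" "a1 \<noteq> 0" "a2 \<noteq> 0"
    and ind: "\<And>e1 e2 e3 c. c \<noteq> 0 \<Longrightarrow> a0 powi e1 * a1 powi e2 * a2 powi e3 = c ^ p \<Longrightarrow>
      int p dvd e1 \<and> int p dvd e2 \<and> int p dvd e3"
    using assms unfolding independent_mod_powers_def by blast+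
  have np: "\<not> int p dvd 1" using p_gt_1 by auto
  \<comment> \<open>Moved to one side, such an equation is a relation in which \<open>a n\<close>
    has exponent 1, which \<open>p\<close> does not divide.\<close>
  have ne: "a n \<noteq> c ^ p * (\<Prod>i<n. a i ^ e i)" if n: "n < 3" for n c e
  proof
    assume eq: "a n = c ^ p * (\<Prod>i<n. a i ^ e i)"
    have "a n \<noteq> 0" using nz by (simp add: a_def)
    then have c: "c \<noteq> 0" using eq p_pos by (auto simp: zero_power)
    have "n = 0 \<or> n = 1 \<or> n = 2" using n by auto
    then show False
    proof (elim disjE)
      assume "n = 0"
      then show False using eq ind[OF c, of 1 0 0] np by (simp add: a_def)
    next
      assume "n = 1"
      then have "a1 = c ^ p * a0 ^ e 0" using eq by (simp add: a_def)
      then have "a0 powi (- int (e 0)) * a1 powi 1 * a2 powi 0 = c ^ p"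
        using nz by (simp add: power_int_minus field_simps)
      then show False using ind[OF c] np by blast
    next
      assume "n = 2"
      then have "a2 = c ^ p * (a0 ^ e 0 * a1 ^ e 1)" using eq by (simp add: a_def numeral_2_eq_2)
      then have "a0 powi (- int (e 0)) * a1 powi (- int (e 1)) * a2 powi 1 = c ^ p"
        using nz by (simp add: power_int_minus field_simps)
      then show False using ind[OF c] np by blast
    qed
  qed
  have "\<exists>K x s. kummer_tower p \<zeta> 3 K x s a"
    by (rule kummer_tower_exists[of 3 a 3, OF _ ne]) (use nz in \<open>auto simp: a_def\<close>)
  then obtain K x s where "kummer_tower p \<zeta> 3 K x s a" by blast
  then have "kummer3 p \<zeta> K x s a"
    unfolding kummer_tower_def by unfold_locales auto
  then show thesis by (rule that) (simp_all add: a_def)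
qed

end

section \<open>From a Kummer extension to a realization\<close>

context kummer3
begin

lemma s_funpow_K: "i < 3 \<Longrightarrow> y \<in> K \<Longrightarrow> (s i ^^ n) y \<in> K"
  using funpow_mem[of K "s i"] sK by blast

lemma s_funpow_x:
  "i < 3 \<Longrightarrow> j < 3 \<Longrightarrow> (s i ^^ n) (x j) = (if i = j then to_ac \<zeta> ^ n * x j else x j)"
proof (induction n)
  case (Suc n)
  then show ?case using s_scale[of i "x j" "\<zeta> ^ n"] xK s_x by (auto simp: mult_ac)
qed simp

lemma s_funpow_scale:
  assumes "i < 3" "y \<in> K"
  shows "(s i ^^ n) (to_ac \<zeta> ^ m * y) = to_ac \<zeta> ^ m * (s i ^^ n) y"
  using s_scale[OF assms(1) s_funpow_K[OF assms], of "\<zeta> ^ m"] by (induction n) (simp_all add: s_scale[OF assms(1) s_funpow_K[OF assms], of "\<zeta> ^ m", simplified])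

lemma nrm_power:
  assumes "i < 3" "h \<in> K"
  shows "nrm i (h ^ m) k = nrm i h k ^ m"
proof (induction m)
  case 0
  show ?case using nrm_fixed[of i 1 k] fhomD(1)[OF s_hom[OF assms(1)] K] by simp
next
  case (Suc m)
  then show ?case using nrm_mult[OF assms subfld_power[OF K assms(2)]] by simp
qed

text \<open>The twisted operators \<open>V i\<close>, sending \<open>y\<close> to
  \<open>s i y / F i\<close>, commute by \<open>C\<close>, and their p-th iterates are the identity
  by \<open>N\<close>. The product of the three averaging sums \<open>P i\<close> therefore takes
  values in their common fixed vectors, which are the solutions \<open>b\<close>; it is not
  identically zero, by independence of the p^3 automorphisms.\<close>

lemma hilbert90:
  assumes F: "\<And>i. i < 3 \<Longrightarrow> F i \<in> K" "\<And>i. i < 3 \<Longrightarrow> F i \<noteq> 0"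
    and N: "\<And>i. i < 3 \<Longrightarrow> nrm i (F i) p = 1"
    and C: "\<And>i j. i < 3 \<Longrightarrow> j < 3 \<Longrightarrow> F i * s i (F j) = F j * s j (F i)"
  obtains b where "b \<in> K" "b \<noteq> 0" "\<And>i. i < 3 \<Longrightarrow> s i b = F i * b"
proof -
  define V where "V i y = s i y / F i" for i y
  define P where "P i y = (\<Sum>n<p. (V i ^^ n) y)" for i y
  have VK: "V i y \<in> K" if "i < 3" "y \<in> K" for i y
    unfolding V_def using that by (intro subfldD(8)[OF K] sK F)
  have VnK: "(V i ^^ n) y \<in> K" if "i < 3" "y \<in> K" for i y n
    using funpow_mem[of K "V i"] VK that by blast
  have Vsum: "V i (sum h S) = (\<Sum>r\<in>S. V i (h r))" if "i < 3" "\<And>r. r \<in> S \<Longrightarrow> h r \<in> K" for i and h :: "nat \<Rightarrow> _" and S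
    unfolding V_def using fhom_sum[OF s_hom[OF that(1)] K, of S h] that(2) by (simp add: sum_divide_distrib)
  have Vnsum: "(V i ^^ n) (sum h S) = (\<Sum>r\<in>S. (V i ^^ n) (h r))" if "i < 3" "\<And>r. r \<in> S \<Longrightarrow> h r \<in> K" for i n and h :: "nat \<Rightarrow> _" and S
    using that by (induction n) (simp_all add: Vsum VnK)
  have Vmult: "(V i ^^ n) (y * z) = (V i ^^ n) y * (s i ^^ n) z" if "i < 3" "y \<in> K" "z \<in> K" for i n y z
  proof -
    have "V i (u * v) = V i u * s i v" if "u \<in> K" "v \<in> K" for u v
      using fhomD(4)[OF s_hom[OF \<open>i < 3\<close>] K that] by (simp add: V_def)
    then show ?thesis using that by (induction n) (simp_all add: VnK s_funpow_K)
  qed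
  have Vnz: "(V i ^^ n) y \<noteq> 0" if "i < 3" "y \<in> K" "y \<noteq> 0" for i n y
  proof -
    have "V i u \<noteq> 0" if "u \<in> K" "u \<noteq> 0" for u
      using fhomD(8)[OF s_hom[OF \<open>i < 3\<close>] K that(1)] that(2) F(2)[OF \<open>i < 3\<close>] by (simp add: V_def)
    then show ?thesis using that by (induction n) (simp_all add: VnK)
  qed
  have Vcomm: "V i (V j y) = V j (V i y)" if "i < 3" "j < 3" "y \<in> K" for i j y
    using fhomD(9)[OF s_hom[OF that(1)] K sK[OF that(2,3)] F(1)[OF that(2)]]
      fhomD(9)[OF s_hom[OF that(2)] K sK[OF that(1,3)] F(1)[OF that(1)]] s_comm[OF that] C[OF that(1,2)]
    by (simp add: V_def mult.commute)
  \<comment> \<open>The iterates of \<open>V i\<close> at 1 are the inverses of the partial norms of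
    \<open>F i\<close>, so \<open>N\<close> makes the p-th one equal to 1.\<close>
  have V1: "(V i ^^ n) 1 * nrm i (F i) n = 1" if i: "i < 3" for i n
  proof (induction n)
    case (Suc n)
    have Fi: "inverse (F i) \<in> K" using subfldD(6)[OF K F(1)[OF i]] .
    have "(V i ^^ Suc n) 1 = (V i ^^ n) (1 * inverse (F i))"
      using fhomD(1)[OF s_hom[OF i] K] by (simp add: funpow_swap1 V_def divide_inverse del: funpow.simps(2)) (simp add: funpow_swap1 V_def divide_inverse)
    also have "\<dots> = (V i ^^ n) 1 * (s i ^^ n) (inverse (F i))"
      by (rule Vmult[OF i _ Fi]) (rule subfldD(2)[OF K])
    also have "(s i ^^ n) (inverse (F i)) = inverse ((s i ^^ n) (F i))"
      by (rule fhomD(6)[OF fhom_funpow[OF s_hom[OF i] sK[OF i]] K F(1)[OF i]])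
    finally have e: "(V i ^^ Suc n) 1 = (V i ^^ n) 1 * inverse ((s i ^^ n) (F i))" .
    have "(s i ^^ n) (F i) \<noteq> 0"
      using fhomD(8)[OF fhom_funpow[OF s_hom[OF i] sK[OF i]] K F(1)[OF i], of n] F(2)[OF i] by simp
    moreover have "nrm i (F i) (Suc n) = nrm i (F i) n * (s i ^^ n) (F i)" by (simp add: nrm_def)
    ultimately show ?case unfolding e using Suc by (simp add: field_simps)
  qed (simp add: nrm_def)
  have Vp: "(V i ^^ p) y = y" if "i < 3" "y \<in> K" for i y
    using Vmult[OF that(1) subfldD(2)[OF K] that(2), of p] V1[OF that(1), of p] N[OF that(1)] s_order[OF that] by simp
  have PK: "P i y \<in> K" if "i < 3" "y \<in> K" for i y
    unfolding P_def by (intro subfld_sum[OF K] VnK that)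
  have VP: "V i (P i y) = P i y" if "i < 3" "y \<in> K" for i y
  proof -
    have "V i (P i y) = (\<Sum>n<p. (V i ^^ Suc n) y)" unfolding P_def by (simp add: Vsum VnK that)
    also have "\<dots> = P i y" unfolding P_def by (rule sum_cyclic_shift[OF p_pos]) (simp add: Vp that)
    finally show ?thesis .
  qed
  have VPc: "V i (P j y) = P j (V i y)" if "i < 3" "j < 3" "y \<in> K" for i j y
  proof -
    have "V i ((V j ^^ n) y) = (V j ^^ n) (V i y)" for n
      using funpow_commute_on[of K "V i" "V j" y 1 n] VK Vcomm that by simp
    then show ?thesis unfolding P_def using that by (simp add: Vsum VnK)
  qed
  let ?S = "{..<p} \<times> {..<p} \<times> {..<p}"
  \<comment> \<open>\<open>\<chi> v\<close> is the automorphism with exponents \<open>v\<close>, and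
    \<open>q v\<close> is the coefficient that it receives when the three sums are expanded.\<close>
  define \<chi> where "\<chi> v t = (s 0 ^^ fst v) ((s 1 ^^ fst (snd v)) ((s 2 ^^ snd (snd v)) t))" for v t
  define q where "q v = (V 0 ^^ fst v) ((V 1 ^^ fst (snd v)) ((V 2 ^^ snd (snd v)) 1))" for v
  have lt3: "(0::nat) < 3" "(1::nat) < 3" "(2::nat) < 3" by simp_all
  note f0 = fhom_funpow[OF s_hom[OF lt3(1)] sK[OF lt3(1)]] and f1 = fhom_funpow[OF s_hom[OF lt3(2)] sK[OF lt3(2)]]
    and f2 = fhom_funpow[OF s_hom[OF lt3(3)] sK[OF lt3(3)]]
  have exp: "P 0 (P 1 (P 2 t)) = (\<Sum>v\<in>?S. q v * \<chi> v t)" if t: "t \<in> K" for t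
  proof -
    have "(V 2 ^^ l) t = (V 2 ^^ l) 1 * (s 2 ^^ l) t" for l
      using Vmult[OF lt3(3) subfldD(2)[OF K] t, of l] by simp
    then have m: "(V 0 ^^ i) ((V 1 ^^ j) ((V 2 ^^ l) t)) = q (i, j, l) * \<chi> (i, j, l) t" for i j l
      unfolding q_def \<chi>_def using t subfldD(2)[OF K]
      by (simp only: fst_conv snd_conv Vmult VnK s_funpow_K lt3)
    have "P 0 (P 1 (P 2 t)) = (\<Sum>i<p. \<Sum>j<p. \<Sum>l<p. (V 0 ^^ i) ((V 1 ^^ j) ((V 2 ^^ l) t)))"
      unfolding P_def by (simp only: Vnsum VnK subfld_sum[OF K] lt3 t)
    also have "\<dots> = (\<Sum>v\<in>?S. q v * \<chi> v t)"
      unfolding m by (simp add: sum.cartesian_product split_def)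
    finally show ?thesis .
  qed
  have "\<exists>t\<in>K. P 0 (P 1 (P 2 t)) \<noteq> 0"
  proof (rule ccontr)
    assume "\<not> ?thesis"
    then have 0: "(\<Sum>v\<in>?S. q v * \<chi> v t) = 0" if "t \<in> K" for t using exp that by auto
    have v0: "(0, 0, 0) \<in> ?S" using p_pos by simp
    \<comment> \<open>This contradicts the value 1 of \<open>q\<close> at the zero
      exponents.\<close>
    have "q (0, 0, 0) = 0"
    proof (rule dedekind_independence[OF _ subfldD(2,4)[OF K] _ _ _ 0 v0])
      show "\<chi> v 1 = 1" for v
        unfolding \<chi>_def using fhomD(1)[OF f0 K] fhomD(1)[OF f1 K] fhomD(1)[OF f2 K] by simp
      show "\<chi> v (y * z) = \<chi> v y * \<chi> v z" if "y \<in> K" "z \<in> K" for v y z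
        unfolding \<chi>_def using that by (simp only: fhomD(4)[OF f0 K] fhomD(4)[OF f1 K] fhomD(4)[OF f2 K] s_funpow_K lt3)
      show "\<exists>y\<in>K. \<chi> v y \<noteq> \<chi> w y" if vw: "v \<in> ?S" "w \<in> ?S" "v \<noteq> w" for v w
      proof (rule ccontr)
        assume "\<not> ?thesis"
        then have e: "\<chi> v (x i) = \<chi> w (x i)" if "i < 3" for i using xK that by blast
        have "\<chi> u (x 0) = to_ac \<zeta> ^ fst u * x 0" "\<chi> u (x 1) = to_ac \<zeta> ^ fst (snd u) * x 1"
          "\<chi> u (x 2) = to_ac \<zeta> ^ snd (snd u) * x 2" for u
          using xK by (simp_all add: \<chi>_def s_funpow_x s_funpow_scale)
        then have "to_ac \<zeta> ^ fst v = to_ac \<zeta> ^ fst w" "to_ac \<zeta> ^ fst (snd v) = to_ac \<zeta> ^ fst (snd w)"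
          "to_ac \<zeta> ^ snd (snd v) = to_ac \<zeta> ^ snd (snd w)"
          using e[OF lt3(1)] e[OF lt3(2)] e[OF lt3(3)] x_nz[OF lt3(1)] x_nz[OF lt3(2)] x_nz[OF lt3(3)] by simp_all
        then have "fst v = fst w" "fst (snd v) = fst (snd w)" "snd (snd v) = snd (snd w)"
          using vw(1,2) by (auto intro!: ac.zeta_power_inj)
        then show False using vw(3) by (simp add: prod_eq_iff)
      qed
    qed simp
    then show False by (simp add: q_def)
  qed
  then obtain t where t: "t \<in> K" "P 0 (P 1 (P 2 t)) \<noteq> 0" by blast
  define b where "b = P 0 (P 1 (P 2 t))"
  have bK: "b \<in> K" unfolding b_def using t(1) by (simp add: PK)
  have "V i b = b" if i: "i < 3" for i
  proof -
    have "i = 0 \<or> i = 1 \<or> i = 2" using i by auto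
    then show ?thesis unfolding b_def using t(1) by (elim disjE) (simp_all only: VP VPc PK lt3)
  qed
  then have "s i b = F i * b" if "i < 3" for i using F(2)[OF that] that by (metis V_def nonzero_eq_divide_eq mult.commute)
  then show thesis using bK t(2) that b_def by blast
qed

text \<open>\<open>wi\<close> and \<open>wj\<close> differ from \<open>s i h / h\<close> and
  \<open>s j h / h\<close> by p-th roots of unity, which lie in k and are fixed; the quotients
  themselves satisfy the symmetric rule because \<open>s i\<close> and \<open>s j\<close> commute.
  This is the tool for showing that a root does not lie in \<open>K\<close>.\<close>

lemma root_cocycle:
  assumes ij: "i < 3" "j < 3" and h: "h \<in> K" "h \<noteq> 0"
    and w: "s i h ^ p = wi ^ p * h ^ p" "s j h ^ p = wj ^ p * h ^ p"
  shows "wi * s i wj = wj * s j wi"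
proof -
  have *: "\<exists>z. w = to_ac z * (s i h / h)" if "i < 3" "s i h ^ p = w ^ p * h ^ p" for i w
  proof -
    have nz: "s i h \<noteq> 0" using fhomD(8)[OF s_hom[OF that(1)] K h(1)] h(2) by simp
    then have "(w * h / s i h) ^ p = 1" unfolding power_divide power_mult_distrib that(2)[symmetric] by simp
    then obtain e where "w * h / s i h = to_ac \<zeta> ^ e" using ac.root_of_unity_eq_zeta_power by metis
    then have "w = to_ac (\<zeta> ^ e) * (s i h / h)" using nz h(2) by (simp add: field_simps)
    then show ?thesis by blast
  qed
  obtain z z' where z: "wi = to_ac z * (s i h / h)" "wj = to_ac z' * (s j h / h)"
    using *[OF ij(1) w(1)] *[OF ij(2) w(2)] by blast
  have q: "s i h / h \<in> K" "s j h / h \<in> K" using ij h by (auto intro: subfldD(8)[OF K] sK)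
  have "s i h \<noteq> 0" "s j h \<noteq> 0" using fhomD(8)[OF s_hom K h(1)] ij h(2) by auto
  then show ?thesis
    unfolding z s_scale[OF ij(1) q(2)] s_scale[OF ij(2) q(1)]
    using fhomD(9)[OF s_hom K sK h(1)] ij h s_comm[OF ij h(1)] by (simp add: field_simps)
qed

end

text \<open>Norms and commutation rules of \<open>u\<close> are correct up to p-th roots of unity,
  hence exactly correct for the p-th powers. Hilbert 90 applies to these, and \<open>y\<close> is a
  p-th root of the solution.\<close>

lemma (in kummer3) kummer_root:
  assumes u: "\<And>i. i < 3 \<Longrightarrow> u i \<in> K" "\<And>i. i < 3 \<Longrightarrow> u i \<noteq> 0" and N: "\<And>i. i < 3 \<Longrightarrow> nrm i (u i) p ^ p = 1"
    and C: "\<And>i j. i < 3 \<Longrightarrow> j < 3 \<Longrightarrow> (u i * s i (u j)) ^ p = (u j * s j (u i)) ^ p"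
  obtains y where "y \<noteq> 0" "y ^ p \<in> K" "\<And>i. i < 3 \<Longrightarrow> s i (y ^ p) = u i ^ p * y ^ p"
proof -
  obtain b where b: "b \<in> K" "b \<noteq> 0" "\<And>i. i < 3 \<Longrightarrow> s i b = u i ^ p * b"
  proof (rule hilbert90[of "\<lambda>i. u i ^ p"])
    show "u i ^ p \<in> K" "u i ^ p \<noteq> 0" "nrm i (u i ^ p) p = 1" if "i < 3" for i
      using u N that by (auto simp: nrm_power subfld_power[OF K])
    show "u i ^ p * s i (u j ^ p) = u j ^ p * s j (u i ^ p)" if "i < 3" "j < 3" for i j
      using C[OF that] fhom_power[OF s_hom K u(1)] that by (simp add: power_mult_distrib)
  qed blast
  obtain y where "y ^ p = b" using nth_root_exists[of p b] p_pos by metis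
  then show thesis using b p_pos by (intro that[of y]) (auto simp: zero_power)
qed

text \<open>The cocycles \<open>f\<close> and \<open>g\<close> describe how the extensions of the automorphisms \<open>s\<^sub>i\<close> act on \<open>y1\<close> and \<open>y2\<close>.\<close>

locale kummer5 = kummer3 +
  fixes f g :: "nat \<Rightarrow> 'a alg_closure" and c1 d1 c2 d2 c d :: nat and y1 y2 :: "'a alg_closure"
  assumes f_K: "i < 3 \<Longrightarrow> f i \<in> K" and g_K: "i < 3 \<Longrightarrow> g i \<in> K"
    and f_nrm: "nrm 0 (f 0) p = to_ac \<zeta> ^ c1" "nrm 1 (f 1) p = to_ac \<zeta> ^ c2" "nrm 2 (f 2) p = to_ac \<zeta> ^ c"
    and g_nrm: "nrm 0 (g 0) p = to_ac \<zeta> ^ d1" "nrm 1 (g 1) p = to_ac \<zeta> ^ d2" "nrm 2 (g 2) p = to_ac \<zeta> ^ d"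
    and f_comm: "f 0 * s 0 (f 2) = to_ac \<zeta> * (f 2 * s 2 (f 0))" "f 1 * s 1 (f 2) = f 2 * s 2 (f 1)"
      "f 0 * s 0 (f 1) = f 1 * s 1 (f 0)"
    and g_comm: "g 0 * s 0 (g 2) = g 2 * s 2 (g 0)" "g 1 * s 1 (g 2) = to_ac \<zeta> * (g 2 * s 2 (g 1))"
      "g 0 * s 0 (g 1) = g 1 * s 1 (g 0)"
    and y1_pow: "y1 ^ p \<in> K" and y2_pow: "y2 ^ p \<in> K"
    and s_y1: "i < 3 \<Longrightarrow> s i (y1 ^ p) = f i ^ p * y1 ^ p" and s_y2: "i < 3 \<Longrightarrow> s i (y2 ^ p) = g i ^ p * y2 ^ p"
    and f_nz: "i < 3 \<Longrightarrow> f i \<noteq> 0" and g_nz: "i < 3 \<Longrightarrow> g i \<noteq> 0" and y1_nz: "y1 \<noteq> 0" and y2_nz: "y2 \<noteq> 0"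
begin

lemma zeta_ne_1: "to_ac \<zeta> \<noteq> 1"
  using ac.zeta_prim[of 1] ac.p_gt_1 by simp

text \<open>Otherwise \<open>root_cocycle\<close> would make \<open>f 0\<close> and
  \<open>f 2\<close> satisfy the symmetric rule, whereas \<open>f_comm\<close> has the factor
  \<zeta>.\<close>

lemma y1_notin_K: "y1 \<notin> K"
proof
  assume y: "y1 \<in> K"
  have "f 0 * s 0 (f 2) = f 2 * s 2 (f 0)"
    by (rule root_cocycle[OF _ _ y y1_nz]) (use s_y1 fhom_power[OF s_hom K y] in auto)
  moreover have "f 2 * s 2 (f 0) \<noteq> 0" using f_nz fhomD(8)[OF s_hom K f_K] by simp
  ultimately show False using f_comm(1) zeta_ne_1 by simp
qed

lemma radical_K: "radical p K y1"
  by (rule radical_if_not_mem[OF ac.primitive_root_axioms K base y1_pow y1_notin_K])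

definition "L = ext p K y1"

lemma L: "subfld L" "\<And>y. y \<in> K \<Longrightarrow> y \<in> L" "y1 \<in> L"
  unfolding L_def by (rule subfld_ext[OF K p_gt_1 y1_pow radical_K], erule ext_base[OF K p_gt_1 y1_pow],
    rule ext_gen[OF K p_gt_1 y1_pow])

lemma ex_extension_L:
  assumes "fhom K \<tau>" "\<And>y. y \<in> K \<Longrightarrow> \<tau> y \<in> K" "u \<in> K" "\<tau> (y1 ^ p) = u ^ p * y1 ^ p"
  shows "\<exists>\<tau>'. fhom L \<tau>' \<and> (\<forall>y\<in>K. \<tau>' y = \<tau> y) \<and> \<tau>' y1 = u * y1 \<and> (\<forall>y\<in>L. \<tau>' y \<in> L)"
  unfolding L_def by (rule fhom_extend_ext[OF K p_gt_1 radical_K assms]) auto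

text \<open>Otherwise \<open>y2\<close> is \<open>h * y1 ^ e\<close> with \<open>h\<close> in
  \<open>K\<close>, and the quotients \<open>g i / f i ^ e\<close> obey the symmetric rule. The
  indices 0 and 2 then force e = 0, after which the indices 1 and 2 contradict the factor \<zeta> in
  \<open>g_comm\<close>.\<close>

lemma y2_notin_L: "y2 \<notin> L"
proof
  assume y: "y2 \<in> L"
  have "to_ac \<zeta> \<in> K" "y1 ^ p = to_ac \<zeta> ^ p * y1 ^ p" using base ac.zeta_p by auto
  then obtain B where B: "fhom L B" "\<And>y. y \<in> K \<Longrightarrow> B y = y" "B y1 = to_ac \<zeta> * y1" "\<And>y. y \<in> L \<Longrightarrow> B y \<in> L"
    using ex_extension_L[of "\<lambda>y. y" "to_ac \<zeta>"] by (auto simp: fhom_def)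
  have "B y2 ^ p = y2 ^ p" using fhom_power[OF B(1) L(1) y, of p] B(2)[OF y2_pow] by simp
  then have "(B y2 / y2) ^ p = 1" using y2_nz by (simp add: power_divide)
  then obtain e where e: "e < p" "B y2 / y2 = to_ac \<zeta> ^ e" by (rule ac.root_of_unity_eq_zeta_power)
  \<comment> \<open>\<open>B\<close> fixes \<open>K\<close> and multiplies \<open>y1\<close> by
    \<zeta>. It multiplies \<open>y2\<close> by \<zeta>^e, and division by \<open>y1 ^ e\<close>
    compensates this.\<close>
  define h where "h = y2 / y1 ^ e"
  have ye: "y1 ^ e \<in> L" by (rule subfld_power[OF L(1,3)])
  have hL: "h \<in> L" unfolding h_def by (rule subfldD(8)[OF L(1) y ye])
  have "B (y1 ^ e) = to_ac \<zeta> ^ e * y1 ^ e" using fhom_power[OF B(1) L(1,3), of e] B(3) by (simp add: power_mult_distrib)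
  moreover have "B y2 = to_ac \<zeta> ^ e * y2" using e(2) y2_nz by (simp add: field_simps)
  ultimately have "B h = h" unfolding h_def fhomD(9)[OF B(1) L(1) y ye] using ac.zeta_nz by simp
  then have hK: "h \<in> K"
    using ac.mem_if_fixed_in_ext[OF K base radical_K, of B h] B hL unfolding L_def by blast
  have hnz: "h \<noteq> 0" unfolding h_def using y1_nz y2_nz by simp
  have fK: "f i ^ e \<in> K" if "i < 3" for i by (rule subfld_power[OF K f_K[OF that]])
  have hp: "h ^ p = y2 ^ p / (y1 ^ p) ^ e" unfolding h_def by (simp add: power_divide mult.commute flip: power_mult)
  have hw: "s i h ^ p = (g i / f i ^ e) ^ p * h ^ p" if i: "i < 3" for i
  proof -
    have "s i h ^ p = s i (h ^ p)" by (rule fhom_power[OF s_hom[OF i] K hK, symmetric])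
    also have "\<dots> = s i (y2 ^ p) / s i (y1 ^ p) ^ e"
      unfolding hp fhomD(9)[OF s_hom[OF i] K y2_pow subfld_power[OF K y1_pow]] fhom_power[OF s_hom[OF i] K y1_pow] ..
    also have "\<dots> = (g i / f i ^ e) ^ p * h ^ p"
      unfolding hp s_y1[OF i] s_y2[OF i] by (simp add: power_divide power_mult_distrib mult.commute flip: power_mult)
    finally show ?thesis .
  qed
  have R: "(g i * s i (g j)) / (f i * s i (f j)) ^ e = (g j * s j (g i)) / (f j * s j (f i)) ^ e" if ij: "i < 3" "j < 3" for i j
    using root_cocycle[OF ij hK hnz hw[OF ij(1)] hw[OF ij(2)]] fhomD(9)[OF s_hom K g_K fK] fhom_power[OF s_hom K f_K] ij
    by (simp add: power_mult_distrib)
  have nz: "g j * s j (g i) \<noteq> 0" "f j * s j (f i) \<noteq> 0" if "i < 3" "j < 3" for i j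
    using that f_nz g_nz fhomD(8)[OF s_hom K f_K] fhomD(8)[OF s_hom K g_K] by auto
  have "to_ac \<zeta> ^ e = 1"
  proof -
    define Q F where "Q = g 2 * s 2 (g 0)" and "F = f 2 * s 2 (f 0)"
    have "Q / (to_ac \<zeta> * F) ^ e = Q / F ^ e" using R[of 0 2] unfolding f_comm g_comm Q_def F_def by simp
    moreover have "Q \<noteq> 0" "F \<noteq> 0" using nz[of 0 2] by (auto simp: Q_def F_def)
    ultimately show ?thesis using ac.zeta_nz by (simp add: power_mult_distrib field_simps)
  qed
  then have "e = 0" using ac.zeta_prim[of e] e(1) by auto
  then have "g 1 * s 1 (g 2) = g 2 * s 2 (g 1)" using R[of 1 2] by simp
  then show False using nz[of 1 2] g_comm(2) zeta_ne_1 by simp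
qed

lemma y2_pow_L: "y2 ^ p \<in> L"
  by (rule L(2)[OF y2_pow])

lemma radical_L: "radical p L y2"
  by (rule radical_if_not_mem[OF ac.primitive_root_axioms L(1) L(2)[OF base] y2_pow_L y2_notin_L])

definition "M = ext p L y2"

lemma M: "subfld M" "\<And>y. y \<in> L \<Longrightarrow> y \<in> M" "y2 \<in> M"
  unfolding M_def by (rule subfld_ext[OF L(1) p_gt_1 y2_pow_L radical_L], erule ext_base[OF L(1) p_gt_1 y2_pow_L],
    rule ext_gen[OF L(1) p_gt_1 y2_pow_L])

lemma K_M: "y \<in> K \<Longrightarrow> y \<in> M" and y1_M: "y1 \<in> M"
  using L M(2) by auto

text \<open>A homomorphism of \<open>M\<close> into itself is recorded by its restriction
  \<open>t\<close> to \<open>K\<close> and its factors \<open>u1\<close>, \<open>u2\<close> on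
  \<open>y1\<close>, \<open>y2\<close>. It is determined by these data, which compose by the twisted
  rule in \<open>aut_comp\<close>.\<close>

definition aut where
  "aut \<sigma> t u1 u2 \<longleftrightarrow> fhom M \<sigma> \<and> (\<forall>y\<in>M. \<sigma> y \<in> M) \<and> (\<forall>y\<in>K. \<sigma> y = t y \<and> t y \<in> K) \<and>
    u1 \<in> K \<and> u2 \<in> K \<and> \<sigma> y1 = u1 * y1 \<and> \<sigma> y2 = u2 * y2"

lemma ex_aut:
  assumes "fhom K t" "\<And>y. y \<in> K \<Longrightarrow> t y \<in> K" "u1 \<in> K" "u2 \<in> K"
    "t (y1 ^ p) = u1 ^ p * y1 ^ p" "t (y2 ^ p) = u2 ^ p * y2 ^ p"
  shows "\<exists>\<sigma>. aut \<sigma> t u1 u2"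
proof -
  obtain \<tau> where \<tau>: "fhom L \<tau>" "\<And>y. y \<in> K \<Longrightarrow> \<tau> y = t y" "\<tau> y1 = u1 * y1" "\<And>y. y \<in> L \<Longrightarrow> \<tau> y \<in> L"
    using ex_extension_L[OF assms(1-3,5)] by blast
  have eq: "\<tau> (y2 ^ p) = u2 ^ p * y2 ^ p" using \<tau>(2)[OF y2_pow] assms(6) by simp
  have "\<exists>\<sigma>. fhom M \<sigma> \<and> (\<forall>y\<in>L. \<sigma> y = \<tau> y) \<and> \<sigma> y2 = u2 * y2 \<and> (\<forall>y\<in>M. \<sigma> y \<in> M)"
    unfolding M_def by (rule fhom_extend_ext[OF L(1) p_gt_1 radical_L \<tau>(1,4) L(2)[OF assms(4)] eq]) auto
  then obtain \<sigma> where "fhom M \<sigma>" "\<And>y. y \<in> L \<Longrightarrow> \<sigma> y = \<tau> y" "\<sigma> y2 = u2 * y2" "\<And>y. y \<in> M \<Longrightarrow> \<sigma> y \<in> M"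
    by blast
  then have "aut \<sigma> t u1 u2" unfolding aut_def using \<tau> assms L by auto
  then show ?thesis by blast
qed

lemma aut_unique:
  assumes "aut \<sigma> t u1 u2" "aut \<sigma>' t' u1 u2" "\<And>y. y \<in> K \<Longrightarrow> t y = t' y" "y \<in> M"
  shows "\<sigma> y = \<sigma>' y"
proof -
  note a = assms(1,2)[unfolded aut_def]
  have fL: "fhom L \<sigma>" "fhom L \<sigma>'" using a M(2) unfolding fhom_def by auto
  have eL: "\<sigma> y = \<sigma>' y" if "y \<in> L" for y
    by (rule fhom_eq_on_ext[OF K p_gt_1 radical_K, folded L_def, OF fL]) (use a assms(3) that in auto)
  show ?thesis
    by (rule fhom_eq_on_ext[OF L(1) p_gt_1 radical_L, folded M_def]) (use a eL assms(4) in auto)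
qed

lemma aut_comp:
  assumes \<sigma>: "aut \<sigma> t u1 u2" and \<tau>: "aut \<tau> t' v1 v2"
  shows "aut (\<lambda>y. \<sigma> (\<tau> y)) (\<lambda>y. t (t' y)) (t v1 * u1) (t v2 * u2)"
proof -
  note a = \<sigma>[unfolded aut_def] \<tau>[unfolded aut_def]
  have "fhom M (\<lambda>y. \<sigma> (\<tau> y))" by (rule fhom_comp) (use a in auto)
  moreover have "\<sigma> (v1 * y1) = t v1 * u1 * y1" "\<sigma> (v2 * y2) = t v2 * u2 * y2"
    using a fhomD(4)[of M \<sigma>] M K_M y1_M by auto
  ultimately show ?thesis using a subfldD(4)[OF K] unfolding aut_def by auto
qed

lemma aut_id: "aut (\<lambda>y. y) (\<lambda>y. y) 1 1"
  using subfldD(2)[OF K] by (simp add: aut_def fhom_def)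

text \<open>\<open>S i\<close> lifts \<open>s i\<close> with the cocycles as factors;
  \<open>B1\<close> and \<open>B2\<close> fix \<open>K\<close> and correspond to \<beta>1 and
  \<beta>2.\<close>

definition "S i = (SOME \<sigma>. aut \<sigma> (s i) (f i) (g i))"
definition "B1 = (SOME \<sigma>. aut \<sigma> (\<lambda>y. y) (to_ac \<zeta>) 1)"
definition "B2 = (SOME \<sigma>. aut \<sigma> (\<lambda>y. y) 1 (to_ac \<zeta>))"

lemma aut_S: "i < 3 \<Longrightarrow> aut (S i) (s i) (f i) (g i)"
  unfolding S_def by (rule someI_ex[OF ex_aut]) (use s_hom sK f_K g_K s_y1 s_y2 in auto)

lemma aut_B: "aut B1 (\<lambda>y. y) (to_ac \<zeta>) 1" "aut B2 (\<lambda>y. y) 1 (to_ac \<zeta>)"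
  unfolding B1_def B2_def
  by (rule someI_ex[OF ex_aut]; use base[of \<zeta>] subfldD(2)[OF K] ac.zeta_p in \<open>simp add: fhom_def\<close>)+

lemma aut_S_funpow: "i < 3 \<Longrightarrow> aut (S i ^^ n) (s i ^^ n) (nrm i (f i) n) (nrm i (g i) n)"
proof (induction n)
  case 0
  show ?case using aut_id by (simp add: nrm_def id_def)
next
  case (Suc n)
  have "aut (\<lambda>y. (S i ^^ n) (S i y)) (\<lambda>y. (s i ^^ n) (s i y)) ((s i ^^ n) (f i) * nrm i (f i) n) ((s i ^^ n) (g i) * nrm i (g i) n)"
    by (rule aut_comp[OF Suc.IH[OF Suc.prems] aut_S[OF Suc.prems]])
  then show ?case by (simp add: nrm_def comp_def mult.commute funpow_Suc_right del: funpow.simps(2))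
qed

lemma aut_B_funpow: "aut (B1 ^^ n) (\<lambda>y. y) (to_ac \<zeta> ^ n) 1" "aut (B2 ^^ n) (\<lambda>y. y) 1 (to_ac \<zeta> ^ n)"
proof (induction n)
  case (Suc n)
  show "aut (B1 ^^ Suc n) (\<lambda>y. y) (to_ac \<zeta> ^ Suc n) 1" "aut (B2 ^^ Suc n) (\<lambda>y. y) 1 (to_ac \<zeta> ^ Suc n)"
    using aut_comp[OF aut_B(1) Suc.IH(1)] aut_comp[OF aut_B(2) Suc.IH(2)] by (simp_all add: comp_def mult.commute)
qed (use aut_id in \<open>simp_all add: id_def\<close>)

text \<open>The two sides of each relation are compared through their restrictions to
  \<open>K\<close> and their factors on \<open>y1\<close> and \<open>y2\<close>. The \<zeta> in
  \<open>f_comm\<close> accounts for \<open>B1\<close>, the \<zeta> in \<open>g_comm\<close> for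
  \<open>B2\<close>, and the norms of the \<open>f i\<close> and \<open>g i\<close> account for the
  p-th powers.\<close>

sublocale ops: pc_ops M "S 0" "S 1" "S 2" B1 B2 p c1 d1 c2 d2 c d
proof
  have lt: "(0::nat) < 3" "(1::nat) < 3" "(2::nat) < 3" by simp_all
  note S = aut_S[OF lt(1)] aut_S[OF lt(2)] aut_S[OF lt(3)] and C = aut_comp and U = aut_unique
  show "p > 0" by (rule p_pos)
  fix y assume y: "y \<in> M"
  show "S 0 y \<in> M" "S 1 y \<in> M" "S 2 y \<in> M" "B1 y \<in> M" "B2 y \<in> M"
    using S aut_B y unfolding aut_def by auto
  have s1: "s i 1 = 1" if "i < 3" for i using fhomD(1)[OF s_hom[OF that] K] .
  have eqI: "\<sigma> y = \<sigma>' y" if "aut \<sigma> t u1 u2" "aut \<sigma>' t' v1 v2" "u1 = v1" "u2 = v2" "\<And>y. y \<in> K \<Longrightarrow> t y = t' y" for \<sigma> \<sigma>' t t' u1 u2 v1 v2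
    using aut_unique[OF that(1) _ that(5) y, of \<sigma>'] that(2-4) by simp
  have sz: "s i (to_ac \<zeta> * h) = to_ac \<zeta> * s i h" if "i < 3" "h \<in> K" for i h using s_scale[OF that] .
  show "S 0 (S 2 y) = S 2 (S 0 (B1 y))"
    by (rule eqI[OF C[OF S(1,3)] C[OF S(3) C[OF S(1) aut_B(1)]]])
      (use f_comm g_comm f_K g_K s_comm lt in \<open>simp_all add: sz s1 s_base mult_ac\<close>)
  show "S 1 (S 2 y) = S 2 (S 1 (B2 y))"
    by (rule eqI[OF C[OF S(2,3)] C[OF S(3) C[OF S(2) aut_B(2)]]])
      (use f_comm g_comm f_K g_K s_comm lt in \<open>simp_all add: sz s1 s_base mult_ac\<close>)
  show "S 0 (S 1 y) = S 1 (S 0 y)"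
    by (rule eqI[OF C[OF S(1,2)] C[OF S(2,1)]])
      (use f_comm g_comm f_K g_K s_comm lt in \<open>simp_all add: mult_ac\<close>)
  have SB: "B1 (S i y) = S i (B1 y)" "B2 (S i y) = S i (B2 y)" if "i < 3" for i
    by (rule eqI[OF C[OF aut_B(1) aut_S[OF that]] C[OF aut_S[OF that] aut_B(1)]],
        use that in \<open>simp_all add: s1 s_base\<close>)
      (rule eqI[OF C[OF aut_B(2) aut_S[OF that]] C[OF aut_S[OF that] aut_B(2)]],
        use that in \<open>simp_all add: s1 s_base\<close>)
  show "B1 (S 0 y) = S 0 (B1 y)" "B1 (S 1 y) = S 1 (B1 y)" "B1 (S 2 y) = S 2 (B1 y)"
    "B2 (S 0 y) = S 0 (B2 y)" "B2 (S 1 y) = S 1 (B2 y)" "B2 (S 2 y) = S 2 (B2 y)"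
    by (rule SB; simp)+
  show "B2 (B1 y) = B1 (B2 y)"
    by (rule eqI[OF C[OF aut_B(2,1)] C[OF aut_B]]) simp_all
  show "(B1 ^^ p) y = y" "(B2 ^^ p) y = y"
    by (rule eqI[OF aut_B_funpow(1) aut_id] eqI[OF aut_B_funpow(2) aut_id]; simp add: ac.zeta_p[simplified])+
  have P: "(S i ^^ p) y = (B1 ^^ m) ((B2 ^^ n) y)"
    if "i < 3" "nrm i (f i) p = to_ac \<zeta> ^ m" "nrm i (g i) p = to_ac \<zeta> ^ n" for i m n
    by (rule eqI[OF aut_S_funpow[OF that(1)] C[OF aut_B_funpow]]) (use that s_order in simp_all)
  show "(S 0 ^^ p) y = (B1 ^^ c1) ((B2 ^^ d1) y)" "(S 1 ^^ p) y = (B1 ^^ c2) ((B2 ^^ d2) y)"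
    "(S 2 ^^ p) y = (B1 ^^ c) ((B2 ^^ d) y)"
    by (rule P; use f_nrm g_nrm in simp)+
qed

end

section \<open>The realized group as normal forms of automorphisms\<close>

context kummer5
begin

lemma nf_eq: "ops.nf (i, j, l, m, n) y = (S 0 ^^ i) ((S 1 ^^ j) ((S 2 ^^ l) ((B1 ^^ m) ((B2 ^^ n) y))))"
  unfolding ops.nf_def by simp

lemma aut_nf:
  "\<exists>u1 u2. aut (ops.nf (i, j, l, m, n)) (\<lambda>y. (s 0 ^^ i) ((s 1 ^^ j) ((s 2 ^^ l) y))) u1 u2"
proof -
  have lt: "(0::nat) < 3" "(1::nat) < 3" "(2::nat) < 3" by simp_all
  note C = aut_comp and S = aut_S_funpow[OF lt(1)] aut_S_funpow[OF lt(2)] aut_S_funpow[OF lt(3)]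
  have "ops.nf (i, j, l, m, n) = (\<lambda>y. (S 0 ^^ i) ((S 1 ^^ j) ((S 2 ^^ l) ((B1 ^^ m) ((B2 ^^ n) y)))))"
    unfolding fun_eq_iff nf_eq by simp
  then show ?thesis
    using C[OF S(1) C[OF S(2) C[OF S(3) C[OF aut_B_funpow]]], of i j l m n] by metis
qed

lemma nf_hom: "fhom M (ops.nf v)"
  using aut_nf unfolding aut_def by (cases v) blast

lemma nf_base: "ops.nf v (to_ac z) = to_ac z"
proof -
  obtain i j l m n where v: "v = (i, j, l, m, n)" by (metis prod_cases5)
  have "(s k ^^ q) (to_ac z) = to_ac z" if "k < 3" for k q using s_base[OF that] by (induction q) simp_all
  then show ?thesis using aut_nf[of i j l m n] base[of z] unfolding v aut_def by auto
qed

lemma nf_x: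
  "ops.nf (i, j, l, m, n) (x 0) = to_ac \<zeta> ^ i * x 0" "ops.nf (i, j, l, m, n) (x 1) = to_ac \<zeta> ^ j * x 1"
  "ops.nf (i, j, l, m, n) (x 2) = to_ac \<zeta> ^ l * x 2"
  using aut_nf[of i j l m n] xK unfolding aut_def by (auto simp: s_funpow_x s_funpow_scale)

lemma nf_y:
  "ops.nf (i, j, l, m, n) y1 = to_ac \<zeta> ^ m * ops.nf (i, j, l, 0, 0) y1"
  "ops.nf (i, j, l, m, n) y2 = to_ac \<zeta> ^ n * ops.nf (i, j, l, 0, 0) y2"
proof -
  have "ops.nf (i, j, l, m, n) y = ops.nf (i, j, l, 0, 0) ((B1 ^^ m) ((B2 ^^ n) y))" for y
    unfolding nf_eq by simp
  moreover have "(B1 ^^ m) ((B2 ^^ n) y1) = to_ac (\<zeta> ^ m) * y1" "(B1 ^^ m) ((B2 ^^ n) y2) = to_ac (\<zeta> ^ n) * y2"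
    using aut_comp[OF aut_B_funpow, of m n] by (simp_all add: aut_def)
  ultimately show "ops.nf (i, j, l, m, n) y1 = to_ac \<zeta> ^ m * ops.nf (i, j, l, 0, 0) y1"
    "ops.nf (i, j, l, m, n) y2 = to_ac \<zeta> ^ n * ops.nf (i, j, l, 0, 0) y2"
    using fhomD(4)[OF nf_hom M(1) K_M[OF base]] y1_M M(3) nf_base by (simp_all del: to_ac_power, simp_all)
qed

text \<open>The first three exponents are read off from the roots \<open>x i\<close>, and then the
  last two from \<open>y1\<close> and \<open>y2\<close>.\<close>

lemma nf_inj:
  assumes v: "v \<in> nf_box p" "w \<in> nf_box p" and e: "\<And>y. y \<in> M \<Longrightarrow> ops.nf v y = ops.nf w y"
  shows "v = w"
proof -
  obtain i j l m n i' j' l' m' n' where vw: "v = (i, j, l, m, n)" "w = (i', j', l', m', n')"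
    by (metis prod_cases5)
  have lt: "(0::nat) < 3" "(1::nat) < 3" "(2::nat) < 3" by simp_all
  have nz: "ops.nf u y \<noteq> 0" if "y \<in> M" "y \<noteq> 0" for u y
    using fhomD(8)[OF nf_hom M(1) that(1)] that(2) by simp
  have "i = i'" "j = j'" "l = l'"
    using e[OF K_M[OF xK[OF lt(1)]]] e[OF K_M[OF xK[OF lt(2)]]] e[OF K_M[OF xK[OF lt(3)]]] v
      x_nz[OF lt(1)] x_nz[OF lt(2)] x_nz[OF lt(3)]
    unfolding vw nf_x by (auto intro: ac.zeta_power_inj)
  moreover from this have "m = m'" "n = n'"
    using e[OF y1_M] e[OF M(3)] nz[OF y1_M y1_nz] nz[OF M(3) y2_nz] v
    unfolding vw nf_y[of i j l m n] nf_y[of i' j' l' m' n'] by (auto intro: ac.zeta_power_inj)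
  ultimately show ?thesis by (simp add: vw)
qed

text \<open>Descent through \<open>M\<close>, \<open>L\<close> and \<open>K\<close>: invariance
  under \<open>B2\<close> leads to \<open>L\<close>, under \<open>B1\<close> to \<open>K\<close>,
  and under the \<open>S i\<close> to k.\<close>

lemma fixed_M:
  assumes y: "y \<in> M" and fix_y: "B1 y = y" "B2 y = y" "\<And>i. i < 3 \<Longrightarrow> S i y = y"
  shows "y \<in> range to_ac"
proof -
  note B = aut_B[unfolded aut_def]
  have id: "B2 y = y" if "y \<in> L" for y
    by (rule fhom_eq_on_ext[OF K p_gt_1 radical_K, folded L_def, of B2 "\<lambda>y. y"])
      (use B M(2) that in \<open>auto simp: fhom_def\<close>)
  have "y \<in> L"
    by (rule ac.mem_if_fixed_in_ext[OF L(1) L(2)[OF base] radical_L, of B2])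
      (use B id y fix_y in \<open>auto simp: M_def\<close>)
  then have "y \<in> K"
    by (intro ac.mem_if_fixed_in_ext[OF K base radical_K, of B1])
      (use B M(2) fix_y in \<open>auto simp: fhom_def L_def\<close>)
  then show ?thesis
    using fix_y(3) aut_S unfolding aut_def by (intro fixed) auto
qed

text \<open>Products in \<open>G\<close> and compositions of the automorphisms are computed by the
  same exponent arithmetic \<open>nf_mult\<close> and \<open>nf_red\<close>, so sending an element
  to the automorphism with its coordinates is an action.\<close>

lemma realizable_if_phi4:
  fixes G :: "('g, 'm) monoid_scheme"
  assumes "phi4 G p \<alpha> \<alpha>1 \<alpha>2 \<beta>1 \<beta>2 c1 d1 c2 d2 c d"
  shows "realizable TYPE('a) G"
proof -
  interpret P: phi4 G p \<alpha> \<alpha>1 \<alpha>2 \<beta>1 \<beta>2 c1 d1 c2 d2 c d by fact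
  have "galois_action G M (\<lambda>h. ops.nf (P.coord h))"
  proof
    show "finite (carrier G)"
      using P.phi_bij bij_betw_finite[of P.\<phi> "nf_box p" "carrier G"] by simp
    show "h = h'" if "h \<in> carrier G" "h' \<in> carrier G" "\<And>y. y \<in> M \<Longrightarrow> ops.nf (P.coord h) y = ops.nf (P.coord h') y" for h h'
      using nf_inj[OF P.phi_coord(1)[OF that(1)] P.phi_coord(1)[OF that(2)] that(3)] P.phi_coord(2) that(1,2) by metis
    show "ops.nf (P.coord (h \<otimes>\<^bsub>G\<^esub> h')) y = ops.nf (P.coord h) (ops.nf (P.coord h') y)"
      if "h \<in> carrier G" "h' \<in> carrier G" "y \<in> M" for h h' y
      unfolding P.coord_mult[OF that(1,2)] ops.nf_nf[OF that(3)] by (rule ops.nf_red[OF that(3), symmetric])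
    show "y \<in> range to_ac" if y: "y \<in> M" "\<And>h. h \<in> carrier G \<Longrightarrow> ops.nf (P.coord h) y = y" for y
    proof (rule fixed_M[OF y(1)])
      show "B1 y = y" "B2 y = y"
        using y(2)[OF P.in_carrier(4)] y(2)[OF P.in_carrier(5)]
        unfolding P.coord_gens nf_eq by simp_all
      have "S 0 y = y" "S 1 y = y" "S 2 y = y"
        using y(2)[OF P.in_carrier(2)] y(2)[OF P.in_carrier(3)] y(2)[OF P.in_carrier(1)]
        unfolding P.coord_gens nf_eq by simp_all
      then show "S i y = y" if "i < 3" for i
        using that all_less_3[of "\<lambda>i. S i y = y"] by blast
    qed
  qed (use M(1) K_M[OF base] nf_hom nf_base ops.nf_mem in auto)
  then show ?thesis by (rule galois_action.realizable)
qed

end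

lemma (in kummer3) kummer5_if_obs:
  assumes "obs (\<zeta> ^ c1) (\<zeta> ^ c2) (\<zeta> ^ c)" "kummer3.obs p \<zeta> K (s \<circ> swap01) (\<zeta> ^ d2) (\<zeta> ^ d1) (\<zeta> ^ d)"
  shows "\<exists>f g y1 y2. kummer5 p \<zeta> K x s a f g c1 d1 c2 d2 c d y1 y2"
proof -
  interpret swap: kummer3 p \<zeta> K "x \<circ> swap01" "s \<circ> swap01" "a \<circ> swap01"
    by (rule kummer3_swap) unfold_locales
  have lt3: "i = 0 \<or> i = 1 \<or> i = 2" if "i < 3" for i :: nat using that by auto
  obtain f :: "nat \<Rightarrow> 'a alg_closure" where f: "\<forall>i<3. f i \<in> K \<and> f i \<noteq> 0"
    "nrm 0 (f 0) p = to_ac (\<zeta> ^ c1)" "nrm 1 (f 1) p = to_ac (\<zeta> ^ c2)" "nrm 2 (f 2) p = to_ac (\<zeta> ^ c)"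
    "f 0 * s 0 (f 2) = to_ac \<zeta> * (f 2 * s 2 (f 0))" "f 0 * s 0 (f 1) = f 1 * s 1 (f 0)" "f 1 * s 1 (f 2) = f 2 * s 2 (f 1)"
    using assms(1) unfolding obs_def by blast
  obtain h :: "nat \<Rightarrow> 'a alg_closure" where h: "\<forall>i<3. h i \<in> K \<and> h i \<noteq> 0"
    "swap.nrm 0 (h 0) p = to_ac (\<zeta> ^ d2)" "swap.nrm 1 (h 1) p = to_ac (\<zeta> ^ d1)" "swap.nrm 2 (h 2) p = to_ac (\<zeta> ^ d)"
    "h 0 * (s \<circ> swap01) 0 (h 2) = to_ac \<zeta> * (h 2 * (s \<circ> swap01) 2 (h 0))"
    "h 0 * (s \<circ> swap01) 0 (h 1) = h 1 * (s \<circ> swap01) 1 (h 0)" "h 1 * (s \<circ> swap01) 1 (h 2) = h 2 * (s \<circ> swap01) 2 (h 1)"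
    using assms(2) unfolding swap.obs_def by blast
  \<comment> \<open>\<open>h\<close> is indexed for the exchanged generators; \<open>g\<close>
    restores the order \<alpha>1, \<alpha>2, \<alpha>.\<close>
  define g where "g i = h (swap01 i)" for i
  have sw: "swap01 0 = 1" "swap01 1 = 0" "swap01 2 = 2" by (simp_all add: swap01_def)
  have sc: "(s \<circ> swap01) 0 = s 1" "(s \<circ> swap01) 1 = s 0" "(s \<circ> swap01) 2 = s 2" unfolding comp_def sw by simp_all
  have g: "\<forall>i<3. g i \<in> K \<and> g i \<noteq> 0"
    using h(1) by (auto simp: g_def swap01_def)
  have gn: "nrm 0 (g 0) p = to_ac (\<zeta> ^ d1)" "nrm 1 (g 1) p = to_ac (\<zeta> ^ d2)" "nrm 2 (g 2) p = to_ac (\<zeta> ^ d)"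
    using h(2-4) unfolding nrm_def swap.nrm_def sc g_def sw by simp_all
  have gc: "g 1 * s 1 (g 2) = to_ac \<zeta> * (g 2 * s 2 (g 1))" "g 0 * s 0 (g 1) = g 1 * s 1 (g 0)" "g 0 * s 0 (g 2) = g 2 * s 2 (g 0)"
    using h(5-7) unfolding sc g_def sw by simp_all
  have z: "to_ac (\<zeta> ^ m) ^ p = 1" for m using zeta_power_power_p[of m] by (simp flip: to_ac_power)
  obtain y1 where y1: "y1 \<noteq> 0" "y1 ^ p \<in> K" "\<And>i. i < 3 \<Longrightarrow> s i (y1 ^ p) = f i ^ p * y1 ^ p"
  proof (rule kummer_root[of f])
    show "nrm i (f i) p ^ p = 1" if "i < 3" for i using lt3[OF that] f(2-4) z by auto
    show "(f i * s i (f j)) ^ p = (f j * s j (f i)) ^ p" if "i < 3" "j < 3" for i j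
      using lt3[OF that(1)] lt3[OF that(2)] f(5-7) ac.zeta_p
      by (elim disjE) (simp_all only: power_mult_distrib[of "to_ac \<zeta>"] mult_1_left)
  qed (use f(1) in blast)+
  obtain y2 where y2: "y2 \<noteq> 0" "y2 ^ p \<in> K" "\<And>i. i < 3 \<Longrightarrow> s i (y2 ^ p) = g i ^ p * y2 ^ p"
  proof (rule kummer_root[of g])
    show "nrm i (g i) p ^ p = 1" if "i < 3" for i using lt3[OF that] gn z by auto
    show "(g i * s i (g j)) ^ p = (g j * s j (g i)) ^ p" if "i < 3" "j < 3" for i j
      using lt3[OF that(1)] lt3[OF that(2)] gc ac.zeta_p
      by (elim disjE) (simp_all only: power_mult_distrib[of "to_ac \<zeta>"] mult_1_left)
  qed (use g in blast)+
  have "kummer5 p \<zeta> K x s a f g c1 d1 c2 d2 c d y1 y2"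
    by unfold_locales (use f g gn gc y1 y2 in auto)
  then show ?thesis by blast
qed

context primitive_root
begin

lemma realizable_iff_obs:
  fixes G :: "('g, 'm) monoid_scheme"
  assumes "phi4 G p \<alpha> \<alpha>1 \<alpha>2 \<beta>1 \<beta>2 c1 d1 c2 d2 c d"
  shows "realizable TYPE('a) G \<longleftrightarrow> (\<exists>K x s a. kummer3 p \<zeta> K x s a \<and>
    kummer3.obs p \<zeta> K s (\<zeta> ^ c1) (\<zeta> ^ c2) (\<zeta> ^ c) \<and>
    kummer3.obs p \<zeta> K (s \<circ> swap01) (\<zeta> ^ d2) (\<zeta> ^ d1) (\<zeta> ^ d))"
proof
  interpret P: phi4 G p \<alpha> \<alpha>1 \<alpha>2 \<beta>1 \<beta>2 c1 d1 c2 d2 c d by fact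
  assume "realizable TYPE('a) G"
  moreover have "finite (carrier G)"
    using P.phi_bij bij_betw_finite[of P.\<phi> "nf_box p" "carrier G"] by simp
  ultimately obtain M :: "'a alg_closure set" and act where "galois_action G M act"
    using galois_action_if_realizable[OF P.is_group] by blast
  then interpret phi4_action G M act p \<alpha> \<alpha>1 \<alpha>2 \<beta>1 \<beta>2 c1 d1 c2 d2 c d \<zeta>
    by (intro phi4_action.intro assms primitive_root_axioms)
  show "\<exists>K x s a. kummer3 p \<zeta> K x s a \<and> kummer3.obs p \<zeta> K s (\<zeta> ^ c1) (\<zeta> ^ c2) (\<zeta> ^ c) \<and>
    kummer3.obs p \<zeta> K (s \<circ> swap01) (\<zeta> ^ d2) (\<zeta> ^ d1) (\<zeta> ^ d)"
    by (rule kummer3_if_action)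
next
  assume "\<exists>K x s a. kummer3 p \<zeta> K x s a \<and> kummer3.obs p \<zeta> K s (\<zeta> ^ c1) (\<zeta> ^ c2) (\<zeta> ^ c) \<and>
    kummer3.obs p \<zeta> K (s \<circ> swap01) (\<zeta> ^ d2) (\<zeta> ^ d1) (\<zeta> ^ d)"
  then obtain K x s a where k: "kummer3 p \<zeta> K x s a" "kummer3.obs p \<zeta> K s (\<zeta> ^ c1) (\<zeta> ^ c2) (\<zeta> ^ c)"
    "kummer3.obs p \<zeta> K (s \<circ> swap01) (\<zeta> ^ d2) (\<zeta> ^ d1) (\<zeta> ^ d)" by blast
  obtain f g y1 y2 where "kummer5 p \<zeta> K x s a f g c1 d1 c2 d2 c d y1 y2"
    using kummer3.kummer5_if_obs[OF k] by blast
  then show "realizable TYPE('a) G" by (rule kummer5.realizable_if_phi4[OF _ assms])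
qed

text \<open>A realization supplies one Kummer extension, an independent triple lets one be
  constructed; both can be used because \<open>R1\<close> and \<open>R2\<close> express the cocycle
  conditions by \<open>a\<close> alone. \<open>R2\<close> belongs to \<beta>2 and \<open>R1\<close>
  to \<beta>1, in the order in which the theorem lists the elements.\<close>

lemma realizable_iff:
  fixes G :: "('g, 'm) monoid_scheme"
  assumes "phi4 G p \<alpha> \<alpha>1 \<alpha>2 \<beta>1 \<beta>2 c1 d1 c2 d2 c d"
    and obs1: "\<And>K x s a. kummer3 p \<zeta> K x s a \<Longrightarrow>
      kummer3.obs p \<zeta> K s (\<zeta> ^ c1) (\<zeta> ^ c2) (\<zeta> ^ c) \<longleftrightarrow> R1 (a 0) (a 1) (a 2)"
    and obs2: "\<And>K x s a. kummer3 p \<zeta> K x s a \<Longrightarrow>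
      kummer3.obs p \<zeta> K (s \<circ> swap01) (\<zeta> ^ d2) (\<zeta> ^ d1) (\<zeta> ^ d) \<longleftrightarrow> R2 (a 0) (a 1) (a 2)"
  shows "realizable TYPE('a) G \<longleftrightarrow>
    (\<exists>a1 a2 a3. independent_mod_powers p a1 a2 a3 \<and> R2 a1 a2 a3 \<and> R1 a1 a2 a3)"
proof -
  have "\<exists>K x s a. kummer3 p \<zeta> K x s a \<and> kummer3.obs p \<zeta> K s (\<zeta> ^ c1) (\<zeta> ^ c2) (\<zeta> ^ c) \<and>
    kummer3.obs p \<zeta> K (s \<circ> swap01) (\<zeta> ^ d2) (\<zeta> ^ d1) (\<zeta> ^ d)"
    if ind: "independent_mod_powers p a1 a2 a3" and R: "R2 a1 a2 a3" "R1 a1 a2 a3" for a1 a2 a3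
  proof -
    obtain K x s a where k: "kummer3 p \<zeta> K x s a" "a 0 = a1" "a 1 = a2" "a 2 = a3"
      by (rule kummer3_if_independent[OF ind])
    then show ?thesis using R obs1[OF k(1)] obs2[OF k(1)] by blast
  qed
  moreover have "independent_mod_powers p (a 0) (a 1) (a 2) \<and> R2 (a 0) (a 1) (a 2) \<and> R1 (a 0) (a 1) (a 2)"
    if "kummer3 p \<zeta> K x s a" "kummer3.obs p \<zeta> K s (\<zeta> ^ c1) (\<zeta> ^ c2) (\<zeta> ^ c)"
      "kummer3.obs p \<zeta> K (s \<circ> swap01) (\<zeta> ^ d2) (\<zeta> ^ d1) (\<zeta> ^ d)" for K x s a
    using kummer3.independent[OF that(1)] obs1[OF that(1)] obs2[OF that(1)] that(2,3) by blast
  ultimately show ?thesis unfolding realizable_iff_obs[OF assms(1)] by blast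
qed

end

section \<open>The conditions in terms of Brauer classes\<close>

context kummer3
begin

lemma obs_one: "obs (\<zeta> ^ m) (\<zeta> ^ 0) (\<zeta> ^ 0) \<longleftrightarrow> symbol_class p \<zeta> (a 0) (\<zeta> ^ m * a 2) = \<one>\<^bsub>Br\<^esub>"
  using obs_iff_split_one[of "\<zeta> ^ m"] symbol_class_eq_one_iff[of "a 0" "\<zeta> ^ m * a 2"] a_nz zeta_nz by simp

lemma obs_two: "obs (\<zeta> ^ m) (\<zeta> ^ n) (\<zeta> ^ 0) \<longleftrightarrow>
    symbol_class p \<zeta> (a 0) (\<zeta> ^ m * a 2) \<otimes>\<^bsub>Br\<^esub> symbol_class p \<zeta> (a 1) (\<zeta> ^ n) = \<one>\<^bsub>Br\<^esub>"
  using obs_iff_split_two[of "\<zeta> ^ m" "\<zeta> ^ n"]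
    symbol_class_mult_eq_one_iff[of "a 0" "\<zeta> ^ m * a 2" "a 1" "\<zeta> ^ n"] a_nz[of 0] a_nz[of 1] a_nz[of 2] zeta_nz by simp

lemma obs_power: "obs (\<zeta> ^ 0) (\<zeta> ^ 0) (\<zeta> ^ 1) \<longleftrightarrow> symbol_class p \<zeta> (inverse \<zeta> * a 0) (a 2) = \<one>\<^bsub>Br\<^esub>"
  using obs_iff_split_swapped[of \<zeta>] symbol_class_eq_one_iff[of "inverse \<zeta> * a 0" "a 2"] a_nz zeta_nz by simp

end

lemma kummer3_obs_swap01:
  assumes "kummer3 p \<zeta> K x s a"
  shows "kummer3.obs p \<zeta> K (s \<circ> swap01) (\<zeta> ^ m) (\<zeta> ^ 0) (\<zeta> ^ 0) \<longleftrightarrow>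
      symbol_class p \<zeta> (a 1) (\<zeta> ^ m * a 2) = \<one>\<^bsub>Br\<^esub>"
    "kummer3.obs p \<zeta> K (s \<circ> swap01) (\<zeta> ^ m) (\<zeta> ^ n) (\<zeta> ^ 0) \<longleftrightarrow>
      symbol_class p \<zeta> (a 1) (\<zeta> ^ m * a 2) \<otimes>\<^bsub>Br\<^esub> symbol_class p \<zeta> (a 0) (\<zeta> ^ n) = \<one>\<^bsub>Br\<^esub>"
    "kummer3.obs p \<zeta> K (s \<circ> swap01) (\<zeta> ^ 0) (\<zeta> ^ 0) (\<zeta> ^ 1) \<longleftrightarrow>
      symbol_class p \<zeta> (inverse \<zeta> * a 1) (a 2) = \<one>\<^bsub>Br\<^esub>"
proof -
  have e: "(a \<circ> swap01) 0 = a 1" "(a \<circ> swap01) 1 = a 0" "(a \<circ> swap01) 2 = a 2"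
    by (simp_all add: swap01_def)
  note S = kummer3_swap[OF assms]
  show "kummer3.obs p \<zeta> K (s \<circ> swap01) (\<zeta> ^ m) (\<zeta> ^ 0) (\<zeta> ^ 0) \<longleftrightarrow>
      symbol_class p \<zeta> (a 1) (\<zeta> ^ m * a 2) = \<one>\<^bsub>Br\<^esub>"
    "kummer3.obs p \<zeta> K (s \<circ> swap01) (\<zeta> ^ m) (\<zeta> ^ n) (\<zeta> ^ 0) \<longleftrightarrow>
      symbol_class p \<zeta> (a 1) (\<zeta> ^ m * a 2) \<otimes>\<^bsub>Br\<^esub> symbol_class p \<zeta> (a 0) (\<zeta> ^ n) = \<one>\<^bsub>Br\<^esub>"
    "kummer3.obs p \<zeta> K (s \<circ> swap01) (\<zeta> ^ 0) (\<zeta> ^ 0) (\<zeta> ^ 1) \<longleftrightarrow>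
      symbol_class p \<zeta> (inverse \<zeta> * a 1) (a 2) = \<one>\<^bsub>Br\<^esub>"
    by (rule kummer3.obs_one[OF S, unfolded e] kummer3.obs_two[OF S, unfolded e] kummer3.obs_power[OF S, unfolded e])+
qed

section \<open>The groups of the theorem\<close>

context primitive_root
begin

context
  fixes G :: "('g, 'm) monoid_scheme" and \<alpha> \<alpha>1 \<alpha>2 \<beta>1 \<beta>2 :: 'g and c1 d1 c2 d2 :: nat
begin

text \<open>In this and the following names the two last words describe the conditions for \<beta>2
  and for \<beta>1: \<open>power\<close> is the symbol coming from a nontrivial p-th power of
  \<alpha>, \<open>one\<close> a single symbol, \<open>two\<close> a product of two symbols.\<close>

lemma realizable_power_one:
  assumes "phi4 G p \<alpha> \<alpha>1 \<alpha>2 \<beta>1 \<beta>2 c1 0 0 0 0 1"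
  shows "realizable TYPE('a) G \<longleftrightarrow> (\<exists>a1 a2 a3. independent_mod_powers p a1 a2 a3 \<and>
    symbol_class p \<zeta> (inverse \<zeta> * a2) a3 = \<one>\<^bsub>Br\<^esub> \<and> symbol_class p \<zeta> a1 (\<zeta> ^ c1 * a3) = \<one>\<^bsub>Br\<^esub>)"
  by (rule realizable_iff[OF assms kummer3.obs_one kummer3_obs_swap01(3)])

lemma realizable_power_two:
  assumes "phi4 G p \<alpha> \<alpha>1 \<alpha>2 \<beta>1 \<beta>2 c1 0 c2 0 0 1"
  shows "realizable TYPE('a) G \<longleftrightarrow> (\<exists>a1 a2 a3. independent_mod_powers p a1 a2 a3 \<and>
    symbol_class p \<zeta> (inverse \<zeta> * a2) a3 = \<one>\<^bsub>Br\<^esub> \<and>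
    symbol_class p \<zeta> a1 (\<zeta> ^ c1 * a3) \<otimes>\<^bsub>Br\<^esub> symbol_class p \<zeta> a2 (\<zeta> ^ c2) = \<one>\<^bsub>Br\<^esub>)"
  by (rule realizable_iff[OF assms kummer3.obs_two kummer3_obs_swap01(3)])

lemma realizable_one_one:
  assumes "phi4 G p \<alpha> \<alpha>1 \<alpha>2 \<beta>1 \<beta>2 c1 0 0 d2 0 0"
  shows "realizable TYPE('a) G \<longleftrightarrow> (\<exists>a1 a2 a3. independent_mod_powers p a1 a2 a3 \<and>
    symbol_class p \<zeta> a2 (\<zeta> ^ d2 * a3) = \<one>\<^bsub>Br\<^esub> \<and> symbol_class p \<zeta> a1 (\<zeta> ^ c1 * a3) = \<one>\<^bsub>Br\<^esub>)"
  by (rule realizable_iff[OF assms kummer3.obs_one kummer3_obs_swap01(1)])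

lemma realizable_one_two:
  assumes "phi4 G p \<alpha> \<alpha>1 \<alpha>2 \<beta>1 \<beta>2 c1 0 c2 d2 0 0"
  shows "realizable TYPE('a) G \<longleftrightarrow> (\<exists>a1 a2 a3. independent_mod_powers p a1 a2 a3 \<and>
    symbol_class p \<zeta> a2 (\<zeta> ^ d2 * a3) = \<one>\<^bsub>Br\<^esub> \<and>
    symbol_class p \<zeta> a1 (\<zeta> ^ c1 * a3) \<otimes>\<^bsub>Br\<^esub> symbol_class p \<zeta> a2 (\<zeta> ^ c2) = \<one>\<^bsub>Br\<^esub>)"
  by (rule realizable_iff[OF assms kummer3.obs_two kummer3_obs_swap01(1)])

lemma realizable_two_two:
  assumes "phi4 G p \<alpha> \<alpha>1 \<alpha>2 \<beta>1 \<beta>2 c1 d1 c2 d2 0 0"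
  shows "realizable TYPE('a) G \<longleftrightarrow> (\<exists>a1 a2 a3. independent_mod_powers p a1 a2 a3 \<and>
    symbol_class p \<zeta> a2 (\<zeta> ^ d2 * a3) \<otimes>\<^bsub>Br\<^esub> symbol_class p \<zeta> a1 (\<zeta> ^ d1) = \<one>\<^bsub>Br\<^esub> \<and>
    symbol_class p \<zeta> a1 (\<zeta> ^ c1 * a3) \<otimes>\<^bsub>Br\<^esub> symbol_class p \<zeta> a2 (\<zeta> ^ c2) = \<one>\<^bsub>Br\<^esub>)"
  by (rule realizable_iff[OF assms kummer3.obs_two kummer3_obs_swap01(2)])

end

text \<open>Translates the integer exponents of the theorem into the natural exponents of
  \<open>phi4\<close>; \<open>int_pow_mod\<close> does the same in \<open>G\<close>.\<close>

lemma zeta_power_int_mod: "\<zeta> powi \<kappa> = \<zeta> ^ nat (\<kappa> mod int p)"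
proof -
  have "\<zeta> powi \<kappa> = \<zeta> powi (int p * (\<kappa> div int p) + \<kappa> mod int p)" by simp
  also have "\<dots> = (\<zeta> powi int p) powi (\<kappa> div int p) * \<zeta> powi (\<kappa> mod int p)"
    using zeta_nz by (simp only: power_int_add power_int_mult simp_thms)
  also have "\<zeta> powi int p = 1" using zeta_p by simp
  also have "\<zeta> powi (\<kappa> mod int p) = \<zeta> ^ nat (\<kappa> mod int p)"
    using p_pos by (simp add: power_int_def)
  finally show ?thesis by simp
qed

end

lemma (in group) int_pow_mod:
  assumes "x \<in> carrier G" "x [^] (p::nat) = \<one>" "p > 0"
  shows "x [^] (\<kappa>::int) = x [^] nat (\<kappa> mod int p)"
proof -
  have "x [^] \<kappa> = x [^] (int p * (\<kappa> div int p) + \<kappa> mod int p)" by simp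
  also have "\<dots> = (x [^] int p) [^] (\<kappa> div int p) \<otimes> x [^] (\<kappa> mod int p)"
    using assms(1) by (simp only: int_pow_mult int_pow_pow)
  also have "x [^] int p = \<one>" using assms by (simp add: int_pow_int)
  also have "x [^] (\<kappa> mod int p) = x [^] nat (\<kappa> mod int p)"
    using assms(3) by (simp flip: int_pow_int)
  finally show ?thesis using assms(1) by simp
qed

text \<open>Every case is an instance of one of the five shapes of power relations treated above;
  only the exponents have to be supplied.\<close>

theorem mainTheorem6:
  fixes p :: nat and \<zeta> :: "'a::field"
    and G :: "('g, 'm) monoid_scheme" and \<alpha> \<alpha>1 \<alpha>2 \<beta>1 \<beta>2 :: 'g
  assumes "Factorial_Ring.prime p" and "odd p" and "CHAR('a) \<noteq> p"
    and "\<zeta> ^ p = 1" and "\<And>n. 0 < n \<Longrightarrow> n < p \<Longrightarrow> \<zeta> ^ n \<noteq> 1"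
    and "Phi4_generators p G \<alpha> \<alpha>1 \<alpha>2 \<beta>1 \<beta>2"
  shows
   "(\<alpha> [^]\<^bsub>G\<^esub> p = \<beta>2 \<and> \<alpha>1 [^]\<^bsub>G\<^esub> p = \<beta>1 \<and> \<alpha>2 [^]\<^bsub>G\<^esub> p = \<one>\<^bsub>G\<^esub> \<longrightarrow>
      (realizable TYPE('a) G \<longleftrightarrow> (\<exists>a1 a2 a3. independent_mod_powers p a1 a2 a3 \<and>
        symbol_class p \<zeta> (inverse \<zeta> * a2) a3 = \<one>\<^bsub>Br\<^esub> \<and>
        symbol_class p \<zeta> a1 (\<zeta> * a3) = \<one>\<^bsub>Br\<^esub>)))
  \<and> (\<alpha> [^]\<^bsub>G\<^esub> p = \<beta>2 \<and> \<alpha>2 [^]\<^bsub>G\<^esub> p = \<beta>1 \<and> \<alpha>1 [^]\<^bsub>G\<^esub> p = \<one>\<^bsub>G\<^esub> \<longrightarrow>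
      (realizable TYPE('a) G \<longleftrightarrow> (\<exists>a1 a2 a3. independent_mod_powers p a1 a2 a3 \<and>
        symbol_class p \<zeta> (inverse \<zeta> * a2) a3 = \<one>\<^bsub>Br\<^esub> \<and>
        symbol_class p \<zeta> a1 a3 \<otimes>\<^bsub>Br\<^esub> symbol_class p \<zeta> a2 \<zeta> = \<one>\<^bsub>Br\<^esub>)))
  \<and> (\<alpha>1 [^]\<^bsub>G\<^esub> p = \<beta>1 \<and> \<alpha>2 [^]\<^bsub>G\<^esub> p = \<beta>2 \<and> \<alpha> [^]\<^bsub>G\<^esub> p = \<one>\<^bsub>G\<^esub> \<longrightarrow>
      (realizable TYPE('a) G \<longleftrightarrow> (\<exists>a1 a2 a3. independent_mod_powers p a1 a2 a3 \<and>
        symbol_class p \<zeta> a2 (\<zeta> * a3) = \<one>\<^bsub>Br\<^esub> \<and>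
        symbol_class p \<zeta> a1 (\<zeta> * a3) = \<one>\<^bsub>Br\<^esub>)))
  \<and> (\<forall>r \<in> {1..(p - 1) div 2}. \<forall>\<kappa>. \<kappa> = least_primroot p ^ r \<longrightarrow>
      \<alpha>1 [^]\<^bsub>G\<^esub> p = \<beta>1 [^]\<^bsub>G\<^esub> \<kappa> \<and> \<alpha>2 [^]\<^bsub>G\<^esub> p = \<beta>2 \<and> \<alpha> [^]\<^bsub>G\<^esub> p = \<one>\<^bsub>G\<^esub> \<longrightarrow>
      (realizable TYPE('a) G \<longleftrightarrow> (\<exists>a1 a2 a3. independent_mod_powers p a1 a2 a3 \<and>
        symbol_class p \<zeta> a2 (\<zeta> * a3) = \<one>\<^bsub>Br\<^esub> \<and>
        symbol_class p \<zeta> a1 (\<zeta> ^ \<kappa> * a3) = \<one>\<^bsub>Br\<^esub>)))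
  \<and> (\<forall>\<kappa> :: int. [4 * \<kappa> = - 1] (mod int p) \<longrightarrow>
      \<alpha>1 [^]\<^bsub>G\<^esub> p = \<beta>2 [^]\<^bsub>G\<^esub> \<kappa> \<and> \<alpha>2 [^]\<^bsub>G\<^esub> p = \<beta>1 \<otimes>\<^bsub>G\<^esub> \<beta>2 \<and> \<alpha> [^]\<^bsub>G\<^esub> p = \<one>\<^bsub>G\<^esub> \<longrightarrow>
      (realizable TYPE('a) G \<longleftrightarrow> (\<exists>a1 a2 a3. independent_mod_powers p a1 a2 a3 \<and>
        symbol_class p \<zeta> a2 (\<zeta> * a3) \<otimes>\<^bsub>Br\<^esub> symbol_class p \<zeta> a1 (\<zeta> powi \<kappa>) = \<one>\<^bsub>Br\<^esub> \<and>
        symbol_class p \<zeta> a1 a3 \<otimes>\<^bsub>Br\<^esub> symbol_class p \<zeta> a2 \<zeta> = \<one>\<^bsub>Br\<^esub>)))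
  \<and> (\<alpha>1 [^]\<^bsub>G\<^esub> p = \<beta>2 \<and> \<alpha>2 [^]\<^bsub>G\<^esub> p = \<beta>1 [^]\<^bsub>G\<^esub> least_nonresidue p \<and> \<alpha> [^]\<^bsub>G\<^esub> p = \<one>\<^bsub>G\<^esub> \<longrightarrow>
      (realizable TYPE('a) G \<longleftrightarrow> (\<exists>a1 a2 a3. independent_mod_powers p a1 a2 a3 \<and>
        symbol_class p \<zeta> a2 a3 \<otimes>\<^bsub>Br\<^esub> symbol_class p \<zeta> a1 \<zeta> = \<one>\<^bsub>Br\<^esub> \<and>
        symbol_class p \<zeta> a1 a3 \<otimes>\<^bsub>Br\<^esub> symbol_class p \<zeta> a2 (\<zeta> ^ least_nonresidue p) = \<one>\<^bsub>Br\<^esub>)))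
  \<and> (\<forall>r \<in> {1..(p - 1) div 2}. \<forall>\<kappa> :: int. [4 * \<kappa> = int (least_primroot p ^ (2 * r + 1))] (mod int p) \<longrightarrow>
      \<alpha>1 [^]\<^bsub>G\<^esub> p = \<beta>2 [^]\<^bsub>G\<^esub> \<kappa> \<and> \<alpha>2 [^]\<^bsub>G\<^esub> p = \<beta>1 \<otimes>\<^bsub>G\<^esub> \<beta>2 \<and> \<alpha> [^]\<^bsub>G\<^esub> p = \<one>\<^bsub>G\<^esub> \<longrightarrow>
      (realizable TYPE('a) G \<longleftrightarrow> (\<exists>a1 a2 a3. independent_mod_powers p a1 a2 a3 \<and>
        symbol_class p \<zeta> a2 (\<zeta> * a3) \<otimes>\<^bsub>Br\<^esub> symbol_class p \<zeta> a1 (\<zeta> powi \<kappa>) = \<one>\<^bsub>Br\<^esub> \<and>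
        symbol_class p \<zeta> a1 a3 \<otimes>\<^bsub>Br\<^esub> symbol_class p \<zeta> a2 \<zeta> = \<one>\<^bsub>Br\<^esub>)))
  \<and> (\<alpha> [^]\<^bsub>G\<^esub> p = \<beta>2 \<and> \<alpha>1 [^]\<^bsub>G\<^esub> p = \<one>\<^bsub>G\<^esub> \<and> \<alpha>2 [^]\<^bsub>G\<^esub> p = \<one>\<^bsub>G\<^esub> \<longrightarrow>
      (realizable TYPE('a) G \<longleftrightarrow> (\<exists>a1 a2 a3. independent_mod_powers p a1 a2 a3 \<and>
        symbol_class p \<zeta> (inverse \<zeta> * a2) a3 = \<one>\<^bsub>Br\<^esub> \<and>
        symbol_class p \<zeta> a1 a3 = \<one>\<^bsub>Br\<^esub>)))
  \<and> (\<alpha>1 [^]\<^bsub>G\<^esub> p = \<beta>1 \<and> \<alpha> [^]\<^bsub>G\<^esub> p = \<one>\<^bsub>G\<^esub> \<and> \<alpha>2 [^]\<^bsub>G\<^esub> p = \<one>\<^bsub>G\<^esub> \<longrightarrow>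
      (realizable TYPE('a) G \<longleftrightarrow> (\<exists>a1 a2 a3. independent_mod_powers p a1 a2 a3 \<and>
        symbol_class p \<zeta> a2 a3 = \<one>\<^bsub>Br\<^esub> \<and>
        symbol_class p \<zeta> a1 (\<zeta> * a3) = \<one>\<^bsub>Br\<^esub>)))
  \<and> (\<alpha>2 [^]\<^bsub>G\<^esub> p = \<beta>1 \<and> \<alpha> [^]\<^bsub>G\<^esub> p = \<one>\<^bsub>G\<^esub> \<and> \<alpha>1 [^]\<^bsub>G\<^esub> p = \<one>\<^bsub>G\<^esub> \<longrightarrow>
      (realizable TYPE('a) G \<longleftrightarrow> (\<exists>a1 a2 a3. independent_mod_powers p a1 a2 a3 \<and>
        symbol_class p \<zeta> a2 a3 = \<one>\<^bsub>Br\<^esub> \<and>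
        symbol_class p \<zeta> a1 a3 \<otimes>\<^bsub>Br\<^esub> symbol_class p \<zeta> a2 \<zeta> = \<one>\<^bsub>Br\<^esub>)))
  \<and> (\<alpha> [^]\<^bsub>G\<^esub> p = \<one>\<^bsub>G\<^esub> \<and> \<alpha>1 [^]\<^bsub>G\<^esub> p = \<one>\<^bsub>G\<^esub> \<and> \<alpha>2 [^]\<^bsub>G\<^esub> p = \<one>\<^bsub>G\<^esub> \<longrightarrow>
      (realizable TYPE('a) G \<longleftrightarrow> (\<exists>a1 a2 a3. independent_mod_powers p a1 a2 a3 \<and>
        symbol_class p \<zeta> a2 a3 = \<one>\<^bsub>Br\<^esub> \<and>
        symbol_class p \<zeta> a1 a3 = \<one>\<^bsub>Br\<^esub>)))"
proof -
  interpret primitive_root p \<zeta>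
    by unfold_locales (fact assms)+
  have G: "group G" and car: "\<beta>1 \<in> carrier G" "\<beta>2 \<in> carrier G" and bp: "\<beta>2 [^]\<^bsub>G\<^esub> p = \<one>\<^bsub>G\<^esub>"
    using assms(6) by (auto simp: Phi4_generators_def)
  interpret group G by (rule G)
  have phi: "phi4 G p \<alpha> \<alpha>1 \<alpha>2 \<beta>1 \<beta>2 c1 d1 c2 d2 c d"
    if "\<alpha>1 [^]\<^bsub>G\<^esub> p = \<beta>1 [^]\<^bsub>G\<^esub> c1 \<otimes>\<^bsub>G\<^esub> \<beta>2 [^]\<^bsub>G\<^esub> d1" "\<alpha>2 [^]\<^bsub>G\<^esub> p = \<beta>1 [^]\<^bsub>G\<^esub> c2 \<otimes>\<^bsub>G\<^esub> \<beta>2 [^]\<^bsub>G\<^esub> d2"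
      "\<alpha> [^]\<^bsub>G\<^esub> p = \<beta>1 [^]\<^bsub>G\<^esub> c \<otimes>\<^bsub>G\<^esub> \<beta>2 [^]\<^bsub>G\<^esub> d" for c1 d1 c2 d2 c d :: nat
    by (intro phi4.intro G phi4_axioms.intro that assms(6) p_gt_1)
  note simps = zeta_power_int_mod[symmetric] power_one_right power_0 mult_1_left
  \<comment> \<open>The groups e and f_r have power relations of the same form with an integer
    exponent \<kappa>, so one argument serves both; \<open>nat (\<kappa> mod int p)\<close> is the
    natural exponent passed to \<open>phi4\<close>.\<close>
  have k57: "realizable TYPE('a) G \<longleftrightarrow> (\<exists>a1 a2 a3. independent_mod_powers p a1 a2 a3 \<and>
      symbol_class p \<zeta> a2 (\<zeta> * a3) \<otimes>\<^bsub>Br\<^esub> symbol_class p \<zeta> a1 (\<zeta> powi \<kappa>) = \<one>\<^bsub>Br\<^esub> \<and>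
      symbol_class p \<zeta> a1 a3 \<otimes>\<^bsub>Br\<^esub> symbol_class p \<zeta> a2 \<zeta> = \<one>\<^bsub>Br\<^esub>)"
    if k: "\<alpha>1 [^]\<^bsub>G\<^esub> p = \<beta>2 [^]\<^bsub>G\<^esub> \<kappa>" "\<alpha>2 [^]\<^bsub>G\<^esub> p = \<beta>1 \<otimes>\<^bsub>G\<^esub> \<beta>2" "\<alpha> [^]\<^bsub>G\<^esub> p = \<one>\<^bsub>G\<^esub>" for \<kappa> :: int
  proof -
    show ?thesis
      by (rule realizable_two_two[where ?c1.0 = 0 and ?d1.0 = "nat (\<kappa> mod int p)" and ?c2.0 = 1 and ?d2.0 = 1, OF phi, unfolded simps])
        (use k car int_pow_mod[OF car(2) bp p_pos, of \<kappa>] in simp_all)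
  qed
  show ?thesis
    apply (intro conjI impI ballI allI; (elim conjE)?)
    subgoal by (rule realizable_power_one[where ?c1.0 = 1, OF phi, unfolded simps]) (use car in simp_all)
    subgoal by (rule realizable_power_two[where ?c1.0 = 0 and ?c2.0 = 1, OF phi, unfolded simps]) (use car in simp_all)
    subgoal by (rule realizable_one_one[where ?c1.0 = 1 and ?d2.0 = 1, OF phi, unfolded simps]) (use car in simp_all)
    subgoal by (rule realizable_one_one[where ?d2.0 = 1, OF phi, unfolded simps]) (use car in simp_all)
    subgoal by (rule k57) (use car in simp_all)
    subgoal by (rule realizable_two_two[where ?c1.0 = 0 and ?d1.0 = 1 and ?d2.0 = 0, OF phi, unfolded simps]) (use car in simp_all)
    subgoal by (rule k57) (use car in simp_all)
    subgoal by (rule realizable_power_one[where ?c1.0 = 0, OF phi, unfolded simps]) (use car in simp_all)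
    subgoal by (rule realizable_one_one[where ?c1.0 = 1 and ?d2.0 = 0, OF phi, unfolded simps]) (use car in simp_all)
    subgoal by (rule realizable_one_two[where ?c1.0 = 0 and ?c2.0 = 1 and ?d2.0 = 0, OF phi, unfolded simps]) (use car in simp_all)
    subgoal by (rule realizable_one_one[where ?c1.0 = 0 and ?d2.0 = 0, OF phi, unfolded simps]) (use car in simp_all)
    done
qed

end
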